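(* Let $k$ be a commutative ring, $d\ge1$ an integer, and let $\mathcal{M}$ be a $d$-stable dg category over $k$ with $H^0\mathcal{M}\neq0$. Then $\mathrm{w.gl.dim}\,\mathcal{M}=d+1$.
   Context: All dg categories are small, $k$-linear and cohomologically graded; modules are right modules. A dg category $\mathcal{A}$ is additive if $H^0\mathcal{A}$ is additive, and connective if $H^i\mathcal{A}(X,Y)=0$ for all $i>0$. For every connective additive dg category, $H^0$ is assumed idempotent complete. $H^0\mathcal{M}\ne0$ means that $H^0\mathcal{M}$ has a nonzero object. For connective $\mathcal{A}$, $\mathsf{Mod}\,H^0\mathcal{A}$ is identified with the heart of the standard $t$-structure on the derived category $\mathcal{D}(\mathcal{A})$. For $n\ge0$, $\mathrm{w.gl.dim}\,\mathcal{A}\le n$ means that $M\otimes^{\mathbb{L}}_{\mathcal{A}}N\in\mathcal{D}^{\ge-n}(k)$ for every $M\in\mathsf{Mod}\,H^0\mathcal{A}$ and $N\in\mathsf{Mod}\,H^0\mathcal{A}^{\mathrm{op}}$; $\mathrm{w.gl.dim}\,\mathcal{A}$ is the least such $n$. Twisted complexes and $d$-stability. A bounded one-sided twisted complex $X^\bullet$ in $\mathcal{A}$ consists of objects $X^i\in\mathcal{A}$, zero for all but finitely many $i\in\mathbb{Z}$, and $d_X^{i,j}\in\mathcal{A}(X^i,X^j)^{i-j+1}$ with $d_X^{i,j}=0$ for $i\ge j$ and $d_{\mathcal{A}}(d_X^{i,j})+(-1)^j\sum_k d_X^{k,j}\circ d_X^{i,k}=0$. A degree-$m$ morphism $X^\bullet\to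 Y^\bullet$ is a family $f^{i,j}\in\mathcal{A}(X^i,Y^j)^{i-j+m}$ with differential $(df)^{i,j}=(-1)^jd_{\mathcal{A}}(f^{i,j})+\sum_k\bigl(d_Y^{k,j}\circ f^{i,k}-(-1)^mf^{k,j}\circ d_X^{i,k}\bigr)$. These form a dg category $\mathrm{tw}(\mathcal{A})$; put $\mathrm{htw}(\mathcal{A})=H^0\mathrm{tw}(\mathcal{A})$. An object $A\in\mathcal{A}$ is a twisted complex in degree $0$, so $A[-i]$ is $A$ in degree $i$. For $X^\bullet$ concentrated in degrees $0,\dots,d+1$: it is left $d$-exact if $\mathrm{htw}(\mathcal{A})(A[-i],X^\bullet)=0$ for all $A\in\mathcal{A}$, $i\le d$; right $d$-exact if $\mathrm{htw}(\mathcal{A})(X^\bullet,A[-i])=0$ for all $A\in\mathcal{A}$, $i\ge1$. A homotopy $d$-kernel of $f\colon X^d\to X^{d+1}$ in $Z^0\mathcal{A}$ is a left $d$-exact $X^\bullet$ with $d_X^{d,d+1}=f$; a homotopy $d$-cokernel of $f\colon X^0\to X^1$ in $Z^0\mathcal{A}$ is a right $d$-exact $X^\bullet$ with $d_X^{0,1}=f$. An additive connective dg category $\mathcal{M}$ is $d$-stable if (i) every morphism in $Z^0\mathcal{M}$ has a homotopy $d$-kernel and a homotopy $d$-cokernel, and (ii) a twisted complex in $\mathrm{tw}(\mathcal{M})$ concentrated in degrees $0,\dots,d+1$ is left $d$-exact if and only if it is right $d$-exact. *)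

theory Defs
  imports "HOL-Algebra.Module" "HOL-Algebra.AbelCoset" "HOL-Library.Extended_Nat"
begin

section \<open>Cochain complexes of modules\<close>

definition linear_map ::
  "'k ring \<Rightarrow> ('k, 'a) module \<Rightarrow> ('k, 'b) module \<Rightarrow> ('a \<Rightarrow> 'b) \<Rightarrow> bool" where
  "linear_map R M N f \<longleftrightarrow>
     f \<in> carrier M \<rightarrow> carrier N \<and>
     (\<forall>x\<in>carrier M. \<forall>y\<in>carrier M. f (x \<oplus>\<^bsub>M\<^esub> y) = f x \<oplus>\<^bsub>N\<^esub> f y) \<and>
     (\<forall>c\<in>carrier R. \<forall>x\<in>carrier M. f (c \<odot>\<^bsub>M\<^esub> x) = c \<odot>\<^bsub>N\<^esub> f x)"

definition signed :: "('k, 'a) module \<Rightarrow> int \<Rightarrow> 'a \<Rightarrow> 'a" where \<comment> \<open>\<open>(-1)\<^sup>n x\<close>\<close>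
  "signed M n x = (if even n then x else \<ominus>\<^bsub>M\<^esub> x)"

record ('k, 'a) cochain =
  cpt :: "int \<Rightarrow> ('k, 'a) module"
  cdiff :: "int \<Rightarrow> 'a \<Rightarrow> 'a"

definition cochain_complex :: "'k ring \<Rightarrow> ('k, 'a) cochain \<Rightarrow> bool" where
  "cochain_complex R C \<longleftrightarrow>
     (\<forall>n. Module.module R (cpt C n)) \<and>
     (\<forall>n. linear_map R (cpt C n) (cpt C (n + 1)) (cdiff C n)) \<and>
     (\<forall>n. \<forall>x\<in>carrier (cpt C n). cdiff C (n + 1) (cdiff C n x) = \<zero>\<^bsub>cpt C (n + 2)\<^esub>)"

definition cocycles :: "('k, 'a) cochain \<Rightarrow> int \<Rightarrow> 'a set" where
  "cocycles C n = {x \<in> carrier (cpt C n). cdiff C n x = \<zero>\<^bsub>cpt C (n + 1)\<^esub>}"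

definition coboundaries :: "('k, 'a) cochain \<Rightarrow> int \<Rightarrow> 'a set" where
  "coboundaries C n = cdiff C (n - 1) ` carrier (cpt C (n - 1))"

definition cohomology_zero :: "('k, 'a) cochain \<Rightarrow> int \<Rightarrow> bool" where
  "cohomology_zero C n \<longleftrightarrow> cocycles C n = coboundaries C n"

definition in_D_ge :: "('k, 'a) cochain \<Rightarrow> int \<Rightarrow> bool" where \<comment> \<open>\<open>C \<in> D\<^sup>\<ge>\<^sup>m(k)\<close>\<close>
  "in_D_ge C m \<longleftrightarrow> (\<forall>i<m. cohomology_zero C i)"


section \<open>Dg categories\<close>

text \<open>
  \<open>cmp A X Y Z m n g f\<close> is \<open>g \<circ> f\<close> for \<open>g\<close> in \<open>A(Y,Z)\<^sup>m\<close> and \<open>f\<close> in \<open>A(X,Y)\<^sup>n\<close>.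
  Hom complexes of different pairs of objects, and their homogeneous components, are not
  required to be disjoint, so objects and degrees are passed explicitly.
\<close>

record ('o, 'k, 'a) dgcat =
  Ob :: "'o set"
  Hom :: "'o \<Rightarrow> 'o \<Rightarrow> ('k, 'a) cochain"
  cmp :: "'o \<Rightarrow> 'o \<Rightarrow> 'o \<Rightarrow> int \<Rightarrow> int \<Rightarrow> 'a \<Rightarrow> 'a \<Rightarrow> 'a"
  ident :: "'o \<Rightarrow> 'a"

abbreviation dhom :: "('o, 'k, 'a) dgcat \<Rightarrow> 'o \<Rightarrow> 'o \<Rightarrow> int \<Rightarrow> ('k, 'a) module" where
  "dhom A X Y n \<equiv> cpt (Hom A X Y) n"

locale dg_category = cring R for R :: "'k ring" +
  fixes A :: "('o, 'k, 'a) dgcat"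
  assumes Hom_complex: "\<lbrakk>X \<in> Ob A; Y \<in> Ob A\<rbrakk> \<Longrightarrow> cochain_complex R (Hom A X Y)"
    and comp_linear_left:
      "\<lbrakk>X \<in> Ob A; Y \<in> Ob A; Z \<in> Ob A; f \<in> carrier (dhom A X Y n)\<rbrakk> \<Longrightarrow>
       linear_map R (dhom A Y Z m) (dhom A X Z (m + n)) (\<lambda>g. cmp A X Y Z m n g f)"
    and comp_linear_right:
      "\<lbrakk>X \<in> Ob A; Y \<in> Ob A; Z \<in> Ob A; g \<in> carrier (dhom A Y Z m)\<rbrakk> \<Longrightarrow>
       linear_map R (dhom A X Y n) (dhom A X Z (m + n)) (\<lambda>f. cmp A X Y Z m n g f)"
    and comp_assoc:
      "\<lbrakk>W \<in> Ob A; X \<in> Ob A; Y \<in> Ob A; Z \<in> Ob A; h \<in> carrier (dhom A Y Z l);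
        g \<in> carrier (dhom A X Y m); f \<in> carrier (dhom A W X n)\<rbrakk> \<Longrightarrow>
       cmp A W X Z (l + m) n (cmp A X Y Z l m h g) f =
       cmp A W Y Z l (m + n) h (cmp A W X Y m n g f)"
    and ident_closed: "X \<in> Ob A \<Longrightarrow> ident A X \<in> carrier (dhom A X X 0)"
    and comp_ident_left:
      "\<lbrakk>X \<in> Ob A; Y \<in> Ob A; f \<in> carrier (dhom A X Y n)\<rbrakk> \<Longrightarrow> cmp A X Y Y 0 n (ident A Y) f = f"
    and comp_ident_right:
      "\<lbrakk>X \<in> Ob A; Y \<in> Ob A; f \<in> carrier (dhom A X Y n)\<rbrakk> \<Longrightarrow> cmp A X X Y n 0 f (ident A X) = f"
    and leibniz:
      "\<lbrakk>X \<in> Ob A; Y \<in> Ob A; Z \<in> Ob A;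
        g \<in> carrier (dhom A Y Z m); f \<in> carrier (dhom A X Y n)\<rbrakk> \<Longrightarrow>
       cdiff (Hom A X Z) (m + n) (cmp A X Y Z m n g f) =
       cmp A X Y Z (m + 1) n (cdiff (Hom A Y Z) m g) f \<oplus>\<^bsub>dhom A X Z (m + n + 1)\<^esub>
       signed (dhom A X Z (m + n + 1)) m (cmp A X Y Z m (n + 1) g (cdiff (Hom A X Y) n f))"

definition op_dgcat :: "('o, 'k, 'a) dgcat \<Rightarrow> ('o, 'k, 'a) dgcat" where
  "op_dgcat A =
     \<lparr>Ob = Ob A, Hom = (\<lambda>X Y. Hom A Y X),
      cmp = (\<lambda>X Y Z m n g f. signed (dhom A Z X (m + n)) (m * n) (cmp A Z Y X n m f g)),
      ident = ident A\<rparr>"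

definition connective :: "('o, 'k, 'a) dgcat \<Rightarrow> bool" where
  "connective A \<longleftrightarrow> (\<forall>X\<in>Ob A. \<forall>Y\<in>Ob A. \<forall>i>0. cohomology_zero (Hom A X Y) i)"


subsection \<open>The homotopy category\<close>

text \<open>
  A morphism \<open>X \<rightarrow> Y\<close> of \<open>H\<^sup>0A\<close> is represented by an element of \<open>Z\<^sup>0A(X,Y)\<close>; two
  representatives give the same morphism if and only if they are related by \<open>h0_eq\<close>.
\<close>

abbreviation Z0 :: "('o, 'k, 'a) dgcat \<Rightarrow> 'o \<Rightarrow> 'o \<Rightarrow> 'a set" where
  "Z0 A X Y \<equiv> cocycles (Hom A X Y) 0"

definition h0_eq :: "('o, 'k, 'a) dgcat \<Rightarrow> 'o \<Rightarrow> 'o \<Rightarrow> 'a \<Rightarrow> 'a \<Rightarrow> bool" where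
  "h0_eq A X Y f g \<longleftrightarrow> f \<ominus>\<^bsub>dhom A X Y 0\<^esub> g \<in> coboundaries (Hom A X Y) 0"

definition h0_zero_object :: "('o, 'k, 'a) dgcat \<Rightarrow> 'o \<Rightarrow> bool" where
  "h0_zero_object A Z \<longleftrightarrow>
     Z \<in> Ob A \<and>
     (\<forall>X\<in>Ob A. cohomology_zero (Hom A X Z) 0 \<and> cohomology_zero (Hom A Z X) 0)"

definition h0_nonzero :: "('o, 'k, 'a) dgcat \<Rightarrow> bool" where
  "h0_nonzero A \<longleftrightarrow> (\<exists>X\<in>Ob A. \<not> h0_zero_object A X)"

definition h0_biproduct ::
  "('o, 'k, 'a) dgcat \<Rightarrow> 'o \<Rightarrow> 'o \<Rightarrow> 'o \<Rightarrow> 'a \<Rightarrow> 'a \<Rightarrow> 'a \<Rightarrow> 'a \<Rightarrow> bool" where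
  "h0_biproduct A X Y S i j p q \<longleftrightarrow>
     S \<in> Ob A \<and> i \<in> Z0 A X S \<and> j \<in> Z0 A Y S \<and> p \<in> Z0 A S X \<and> q \<in> Z0 A S Y \<and>
     h0_eq A X X (cmp A X S X 0 0 p i) (ident A X) \<and>
     h0_eq A Y Y (cmp A Y S Y 0 0 q j) (ident A Y) \<and>
     h0_eq A Y X (cmp A Y S X 0 0 p j) \<zero>\<^bsub>dhom A Y X 0\<^esub> \<and>
     h0_eq A X Y (cmp A X S Y 0 0 q i) \<zero>\<^bsub>dhom A X Y 0\<^esub> \<and>
     h0_eq A S S (cmp A S X S 0 0 i p \<oplus>\<^bsub>dhom A S S 0\<^esub> cmp A S Y S 0 0 j q) (ident A S)"

definition additive_dgcat :: "('o, 'k, 'a) dgcat \<Rightarrow> bool" where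
  "additive_dgcat A \<longleftrightarrow>
     (\<exists>Z. h0_zero_object A Z) \<and>
     (\<forall>X\<in>Ob A. \<forall>Y\<in>Ob A. \<exists>S i j p q. h0_biproduct A X Y S i j p q)"

definition h0_idempotent_complete :: "('o, 'k, 'a) dgcat \<Rightarrow> bool" where
  "h0_idempotent_complete A \<longleftrightarrow>
     (\<forall>X\<in>Ob A. \<forall>e\<in>Z0 A X X. h0_eq A X X (cmp A X X X 0 0 e e) e \<longrightarrow>
        (\<exists>Y\<in>Ob A. \<exists>r\<in>Z0 A X Y. \<exists>s\<in>Z0 A Y X.
           h0_eq A X X (cmp A X Y X 0 0 s r) e \<and>
           h0_eq A Y Y (cmp A Y X Y 0 0 r s) (ident A Y)))"


section \<open>Twisted complexes\<close>

text \<open>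
  Degrees outside the finite set \<open>tsupp T\<close> carry a formal zero object; the values of \<open>tobj T\<close>
  and \<open>tdiff T\<close> there are irrelevant.
\<close>

record ('o, 'a) twisted =
  tsupp :: "int set"
  tobj :: "int \<Rightarrow> 'o"
  tdiff :: "int \<Rightarrow> int \<Rightarrow> 'a"

definition twisted_complex :: "('o, 'k, 'a) dgcat \<Rightarrow> ('o, 'a) twisted \<Rightarrow> bool" where
  "twisted_complex A T \<longleftrightarrow>
     finite (tsupp T) \<and>
     (\<forall>i\<in>tsupp T. tobj T i \<in> Ob A) \<and>
     (\<forall>i\<in>tsupp T. \<forall>j\<in>tsupp T.
        tdiff T i j \<in> carrier (dhom A (tobj T i) (tobj T j) (i - j + 1)) \<and>
        (i \<ge> j \<longrightarrow> tdiff T i j = \<zero>\<^bsub>dhom A (tobj T i) (tobj T j) (i - j + 1)\<^esub>) \<and>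
        (let H = dhom A (tobj T i) (tobj T j) (i - j + 2) in
         cdiff (Hom A (tobj T i) (tobj T j)) (i - j + 1) (tdiff T i j) \<oplus>\<^bsub>H\<^esub>
         signed H j (\<Oplus>\<^bsub>H\<^esub>k\<in>tsupp T.
           cmp A (tobj T i) (tobj T k) (tobj T j) (k - j + 1) (i - k + 1)
             (tdiff T k j) (tdiff T i k)) = \<zero>\<^bsub>H\<^esub>))"

text \<open>\<open>mult\<close> and \<open>one\<close> play no role in a module and are left unspecified.\<close>

definition product_module :: "'i set \<Rightarrow> ('i \<Rightarrow> ('k, 'a) module) \<Rightarrow> ('k, 'i \<Rightarrow> 'a) module" where
  "product_module I F =
     \<lparr>carrier = (\<Pi>\<^sub>E i\<in>I. carrier (F i)), mult = undefined, one = undefined,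
      zero = (\<lambda>i\<in>I. \<zero>\<^bsub>F i\<^esub>),
      add = (\<lambda>f g. \<lambda>i\<in>I. f i \<oplus>\<^bsub>F i\<^esub> g i),
      smult = (\<lambda>c f. \<lambda>i\<in>I. c \<odot>\<^bsub>F i\<^esub> f i)\<rparr>"

definition tw_Hom ::
  "('o, 'k, 'a) dgcat \<Rightarrow> ('o, 'a) twisted \<Rightarrow> ('o, 'a) twisted \<Rightarrow> ('k, int \<times> int \<Rightarrow> 'a) cochain" where
  "tw_Hom A X Y =
     \<lparr>cpt = (\<lambda>m. product_module (tsupp X \<times> tsupp Y)
        (\<lambda>(i, j). dhom A (tobj X i) (tobj Y j) (i - j + m))),
      cdiff = (\<lambda>m f. \<lambda>(i, j)\<in>tsupp X \<times> tsupp Y.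
        let H = dhom A (tobj X i) (tobj Y j) (i - j + m + 1) in
        signed H j (cdiff (Hom A (tobj X i) (tobj Y j)) (i - j + m) (f (i, j))) \<oplus>\<^bsub>H\<^esub>
        ((\<Oplus>\<^bsub>H\<^esub>k\<in>tsupp Y. cmp A (tobj X i) (tobj Y k) (tobj Y j) (k - j + 1) (i - k + m)
            (tdiff Y k j) (f (i, k))) \<ominus>\<^bsub>H\<^esub>
         signed H m (\<Oplus>\<^bsub>H\<^esub>k\<in>tsupp X. cmp A (tobj X i) (tobj X k) (tobj Y j)
            (k - j + m) (i - k + 1) (f (k, j)) (tdiff X i k))))\<rparr>"

definition tw :: "('o, 'k, 'a) dgcat \<Rightarrow> (('o, 'a) twisted, 'k, int \<times> int \<Rightarrow> 'a) dgcat" where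
  "tw A =
     \<lparr>Ob = {T. twisted_complex A T},
      Hom = tw_Hom A,
      cmp = (\<lambda>X Y Z m n g f. \<lambda>(i, j)\<in>tsupp X \<times> tsupp Z.
        \<Oplus>\<^bsub>dhom A (tobj X i) (tobj Z j) (i - j + m + n)\<^esub>k\<in>tsupp Y.
          cmp A (tobj X i) (tobj Y k) (tobj Z j) (k - j + m) (i - k + n) (g (k, j)) (f (i, k))),
      ident = (\<lambda>X. \<lambda>(i, j)\<in>tsupp X \<times> tsupp X.
        if i = j then ident A (tobj X i) else \<zero>\<^bsub>dhom A (tobj X i) (tobj X j) (i - j)\<^esub>)\<rparr>"

definition htw_zero ::
  "('o, 'k, 'a) dgcat \<Rightarrow> ('o, 'a) twisted \<Rightarrow> ('o, 'a) twisted \<Rightarrow> bool" where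
  \<comment> \<open>\<open>htw(A)(X,Y) = 0\<close>\<close>
  "htw_zero A X Y \<longleftrightarrow> cohomology_zero (Hom (tw A) X Y) 0"

definition in_degree :: "('o, 'k, 'a) dgcat \<Rightarrow> 'o \<Rightarrow> int \<Rightarrow> ('o, 'a) twisted" where
  \<comment> \<open>\<open>A[-i]\<close>, the object \<open>A\<close> placed in degree \<open>i\<close>\<close>
  "in_degree C A i = \<lparr>tsupp = {i}, tobj = (\<lambda>_. A), tdiff = (\<lambda>_ _. \<zero>\<^bsub>dhom C A A 1\<^esub>)\<rparr>"


section \<open>Stability\<close>

definition d_twisted :: "nat \<Rightarrow> ('o, 'k, 'a) dgcat \<Rightarrow> ('o, 'a) twisted \<Rightarrow> bool" where
  \<comment> \<open>concentrated in degrees \<open>0, \<dots>, d+1\<close>\<close>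
  "d_twisted d A T \<longleftrightarrow> T \<in> Ob (tw A) \<and> tsupp T \<subseteq> {0..int d + 1}"

definition left_exact :: "nat \<Rightarrow> ('o, 'k, 'a) dgcat \<Rightarrow> ('o, 'a) twisted \<Rightarrow> bool" where
  "left_exact d A T \<longleftrightarrow>
     d_twisted d A T \<and> (\<forall>X\<in>Ob A. \<forall>i. i \<le> int d \<longrightarrow> htw_zero A (in_degree A X i) T)"

definition right_exact :: "nat \<Rightarrow> ('o, 'k, 'a) dgcat \<Rightarrow> ('o, 'a) twisted \<Rightarrow> bool" where
  "right_exact d A T \<longleftrightarrow>
     d_twisted d A T \<and> (\<forall>X\<in>Ob A. \<forall>i. i \<ge> 1 \<longrightarrow> htw_zero A T (in_degree A X i))"

definition component_is ::
  "('o, 'a) twisted \<Rightarrow> int \<Rightarrow> int \<Rightarrow> 'o \<Rightarrow> 'o \<Rightarrow> 'a \<Rightarrow> bool" where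
  "component_is T i j X Y f \<longleftrightarrow>
     i \<in> tsupp T \<and> j \<in> tsupp T \<and> tobj T i = X \<and> tobj T j = Y \<and> tdiff T i j = f"

definition homotopy_kernel ::
  "nat \<Rightarrow> ('o, 'k, 'a) dgcat \<Rightarrow> 'o \<Rightarrow> 'o \<Rightarrow> 'a \<Rightarrow> ('o, 'a) twisted \<Rightarrow> bool" where
  "homotopy_kernel d A X Y f T \<longleftrightarrow>
     left_exact d A T \<and> component_is T (int d) (int d + 1) X Y f"

definition homotopy_cokernel ::
  "nat \<Rightarrow> ('o, 'k, 'a) dgcat \<Rightarrow> 'o \<Rightarrow> 'o \<Rightarrow> 'a \<Rightarrow> ('o, 'a) twisted \<Rightarrow> bool" where
  "homotopy_cokernel d A X Y f T \<longleftrightarrow>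
     right_exact d A T \<and> component_is T 0 1 X Y f"

definition d_stable :: "'k ring \<Rightarrow> nat \<Rightarrow> ('o, 'k, 'a) dgcat \<Rightarrow> bool" where
  "d_stable R d A \<longleftrightarrow>
     dg_category R A \<and> additive_dgcat A \<and> connective A \<and> h0_idempotent_complete A \<and>
     (\<forall>X\<in>Ob A. \<forall>Y\<in>Ob A. \<forall>f\<in>Z0 A X Y.
        (\<exists>T. homotopy_kernel d A X Y f T) \<and> (\<exists>T. homotopy_cokernel d A X Y f T)) \<and>
     (\<forall>T. d_twisted d A T \<longrightarrow> (left_exact d A T \<longleftrightarrow> right_exact d A T))"


section \<open>Dg modules\<close>

text \<open>
  \<open>act M X Y m n x f\<close> is \<open>x \<cdot> f\<close> in \<open>M(X)\<^sup>m\<^sup>+\<^sup>n\<close>, for \<open>x\<close> in \<open>M(Y)\<^sup>m\<close> and \<open>f\<close> in \<open>A(X,Y)\<^sup>n\<close>.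
\<close>

record ('o, 'k, 'a, 'u) dgmod =
  val :: "'o \<Rightarrow> ('k, 'u) cochain"
  act :: "'o \<Rightarrow> 'o \<Rightarrow> int \<Rightarrow> int \<Rightarrow> 'u \<Rightarrow> 'a \<Rightarrow> 'u"

abbreviation vcpt :: "('o, 'k, 'a, 'u) dgmod \<Rightarrow> 'o \<Rightarrow> int \<Rightarrow> ('k, 'u) module" where
  "vcpt M X n \<equiv> cpt (val M X) n"

locale dg_module = dg_category R A for R :: "'k ring" and A :: "('o, 'k, 'a) dgcat" +
  fixes M :: "('o, 'k, 'a, 'u) dgmod"
  assumes val_complex: "X \<in> Ob A \<Longrightarrow> cochain_complex R (val M X)"
    and act_linear_left:
      "\<lbrakk>X \<in> Ob A; Y \<in> Ob A; f \<in> carrier (dhom A X Y n)\<rbrakk> \<Longrightarrow>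
       linear_map R (vcpt M Y m) (vcpt M X (m + n)) (\<lambda>x. act M X Y m n x f)"
    and act_linear_right:
      "\<lbrakk>X \<in> Ob A; Y \<in> Ob A; x \<in> carrier (vcpt M Y m)\<rbrakk> \<Longrightarrow>
       linear_map R (dhom A X Y n) (vcpt M X (m + n)) (\<lambda>f. act M X Y m n x f)"
    and act_comp:
      "\<lbrakk>X \<in> Ob A; Y \<in> Ob A; Z \<in> Ob A; x \<in> carrier (vcpt M Z l);
        g \<in> carrier (dhom A Y Z m); f \<in> carrier (dhom A X Y n)\<rbrakk> \<Longrightarrow>
       act M X Y (l + m) n (act M Y Z l m x g) f = act M X Z l (m + n) x (cmp A X Y Z m n g f)"
    and act_ident:
      "\<lbrakk>X \<in> Ob A; x \<in> carrier (vcpt M X m)\<rbrakk> \<Longrightarrow> act M X X m 0 x (ident A X) = x"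
    and act_leibniz:
      "\<lbrakk>X \<in> Ob A; Y \<in> Ob A; x \<in> carrier (vcpt M Y m); f \<in> carrier (dhom A X Y n)\<rbrakk> \<Longrightarrow>
       cdiff (val M X) (m + n) (act M X Y m n x f) =
       act M X Y (m + 1) n (cdiff (val M Y) m x) f \<oplus>\<^bsub>vcpt M X (m + n + 1)\<^esub>
       signed (vcpt M X (m + n + 1)) m (act M X Y m (n + 1) x (cdiff (Hom A X Y) n f))"

definition in_heart :: "'k ring \<Rightarrow> ('o, 'k, 'a) dgcat \<Rightarrow> ('o, 'k, 'a, 'u) dgmod \<Rightarrow> bool" where
  "in_heart R A M \<longleftrightarrow>
     dg_module R A M \<and> (\<forall>X\<in>Ob A. \<forall>i. i \<noteq> 0 \<longrightarrow> cohomology_zero (val M X) i)"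

definition quasi_iso ::
  "'k ring \<Rightarrow> ('o, 'k, 'a) dgcat \<Rightarrow> ('o, 'k, 'a, 'u) dgmod \<Rightarrow> ('o, 'k, 'a, 'v) dgmod
   \<Rightarrow> ('o \<Rightarrow> int \<Rightarrow> 'u \<Rightarrow> 'v) \<Rightarrow> bool" where
  "quasi_iso R A P M q \<longleftrightarrow>
     (\<forall>X\<in>Ob A. \<forall>n. linear_map R (vcpt P X n) (vcpt M X n) (q X n)) \<and>
     (\<forall>X\<in>Ob A. \<forall>n. \<forall>x\<in>carrier (vcpt P X n).
        cdiff (val M X) n (q X n x) = q X (n + 1) (cdiff (val P X) n x)) \<and>
     (\<forall>X\<in>Ob A. \<forall>Y\<in>Ob A. \<forall>m n. \<forall>x\<in>carrier (vcpt P Y m). \<forall>f\<in>carrier (dhom A X Y n).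
        q X (m + n) (act P X Y m n x f) = act M X Y m n (q Y m x) f) \<and>
     (\<forall>X\<in>Ob A. \<forall>n. \<forall>z\<in>cocycles (val P X) n.
        q X n z \<in> coboundaries (val M X) n \<longrightarrow> z \<in> coboundaries (val P X) n) \<and>
     (\<forall>X\<in>Ob A. \<forall>n. \<forall>w\<in>cocycles (val M X) n. \<exists>z\<in>cocycles (val P X) n.
        w \<ominus>\<^bsub>vcpt M X n\<^esub> q X n z \<in> coboundaries (val M X) n)"


subsection \<open>Semi-free resolutions\<close>

text \<open>
  A homogeneous element \<open>b\<close> of \<open>P(X)\<^sup>m\<close> is recorded as the triple \<open>(X, m, b)\<close>. A semi-basis is a
  set \<open>B\<close> of such elements with an exhaustive filtration \<open>lev\<close> indexed by \<open>\<nat>\<close> such that \<open>P\<close> is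
  free on \<open>B\<close> as a graded module and the differential of a basis element is a combination of
  basis elements of strictly lower level. Equivalently, \<open>P\<close> has an exhaustive filtration by dg
  submodules whose subquotients are direct sums of shifts of representable modules.
\<close>

definition coefficients ::
  "('o, 'k, 'a) dgcat \<Rightarrow> ('o \<times> int \<times> 'u) set \<Rightarrow> 'o \<Rightarrow> int \<Rightarrow> ('o \<times> int \<times> 'u \<Rightarrow> 'a) set" where
  "coefficients A B Y n =
     {a \<in> (\<Pi>\<^sub>E (X, m, b)\<in>B. carrier (dhom A Y X (n - m))).
        finite {(X, m, b) \<in> B. a (X, m, b) \<noteq> \<zero>\<^bsub>dhom A Y X (n - m)\<^esub>}}"

definition combination ::
  "('o, 'k, 'a) dgcat \<Rightarrow> ('o, 'k, 'a, 'u) dgmod \<Rightarrow> ('o \<times> int \<times> 'u) set \<Rightarrow> 'o \<Rightarrow> int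
   \<Rightarrow> ('o \<times> int \<times> 'u \<Rightarrow> 'a) \<Rightarrow> 'u" where
  "combination A P B Y n a =
     (\<Oplus>\<^bsub>vcpt P Y n\<^esub>\<beta>\<in>{(X, m, b) \<in> B. a (X, m, b) \<noteq> \<zero>\<^bsub>dhom A Y X (n - m)\<^esub>}.
        case \<beta> of (X, m, b) \<Rightarrow> act P Y X m (n - m) b (a (X, m, b)))"

definition semi_basis ::
  "('o, 'k, 'a) dgcat \<Rightarrow> ('o, 'k, 'a, 'u) dgmod \<Rightarrow> ('o \<times> int \<times> 'u) set
   \<Rightarrow> ('o \<times> int \<times> 'u \<Rightarrow> nat) \<Rightarrow> bool" where
  "semi_basis A P B lev \<longleftrightarrow>
     (\<forall>(X, m, b)\<in>B. X \<in> Ob A \<and> b \<in> carrier (vcpt P X m)) \<and>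
     (\<forall>Y\<in>Ob A. \<forall>n.
        bij_betw (combination A P B Y n) (coefficients A B Y n) (carrier (vcpt P Y n))) \<and>
     (\<forall>(X, m, b)\<in>B. let B' = {\<beta> \<in> B. lev \<beta> < lev (X, m, b)} in
        cdiff (val P X) m b \<in> combination A P B' X (m + 1) ` coefficients A B' X (m + 1))"

definition semifree_resolution ::
  "'k ring \<Rightarrow> ('o, 'k, 'a) dgcat \<Rightarrow> ('o, 'k, 'a, 'u) dgmod \<Rightarrow> ('o, 'k, 'a, 'v) dgmod
   \<Rightarrow> ('o \<Rightarrow> int \<Rightarrow> 'u \<Rightarrow> 'v) \<Rightarrow> bool" where
  "semifree_resolution R A P M q \<longleftrightarrow>
     dg_module R A P \<and> (\<exists>B lev. semi_basis A P B lev) \<and> quasi_iso R A P M q"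


subsection \<open>Tensor products\<close>

definition free_module :: "'k ring \<Rightarrow> 'g set \<Rightarrow> ('k, 'g \<Rightarrow> 'k) module" where
  "free_module R G =
     \<lparr>carrier = {c. c \<in> UNIV \<rightarrow> carrier R \<and> finite {g. c g \<noteq> \<zero>\<^bsub>R\<^esub>} \<and> {g. c g \<noteq> \<zero>\<^bsub>R\<^esub>} \<subseteq> G},
      mult = undefined, one = undefined,
      zero = (\<lambda>_. \<zero>\<^bsub>R\<^esub>),
      add = (\<lambda>c c' g. c g \<oplus>\<^bsub>R\<^esub> c' g),
      smult = (\<lambda>r c g. r \<otimes>\<^bsub>R\<^esub> c g)\<rparr>"

definition gen :: "'k ring \<Rightarrow> 'g \<Rightarrow> 'g \<Rightarrow> 'k" where
  "gen R g = (\<lambda>h. if h = g then \<one>\<^bsub>R\<^esub> else \<zero>\<^bsub>R\<^esub>)"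

definition free_extension ::
  "'k ring \<Rightarrow> ('k, 'b) module \<Rightarrow> ('g \<Rightarrow> 'b) \<Rightarrow> ('g \<Rightarrow> 'k) \<Rightarrow> 'b" where
  "free_extension R N \<phi> c = (\<Oplus>\<^bsub>N\<^esub>g\<in>{g. c g \<noteq> \<zero>\<^bsub>R\<^esub>}. c g \<odot>\<^bsub>N\<^esub> \<phi> g)"

definition submodule_span :: "'k ring \<Rightarrow> ('k, 'a) module \<Rightarrow> 'a set \<Rightarrow> 'a set" where
  "submodule_span R M S = \<Inter> {H. submodule H R M \<and> S \<subseteq> H}"

definition quotient_module :: "('k, 'a) module \<Rightarrow> 'a set \<Rightarrow> ('k, 'a set) module" where
  "quotient_module M S =
     \<lparr>carrier = a_rcosets\<^bsub>M\<^esub> S, mult = undefined, one = undefined,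
      zero = S,
      add = (\<lambda>C D. C <+>\<^bsub>M\<^esub> D),
      smult = (\<lambda>r C. \<Union>x\<in>C. S +>\<^bsub>M\<^esub> (r \<odot>\<^bsub>M\<^esub> x))\<rparr>"

text \<open>
  Left modules are right modules over \<open>op_dgcat A\<close>: for \<open>f\<close> in \<open>A(X,Y)\<^sup>j\<close> and \<open>y\<close> in \<open>N(X)\<^sup>l\<close> the
  left action is \<open>f \<cdot> y = (-1)\<^sup>j\<^sup>l y \<cdot> f\<close>. In degree \<open>n\<close> the tensor product is generated by
  symbols \<open>(X, i, x, y)\<close> for \<open>x \<otimes> y\<close>, with \<open>x\<close> in \<open>M(X)\<^sup>i\<close> and \<open>y\<close> in \<open>N(X)\<^sup>n\<^sup>-\<^sup>i\<close>, subject to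
  bilinearity over \<open>k\<close> and \<open>x \<cdot> f \<otimes> y = x \<otimes> f \<cdot> y\<close>; the differential is
  \<open>d(x \<otimes> y) = dx \<otimes> y + (-1)\<^sup>i x \<otimes> dy\<close>.
\<close>

type_synonym ('o, 'u, 'v) tensor_symbol = "'o \<times> int \<times> 'u \<times> 'v"

context
  fixes R :: "'k ring" and A :: "('o, 'k, 'a) dgcat"
    and M :: "('o, 'k, 'a, 'u) dgmod" and N :: "('o, 'k, 'a, 'v) dgmod"
begin

definition tensor_symbols :: "int \<Rightarrow> ('o, 'u, 'v) tensor_symbol set" where
  "tensor_symbols n =
     {(X, i, x, y). X \<in> Ob A \<and> x \<in> carrier (vcpt M X i) \<and> y \<in> carrier (vcpt N X (n - i))}"

definition tensor_free :: "int \<Rightarrow> ('k, ('o, 'u, 'v) tensor_symbol \<Rightarrow> 'k) module" where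
  "tensor_free n = free_module R (tensor_symbols n)"

definition tensor_relators :: "int \<Rightarrow> (('o, 'u, 'v) tensor_symbol \<Rightarrow> 'k) set" where
  "tensor_relators n =
     {gen R (X, i, x \<oplus>\<^bsub>vcpt M X i\<^esub> x', y) \<ominus>\<^bsub>tensor_free n\<^esub>
        (gen R (X, i, x, y) \<oplus>\<^bsub>tensor_free n\<^esub> gen R (X, i, x', y)) | X i x x' y.
        X \<in> Ob A \<and> x \<in> carrier (vcpt M X i) \<and> x' \<in> carrier (vcpt M X i) \<and>
        y \<in> carrier (vcpt N X (n - i))} \<union>
     {gen R (X, i, x, y \<oplus>\<^bsub>vcpt N X (n - i)\<^esub> y') \<ominus>\<^bsub>tensor_free n\<^esub>
        (gen R (X, i, x, y) \<oplus>\<^bsub>tensor_free n\<^esub> gen R (X, i, x, y')) | X i x y y'.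
        X \<in> Ob A \<and> x \<in> carrier (vcpt M X i) \<and>
        y \<in> carrier (vcpt N X (n - i)) \<and> y' \<in> carrier (vcpt N X (n - i))} \<union>
     {gen R (X, i, r \<odot>\<^bsub>vcpt M X i\<^esub> x, y) \<ominus>\<^bsub>tensor_free n\<^esub>
        r \<odot>\<^bsub>tensor_free n\<^esub> gen R (X, i, x, y) | X i r x y.
        X \<in> Ob A \<and> r \<in> carrier R \<and> x \<in> carrier (vcpt M X i) \<and>
        y \<in> carrier (vcpt N X (n - i))} \<union>
     {gen R (X, i, x, r \<odot>\<^bsub>vcpt N X (n - i)\<^esub> y) \<ominus>\<^bsub>tensor_free n\<^esub>
        r \<odot>\<^bsub>tensor_free n\<^esub> gen R (X, i, x, y) | X i r x y.
        X \<in> Ob A \<and> r \<in> carrier R \<and> x \<in> carrier (vcpt M X i) \<and>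
        y \<in> carrier (vcpt N X (n - i))} \<union>
     {gen R (X, i + j, act M X Y i j x f, y) \<ominus>\<^bsub>tensor_free n\<^esub>
        gen R (Y, i, x, signed (vcpt N Y (n - i)) (j * l) (act N Y X l j y f)) | X Y i j l x f y.
        X \<in> Ob A \<and> Y \<in> Ob A \<and> i + j + l = n \<and> x \<in> carrier (vcpt M Y i) \<and>
        f \<in> carrier (dhom A X Y j) \<and> y \<in> carrier (vcpt N X l)}"

definition tensor_relations :: "int \<Rightarrow> (('o, 'u, 'v) tensor_symbol \<Rightarrow> 'k) set" where
  "tensor_relations n = submodule_span R (tensor_free n) (tensor_relators n)"

definition tensor_free_diff ::
  "int \<Rightarrow> (('o, 'u, 'v) tensor_symbol \<Rightarrow> 'k) \<Rightarrow> ('o, 'u, 'v) tensor_symbol \<Rightarrow> 'k" where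
  "tensor_free_diff n =
     free_extension R (tensor_free (n + 1))
       (\<lambda>(X, i, x, y).
          gen R (X, i + 1, cdiff (val M X) i x, y) \<oplus>\<^bsub>tensor_free (n + 1)\<^esub>
          signed (tensor_free (n + 1)) i (gen R (X, i, x, cdiff (val N X) (n - i) y)))"

definition dg_tensor :: "('k, (('o, 'u, 'v) tensor_symbol \<Rightarrow> 'k) set) cochain" where
  "dg_tensor =
     \<lparr>cpt = (\<lambda>n. quotient_module (tensor_free n) (tensor_relations n)),
      cdiff = (\<lambda>n C. \<Union>c\<in>C. tensor_relations (n + 1) +>\<^bsub>tensor_free (n + 1)\<^esub>
        tensor_free_diff n c)\<rparr>"

end


section \<open>Weak global dimension\<close>

text \<open>
  All dg modules have their elements in the type \<open>'u\<close>, which plays the role of the universe. The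
  next condition says that \<open>A\<close> is small with respect to it. Every dg \<open>A\<close>-module in \<open>'u\<close> then has
  a semi-free resolution in \<open>'u\<close>: at most \<open>|'u|\<close> basis elements are needed, and a finite
  combination of them with coefficients in \<open>A\<close> is determined by a finite list of elements of
  \<open>'u\<close>, so that \<open>infinite UNIV\<close> bounds the number of combinations by \<open>|'u|\<close>.
\<close>

definition small_in :: "'u itself \<Rightarrow> ('o, 'k, 'a) dgcat \<Rightarrow> bool" where
  "small_in _ A \<longleftrightarrow>
     infinite (UNIV :: 'u set) \<and>
     (\<exists>\<iota> :: 'o \<Rightarrow> 'u. inj_on \<iota> (Ob A)) \<and>
     (\<exists>\<iota> :: 'a \<Rightarrow> 'u. inj_on \<iota> (\<Union>X\<in>Ob A. \<Union>Y\<in>Ob A. \<Union>n. carrier (dhom A X Y n)))"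

text \<open>
  The derived tensor product is computed by any semi-free resolution of the first factor; up to
  quasi-isomorphism the result does not depend on the resolution.
\<close>

definition derived_tensor_in_D_ge ::
  "'k ring \<Rightarrow> ('o, 'k, 'a) dgcat \<Rightarrow> ('o, 'k, 'a, 'u) dgmod \<Rightarrow> ('o, 'k, 'a, 'u) dgmod \<Rightarrow> int \<Rightarrow> bool"
  where
  "derived_tensor_in_D_ge R A M N m \<longleftrightarrow>
     (\<forall>(P :: ('o, 'k, 'a, 'u) dgmod) q.
        semifree_resolution R A P M q \<longrightarrow> in_D_ge (dg_tensor R A P N) m)"

text \<open>
  \<open>Mod H\<^sup>0A\<close> and \<open>Mod H\<^sup>0A\<^sup>o\<^sup>p\<close> are taken as the hearts of \<open>D(A)\<close> and \<open>D(A\<^sup>o\<^sup>p)\<close>.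
\<close>

definition weak_gl_dim_le :: "'u itself \<Rightarrow> 'k ring \<Rightarrow> ('o, 'k, 'a) dgcat \<Rightarrow> nat \<Rightarrow> bool" where
  "weak_gl_dim_le _ R A n \<longleftrightarrow>
     (\<forall>M N :: ('o, 'k, 'a, 'u) dgmod.
        in_heart R A M \<and> in_heart R (op_dgcat A) N \<longrightarrow>
        derived_tensor_in_D_ge R A M N (- int n))"

definition weak_gl_dim :: "'u itself \<Rightarrow> 'k ring \<Rightarrow> ('o, 'k, 'a) dgcat \<Rightarrow> enat" where
  "weak_gl_dim U R A = Inf (enat ` {n. weak_gl_dim_le U R A n})"

end

theory Submission
 imports Defs
begin

text \<open>
 Upper bound: let \<open>P\<close> be a semi-free resolution of an object of the heart and let \<open>N\<close> lie in
 the heart. By connectivity, finitely many basis elements of \<open>P\<close> can be rearranged into cells whose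
 differentials only involve cells of higher degree. Given a cocycle of degree \<open>e \<le> - d - 2\<close> in the
 tensor product, cells of degree other than \<open>e\<close> are removed because \<open>N\<close> has cohomology in degree \<open>0\<close>
 only, and by additivity the cells of degree \<open>e\<close> merge into one tensor \<open>x \<otimes> w\<close>. The cells of degree
 \<open>e + 1\<close> in \<open>d x\<close> merge in the same way and give a morphism \<open>f\<close> with \<open>f w\<close> null-homotopic. Right
 \<open>d\<close>-exactness of a homotopy \<open>d\<close>-cokernel \<open>T\<close> of \<open>f\<close> extends \<open>x\<close> to a closed morphism \<open>T \<rightarrow> P\<close>,
 which is null-homotopic since \<open>P\<close> is acyclic in negative degrees and \<open>T\<close> has length \<open>d + 1\<close>.

 Lower bound: let \<open>T\<close> be a homotopy \<open>d\<close>-cokernel of the map from a nonzero object \<open>X\<close> to a zero object. As \<open>T\<close> is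
 both left and right \<open>d\<close>-exact, the right module of \<open>T[d + 1]\<close> and the left module of its dual lie in
 the hearts. Their tensor product is the endomorphism complex of \<open>T\<close> shifted by \<open>d + 1\<close>, and the
 identity of \<open>T\<close> is a class in degree \<open>- d - 1\<close>; it does not vanish because the identity of \<open>X\<close> does not.
\<close>

text \<open>In a semi-free module the differential of a generator may involve generators of every
  degree. Connectivity makes the coefficients on generators of the same or lower degree removable,
  and only in the resulting order can cells be stripped off by degree. The morphism \<open>f\<close>
  kills \<open>w\<close> up to homotopy because the class is closed: the coefficients of the cells
  of degree \<open>e + 1\<close> in the differential of \<open>x \<otimes> w\<close> have to be
  cancelled by the rest of the cocycle, which contributes only coboundaries there. The bound comes
  from the degrees \<open>0, ..., d + 1\<close> of \<open>T\<close>: all \<open>k + e\<close> are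
  negative exactly when \<open>e \<le> - d - 2\<close>. Biproducts exist only in \<open>H^0\<close>,
  so merging holds up to homotopy and is carried out modulo the subgroup \<open>bd\<close>. Cells
  have to be removed in the tensor product, in the semi-free module and in the complex of morphisms
  from \<open>T\<close>; the locale \<open>pairing\<close> treats the three at once. In the lower
  bound the zero object in index \<open>1\<close> and connectivity make the morphisms from the later
  terms of \<open>T\<close> to \<open>X\<close> acyclic in the relevant degrees, so a null-homotopy
  of the projection from \<open>T\<close> to \<open>X\<close> can be moved into index
  \<open>0\<close>, where it contracts \<open>X\<close>.\<close>

abbreviation add_in ("(_ +[_]/ _)" [65, 0, 66] 65) where "x +[G] y == x \<oplus>\<^bsub>G\<^esub> y"
abbreviation minus_in ("(_ -[_]/ _)" [65, 0, 66] 65) where "x -[G] y == x \<ominus>\<^bsub>G\<^esub> y"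
abbreviation uminus_in ("(-[_] _)" [0, 81] 80) where "-[G] x == \<ominus>\<^bsub>G\<^esub> x"
abbreviation zero_in ("0[_]") where "0[G] == \<zero>\<^bsub>G\<^esub>"
abbreviation smult_in ("(_ *[_]/ _)" [71, 0, 70] 70) where "r *[G] x == r \<odot>\<^bsub>G\<^esub> x"
abbreviation in_carrier (infix ".:" 50) where "x .: G == x \<in> carrier G"
abbreviation tobj_at ("_$_" [1000, 1000] 1000) where "T$i == tobj T i"
syntax "_fsum" :: "('k, 'a) module => pttrn => 'i set => 'a => 'a" ("(3\<Oplus>[_]/ _:_./ _)" [0, 0, 51, 10] 10)
translations "\<Oplus>[G] i:A. b" == "CONST finsum G (%i. b) A"
syntax "_restr" :: "pttrn => 'i set => 'b => 'i => 'b" ("(3%_:_./ _)" [0, 51, 10] 10)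
translations "%i:A. b" == "CONST restrict (%i. b) A"
abbreviation "df == cdiff"
abbreviation "sg == signed"
abbreviation "sp == tsupp"
abbreviation "hz == cohomology_zero"
abbreviation "cobd == coboundaries"
abbreviation "pm == product_module"

section \<open>Additive maps, signs and finite sums in abelian groups\<close>

definition amap :: "('k, 'a) module => ('k, 'b) module => ('a => 'b) => bool" where
 "amap G H f \<longleftrightarrow> f : carrier G \<rightarrow> carrier H &
  (ALL x:carrier G. ALL y:carrier G. f (x +[G] y) = f x +[H] f y)"

lemma amI:
 assumes "!!x. x .: G ==> f x .: H"
  and "!!x y. x .: G ==> y .: G ==> f (x +[G] y) = f x +[H] f y"
 shows "amap G H f"
 using assms by (auto simp: amap_def)

lemma am_cl: "amap G H f ==> x .: G ==> f x .: H"
 by (auto simp: amap_def)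

lemma am_add:
 "amap G H f ==> x .: G ==> y .: G ==> f (x +[G] y) = f x +[H] f y"
 by (auto simp: amap_def)

lemma linI:
 assumes "!!x. x .: M ==> f x .: N"
  and "!!x y. x .: M ==> y .: M ==> f (x +[M] y) = f x +[N] f y"
  and "!!c x. c .: R ==> x .: M ==> f (c *[M] x) = c *[N] f x"
 shows "linear_map R M N f"
 using assms by (auto simp: linear_map_def)

lemma lin_smult:
 "linear_map R M N f ==> c .: R ==> x .: M ==> f (c *[M] x) = c *[N] f x"
 by (auto simp: linear_map_def)

lemma lin_am: "linear_map R M N f ==> amap M N f"
 by (auto simp: linear_map_def amap_def)

lemma lin_comp:
 "linear_map R L M f ==> linear_map R M N g ==> linear_map R L N (%x. g (f x))"
 by (auto simp: linear_map_def Pi_iff)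

locale agrp = abelian_group M for M :: "('k, 'a) module" (structure)

lemmas (in agrp) ag = local.agrp_axioms

lemma module_agrp: "Module.module R M ==> agrp M"
 by (simp add: Module.module_def agrp_def)

lemma am_0:
 assumes "agrp G" "agrp H" "amap G H f"
 shows "f 0[G] = 0[H]"
proof -
 interpret G: agrp G by fact
 interpret H: agrp H by fact
 have "f 0[G] +[H] f 0[G] = f 0[G]"
  using am_add[OF assms(3), of "0[G]" "0[G]"] by simp
 then show ?thesis
  using am_cl[OF assms(3), of "0[G]"] by (simp add: H.add.r_cancel_one)
qed

lemma am_neg:
 assumes "agrp G" "agrp H" "amap G H f" "x .: G"
 shows "f (\<ominus>\<^bsub>G\<^esub> x) = -[H] f x"
proof -
 interpret G: agrp G by fact
 interpret H: agrp H by fact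
 have "f (\<ominus>\<^bsub>G\<^esub> x) +[H] f x = 0[H]"
  using am_add[OF assms(3), of "-[G] x" x] am_0[OF assms(1-3)] assms(4)
  by (simp add: G.l_neg)
 then show ?thesis
  using am_cl[OF assms(3)] assms(4) by (metis G.a_inv_closed H.minus_equality)
qed

lemma am_minus:
 assumes "agrp G" "agrp H" "amap G H f" "x .: G" "y .: G"
 shows "f (x -[G] y) = f x -[H] f y"
proof -
 interpret G: agrp G by fact
 interpret H: agrp H by fact
 show ?thesis
  using assms am_neg[OF assms(1-3)]
  by (simp add: G.minus_eq H.minus_eq am_add[OF assms(3)])
qed

lemma am_finsum:
 assumes "agrp G" "agrp H" "amap G H f"
  and "!!i. i : I ==> x i .: G"
 shows "f (\<Oplus>[G] i:I. x i) = (\<Oplus>[H] i:I. f (x i))"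
proof -
 interpret G: agrp G by fact
 interpret H: agrp H by fact
 show ?thesis
 proof (cases "finite I")
  case True
  then show ?thesis using assms(4)
  proof (induction I)
   case empty
   then show ?case using am_0[OF assms(1-3)] by simp
  next
   case (insert i I)
   then show ?case
   using am_cl[OF assms(3)]
   by (simp add: Pi_iff am_add[OF assms(3)])
  qed
 next
  case False
  then show ?thesis using am_0[OF assms(1-3)] by simp
 qed
qed

lemma signed_even [simp]: "even n ==> sg M n x = x"
 by (simp add: signed_def)

lemma sg_odd: "odd n ==> sg M n x = -[M] x"
 by (simp add: signed_def)

lemma sg_parity: "even (m - n) ==> sg M m x = sg M n x"
 by (auto simp: signed_def)

context agrp
begin

lemma sg_cl [simp]: "x .: M ==> sg M n x .: M"
 by (simp add: signed_def)

lemma sg_sg: "x .: M ==> sg M m (sg M n x) = sg M (m + n) x"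
 by (simp add: signed_def)

lemma sg_add:
 "x .: M ==> y .: M ==> sg M n (x \<oplus> y) = sg M n x \<oplus> sg M n y"
 by (simp add: signed_def minus_add)

lemma minus_zero' [simp]: "\<ominus> \<zero> = \<zero>"
 by (metis l_zero r_neg zero_closed a_inv_closed)

lemma sg_0 [simp]: "sg M n \<zero> = \<zero>"
 by (simp add: signed_def)

lemma neg_signed: "x .: M ==> \<ominus> (sg M n x) = sg M (n + 1) x"
 by (simp add: signed_def)

lemma sg_cancel: "x .: M ==> odd (m + n) ==> sg M m x \<oplus> sg M n x = \<zero>"
 by (auto simp: signed_def r_neg l_neg)

lemma signed_cancel': "x .: M ==> y .: M ==> odd (m + n) ==>
  sg M m x \<oplus> (sg M n x \<oplus> y) = y"
 using sg_cancel[of x m n] by (simp flip: a_assoc)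

lemma signed_eq_zero [simp]: "x .: M ==> sg M n x = \<zero> \<longleftrightarrow> x = \<zero>"
 by (auto simp: signed_def)

lemma addmap_signed_self: "amap M M (sg M n)"
 by (auto simp: amap_def sg_add)

lemma minus_eq_zero_iff: "x .: M ==> y .: M ==> x \<ominus> y = \<zero> \<longleftrightarrow> x = y"
 by (metis add.inv_solve_right' l_zero minus_eq zero_closed)

lemma add_diff_self: "x .: M ==> y .: M ==> (x \<ominus> y) \<oplus> y = x"
 by (simp add: minus_eq a_assoc l_neg)

end

lemma am_sg:
 assumes "agrp G" "agrp H" "amap G H f" "x .: G"
 shows "f (sg G n x) = sg H n (f x)"
 using am_neg[OF assms] by (simp add: signed_def)

lemma sg_finsum:
 assumes "agrp G" "!!i. i : I ==> x i .: G"
 shows "sg G n (\<Oplus>[G] i:I. x i) = (\<Oplus>[G] i:I. sg G n (x i))"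
 using am_finsum[OF assms(1,1) agrp.addmap_signed_self[OF assms(1)], of I x] assms(2)
 by blast

lemma (in abelian_monoid) finsum_all_0: "(!!i. i : I ==> f i = \<zero>) ==> (\<Oplus>i\<in>I. f i) = \<zero>"
 by (rule add.finprod_one_eqI)

lemma (in abelian_monoid) finsum_single:
 assumes "finite I" "k : I" "f k .: G" "!!i. i : I ==> i ~= k ==> f i = \<zero>"
 shows "(\<Oplus>i\<in>I. f i) = f k"
proof -
 have "(\<Oplus>i\<in>I. f i) = (\<Oplus>i\<in>insert k (I - {k}). f i)"
  using assms(2) by (simp add: insert_absorb)
 also have "... = f k \<oplus> (\<Oplus>i\<in>I - {k}. f i)"
  using assms by (intro finsum_insert) auto
 also have "(\<Oplus>i\<in>I - {k}. f i) = \<zero>"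
  using assms(4) by (intro finsum_all_0) auto
 finally show ?thesis using assms(3) by simp
qed

lemma (in abelian_monoid) finsum_swap:
 assumes "finite I" "finite J" "!!i j. i : I ==> j : J ==> f i j .: G"
 shows "(\<Oplus>i\<in>I. \<Oplus>j\<in>J. f i j) = (\<Oplus>j\<in>J. \<Oplus>i\<in>I. f i j)"
 using assms(1,3)
proof (induction I)
 case empty
 then show ?case by simp
next
 case (insert i I)
 then have "(\<Oplus>j\<in>J. \<Oplus>i\<in>insert i I. f i j) = (\<Oplus>j\<in>J. f i j \<oplus> (\<Oplus>i\<in>I. f i j))"
  by (intro finsum_cong') (auto simp: Pi_iff)
 also have "... = (\<Oplus>j\<in>J. f i j) \<oplus> (\<Oplus>j\<in>J. \<Oplus>i\<in>I. f i j)"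
  using insert by (intro finsum_addf) (auto simp: Pi_iff)
 finally show ?case using insert by (simp add: Pi_iff)
qed

section \<open>Complexes of abelian groups\<close>

text \<open>Cohomology concerns kernels and images of additive maps, and the spans of cells below
  are handled as subgroups; so the additive structure is what all the complexes are compared
  by.\<close>

definition acx :: "('k, 'a) cochain => bool" where
 "acx C \<longleftrightarrow> (ALL n. agrp (cpt C n)) &
  (ALL n. amap (cpt C n) (cpt C (n + 1)) (df C n)) &
  (ALL n. ALL x:carrier (cpt C n). df C (n + 1) (df C n x) = 0[cpt C (n + 2)])"

lemma acxD:
 assumes "acx C"
 shows "agrp (cpt C n)" "amap (cpt C n) (cpt C (n + 1)) (df C n)"
 using assms by (auto simp: acx_def)

lemma cc_acx: "cochain_complex R C ==> acx C"
 by (auto simp: cochain_complex_def acx_def intro: lin_am module_agrp)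

text \<open>The target degree is a variable with a side equation because degrees such as
  \<open>n - 1 + 1\<close> and \<open>n\<close> index syntactically different components. Most
  closure lemmas below take this form for the same reason.\<close>

lemma acx_cl: "acx C ==> x .: cpt C n ==> m = n + 1 ==> df C n x .: cpt C m"
 by (simp add: am_cl[OF acxD(2)])

lemma acx_dd: "acx C ==> x .: cpt C n ==> m = n + 1 ==> k = n + 2 ==>
  df C m (df C n x) = 0[cpt C k]"
 by (auto simp: acx_def)

lemma acx_coboundary_cocycle:
 assumes "acx C" shows "cobd C n <= cocycles C n"
 unfolding coboundaries_def cocycles_def
 using acx_cl[OF assms, where m = n and n = "n - 1"] acx_dd[OF assms, where m = n and n = "n - 1" and k = "n + 1"]
 by auto

lemma coboundariesI: "y .: cpt C m ==> m = n - 1 ==> df C m y : cobd C n"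
 by (auto simp: coboundaries_def)

lemma coboundariesE:
 assumes "x : cobd C n" "m = n - 1"
 obtains y where "y .: cpt C m" "x = df C m y"
 using assms by (auto simp: coboundaries_def)

lemma cobd_sub:
 assumes "acx C" shows "additive_subgroup (cobd C n) (cpt C n)"
proof -
 interpret G: agrp "cpt C n" by (rule acxD(1)[OF assms])
 interpret H: agrp "cpt C (n - 1)" by (rule acxD(1)[OF assms])
 have am: "amap (cpt C (n - 1)) (cpt C n) (df C (n - 1))"
  using acxD(2)[OF assms, of "n - 1"] by simp
 have s: "cobd C n <= carrier (cpt C n)"
  unfolding coboundaries_def using am_cl[OF am] by auto
 show ?thesis
 proof (rule additive_subgroupI, rule G.add.subgroupI)
  show "cobd C n <= carrier (cpt C n)" by (rule s)
  show "cobd C n ~= {}"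
   using H.zero_closed by (auto simp: coboundaries_def)
  fix a assume "a : cobd C n"
  then obtain y where y: "y .: cpt C (n - 1)" "a = df C (n - 1) y"
   by (auto simp: coboundaries_def)
  have "-[cpt C n] a = df C (n - 1) (\<ominus>\<^bsub>cpt C (n - 1)\<^esub> y)"
   using am_neg[OF H.ag G.ag am y(1)] y by simp
  then show "-[cpt C n] a : cobd C n"
   using y by (auto simp: coboundaries_def)
  fix b assume "b : cobd C n"
  then obtain x where x: "x .: cpt C (n - 1)" "b = df C (n - 1) x"
   by (auto simp: coboundaries_def)
  have "a +[cpt C n] b = df C (n - 1) (y +[cpt C (n - 1)] x)"
   using am_add[OF am] x y by simp
  then show "a +[cpt C n] b : cobd C n"
   using x y by (auto simp: coboundaries_def)
 qed
qed

lemma cocycles_subgroup: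
 assumes "acx C" shows "additive_subgroup (cocycles C n) (cpt C n)"
proof -
 interpret G: agrp "cpt C n" by (rule acxD(1)[OF assms])
 interpret H: agrp "cpt C (n + 1)" by (rule acxD(1)[OF assms])
 note am = acxD(2)[OF assms, of n]
 note aa = G.ag H.ag am
 show ?thesis
  by (rule additive_subgroupI, rule G.add.subgroupI)
   (use am_0[OF aa] am_neg[OF aa] am_add[OF am] in \<open>auto simp: cocycles_def\<close>)
qed

lemma acyclicE:
 assumes "hz C n" "x .: cpt C n" "df C n x = 0[cpt C k]" "k = n + 1" "m = n - 1"
 obtains y where "y .: cpt C m" "df C m y = x"
proof -
 have "x : cobd C n"
  using assms by (auto simp: cohomology_zero_def cocycles_def)
 then show ?thesis using that assms(5) by (auto simp: coboundaries_def)
qed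

lemma cohomology_zeroI:
 assumes "acx C"
  "!!x. x .: cpt C n ==> df C n x = 0[cpt C (n + 1)] ==>
   EX y:carrier (cpt C (n - 1)). df C (n - 1) y = x"
 shows "hz C n"
 unfolding cohomology_zero_def using acx_coboundary_cocycle[OF assms(1)] assms(2)
 by (fastforce simp: cocycles_def coboundaries_def)

text \<open>The inductive step of every peeling argument below: a filtration step of a complex whose
 subquotient \<open>K\<close> is acyclic in one degree.\<close>

lemma peel_step:
 assumes C: "acx C" and K: "acx K" and ac: "hz K k"
  and W: "!!n. additive_subgroup (W n) (cpt C n)"
  and dW: "!!n x. x : W n ==> df C n x : W (n + 1)"
  and kap: "!!j. amap (cpt K j) (cpt C (j + m)) (\<kappa> j)"
  and dk: "!!j y. y .: cpt K j ==>
   df C (j + m) (\<kappa> j y) -[cpt C (j + m + 1)] sg (cpt C (j + m + 1)) s (\<kappa> (j + 1) (df K j y))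
   : W (j + m + 1)"
  and inj: "!!j y. y .: cpt K j ==> \<kappa> j y : W (j + m) ==> y = 0[cpt K j]"
  and x: "v : W (k + m)" "y .: cpt K k" "x = v +[cpt C (k + m)] \<kappa> k y"
  and dx: "df C (k + m) x : W (k + m + 1)"
 shows "EX \<eta>:carrier (cpt K (k - 1)).
  x -[cpt C (k + m)] df C (k - 1 + m) (\<kappa> (k - 1) \<eta>) : W (k + m)"
proof -
 let ?C = "cpt C (k + m)" and ?C1 = "cpt C (k + m + 1)"
 interpret G: agrp ?C by (rule acxD(1)[OF C])
 interpret H: agrp ?C1 by (rule acxD(1)[OF C])
 interpret K0: agrp "cpt K (k - 1)" by (rule acxD(1)[OF K])
 interpret K1: agrp "cpt K k" by (rule acxD(1)[OF K])
 interpret K2: agrp "cpt K (k + 1)" by (rule acxD(1)[OF K])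
 interpret W0: additive_subgroup "W (k + m)" ?C by (rule W)
 interpret W1: additive_subgroup "W (k + m + 1)" ?C1 by (rule W)
 have kc: "\<kappa> k y .: ?C" using am_cl[OF kap] x by blast
 have e1: "k + 1 + m = k + m + 1" by simp
 have kap1: "amap (cpt K (k + 1)) ?C1 (\<kappa> (k + 1))" using kap[of "k + 1"] by (simp only: e1)
 have dy: "df K k y .: cpt K (k + 1)" using am_cl[OF acxD(2)[OF K]] x by blast
 have kdy: "\<kappa> (k + 1) (df K k y) .: ?C1" by (rule am_cl[OF kap1 dy])
 have vc: "v .: ?C" using x W0.a_subset by blast
 have dv: "df C (k + m) v : W (k + m + 1)" by (rule dW) (rule x)
 have dvc: "df C (k + m) v .: ?C1" using dv W1.a_subset by blast
 have dkc: "df C (k + m) (\<kappa> k y) .: ?C1" by (rule am_cl[OF acxD(2)[OF C] kc])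
 have dxe: "df C (k + m) x = df C (k + m) v +[?C1] df C (k + m) (\<kappa> k y)"
  unfolding x(3) by (rule am_add[OF acxD(2)[OF C] vc kc])
 have "df C (k + m) (\<kappa> k y) : W (k + m + 1)"
 proof -
  have "df C (k + m) (\<kappa> k y) = (\<ominus>\<^bsub>?C1\<^esub> df C (k + m) v) +[?C1] df C (k + m) x"
   unfolding dxe using dvc dkc by (simp add: H.r_neg1)
  then show ?thesis using dv dx by simp
 qed
 then have "sg ?C1 s (\<kappa> (k + 1) (df K k y)) : W (k + m + 1)"
 proof -
  let ?a = "df C (k + m) (\<kappa> k y)" and ?b = "sg ?C1 s (\<kappa> (k + 1) (df K k y))"
  assume a: "?a : W (k + m + 1)"
  have "?b = ?a +[?C1] -[?C1] (?a -[?C1] ?b)"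
   using dkc kdy by (simp add: H.minus_eq H.minus_add H.r_neg1 H.r_neg2)
  then show ?thesis using a dk[OF x(2)] by (metis W1.a_closed W1.a_inv_closed)
 qed
 then have "\<kappa> (k + 1) (df K k y) : W (k + m + 1)"
  using kdy by (auto simp: signed_def split: if_splits) (metis H.minus_minus W1.a_inv_closed)
 \<comment> \<open>Modulo \<open>W\<close> and up to sign, \<open>\<kappa>\<close> commutes with the
   differentials, so it sends \<open>df K k y\<close> into \<open>W\<close>; injectivity modulo
   \<open>W\<close> makes \<open>y\<close> a cocycle of \<open>K\<close>.\<close>
 then have "df K k y = 0[cpt K (k + 1)]"
  using inj[of "df K k y" "k + 1"] dy by (simp only: e1)
 then obtain \<eta> where eta: "\<eta> .: cpt K (k - 1)" "df K (k - 1) \<eta> = y"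
  using acyclicE[OF ac x(2)] by blast
 \<comment> \<open>The sign \<open>s\<close> is put on the primitive in advance, to offset the one
   with which \<open>\<kappa>\<close> commutes with the differentials.\<close>
 define \<eta>' where "\<eta>' = sg (cpt K (k - 1)) s \<eta>"
 have eta': "\<eta>' .: cpt K (k - 1)" using eta by (simp add: \<eta>'_def)
 have deta': "df K (k - 1) \<eta>' = sg (cpt K k) s y"
  using am_sg[OF K0.ag K1.ag _ eta(1), of "df K (k - 1)" s]
   acxD(2)[OF K, of "k - 1"] eta by (simp add: \<eta>'_def)
 have "\<kappa> k (sg (cpt K k) s y) = sg ?C s (\<kappa> k y)"
  by (rule am_sg[OF K1.ag G.ag kap x(2)])
 then have sk: "sg ?C s (\<kappa> k (sg (cpt K k) s y)) = \<kappa> k y"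
  using kc by (simp add: G.sg_sg)
 have e2: "k - 1 + m + 1 = k + m" and e3: "k - 1 + 1 = k" by simp_all
 have d2: "df C (k - 1 + m) (\<kappa> (k - 1) \<eta>') -[?C] \<kappa> k y : W (k + m)"
  using dk[OF eta'] unfolding e2 e3 deta' sk .
 have kc2: "df C (k - 1 + m) (\<kappa> (k - 1) \<eta>') .: ?C"
  using am_cl[OF acxD(2)[OF C, of "k - 1 + m"] am_cl[OF kap eta']]
  by (simp only: e2)
 have "x -[?C] df C (k - 1 + m) (\<kappa> (k - 1) \<eta>')
   = v +[?C] -[?C] (df C (k - 1 + m) (\<kappa> (k - 1) \<eta>') -[?C] \<kappa> k y)"
  unfolding x(3) using vc kc kc2 by (simp add: G.minus_eq G.minus_add G.a_ac)
 also have "... : W (k + m)" using x d2 by simp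
 finally show ?thesis using eta' by blast
qed

text \<open>The indices of \<open>D\<close> are removed one at a time in an order that
  \<open>step\<close> may choose; \<open>U\<close> is the invariant that keeps a removal possible.
  The corrections add up to a single \<open>q\<close> because \<open>W\<close> grows with its index
  set, so each of them lies in the initial span.\<close>

lemma peel:
 assumes C: "acx C" and "finite D"
  and W: "!!J. additive_subgroup (W J n) (cpt C n)"
  and W': "!!J. W J (n - 1) <= carrier (cpt C (n - 1))"
  and Wadd: "!!J x y. x : W J (n - 1) ==> y : W J (n - 1) ==> x +[cpt C (n - 1)] y : W J (n - 1)"
  and W0: "!!J. 0[cpt C (n - 1)] : W J (n - 1)"
  and mono: "!!J J'. J <= J' ==> W J (n - 1) <= W J' (n - 1)"
  and U: "U D"
  and step: "!!D'. D' <= D ==> D' ~= {} ==> U D' ==> EX i:D'. U (D' - {i}) &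
   (ALL x:W (J0 \<union> D') n. df C n x : W J0 (n + 1) -->
   (EX q:W (J0 \<union> D') (n - 1). x -[cpt C n] df C (n - 1) q : W (J0 \<union> (D' - {i})) n))"
  and x: "x : W (J0 \<union> D) n" "df C n x : W J0 (n + 1)"
 shows "EX q:W (J0 \<union> D) (n - 1). x -[cpt C n] df C (n - 1) q : W J0 n"
proof -
 interpret G: agrp "cpt C n" by (rule acxD(1)[OF C])
 interpret G0: agrp "cpt C (n - 1)" by (rule acxD(1)[OF C])
 interpret G1: agrp "cpt C (n + 1)" by (rule acxD(1)[OF C])
 have am: "amap (cpt C (n - 1)) (cpt C n) (df C (n - 1))"
  using acxD(2)[OF C, of "n - 1"] by simp
 \<comment> \<open>Generalised over \<open>D'\<close> and \<open>x\<close>, since the removal of an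
   index changes both.\<close>
 have gen: "D' <= D ==> U D' ==> x : W (J0 \<union> D') n ==> df C n x : W J0 (n + 1) ==>
   EX q:W (J0 \<union> D') (n - 1). x -[cpt C n] df C (n - 1) q : W J0 n" for D' x
 proof (induction "card D'" arbitrary: D' x rule: less_induct)
  case less
  have xc: "x .: cpt C n" using less.prems additive_subgroup.a_subset[OF W] by blast
  have fD: "finite D'" using \<open>finite D\<close> less.prems finite_subset by blast
  show ?case
  proof (cases "D' = {}")
   case True
   have "x -[cpt C n] df C (n - 1) 0[cpt C (n - 1)] = x"
   using am_0[OF G0.ag G.ag am] xc
   by (simp add: G.minus_eq)
   then show ?thesis using True less.prems W0 by (metis Un_empty_right)
  next
   case False
   obtain i q where i: "i : D'" "U (D' - {i})" and q: "q : W (J0 \<union> D') (n - 1)"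
   "x -[cpt C n] df C (n - 1) q : W (J0 \<union> (D' - {i})) n"
   using step[OF less.prems(1) False less.prems(2)] less.prems(3,4) by blast
   have qc: "q .: cpt C (n - 1)" using q W' by blast
   have dqc: "df C (n - 1) q .: cpt C n" using am_cl[OF am qc] .
   \<comment> \<open>Subtracting a coboundary leaves the differential unchanged, so the hypothesis
     that it lies over \<open>J0\<close> passes to the smaller index set.\<close>
   have "df C n (x -[cpt C n] df C (n - 1) q) = df C n x"
   using am_minus[OF G.ag G1.ag acxD(2)[OF C] xc dqc]
   acx_dd[OF C qc, of n "n + 1"] am_cl[OF acxD(2)[OF C] xc] by (simp add: G1.minus_eq)
   moreover have "card (D' - {i}) < card D'" using i(1) fD by (meson card_Diff1_less)
   ultimately obtain r where r: "r : W (J0 \<union> (D' - {i})) (n - 1)"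
   "x -[cpt C n] df C (n - 1) q -[cpt C n] df C (n - 1) r : W J0 n"
   using less.hyps[of "D' - {i}" "x -[cpt C n] df C (n - 1) q"] less.prems q i(2) by auto
   have r': "r : W (J0 \<union> D') (n - 1)" using r(1) mono[of "J0 \<union> (D' - {i})" "J0 \<union> D'"] by blast
   then have rc: "r .: cpt C (n - 1)" using W' by blast
   have "x -[cpt C n] df C (n - 1) (q +[cpt C (n - 1)] r)
   = x -[cpt C n] df C (n - 1) q -[cpt C n] df C (n - 1) r"
   using xc dqc am_cl[OF am rc] am_add[OF am qc rc]
   by (simp add: G.minus_eq G.minus_add G.a_ac)
   then show ?thesis using r(2) Wadd[OF q(1) r'] by metis
  qed
 qed
 then show ?thesis using x U by blast
qed

section \<open>Complexes of tuples\<close>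

lemma pm_simps [simp]:
 "carrier (pm I F) = (\<Pi>\<^sub>E i\<in>I. carrier (F i))"
 "0[pm I F] = (%i:I. 0[F i])"
 "x +[pm I F] y = (%i:I. x i +[F i] y i)"
 "c *[pm I F] x = (%i:I. c *[F i] x i)"
 by (simp_all add: product_module_def)

lemma pm_module:
 assumes "cring R" "!!i. i : I ==> Module.module R (F i)"
 shows "Module.module R (pm I F)"
proof (rule moduleI[OF assms(1)])
 have ag: "i : I ==> agrp (F i)" for i by (rule module_agrp[OF assms(2)])
 have ab: "i : I ==> abelian_group (F i)" for i
  using module_agrp[OF assms(2)] by (simp add: agrp_def)
 then have am: "i : I ==> abelian_monoid (F i)" for i
  by (simp add: abelian_group_def)
 show "abelian_group (pm I F)"
 proof (rule abelian_groupI)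
  fix x y z
  assume x: "x .: pm I F" and y: "y .: pm I F"
  then have xc: "x i .: F i" and yc: "y i .: F i" if "i : I" for i
   using that by auto
  show "x +[pm I F] y .: pm I F"
   using abelian_monoid.a_closed[OF am xc yc] by auto
  show "x +[pm I F] y = y +[pm I F] x"
   using abelian_monoid.a_comm[OF am xc yc] by (simp cong: restrict_cong)
  show "EX w:carrier (pm I F). w +[pm I F] x = 0[pm I F]"
  proof
   let ?w = "%i:I. -[F i] x i"
   show "?w .: pm I F"
   using abelian_group.a_inv_closed[OF ab xc] by auto
   show "?w +[pm I F] x = 0[pm I F]"
   using abelian_group.l_neg[OF ab xc] by (simp cong: restrict_cong)
  qed
  show "0[pm I F] +[pm I F] x = x"
  proof
   fix i show "(0[pm I F] +[pm I F] x) i = x i"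
   using x abelian_monoid.l_zero[OF am xc] by (cases "i : I") (simp_all add: PiE_arb[of x])
  qed
  assume z: "z .: pm I F"
  then have zc: "z i .: F i" if "i : I" for i
   using that by auto
  show "x +[pm I F] y +[pm I F] z = x +[pm I F] (y +[pm I F] z)"
   using abelian_monoid.a_assoc[OF am xc yc zc] by (simp cong: restrict_cong)
 next
  show "0[pm I F] .: pm I F"
   using abelian_monoid.zero_closed[OF am] by auto
 qed
next
 fix a x assume a: "a .: R" and x: "x .: pm I F"
 then have xc: "x i .: F i" if "i : I" for i
  using that by auto
 show "a *[pm I F] x .: pm I F"
  using Module.module.smult_closed[OF assms(2) a xc] by auto
 fix b assume b: "b .: R"
 show "(a +[R] b) *[pm I F] x
   = a *[pm I F] x +[pm I F] b *[pm I F] x"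
  using Module.module.smult_l_distr[OF assms(2) a b xc] by (simp cong: restrict_cong)
 show "(a \<otimes>\<^bsub>R\<^esub> b) *[pm I F] x = a *[pm I F] (b *[pm I F] x)"
  using Module.module.smult_assoc1[OF assms(2) a b xc] by (simp cong: restrict_cong)
next
 fix x assume x: "x .: pm I F"
 then have xc: "x i .: F i" if "i : I" for i
  using that by auto
 show "\<one>\<^bsub>R\<^esub> *[pm I F] x = x"
 proof
  fix i show "(\<one>\<^bsub>R\<^esub> *[pm I F] x) i = x i"
   using x Module.module.smult_one[OF assms(2) xc] by (cases "i : I") (simp_all add: PiE_arb[of x])
 qed
next
 fix a x y assume a: "a .: R"
  and x: "x .: pm I F" and y: "y .: pm I F"
 then have xc: "x i .: F i" and yc: "y i .: F i" if "i : I" for i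
  using that by auto
 show "a *[pm I F] (x +[pm I F] y)
   = a *[pm I F] x +[pm I F] a *[pm I F] y"
  using Module.module.smult_r_distr[OF assms(2) a xc yc] by (simp cong: restrict_cong)
qed

lemma pm_eval: "i : I ==> amap (pm I F) (F i) (%x. x i)"
 by (auto simp: amap_def)

text \<open>\<open>\<delta>\<close> is the diagonal and \<open>\<phi>\<close> the off-diagonal part of the differential.\<close>

locale tuple_complex = cring R for R :: "'k ring" +
 fixes I :: "int set" and K :: "int => int => ('k, 'q) module"
  and \<delta> :: "int => int => 'q => 'q" and \<phi> :: "int => int => int => 'q => 'q"
 assumes fin: "finite I"
  and K_module: "i : I ==> Module.module R (K n i)"
  and delta_linear: "i : I ==> linear_map R (K n i) (K (n + 1) i) (\<delta> n i)"
  and phi_linear: "i : I ==> k : I ==> linear_map R (K n k) (K (n + 1) i) (\<phi> n i k)"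
  and delta_delta: "i : I ==> x .: K n i ==> \<delta> (n + 1) i (\<delta> n i x) = 0[K (n + 2) i]"
  and delta_phi: "i : I ==> k : I ==> x .: K n k ==>
   \<delta> (n + 1) i (\<phi> n i k x) +[K (n + 2) i] \<phi> (n + 1) i k (\<delta> n k x) +[K (n + 2) i]
   (\<Oplus>[K (n + 2) i] l:I. \<phi> (n + 1) i l (\<phi> n l k x)) = 0[K (n + 2) i]"
begin

definition tcx :: "('k, int => 'q) cochain" where
 "tcx = \<lparr>cpt = (%n. pm I (K n)),
  cdiff = (%n x. %i:I. \<delta> n i (x i) +[K (n + 1) i] (\<Oplus>[K (n + 1) i] k:I. \<phi> n i k (x k)))\<rparr>"

lemma K_agrp: "i : I ==> agrp (K n i)"
 by (rule module_agrp[OF K_module])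

lemma delta_closed: "i : I ==> x .: K n i ==> m = n + 1 ==> \<delta> n i x .: K m i"
 using am_cl[OF lin_am[OF delta_linear]] by simp

lemma phi_closed: "i : I ==> k : I ==> x .: K n k ==> m = n + 1 ==> \<phi> n i k x .: K m i"
 using am_cl[OF lin_am[OF phi_linear]] by simp

lemma cpt_tcx: "cpt tcx n = pm I (K n)"
 by (simp add: tcx_def)

lemma cdiff_tcx: "i : I ==> df tcx n x i = \<delta> n i (x i) +[K (n + 1) i] (\<Oplus>[K (n + 1) i] k:I. \<phi> n i k (x k))"
 by (simp add: tcx_def)

lemma cdiff_tcx_closed: "x .: cpt tcx n ==> df tcx n x .: cpt tcx (n + 1)"
proof -
 assume x: "x .: cpt tcx n"
 have "df tcx n x i .: K (n + 1) i" if i: "i : I" for i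
 proof -
  interpret G: agrp "K (n + 1) i" by (rule K_agrp[OF i])
  show ?thesis unfolding cdiff_tcx[OF i] using x i
   by (intro G.a_closed G.finsum_closed) (auto simp: cpt_tcx PiE_mem intro!: delta_closed phi_closed)
 qed
 then show ?thesis by (auto simp: cpt_tcx tcx_def)
qed

lemma cc_tcx: "cochain_complex R tcx"
 unfolding cochain_complex_def
proof (intro conjI allI ballI)
 fix n
 show "Module.module R (cpt tcx n)"
  by (simp add: cpt_tcx pm_module[OF is_cring K_module])
 show "linear_map R (cpt tcx n) (cpt tcx (n + 1)) (df tcx n)"
 proof (rule linI)
  fix x assume x: "x .: cpt tcx n"
  then show "df tcx n x .: cpt tcx (n + 1)" by (rule cdiff_tcx_closed)
  { fix y assume y: "y .: cpt tcx n"
   have "df tcx n (x +[cpt tcx n] y) i = df tcx n x i +[K (n + 1) i] df tcx n y i"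
   if i: "i : I" for i
   proof -
   interpret G: agrp "K (n + 1) i" by (rule K_agrp[OF i])
   have xy: "k : I ==> x k .: K n k" "k : I ==> y k .: K n k" for k
   using x y by (auto simp: cpt_tcx PiE_mem)
   have "(\<Oplus>[K (n + 1) i] k:I. \<phi> n i k ((x +[cpt tcx n] y) k))
   = (\<Oplus>[K (n + 1) i] k:I. \<phi> n i k (x k) +[K (n + 1) i] \<phi> n i k (y k))"
   using i xy by (intro G.finsum_cong')
   (auto simp: cpt_tcx am_add[OF lin_am[OF phi_linear]] intro!: phi_closed)
   also have "... = (\<Oplus>[K (n + 1) i] k:I. \<phi> n i k (x k)) +[K (n + 1) i] (\<Oplus>[K (n + 1) i] k:I. \<phi> n i k (y k))"
   using i xy by (intro G.finsum_addf) (auto intro!: phi_closed)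
   finally have s: "(\<Oplus>[K (n + 1) i] k:I. \<phi> n i k ((x +[cpt tcx n] y) k)) = ..." .
   have c: "(\<Oplus>[K (n + 1) i] k:I. \<phi> n i k (x k)) .: K (n + 1) i"
   "(\<Oplus>[K (n + 1) i] k:I. \<phi> n i k (y k)) .: K (n + 1) i"
   using i xy by (auto intro!: G.finsum_closed phi_closed)
   have dd: "\<delta> n i (x i) .: K (n + 1) i" "\<delta> n i (y i) .: K (n + 1) i"
   using i xy by (auto intro!: delta_closed)
   have "\<delta> n i ((x +[cpt tcx n] y) i) = \<delta> n i (x i) +[K (n + 1) i] \<delta> n i (y i)"
   using i xy by (simp add: cpt_tcx am_add[OF lin_am[OF delta_linear]])
   then show ?thesis unfolding cdiff_tcx[OF i] s using c dd by (simp add: G.a_ac)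
   qed
   then show "df tcx n (x +[cpt tcx n] y) = df tcx n x +[cpt tcx (n + 1)] df tcx n y"
   by (auto simp: cpt_tcx fun_eq_iff restrict_def) (simp add: tcx_def)
  }
  { fix c assume c: "c .: R"
   have "df tcx n (c *[cpt tcx n] x) i = c *[K (n + 1) i] df tcx n x i"
   if i: "i : I" for i
   proof -
   interpret G: Module.module R "K (n + 1) i" by (rule K_module[OF i])
   have G: "agrp (K (n + 1) i)" by (rule K_agrp[OF i])
   have xx: "k : I ==> x k .: K n k" for k
   using x by (auto simp: cpt_tcx PiE_mem)
   have "amap (K (n + 1) i) (K (n + 1) i) (%x. c *[K (n + 1) i] x)"
   using c by (auto intro!: amI simp: G.smult_r_distr)
   then have "c *[K (n + 1) i] (\<Oplus>[K (n + 1) i] k:I. \<phi> n i k (x k))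
   = (\<Oplus>[K (n + 1) i] k:I. c *[K (n + 1) i] \<phi> n i k (x k))"
   using xx i phi_closed by (intro am_finsum[OF G G]) auto
   also have "... = (\<Oplus>[K (n + 1) i] k:I. \<phi> n i k ((c *[cpt tcx n] x) k))"
   using i xx c by (intro G.finsum_cong')
   (auto simp: cpt_tcx lin_smult[OF phi_linear] intro!: phi_closed module.smult_closed[OF K_module])
   finally have s: "(\<Oplus>[K (n + 1) i] k:I. \<phi> n i k ((c *[cpt tcx n] x) k))
   = c *[K (n + 1) i] (\<Oplus>[K (n + 1) i] k:I. \<phi> n i k (x k))" by simp
   have cc: "(\<Oplus>[K (n + 1) i] k:I. \<phi> n i k (x k)) .: K (n + 1) i"
   using i xx by (auto intro!: G.finsum_closed phi_closed)
   have "\<delta> n i (x i) .: K (n + 1) i" using i xx by (auto intro!: delta_closed)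
   moreover have "\<delta> n i ((c *[cpt tcx n] x) i) = c *[K (n + 1) i] \<delta> n i (x i)"
   using i xx c by (simp add: cpt_tcx lin_smult[OF delta_linear])
   ultimately show ?thesis unfolding cdiff_tcx[OF i] s using cc c by (simp add: G.smult_r_distr)
   qed
   then show "df tcx n (c *[cpt tcx n] x) = c *[cpt tcx (n + 1)] df tcx n x"
   by (auto simp: cpt_tcx fun_eq_iff restrict_def) (simp add: tcx_def)
  }
 qed
 fix x assume x: "x .: cpt tcx n"
 have "df tcx (n + 1) (df tcx n x) i = 0[K (n + 2) i]" if i: "i : I" for i
 proof -
  interpret G: agrp "K (n + 2) i" by (rule K_agrp[OF i])
  interpret G1: agrp "K (n + 1) i" by (rule K_agrp[OF i])
  have xx: "k : I ==> x k .: K n k" for k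
   using x by (auto simp: cpt_tcx PiE_mem)
  have am: "amap (K (n + 1) i) (K (n + 2) i) (\<delta> (n + 1) i)"
   "k : I ==> amap (K (n + 1) k) (K (n + 2) i) (\<phi> (n + 1) i k)" for k
   using lin_am[OF delta_linear[OF i, of "n + 1"]]
   lin_am[OF phi_linear[OF i, of k "n + 1"]] by (simp_all add: add.assoc)
  have sc: "k : I ==> (\<Oplus>[K (n + 1) k] l:I. \<phi> n k l (x l)) .: K (n + 1) k" for k
   using xx by (intro abelian_monoid.finsum_closed)
   (auto intro!: phi_closed abelian_group.axioms(1) K_agrp[unfolded agrp_def])
  have c1: "k : I ==> \<delta> (n + 1) i (\<phi> n i k (x k)) .: K (n + 2) i"
   "k : I ==> \<phi> (n + 1) i k (\<delta> n k (x k)) .: K (n + 2) i"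
   "k : I ==> l : I ==> \<phi> (n + 1) i k (\<phi> n k l (x l)) .: K (n + 2) i" for k l
   using i xx by (auto intro!: delta_closed[where m = "n + 2" and n = "n + 1"]
   phi_closed[where m = "n + 2" and n = "n + 1"] delta_closed[where m = "n + 1"] phi_closed[where m = "n + 1"])
  have "\<delta> (n + 1) i (df tcx n x i) = \<delta> (n + 1) i (\<delta> n i (x i)) +[K (n + 2) i]
   \<delta> (n + 1) i (\<Oplus>[K (n + 1) i] k:I. \<phi> n i k (x k))"
   unfolding cdiff_tcx[OF i] using i xx sc by (intro am_add[OF am(1)]) (auto intro!: delta_closed)
  also have "... = (\<Oplus>[K (n + 2) i] k:I. \<delta> (n + 1) i (\<phi> n i k (x k)))"
   using i xx am_finsum[OF G1.ag G.ag am(1), of I "%k. \<phi> n i k (x k)"] c1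
   by (simp add: delta_delta phi_closed)
  finally have e1: "\<delta> (n + 1) i (df tcx n x i) = ..." .
  have e2: "\<phi> (n + 1) i k (df tcx n x k) = \<phi> (n + 1) i k (\<delta> n k (x k)) +[K (n + 2) i]
   (\<Oplus>[K (n + 2) i] l:I. \<phi> (n + 1) i k (\<phi> n k l (x l)))" if k: "k : I" for k
  proof -
   have "\<phi> (n + 1) i k (df tcx n x k) = \<phi> (n + 1) i k (\<delta> n k (x k)) +[K (n + 2) i]
   \<phi> (n + 1) i k (\<Oplus>[K (n + 1) k] l:I. \<phi> n k l (x l))"
   unfolding cdiff_tcx[OF k] using k xx sc by (intro am_add[OF am(2)[OF k]]) (auto intro!: delta_closed)
   also have "\<phi> (n + 1) i k (\<Oplus>[K (n + 1) k] l:I. \<phi> n k l (x l)) = (\<Oplus>[K (n + 2) i] l:I. \<phi> (n + 1) i k (\<phi> n k l (x l)))"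
   using k xx phi_closed by (intro am_finsum[OF K_agrp[OF k] G.ag am(2)[OF k]]) auto
   finally show ?thesis .
  qed
  have s2: "k : I ==> (\<Oplus>[K (n + 2) i] l:I. \<phi> (n + 1) i k (\<phi> n k l (x l))) .: K (n + 2) i" for k
   using c1 by (intro G.finsum_closed) auto
  have s3: "k : I ==> (\<Oplus>[K (n + 2) i] l:I. \<phi> (n + 1) i l (\<phi> n l k (x k))) .: K (n + 2) i" for k
   using c1 by (intro G.finsum_closed) auto
  have "(\<Oplus>[K (n + 2) i] k:I. \<phi> (n + 1) i k (df tcx n x k))
   = (\<Oplus>[K (n + 2) i] k:I. \<phi> (n + 1) i k (\<delta> n k (x k)) +[K (n + 2) i]
   (\<Oplus>[K (n + 2) i] l:I. \<phi> (n + 1) i k (\<phi> n k l (x l))))"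
   using c1 s2 e2 by (intro G.finsum_cong') auto
  also have "... = (\<Oplus>[K (n + 2) i] k:I. \<phi> (n + 1) i k (\<delta> n k (x k))) +[K (n + 2) i]
   (\<Oplus>[K (n + 2) i] k:I. \<Oplus>[K (n + 2) i] l:I. \<phi> (n + 1) i k (\<phi> n k l (x l)))"
   using c1 s2 by (intro G.finsum_addf) auto
  \<comment> \<open>Regrouped by the source \<open>k\<close> of the paths
    \<open>k -> l -> i\<close>; each summand of the total then becomes an instance of
    \<open>delta_phi\<close>.\<close>
  also have "(\<Oplus>[K (n + 2) i] k:I. \<Oplus>[K (n + 2) i] l:I. \<phi> (n + 1) i k (\<phi> n k l (x l)))
   = (\<Oplus>[K (n + 2) i] k:I. \<Oplus>[K (n + 2) i] l:I. \<phi> (n + 1) i l (\<phi> n l k (x k)))"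
   using c1 by (intro G.finsum_swap fin) auto
  finally have e3: "(\<Oplus>[K (n + 2) i] k:I. \<phi> (n + 1) i k (df tcx n x k))
   = (\<Oplus>[K (n + 2) i] k:I. \<phi> (n + 1) i k (\<delta> n k (x k))) +[K (n + 2) i]
   (\<Oplus>[K (n + 2) i] k:I. \<Oplus>[K (n + 2) i] l:I. \<phi> (n + 1) i l (\<phi> n l k (x k)))" .
  have "df tcx (n + 1) (df tcx n x) i
   = (\<Oplus>[K (n + 2) i] k:I. \<delta> (n + 1) i (\<phi> n i k (x k))) +[K (n + 2) i]
   ((\<Oplus>[K (n + 2) i] k:I. \<phi> (n + 1) i k (\<delta> n k (x k))) +[K (n + 2) i]
   (\<Oplus>[K (n + 2) i] k:I. \<Oplus>[K (n + 2) i] l:I. \<phi> (n + 1) i l (\<phi> n l k (x k))))"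
   using cdiff_tcx[OF i, of "n + 1" "df tcx n x"] by (simp add: e1 e3 add.assoc)
  also have "... = (\<Oplus>[K (n + 2) i] k:I. \<delta> (n + 1) i (\<phi> n i k (x k)) +[K (n + 2) i]
   (\<phi> (n + 1) i k (\<delta> n k (x k)) +[K (n + 2) i]
   (\<Oplus>[K (n + 2) i] l:I. \<phi> (n + 1) i l (\<phi> n l k (x k)))))"
   using c1 s3 by (simp add: G.finsum_addf Pi_iff)
  also have "... = 0[K (n + 2) i]"
   using c1 s3 delta_phi[OF i _ xx] by (intro G.finsum_all_0) (auto simp flip: G.a_assoc)
  finally show ?thesis .
 qed
 then show "df tcx (n + 1) (df tcx n x) = 0[cpt tcx (n + 2)]"
  by (auto simp: cpt_tcx fun_eq_iff restrict_def) (simp add: tcx_def)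
qed

lemma acx_tcx: "acx tcx"
 by (rule cc_acx[OF cc_tcx])

text \<open>\<open>\<rho>\<close> orders the index set so that \<open>\<phi>\<close> is strictly triangular.\<close>

lemma tuple_acyclic:
 fixes \<rho> :: "int => int"
 assumes inj: "inj_on \<rho> I"
  and tri: "!!i k n x. i : I ==> k : I ==> \<rho> i <= \<rho> k ==> x .: K n k ==> \<phi> n i k x = 0[K (n + 1) i]"
  and ac: "!!i x. i : I ==> c <= \<rho> i ==> x .: K n i ==> \<delta> n i x = 0[K (n + 1) i] ==>
   EX y:carrier (K (n - 1) i). \<delta> (n - 1) i y = x"
  and x: "x .: cpt tcx n" "df tcx n x = 0[cpt tcx (n + 1)]"
   "!!i. i : I ==> \<rho> i < c ==> x i = 0[K n i]"
 shows "EX q:carrier (cpt tcx (n - 1)). (ALL i:I. \<rho> i < c --> q i = 0[K (n - 1) i]) & df tcx (n - 1) q = x"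
 using ac x
proof (induction "card {i\<in>I. c <= \<rho> i}" arbitrary: c x rule: less_induct)
 case less
 note ac = less.prems(1) and x = less.prems(2-4)
 let ?J = "{i\<in>I. c <= \<rho> i}"
 interpret G: agrp "cpt tcx n" by (rule acxD(1)[OF acx_tcx])
 interpret G0: agrp "cpt tcx (n - 1)" by (rule acxD(1)[OF acx_tcx])
 interpret G1: agrp "cpt tcx (n + 1)" by (rule acxD(1)[OF acx_tcx])
 have am: "amap (cpt tcx (n - 1)) (cpt tcx n) (df tcx (n - 1))"
  using acxD(2)[OF acx_tcx, of "n - 1"] by simp
 show ?case
 proof (cases "?J = {}")
  case True
  then have "x i = 0[K n i]" if "i : I" for i using x(3)[OF that] that by (auto simp: not_le)
  then have "x = 0[cpt tcx n]"
   using x(1) by (intro PiE_ext[of _ I "%i. carrier (K n i)"]) (use G.zero_closed in \<open>auto simp: cpt_tcx\<close>)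
  moreover have "df tcx (n - 1) 0[cpt tcx (n - 1)] = 0[cpt tcx n]"
   by (rule am_0[OF G0.ag G.ag am])
  moreover have "ALL i:I. \<rho> i < c --> 0[cpt tcx (n - 1)] i = 0[K (n - 1) i]"
   by (simp add: cpt_tcx)
  ultimately show ?thesis using G0.zero_closed by metis
 next
  case False
  have fJ: "finite ?J" using fin by simp
  \<comment> \<open>At the index of least \<open>\<rho>\<close> that may still carry something, no
    off-diagonal term arrives: those from larger \<open>\<rho>\<close> vanish by triangularity,
    those from smaller \<open>\<rho>\<close> because \<open>x\<close> does. So this component is
    closed for \<open>\<delta>\<close> alone.\<close>
  then obtain i0 where i0: "i0 : ?J" "!!i. i : ?J ==> \<rho> i0 <= \<rho> i"
   using False by (metis (no_types, lifting) arg_min_if_finite not_less)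
  then have i0I: "i0 : I" by simp
  interpret L: agrp "K n i0" by (rule K_agrp[OF i0I])
  interpret L0: agrp "K (n - 1) i0" by (rule K_agrp[OF i0I])
  interpret L1: agrp "K (n + 1) i0" by (rule K_agrp[OF i0I])
  have xx: "k : I ==> x k .: K n k" for k
   using x by (auto simp: cpt_tcx PiE_mem)
  have phi0: "\<phi> m i k 0[K m k] = 0[K (m + 1) i]" if "i : I" "k : I" for m i k
   by (rule am_0[OF K_agrp[OF that(2)] K_agrp[OF that(1)] lin_am[OF phi_linear[OF that]]])
  have small: "x k = 0[K n k]" if "k : I" "\<rho> k < \<rho> i0" for k
  proof -
   have "k ~: ?J" using i0(2)[of k] that(2) by auto
   then show ?thesis using x(3)[of k] that by auto
  qed
  have "(\<Oplus>[K (n + 1) i0] k:I. \<phi> n i0 k (x k)) = 0[K (n + 1) i0]"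
  proof (rule L1.finsum_all_0)
   fix k assume "k : I"
   then show "\<phi> n i0 k (x k) = 0[K (n + 1) i0]"
   using tri[OF i0I _ _ xx, of k] small phi0[OF i0I] by (cases "\<rho> i0 <= \<rho> k") auto
  qed
  moreover have "df tcx n x i0 = 0[K (n + 1) i0]"
   unfolding x(2) using i0I by (simp add: cpt_tcx)
  ultimately have "\<delta> n i0 (x i0) = 0[K (n + 1) i0]"
   unfolding cdiff_tcx[OF i0I] using delta_closed[OF i0I xx[OF i0I]] by simp
  \<comment> \<open>A primitive of this component placed at \<open>i0\<close> affects, apart from
    \<open>i0\<close>, only components of larger \<open>\<rho>\<close>. The difference is therefore
    supported strictly above \<open>i0\<close>.\<close>
  then obtain \<eta> where eta: "\<eta> .: K (n - 1) i0" "\<delta> (n - 1) i0 \<eta> = x i0"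
   using ac[OF i0I _ xx[OF i0I]] i0 by auto
  define q0 where "q0 = (%i:I. if i = i0 then \<eta> else 0[K (n - 1) i])"
  have q0c: "q0 .: cpt tcx (n - 1)"
   using eta G0.zero_closed by (auto simp: q0_def cpt_tcx)
  have dq0: "df tcx (n - 1) q0 i = (if i = i0 then x i0 else 0[K n i])" if i: "i : I" "\<rho> i <= \<rho> i0" for i
  proof -
   interpret M: agrp "K n i" by (rule K_agrp[OF i(1)])
   interpret M0: agrp "K (n - 1) i" by (rule K_agrp[OF i(1)])
   have "(\<Oplus>[K n i] k:I. \<phi> (n - 1) i k (q0 k)) = 0[K n i]"
   proof (rule M.finsum_all_0)
   fix k assume k: "k : I"
   then show "\<phi> (n - 1) i k (q0 k) = 0[K n i]"
   using tri[OF i(1) k, of \<eta> "n - 1"] i(2) eta phi0[OF i(1) k, of "n - 1"]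
   by (auto simp: q0_def)
   qed
   moreover have "\<delta> (n - 1) i 0[K (n - 1) i] = 0[K n i]"
   using am_0[OF M0.ag M.ag, of "\<delta> (n - 1) i"]
   lin_am[OF delta_linear[OF i(1), of "n - 1"]] by simp
   ultimately show ?thesis
   using cdiff_tcx[OF i(1), of "n - 1" q0] i eta xx[OF i0I] by (simp add: q0_def)
  qed
  have dq0c: "df tcx (n - 1) q0 .: cpt tcx n"
   using am_cl[OF am q0c] .
  define x' where "x' = x -[cpt tcx n] df tcx (n - 1) q0"
  have x'c: "x' .: cpt tcx n" using x dq0c by (simp add: x'_def)
  have "df tcx n x' = df tcx n x -[cpt tcx (n + 1)] df tcx n (df tcx (n - 1) q0)"
   unfolding x'_def using x dq0c
   by (intro am_minus[OF G.ag G1.ag acxD(2)[OF acx_tcx]])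
  then have dx': "df tcx n x' = 0[cpt tcx (n + 1)]"
   using acx_dd[OF acx_tcx q0c, of n "n + 1"] x G1.zero_closed by (simp add: G1.minus_eq del: pm_simps)
  have x'z: "x' i = 0[K n i]" if i: "i : I" "\<rho> i < \<rho> i0 + 1" for i
  proof -
   interpret M: agrp "K n i" by (rule K_agrp[OF i(1)])
   have "x' i = x i -[K n i] df tcx (n - 1) q0 i"
   unfolding x'_def using am_minus[OF G.ag M.ag, of "%x. x i"] x dq0c
   pm_eval[OF i(1), of "K n"] by (simp add: cpt_tcx del: pm_simps)
   moreover have "x i = df tcx (n - 1) q0 i"
   using dq0[OF i(1)] i small[OF i(1)] inj_onD[OF inj, of i i0] i0I
   by (cases "i = i0"; cases "\<rho> i = \<rho> i0") auto
   ultimately show ?thesis using xx[OF i(1)] by (simp add: M.minus_eq M.r_neg)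
  qed
  have "{i\<in>I. \<rho> i0 + 1 <= \<rho> i} \<subset> ?J" using i0 by force
  then have "card {i\<in>I. \<rho> i0 + 1 <= \<rho> i} < card ?J" by (rule psubset_card_mono[OF fJ])
  then obtain q where q: "q .: cpt tcx (n - 1)"
   "!!i. i : I ==> \<rho> i < \<rho> i0 + 1 ==> q i = 0[K (n - 1) i]" "df tcx (n - 1) q = x'"
   using less.hyps[of "\<rho> i0 + 1" x'] ac i0 x'c dx' x'z by force
  have "df tcx (n - 1) (q0 +[cpt tcx (n - 1)] q) = df tcx (n - 1) q0 +[cpt tcx n] x'"
   using am_add[OF am q0c q(1)] q by simp
  also have "... = x"
   unfolding x'_def using x dq0c by (simp add: G.minus_eq G.a_lcomm G.r_neg del: pm_simps)
  finally have "df tcx (n - 1) (q0 +[cpt tcx (n - 1)] q) = x" .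
  moreover have "(q0 +[cpt tcx (n - 1)] q) i = 0[K (n - 1) i]" if i: "i : I" "\<rho> i < c" for i
  proof -
   interpret M: agrp "K (n - 1) i" by (rule K_agrp[OF i(1)])
   show ?thesis using i i0 q(2)[OF i(1)] by (auto simp: cpt_tcx q0_def)
  qed
  moreover have "q0 +[cpt tcx (n - 1)] q .: cpt tcx (n - 1)"
   using q0c q by (rule_tac G0.a_closed)
  ultimately show ?thesis by blast
 qed
qed

end

section \<open>Modules over a dg category\<close>

lemma lin_sg:
 assumes "Module.module R N" "linear_map R M N f"
 shows "linear_map R M N (%x. sg N n (f x))"
proof -
 interpret N: Module.module R N by fact
 interpret N: agrp N by (rule module_agrp[OF assms(1)])
 note lm = assms(2)[THEN lin_am]
 show ?thesis
 proof (rule linI)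
  fix c x assume "c .: R" "x .: M"
  then show "sg N n (f (c *[M] x)) = c *[N] sg N n (f x)"
   using am_cl[OF lm, of x]
   by (simp add: lin_smult[OF assms(2)] signed_def N.smult_r_minus)
 qed (auto simp: am_cl[OF lm] am_add[OF lm] N.sg_add)
qed

context dg_category
begin

lemma hom_module: "X : Ob A ==> Y : Ob A ==> Module.module R (dhom A X Y n)"
 using Hom_complex by (auto simp: cochain_complex_def)

lemma hom_ag: "X : Ob A ==> Y : Ob A ==> agrp (dhom A X Y n)"
 by (rule module_agrp[OF hom_module])

lemma hom_acx: "X : Ob A ==> Y : Ob A ==> acx (Hom A X Y)"
 by (rule cc_acx[OF Hom_complex])

lemma cmp_am_l:
 "X : Ob A ==> Y : Ob A ==> Z : Ob A ==> f .: dhom A X Y n ==> k = m + n ==>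
 amap (dhom A Y Z m) (dhom A X Z k) (%g. cmp A X Y Z m n g f)"
 using lin_am[OF comp_linear_left] by simp

lemma cmp_am_r:
 "X : Ob A ==> Y : Ob A ==> Z : Ob A ==> g .: dhom A Y Z m ==> k = m + n ==>
 amap (dhom A X Y n) (dhom A X Z k) (%f. cmp A X Y Z m n g f)"
 using lin_am[OF comp_linear_right] by simp

lemma cmp_cl:
 "X : Ob A ==> Y : Ob A ==> Z : Ob A ==> g .: dhom A Y Z m ==> f .: dhom A X Y n ==>
 k = m + n ==> cmp A X Y Z m n g f .: dhom A X Z k"
 by (rule am_cl[OF cmp_am_l])

lemma comp_assoc':
 "W : Ob A ==> X : Ob A ==> Y : Ob A ==> Z : Ob A ==> h .: dhom A Y Z l ==>
 g .: dhom A X Y m ==> f .: dhom A W X n ==> p = l + m ==> q = m + n ==>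
 cmp A W X Z p n (cmp A X Y Z l m h g) f = cmp A W Y Z l q h (cmp A W X Y m n g f)"
 by (simp add: comp_assoc)

end

context dg_module
begin

lemma val_module: "X : Ob A ==> Module.module R (vcpt M X n)"
 using val_complex by (auto simp: cochain_complex_def)

lemma val_ag: "X : Ob A ==> agrp (vcpt M X n)"
 by (rule module_agrp[OF val_module])

lemma val_acx: "X : Ob A ==> acx (val M X)"
 by (rule cc_acx[OF val_complex])

lemma act_am_l:
 "X : Ob A ==> Y : Ob A ==> f .: dhom A X Y n ==> k = m + n ==>
 amap (vcpt M Y m) (vcpt M X k) (%x. act M X Y m n x f)"
 using lin_am[OF act_linear_left] by simp

lemma act_am_r:
 "X : Ob A ==> Y : Ob A ==> x .: vcpt M Y m ==> k = m + n ==>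
 amap (dhom A X Y n) (vcpt M X k) (%f. act M X Y m n x f)"
 using lin_am[OF act_linear_right] by simp

lemma act_cl:
 "X : Ob A ==> Y : Ob A ==> x .: vcpt M Y m ==> f .: dhom A X Y n ==> k = m + n ==>
 act M X Y m n x f .: vcpt M X k"
 by (rule am_cl[OF act_am_l])

lemma act_comp':
 "X : Ob A ==> Y : Ob A ==> Z : Ob A ==> x .: vcpt M Z l ==>
 g .: dhom A Y Z m ==> f .: dhom A X Y n ==> p = l + m ==> q = m + n ==>
 act M X Y p n (act M Y Z l m x g) f = act M X Z l q x (cmp A X Y Z m n g f)"
 by (simp add: act_comp)

lemma act_leibniz':
 "X : Ob A ==> Y : Ob A ==> x .: vcpt M Y m ==> f .: dhom A X Y n ==>
 k = m + n ==> l = m + n + 1 ==> m' = m + 1 ==> n' = n + 1 ==>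
 df (val M X) k (act M X Y m n x f) =
 act M X Y m' n (df (val M Y) m x) f +[vcpt M X l]
 sg (vcpt M X l) m (act M X Y m n' x (df (Hom A X Y) n f))"
 by (simp add: act_leibniz)

end

text \<open>Left modules, with their unsigned action; see \<open>left_dg_of_op\<close> for the comparison.\<close>

locale left_dg = dg_category R A for R :: "'k ring" and A :: "('o, 'k, 'a) dgcat" +
 fixes V :: "'o => ('k, 'n) cochain" and la :: "'o => 'o => int => int => 'a => 'n => 'n"
 assumes lval_complex: "X : Ob A ==> cochain_complex R (V X)"
  and la_linear_left:
   "[|X : Ob A; Y : Ob A; y .: cpt (V X) l|] ==>
   linear_map R (dhom A X Y j) (cpt (V Y) (j + l)) (%f. la X Y j l f y)"
  and la_linear_right:
   "[|X : Ob A; Y : Ob A; f .: dhom A X Y j|] ==>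
   linear_map R (cpt (V X) l) (cpt (V Y) (j + l)) (%y. la X Y j l f y)"
  and la_comp:
   "[|X : Ob A; Y : Ob A; Z : Ob A; g .: dhom A Y Z m; f .: dhom A X Y n;
   y .: cpt (V X) l|] ==>
   la X Z (m + n) l (cmp A X Y Z m n g f) y = la Y Z m (n + l) g (la X Y n l f y)"
  and la_ident: "[|X : Ob A; y .: cpt (V X) l|] ==> la X X 0 l (ident A X) y = y"
  and la_leibniz:
   "[|X : Ob A; Y : Ob A; f .: dhom A X Y j; y .: cpt (V X) l|] ==>
   df (V Y) (j + l) (la X Y j l f y) =
   la X Y (j + 1) l (df (Hom A X Y) j f) y +[cpt (V Y) (j + l + 1)]
   sg (cpt (V Y) (j + l + 1)) j (la X Y j (l + 1) f (df (V X) l y))"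
begin

lemma lval_module: "X : Ob A ==> Module.module R (cpt (V X) n)"
 using lval_complex by (auto simp: cochain_complex_def)

lemma lval_ag: "X : Ob A ==> agrp (cpt (V X) n)"
 by (rule module_agrp[OF lval_module])

lemma lv_acx: "X : Ob A ==> acx (V X)"
 by (rule cc_acx[OF lval_complex])

lemma la_am_l:
 "X : Ob A ==> Y : Ob A ==> y .: cpt (V X) l ==> k = j + l ==>
 amap (dhom A X Y j) (cpt (V Y) k) (%f. la X Y j l f y)"
 using lin_am[OF la_linear_left] by simp

lemma la_am_r:
 "X : Ob A ==> Y : Ob A ==> f .: dhom A X Y j ==> k = j + l ==>
 amap (cpt (V X) l) (cpt (V Y) k) (%y. la X Y j l f y)"
 using lin_am[OF la_linear_right] by simp

lemma la_cl:
 "X : Ob A ==> Y : Ob A ==> f .: dhom A X Y j ==> y .: cpt (V X) l ==> k = j + l ==>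
 la X Y j l f y .: cpt (V Y) k"
 by (rule am_cl[OF la_am_r])

lemma la_comp':
 "X : Ob A ==> Y : Ob A ==> Z : Ob A ==> g .: dhom A Y Z m ==> f .: dhom A X Y n ==>
 y .: cpt (V X) l ==> p = m + n ==> q = n + l ==>
 la X Z p l (cmp A X Y Z m n g f) y = la Y Z m q g (la X Y n l f y)"
 by (simp add: la_comp)

lemma la_leibniz':
 "X : Ob A ==> Y : Ob A ==> f .: dhom A X Y j ==> y .: cpt (V X) l ==>
 k = j + l ==> r = j + l + 1 ==> j' = j + 1 ==> l' = l + 1 ==>
 df (V Y) k (la X Y j l f y) =
 la X Y j' l (df (Hom A X Y) j f) y +[cpt (V Y) r]
 sg (cpt (V Y) r) j (la X Y j l' f (df (V X) l y))"
 by (simp add: la_leibniz)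

end

subsection \<open>Representable modules\<close>

definition yon :: "('o, 'k, 'a) dgcat => 'o => ('o, 'k, 'a, 'a) dgmod" where
 "yon A X = \<lparr>val = (%Y. Hom A Y X), act = (%Y Z m n x f. cmp A Y Z X m n x f)\<rparr>"

lemma yon_simps [simp]: "val (yon A X) Y = Hom A Y X" "act (yon A X) Y Z m n x f = cmp A Y Z X m n x f"
 by (simp_all add: yon_def)

lemma (in dg_category) dg_module_yon: "X : Ob A ==> dg_module R A (yon A X)"
 by unfold_locales
  (auto intro: Hom_complex comp_linear_left comp_linear_right comp_assoc comp_ident_right leibniz)

lemma (in dg_category) left_dg_coyon: "X : Ob A ==> left_dg R A (Hom A X) (cmp A X)"
 by unfold_locales
  (auto intro: Hom_complex comp_linear_left comp_linear_right comp_assoc comp_ident_left leibniz)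

subsection \<open>The opposite category\<close>

lemma op_dgcat_simps [simp]:
 "Ob (op_dgcat A) = Ob A" "Hom (op_dgcat A) X Y = Hom A Y X" "ident (op_dgcat A) = ident A"
 "cmp (op_dgcat A) X Y Z m n g f = sg (dhom A Z X (m + n)) (m * n) (cmp A Z Y X n m f g)"
 by (simp_all add: op_dgcat_def)

lemma (in dg_category) dg_category_op: "dg_category R (op_dgcat A)"
proof unfold_locales
 fix X Y assume "X : Ob (op_dgcat A)" "Y : Ob (op_dgcat A)"
 then show "cochain_complex R (Hom (op_dgcat A) X Y)" by (simp add: Hom_complex)
next
 fix X Y Z f n m
 assume "X : Ob (op_dgcat A)" "Y : Ob (op_dgcat A)" "Z : Ob (op_dgcat A)"
  "f .: dhom (op_dgcat A) X Y n"
 then show "linear_map R (dhom (op_dgcat A) Y Z m) (dhom (op_dgcat A) X Z (m + n))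
   (%g. cmp (op_dgcat A) X Y Z m n g f)"
  using comp_linear_right[of Z Y X f n m] by (auto simp: add.commute intro!: lin_sg hom_module)
next
 fix X Y Z g n m
 assume "X : Ob (op_dgcat A)" "Y : Ob (op_dgcat A)" "Z : Ob (op_dgcat A)"
  "g .: dhom (op_dgcat A) Y Z m"
 then show "linear_map R (dhom (op_dgcat A) X Y n) (dhom (op_dgcat A) X Z (m + n))
   (%f. cmp (op_dgcat A) X Y Z m n g f)"
  using comp_linear_left[of Z Y X g m n] by (auto simp: add.commute intro!: lin_sg hom_module)
next
 fix W X Y Z h l g m f n
 assume ob: "W : Ob (op_dgcat A)" "X : Ob (op_dgcat A)" "Y : Ob (op_dgcat A)" "Z : Ob (op_dgcat A)"
  and hgf: "h .: dhom (op_dgcat A) Y Z l" "g .: dhom (op_dgcat A) X Y m"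
   "f .: dhom (op_dgcat A) W X n"
 then have o: "W : Ob A" "X : Ob A" "Y : Ob A" "Z : Ob A"
  and c: "h .: dhom A Z Y l" "g .: dhom A Y X m" "f .: dhom A X W n"
  by auto
 interpret G: agrp "dhom A Z W (l + m + n)" by (rule hom_ag) (use o in auto)
 define gh where "gh = cmp A Z Y X m l g h"
 have gh: "gh .: dhom A Z X (l + m)"
  using cmp_cl[OF o(4,3,2) c(2,1), of "l + m"] by (simp add: gh_def)
 define fg where "fg = cmp A Y X W n m f g"
 have fg: "fg .: dhom A Y W (m + n)"
  using cmp_cl[OF o(3,2,1) c(3,2), of "m + n"] by (simp add: fg_def)
 \<comment> \<open>Both sides are sign multiples of this triple composite, with the same exponent
   \<open>l m + l n + m n\<close>.\<close>
 define r where "r = cmp A Z X W n (l + m) f gh"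
 have r: "r .: dhom A Z W (l + m + n)"
  using cmp_cl[OF o(4,2,1) c(3) gh, of "l + m + n"] by (simp add: r_def)
 have r': "cmp A Z Y W (m + n) l fg h = r"
  using comp_assoc'[OF o(4,3,2,1) c(3,2,1), of "m + n" "l + m"] by (simp add: r_def fg_def gh_def)
 have "cmp A Z X W n (l + m) f (sg (dhom A Z X (l + m)) (l * m) gh) = sg (dhom A Z W (l + m + n)) (l * m) r"
  unfolding r_def using o c
  by (intro am_sg[OF hom_ag G.ag cmp_am_r gh]) auto
 moreover have "cmp A Z Y W (m + n) l (sg (dhom A Y W (m + n)) (m * n) fg) h = sg (dhom A Z W (l + m + n)) (m * n) r"
  unfolding r'[symmetric] using o c
  by (intro am_sg[OF hom_ag G.ag cmp_am_l fg]) auto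
 ultimately show "cmp (op_dgcat A) W X Z (l + m) n (cmp (op_dgcat A) X Y Z l m h g) f =
   cmp (op_dgcat A) W Y Z l (m + n) h (cmp (op_dgcat A) W X Y m n g f)"
  unfolding op_dgcat_simps gh_def[symmetric] fg_def[symmetric]
  using r by (simp add: G.sg_sg add.assoc[symmetric]) (simp add: algebra_simps)
next
 fix X assume "X : Ob (op_dgcat A)"
 then show "ident (op_dgcat A) X .: dhom (op_dgcat A) X X 0" by (simp add: ident_closed)
next
 fix X Y f n assume "X : Ob (op_dgcat A)" "Y : Ob (op_dgcat A)" "f .: dhom (op_dgcat A) X Y n"
 then show "cmp (op_dgcat A) X Y Y 0 n (ident (op_dgcat A) Y) f = f"
  "cmp (op_dgcat A) X X Y n 0 f (ident (op_dgcat A) X) = f"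
  by (simp_all add: comp_ident_left comp_ident_right)
next
 fix X Y Z g m f n
 assume "X : Ob (op_dgcat A)" "Y : Ob (op_dgcat A)" "Z : Ob (op_dgcat A)"
  "g .: dhom (op_dgcat A) Y Z m" "f .: dhom (op_dgcat A) X Y n"
 then have o: "X : Ob A" "Y : Ob A" "Z : Ob A"
  and c: "g .: dhom A Z Y m" "f .: dhom A Y X n"
  by auto
 interpret G: agrp "dhom A Z X (m + n)" by (rule hom_ag) (use o in auto)
 interpret H: agrp "dhom A Z X (m + n + 1)" by (rule hom_ag) (use o in auto)
 have fg: "cmp A Z Y X n m f g .: dhom A Z X (m + n)"
  using cmp_cl[OF o(3,2,1) c(2,1), of "m + n"] by simp
 define p where "p = cmp A Z Y X (n + 1) m (df (Hom A Y X) n f) g"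
 define q where "q = cmp A Z Y X n (m + 1) f (df (Hom A Z Y) m g)"
 have df: "df (Hom A Y X) n f .: dhom A Y X (n + 1)"
  and dg: "df (Hom A Z Y) m g .: dhom A Z Y (m + 1)"
  using acx_cl[OF hom_acx] o c by auto
 have p: "p .: dhom A Z X (m + n + 1)" and q: "q .: dhom A Z X (m + n + 1)"
  using cmp_cl[OF o(3,2,1) df c(1), of "m + n + 1"] cmp_cl[OF o(3,2,1) c(2) dg, of "m + n + 1"]
  by (simp_all add: p_def q_def)
 have l: "df (Hom A Z X) (m + n) (cmp A Z Y X n m f g) = p +[dhom A Z X (m + n + 1)] sg (dhom A Z X (m + n + 1)) n q"
  using leibniz[OF o(3,2,1) c(2,1)] by (simp add: p_def q_def add.commute)
 have "df (Hom A Z X) (m + n) (sg (dhom A Z X (m + n)) (m * n) (cmp A Z Y X n m f g))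
  = sg (dhom A Z X (m + n + 1)) (m * n) (df (Hom A Z X) (m + n) (cmp A Z Y X n m f g))"
  using am_sg[OF G.ag H.ag acxD(2)[OF hom_acx] fg] o by blast
 also have "... = sg (dhom A Z X (m + n + 1)) (m * n + n) q +[dhom A Z X (m + n + 1)]
   sg (dhom A Z X (m + n + 1)) (m * n) p"
  unfolding l using p q by (simp add: H.sg_add H.sg_sg H.a_comm)
 finally have e: "df (Hom A Z X) (m + n) (sg (dhom A Z X (m + n)) (m * n) (cmp A Z Y X n m f g)) = ..." .
 have e2: "sg (dhom A Z X (m + n + 1)) m (sg (dhom A Z X (m + n + 1)) (m * (n + 1)) p)
  = sg (dhom A Z X (m + n + 1)) (m * n) p"
  using p by (simp add: H.sg_sg) (rule sg_parity, simp add: algebra_simps)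
 show "df (Hom (op_dgcat A) X Z) (m + n) (cmp (op_dgcat A) X Y Z m n g f) =
   cmp (op_dgcat A) X Y Z (m + 1) n (df (Hom (op_dgcat A) Y Z) m g) f +[dhom (op_dgcat A) X Z (m + n + 1)]
   sg (dhom (op_dgcat A) X Z (m + n + 1)) m
   (cmp (op_dgcat A) X Y Z m (n + 1) g (df (Hom (op_dgcat A) X Y) n f))"
  using e e2 by (simp add: p_def q_def algebra_simps)
qed

text \<open>The Koszul sign cancels the one in the composition of \<open>op_dgcat\<close>, so
  associativity becomes sign-free. This is also the shape in which the left action occurs in
  \<open>tensor_relators\<close>.\<close>

definition lact :: "('o, 'k, 'a, 'n) dgmod => 'o => 'o => int => int => 'a => 'n => 'n" where
 "lact N X Y j l f y = sg (vcpt N Y (j + l)) (j * l) (act N Y X l j y f)"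

lemma (in dg_category) left_dg_of_op:
 assumes "dg_module R (op_dgcat A) N"
 shows "left_dg R A (val N) (lact N)"
proof -
 interpret N: dg_module R "op_dgcat A" N by fact
 show ?thesis
 proof unfold_locales
  fix X assume "X : Ob A" then show "cochain_complex R (val N X)" using N.val_complex by simp
 next
  fix X Y y l j assume "X : Ob A" "Y : Ob A" "y .: vcpt N X l"
  then show "linear_map R (dhom A X Y j) (vcpt N Y (j + l)) (%f. lact N X Y j l f y)"
   using N.act_linear_right[of Y X y l j] unfolding lact_def
   by (intro lin_sg) (auto simp: add.commute intro: N.val_module)
 next
  fix X Y f l j assume "X : Ob A" "Y : Ob A" "f .: dhom A X Y j"
  then show "linear_map R (vcpt N X l) (vcpt N Y (j + l)) (%y. lact N X Y j l f y)"
   using N.act_linear_left[of Y X f j l] unfolding lact_def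
   by (intro lin_sg) (auto simp: add.commute intro: N.val_module)
 next
  fix X Y Z g m f n y l
  assume o: "X : Ob A" "Y : Ob A" "Z : Ob A"
   and c: "g .: dhom A Y Z m" "f .: dhom A X Y n" "y .: vcpt N X l"
  let ?G = "vcpt N Z (m + n + l)"
  interpret G: agrp ?G using N.val_ag o by simp
  interpret H: agrp "vcpt N Y (n + l)" using N.val_ag o by simp
  interpret K: agrp "dhom A X Z (m + n)" using hom_ag o by simp
  define r where "r = act N Z Y (n + l) m (act N Y X l n y f) g"
  have yf: "act N Y X l n y f .: vcpt N Y (n + l)"
   using N.act_cl[of Y X y l f n "n + l"] o c by simp
  have r: "r .: ?G"
   using N.act_cl[of Z Y _ "n + l" g m "m + n + l"] o c yf by (simp add: r_def)
  have gf: "cmp A X Y Z m n g f .: dhom A X Z (m + n)"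
   using cmp_cl[OF o c(1,2)] by simp
  have sgf: "sg (dhom A X Z (m + n)) (n * m) (cmp A X Y Z m n g f) .: dhom A X Z (m + n)"
   using gf by simp
  have am: "amap (dhom A X Z (m + n)) ?G (%f. act N Z X l (m + n) y f)"
   using N.act_am_r[of Z X y l "m + n + l" "m + n"] o c by simp
  have "r = act N Z X l (m + n) y (sg (dhom A X Z (m + n)) (n * m) (cmp A X Y Z m n g f))"
   unfolding r_def using N.act_comp'[of Z Y X y l f n g m "n + l" "m + n"] o c by (simp add: add.commute)
  also have "... = sg ?G (n * m) (act N Z X l (m + n) y (cmp A X Y Z m n g f))"
   by (rule am_sg[OF K.ag G.ag am gf])
  finally have r2: "act N Z X l (m + n) y (cmp A X Y Z m n g f) = sg ?G (n * m) r"
   using am_cl[OF am gf] by (simp add: G.sg_sg)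
  have "lact N X Z (m + n) l (cmp A X Y Z m n g f) y = sg ?G ((m + n) * l + n * m) r"
   using r by (simp add: lact_def r2 G.sg_sg)
  moreover have "lact N Y Z m (n + l) g (lact N X Y n l f y) = sg ?G (m * (n + l) + n * l) r"
  proof -
   have "act N Z Y (n + l) m (sg (vcpt N Y (n + l)) (n * l) (act N Y X l n y f)) g = sg ?G (n * l) r"
   unfolding r_def using o c
   by (intro am_sg[OF H.ag G.ag N.act_am_l yf]) auto
   then show ?thesis using r by (simp add: lact_def add.assoc[symmetric] G.sg_sg)
  qed
  ultimately show "lact N X Z (m + n) l (cmp A X Y Z m n g f) y = lact N Y Z m (n + l) g (lact N X Y n l f y)"
   by (simp add: algebra_simps)
 next
  fix X y l assume "X : Ob A" "y .: vcpt N X l"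
  then show "lact N X X 0 l (ident A X) y = y" using N.act_ident[of X y l] by (simp add: lact_def)
 next
  fix X Y f j y l
  assume o: "X : Ob A" "Y : Ob A"
   and c: "f .: dhom A X Y j" "y .: vcpt N X l"
  let ?H = "vcpt N Y (j + l + 1)"
  interpret G: agrp "vcpt N Y (j + l)" using N.val_ag o by simp
  interpret H: agrp ?H using N.val_ag o by simp
  have df: "df (Hom A X Y) j f .: dhom A X Y (j + 1)"
   using acx_cl[OF hom_acx] o c by auto
  have dy: "df (val N X) l y .: vcpt N X (l + 1)"
   using acx_cl[OF N.val_acx] o c by auto
  have yf: "act N Y X l j y f .: vcpt N Y (j + l)"
   using N.act_cl[of Y X y l f j "j + l"] o c by simp
  define p where "p = act N Y X (l + 1) j (df (val N X) l y) f"
  define q where "q = act N Y X l (j + 1) y (df (Hom A X Y) j f)"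
  have p: "p .: ?H" and q: "q .: ?H"
   using N.act_cl[of Y X _ "l + 1" f j "j + l + 1"] N.act_cl[of Y X y l _ "j + 1" "j + l + 1"] df dy o c
   by (simp_all add: p_def q_def)
  have "df (val N Y) (j + l) (lact N X Y j l f y) = sg ?H (j * l) (df (val N Y) (j + l) (act N Y X l j y f))"
   unfolding lact_def using am_sg[OF G.ag H.ag acxD(2)[OF N.val_acx] yf] o by simp
  also have "df (val N Y) (j + l) (act N Y X l j y f) = p +[?H] sg ?H l q"
   using N.act_leibniz'[of Y X y l f j "j + l" "j + l + 1" "l + 1" "j + 1"] o c by (simp add: p_def q_def)
  also have "sg ?H (j * l) (p +[?H] sg ?H l q) = sg ?H (j * l + l) q +[?H] sg ?H (j * l) p"
   using p q by (simp add: H.sg_add H.sg_sg H.a_comm)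
  also have "sg ?H (j * l) p = sg ?H j (sg ?H (j * (l + 1)) p)"
   using p by (simp add: H.sg_sg) (rule sg_parity, simp add: algebra_simps)
  finally show "df (val N Y) (j + l) (lact N X Y j l f y) =
   lact N X Y (j + 1) l (df (Hom A X Y) j f) y +[?H]
   sg ?H j (lact N X Y j (l + 1) f (df (val N X) l y))"
   by (simp add: lact_def p_def q_def algebra_simps)
 qed
qed

text \<open>The way back from sign-free left modules to right modules over the opposite category. It
  is needed because the dual of a twisted complex arises as a left module, whereas hearts and tensor
  products are formulated with right modules over \<open>op_dgcat A\<close>.\<close>

definition op_mod :: "('o => ('k, 'n) cochain) => ('o => 'o => int => int => 'a => 'n => 'n) => ('o, 'k, 'a, 'n) dgmod" where
 "op_mod V la = \<lparr>val = V, act = (%Y X l j y f. sg (cpt (V Y) (l + j)) (l * j) (la X Y j l f y))\<rparr>"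

lemma op_mod_simps [simp]:
 "val (op_mod V la) = V" "act (op_mod V la) Y X l j y f = sg (cpt (V Y) (l + j)) (l * j) (la X Y j l f y)"
 by (simp_all add: op_mod_def)

lemma (in left_dg) dg_module_op_mod: "dg_module R (op_dgcat A) (op_mod V la)"
proof -
 interpret op: dg_category R "op_dgcat A" by (rule dg_category_op)
 show ?thesis
 proof unfold_locales
  fix X assume "X : Ob (op_dgcat A)"
  then show "cochain_complex R (val (op_mod V la) X)" by (simp add: lval_complex)
 next
  fix X Y f n m assume "X : Ob (op_dgcat A)" "Y : Ob (op_dgcat A)" "f .: dhom (op_dgcat A) X Y n"
  then show "linear_map R (vcpt (op_mod V la) Y m) (vcpt (op_mod V la) X (m + n)) (%x. act (op_mod V la) X Y m n x f)"
   using la_linear_right[of Y X f n m] by (auto simp: add.commute intro!: lin_sg lval_module)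
 next
  fix X Y x n m assume "X : Ob (op_dgcat A)" "Y : Ob (op_dgcat A)" "x .: vcpt (op_mod V la) Y m"
  then show "linear_map R (dhom (op_dgcat A) X Y n) (vcpt (op_mod V la) X (m + n)) (%f. act (op_mod V la) X Y m n x f)"
   using la_linear_left[of Y X x m n] by (auto simp: add.commute intro!: lin_sg lval_module)
 next
  fix X Y Z x l g m f n
  assume "X : Ob (op_dgcat A)" "Y : Ob (op_dgcat A)" "Z : Ob (op_dgcat A)" "x .: vcpt (op_mod V la) Z l"
   "g .: dhom (op_dgcat A) Y Z m" "f .: dhom (op_dgcat A) X Y n"
  then have o: "X : Ob A" "Y : Ob A" "Z : Ob A" and c: "x .: cpt (V Z) l"
   "g .: dhom A Z Y m" "f .: dhom A Y X n" by auto
  let ?G = "cpt (V X) (l + m + n)"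
  interpret G: agrp ?G using lval_ag o by simp
  interpret H: agrp "cpt (V Y) (l + m)" using lval_ag o by simp
  interpret K: agrp "dhom A Z X (m + n)" using hom_ag o by simp
  have gx: "la Z Y m l g x .: cpt (V Y) (l + m)"
   using la_cl[OF o(3,2) c(2,1)] by (simp add: add.commute)
  have fg: "cmp A Z Y X n m f g .: dhom A Z X (m + n)"
   using cmp_cl[OF o(3,2,1) c(3,2)] by (simp add: add.commute)
  define r where "r = la Y X n (l + m) f (la Z Y m l g x)"
  have r: "r .: ?G" using la_cl[OF o(2,1) c(3) gx, of "l + m + n"] by (simp add: r_def)
  have r2: "la Z X (m + n) l (cmp A Z Y X n m f g) x = r"
   using la_comp'[OF o(3,2,1) c(3,2,1), of "m + n" "l + m"] by (simp add: r_def)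
  have "la Y X n (l + m) f (sg (cpt (V Y) (l + m)) (l * m) (la Z Y m l g x)) = sg ?G (l * m) r"
   unfolding r_def using o c by (intro am_sg[OF H.ag G.ag la_am_r gx]) auto
  moreover have "la Z X (m + n) l (sg (dhom A Z X (m + n)) (m * n) (cmp A Z Y X n m f g)) x = sg ?G (m * n) r"
   unfolding r2[symmetric] using o c by (intro am_sg[OF K.ag G.ag la_am_l fg]) auto
  ultimately show "act (op_mod V la) X Y (l + m) n (act (op_mod V la) Y Z l m x g) f
   = act (op_mod V la) X Z l (m + n) x (cmp (op_dgcat A) X Y Z m n g f)"
   using r by (simp add: G.sg_sg add.assoc[symmetric]) (simp add: algebra_simps)
 next
  fix X x m assume "X : Ob (op_dgcat A)" "x .: vcpt (op_mod V la) X m"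
  then show "act (op_mod V la) X X m 0 x (ident (op_dgcat A) X) = x" by (simp add: la_ident)
 next
  fix X Y x m f n
  assume "X : Ob (op_dgcat A)" "Y : Ob (op_dgcat A)" "x .: vcpt (op_mod V la) Y m"
   "f .: dhom (op_dgcat A) X Y n"
  then have o: "X : Ob A" "Y : Ob A" and c: "x .: cpt (V Y) m" "f .: dhom A Y X n" by auto
  let ?H = "cpt (V X) (m + n + 1)"
  interpret G: agrp "cpt (V X) (m + n)" using lval_ag o by simp
  interpret H: agrp ?H using lval_ag o by simp
  have df: "df (Hom A Y X) n f .: dhom A Y X (n + 1)"
   using acx_cl[OF hom_acx] o c by auto
  have dx: "df (V Y) m x .: cpt (V Y) (m + 1)"
   using acx_cl[OF lv_acx] o c by auto
  have fx: "la Y X n m f x .: cpt (V X) (m + n)"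
   using la_cl[OF o(2,1) c(2,1), of "m + n"] by simp
  define p where "p = la Y X (n + 1) m (df (Hom A Y X) n f) x"
  define q where "q = la Y X n (m + 1) f (df (V Y) m x)"
  have p: "p .: ?H" and q: "q .: ?H"
   using la_cl[OF o(2,1) df c(1), of "m + n + 1"] la_cl[OF o(2,1) c(2) dx, of "m + n + 1"]
   by (simp_all add: p_def q_def)
  have "df (V X) (m + n) (sg (cpt (V X) (m + n)) (m * n) (la Y X n m f x))
   = sg ?H (m * n) (df (V X) (m + n) (la Y X n m f x))"
   using am_sg[OF G.ag H.ag acxD(2)[OF lv_acx] fx] o by simp
  also have "df (V X) (m + n) (la Y X n m f x) = p +[?H] sg ?H n q"
   using la_leibniz'[OF o(2,1) c(2,1), of "m + n" "m + n + 1" "n + 1" "m + 1"] by (simp add: p_def q_def)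
  also have "sg ?H (m * n) (p +[?H] sg ?H n q) = sg ?H (m * n + n) q +[?H] sg ?H (m * n) p"
   using p q by (simp add: H.sg_add H.sg_sg H.a_comm)
  also have "sg ?H (m * n) p = sg ?H m (sg ?H (m * (n + 1)) p)"
   using p by (simp add: H.sg_sg) (rule sg_parity, simp add: algebra_simps)
  finally show "df (val (op_mod V la) X) (m + n) (act (op_mod V la) X Y m n x f) =
   act (op_mod V la) X Y (m + 1) n (df (val (op_mod V la) Y) m x) f +[vcpt (op_mod V la) X (m + n + 1)]
   sg (vcpt (op_mod V la) X (m + n + 1)) m
   (act (op_mod V la) X Y m (n + 1) x (df (Hom (op_dgcat A) X Y) n f))"
   by (simp add: p_def q_def algebra_simps)
 qed
qed

section \<open>Twisted complexes with coefficients in a module\<close>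

text \<open>The pattern behind both proofs that a twisted differential squares to zero: the terms
  \<open>e\<close> and \<open>f\<close> come once from the Leibniz rule, and once more from the
  diagonal differential of \<open>x\<close> and the Maurer-Cartan sum.\<close>

lemma (in agrp) cancel4:
 assumes "e .: M" "f .: M" "odd (p + p')" "odd (q + q')"
 shows "sg M p e \<oplus> sg M q f \<oplus> sg M q' f \<oplus> sg M p' e = \<zero>"
 using assms sg_cancel[of f q q'] sg_cancel[of e p p'] by (simp add: a_assoc)

definition rt :: "('o, 'a) twisted => ('o, 'k, 'a, 'u) dgmod => ('k, int => 'u) cochain" where
 \<comment> \<open>the complex of morphisms from \<open>T\<close> to a right module\<close>
 "rt T M = tuple_complex.tcx (sp T) (%n i. vcpt M T$i (i + n))
  (%n i. df (val M T$i) (i + n))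
  (%n i k x. sg (vcpt M T$i (i + (n + 1))) (n + 1)
   (act M T$i T$k (k + n) (i - k + 1) x (tdiff T i k)))"

definition lt :: "int => ('o, 'a) twisted => ('o => ('k, 'n) cochain) =>
  ('o => 'o => int => int => 'a => 'n => 'n) => ('k, int => 'n) cochain" where
 \<comment> \<open>the tensor product of \<open>T[s]\<close> with a left module\<close>
 "lt s T V la = tuple_complex.tcx (sp T) (%n j. cpt (V T$j) (n + s - j))
  (%n j y. sg (cpt (V T$j) (n + 1 + s - j)) (j + s) (df (V T$j) (n + s - j) y))
  (%n j k y. sg (cpt (V T$j) (n + 1 + s - j)) s
   (la T$k T$j (k - j + 1) (n + s - k) (tdiff T k j) y))"

locale twisted = dg_category R A for R :: "'k ring" and A :: "('o, 'k, 'a) dgcat" +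
 fixes T :: "('o, 'a) twisted"
 assumes twc: "twisted_complex A T"
begin

lemma tfin: "finite (sp T)"
 and tob: "i : sp T ==> T$i : Ob A"
 using twc by (auto simp: twisted_complex_def)

lemma td_cl:
 "i : sp T ==> j : sp T ==> k = i - j + 1 ==> tdiff T i j .: dhom A T$i T$j k"
 using twc by (auto simp: twisted_complex_def)

lemma tdiff_zero:
 "i : sp T ==> j : sp T ==> j <= i ==> tdiff T i j = 0[dhom A T$i T$j (i - j + 1)]"
 using twc by (auto simp: twisted_complex_def)

lemma tdiff_dclosed:
 "i : sp T ==> j : sp T ==>
 df (Hom A T$i T$j) (i - j + 1) (tdiff T i j) .: dhom A T$i T$j (i - j + 2)"
 by (rule acx_cl[OF hom_acx[OF tob tob] td_cl]) auto

lemma td_cmp_cl: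
 assumes "i : sp T" "j : sp T" "k : sp T"
 shows "cmp A T$i T$k T$j (k - j + 1) (i - k + 1) (tdiff T k j) (tdiff T i k)
  .: dhom A T$i T$j (i - j + 2)"
 using assms by (intro cmp_cl tob td_cl) auto

text \<open>The defining equation solved for the sum of composites, which is how it enters once such
  a sum has been pulled through an action.\<close>

lemma maurer_cartan:
 assumes "i : sp T" "j : sp T"
 shows "(\<Oplus>[dhom A T$i T$j (i - j + 2)] k:sp T.
   cmp A T$i T$k T$j (k - j + 1) (i - k + 1) (tdiff T k j) (tdiff T i k)) =
  sg (dhom A T$i T$j (i - j + 2)) (j + 1)
   (df (Hom A T$i T$j) (i - j + 1) (tdiff T i j))"
proof -
 let ?H = "dhom A T$i T$j (i - j + 2)"
 let ?d = "df (Hom A T$i T$j) (i - j + 1) (tdiff T i j)"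
 let ?s = "\<Oplus>[?H] k:sp T.
   cmp A T$i T$k T$j (k - j + 1) (i - k + 1) (tdiff T k j) (tdiff T i k)"
 interpret H: agrp ?H using assms by (intro hom_ag tob)
 have s: "?s .: ?H" using assms by (intro H.finsum_closed) (auto intro: td_cmp_cl)
 have d: "?d .: ?H" by (rule tdiff_dclosed[OF assms])
 have "?d +[?H] sg ?H j ?s = 0[?H]"
  using twc[unfolded twisted_complex_def Let_def, THEN conjunct2, THEN conjunct2, THEN bspec, OF assms(1),
   THEN bspec, OF assms(2), THEN conjunct2, THEN conjunct2] .
 then have "sg ?H j ?s = -[?H] ?d"
  using H.minus_equality[of "sg ?H j ?s" ?d] H.a_comm[of ?d "sg ?H j ?s"] s d by simp
 then have "sg ?H j (sg ?H j ?s) = sg ?H j (sg ?H 1 ?d)"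
  by (simp add: sg_odd)
 then show ?thesis using s d by (simp add: H.sg_sg)
qed

end

locale twisted_right = twisted R A T + dg_module R A M
 for R :: "'k ring" and A :: "('o, 'k, 'a) dgcat" and T :: "('o, 'a) twisted" and M :: "('o, 'k, 'a, 'u) dgmod"
begin

sublocale r: tuple_complex R "sp T" "%n i. vcpt M T$i (i + n)"
 "%n i. df (val M T$i) (i + n)"
 "%n i k x. sg (vcpt M T$i (i + (n + 1))) (n + 1)
   (act M T$i T$k (k + n) (i - k + 1) x (tdiff T i k))"
proof (intro tuple_complex.intro tuple_complex_axioms.intro)
 show "cring R" by (rule is_cring)
 show "finite (sp T)" by (rule tfin)
 fix i n assume i: "i : sp T"
 show "Module.module R (vcpt M T$i (i + n))" using i by (intro val_module tob)
 have "linear_map R (vcpt M T$i (i + n)) (vcpt M T$i (i + n + 1)) (df (val M T$i) (i + n))"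
  using val_complex[OF tob[OF i]] by (auto simp: cochain_complex_def)
 then show "linear_map R (vcpt M T$i (i + n)) (vcpt M T$i (i + (n + 1))) (df (val M T$i) (i + n))"
  by (simp add: add.assoc)
 { fix x assume "x .: vcpt M T$i (i + n)"
  then show "df (val M T$i) (i + (n + 1)) (df (val M T$i) (i + n) x) = 0[vcpt M T$i (i + (n + 2))]"
   using acx_dd[OF val_acx[OF tob[OF i]], of x "i + n" "i + (n + 1)" "i + (n + 2)"] by simp }
 fix k assume k: "k : sp T"
 note o = tob[OF i] tob[OF k]
 have "linear_map R (vcpt M T$k (k + n)) (vcpt M T$i (k + n + (i - k + 1)))
   (%x. act M T$i T$k (k + n) (i - k + 1) x (tdiff T i k))"
  by (rule act_linear_left[OF o td_cl[OF i k]]) simp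
 also have "k + n + (i - k + 1) = i + (n + 1)" by simp
 finally show "linear_map R (vcpt M T$k (k + n)) (vcpt M T$i (i + (n + 1)))
   (%x. sg (vcpt M T$i (i + (n + 1))) (n + 1)
   (act M T$i T$k (k + n) (i - k + 1) x (tdiff T i k)))"
  by (intro lin_sg val_module o)
 fix x assume x: "x .: vcpt M T$k (k + n)"
 let ?G = "vcpt M T$i (i + (n + 2))" and ?G1 = "vcpt M T$i (i + (n + 1))"
 interpret G: agrp ?G by (rule val_ag[OF o(1)])
 interpret G1: agrp ?G1 by (rule val_ag[OF o(1)])
 let ?a = "tdiff T i k"
 let ?xa = "act M T$i T$k (k + n) (i - k + 1) x ?a"
 define e where "e = act M T$i T$k (k + (n + 1)) (i - k + 1) (df (val M T$k) (k + n) x) ?a"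
 define f where "f = act M T$i T$k (k + n) (i - k + 2) x (df (Hom A T$i T$k) (i - k + 1) ?a)"
 note a = td_cl[OF i k refl]
 have da: "df (Hom A T$i T$k) (i - k + 1) ?a .: dhom A T$i T$k (i - k + 2)"
  by (rule tdiff_dclosed[OF i k])
 have dx: "df (val M T$k) (k + n) x .: vcpt M T$k (k + (n + 1))"
  by (rule acx_cl[OF val_acx[OF o(2)] x]) simp
 have e: "e .: ?G" and f: "f .: ?G"
  unfolding e_def f_def by (rule act_cl[OF o dx a], simp, rule act_cl[OF o x da], simp)
 have xa: "?xa .: ?G1" by (rule act_cl[OF o x a]) simp
 have am: "amap ?G1 ?G (df (val M T$i) (i + (n + 1)))"
  using acxD(2)[OF val_acx[OF o(1)], of "i + (n + 1)"] by (simp add: add.assoc)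
 have "df (val M T$i) (i + (n + 1)) ?xa = e +[?G] sg ?G (k + n) f"
  unfolding e_def f_def by (rule act_leibniz'[OF o x a]) auto
 then have 1: "df (val M T$i) (i + (n + 1)) (sg ?G1 (n + 1) ?xa)
   = sg ?G (n + 1) e +[?G] sg ?G (k + 1) f"
  using e f am_sg[OF G1.ag G.ag am xa, of "n + 1"]
   sg_parity[of "n + 1 + (k + n)" "k + 1" ?G f] by (simp add: G.sg_add G.sg_sg)
 have 2: "sg ?G (n + 1 + 1) (act M T$i T$k (k + (n + 1)) (i - k + 1) (df (val M T$k) (k + n) x) ?a)
   = sg ?G (n + 2) e" by (simp add: e_def add.commute)
 have ax: "amap (dhom A T$i T$k (i - k + 2)) ?G (act M T$i T$k (k + n) (i - k + 2) x)"
  by (rule act_am_r[OF o x]) simp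
 have 3: "sg ?G (n + 1 + 1) (act M T$i T$l (l + (n + 1)) (i - l + 1)
   (sg (vcpt M T$l (l + (n + 1))) (n + 1) (act M T$l T$k (k + n) (l - k + 1) x (tdiff T l k))) (tdiff T i l))
  = sg ?G 1 (act M T$i T$k (k + n) (i - k + 2) x
   (cmp A T$i T$l T$k (l - k + 1) (i - l + 1) (tdiff T l k) (tdiff T i l)))"
  if l: "l : sp T" for l
 proof -
  note ol = tob[OF l]
  have xl: "act M T$l T$k (k + n) (l - k + 1) x (tdiff T l k) .: vcpt M T$l (l + (n + 1))"
   by (rule act_cl[OF ol o(2) x td_cl[OF l k refl]]) simp
  let ?r = "act M T$i T$k (k + n) (i - k + 2) x
   (cmp A T$i T$l T$k (l - k + 1) (i - l + 1) (tdiff T l k) (tdiff T i l))"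
  have r: "?r .: ?G" by (rule am_cl[OF ax td_cmp_cl[OF i k l]])
  have r': "act M T$i T$l (l + (n + 1)) (i - l + 1)
   (act M T$l T$k (k + n) (l - k + 1) x (tdiff T l k)) (tdiff T i l) = ?r"
   by (rule act_comp'[OF o(1) ol o(2) x td_cl[OF l k refl] td_cl[OF i l refl]]) auto
  have "act M T$i T$l (l + (n + 1)) (i - l + 1)
   (sg (vcpt M T$l (l + (n + 1))) (n + 1) (act M T$l T$k (k + n) (l - k + 1) x (tdiff T l k))) (tdiff T i l)
   = sg ?G (n + 1) ?r"
   unfolding r'[symmetric]
   by (rule am_sg[OF val_ag[OF ol] G.ag act_am_l[OF o(1) ol td_cl[OF i l refl]] xl]) simp
  then show ?thesis using r sg_parity[of "n + 1 + 1 + (n + 1)" 1 ?G ?r] by (simp add: G.sg_sg)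
 qed
 \<comment> \<open>By associativity all composites of two structure maps act on \<open>x\<close>
   through their sum, which the Maurer-Cartan equation turns into the differential of
   \<open>?a\<close>. So this sum cancels the second Leibniz term \<open>f\<close>.\<close>
 have "(\<Oplus>[?G] l:sp T. sg ?G (n + 1 + 1) (act M T$i T$l (l + (n + 1)) (i - l + 1)
   (sg (vcpt M T$l (l + (n + 1))) (n + 1) (act M T$l T$k (k + n) (l - k + 1) x (tdiff T l k))) (tdiff T i l)))
  = (\<Oplus>[?G] l:sp T. sg ?G 1 (act M T$i T$k (k + n) (i - k + 2) x
   (cmp A T$i T$l T$k (l - k + 1) (i - l + 1) (tdiff T l k) (tdiff T i l))))"
  using am_cl[OF ax td_cmp_cl[OF i k]] by (intro G.finsum_cong' 3) auto
 also have "... = sg ?G 1 (act M T$i T$k (k + n) (i - k + 2) x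
  (\<Oplus>[dhom A T$i T$k (i - k + 2)] l:sp T.
   (cmp A T$i T$l T$k (l - k + 1) (i - l + 1) (tdiff T l k) (tdiff T i l))))"
  using am_cl[OF ax td_cmp_cl[OF i k]]
  by (subst am_finsum[OF hom_ag[OF o] G.ag ax td_cmp_cl[OF i k]])
   (auto simp: sg_finsum[OF G.ag])
 also have "... = sg ?G k f"
  unfolding maurer_cartan[OF i k] f_def
  using am_sg[OF hom_ag[OF o] G.ag ax da, of "k + 1"] am_cl[OF ax da]
   sg_parity[of "2 + k" k ?G] by (simp add: G.sg_sg)
 finally have 4: "(\<Oplus>[?G] l:sp T. sg ?G (n + 1 + 1) (act M T$i T$l (l + (n + 1)) (i - l + 1)
   (sg (vcpt M T$l (l + (n + 1))) (n + 1) (act M T$l T$k (k + n) (l - k + 1) x (tdiff T l k))) (tdiff T i l)))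
  = sg ?G k f" .
 have "n + 1 + 1 = n + 2" by simp
 have "sg ?G (n + 1) e +[?G] sg ?G (k + 1) f +[?G] sg ?G (n + 2) e +[?G] sg ?G k f = 0[?G]"
  using e f G.cancel4[OF e f, of "n + 1" "n + 2" k "k + 1"] by (simp add: G.a_ac)
 then show "df (val M T$i) (i + (n + 1)) (sg ?G1 (n + 1) ?xa) +[?G]
  sg (vcpt M T$i (i + (n + 1 + 1))) (n + 1 + 1)
  (act M T$i T$k (k + (n + 1)) (i - k + 1) (df (val M T$k) (k + n) x) ?a) +[?G]
  (\<Oplus>[?G] l:sp T. sg (vcpt M T$i (i + (n + 1 + 1))) (n + 1 + 1)
   (act M T$i T$l (l + (n + 1)) (i - l + 1)
   (sg (vcpt M T$l (l + (n + 1))) (n + 1) (act M T$l T$k (k + n) (l - k + 1) x (tdiff T l k))) (tdiff T i l))) = 0[?G]"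
  unfolding \<open>n + 1 + 1 = n + 2\<close> 1 2[unfolded \<open>n + 1 + 1 = n + 2\<close>] 4[unfolded \<open>n + 1 + 1 = n + 2\<close>] .
qed

lemma rt_tcx: "rt T M = r.tcx"
 by (simp add: rt_def)

lemma rt_cochain_complex: "cochain_complex R (rt T M)"
 unfolding rt_tcx by (rule r.cc_tcx)

lemma rt_acx: "acx (rt T M)"
 by (rule cc_acx[OF rt_cochain_complex])

lemma rt_cpt: "cpt (rt T M) n = pm (sp T) (%i. vcpt M T$i (i + n))"
 by (simp add: rt_tcx r.cpt_tcx)

lemma rt_mem: "x .: cpt (rt T M) n ==> i : sp T ==> k = i + n ==> x i .: vcpt M T$i k"
 by (auto simp: rt_cpt)

lemma rt_term_closed:
 assumes "i : sp T" "k : sp T" "x .: vcpt M T$k (k + n)" "m = i + (n + 1)"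
 shows "act M T$i T$k (k + n) (i - k + 1) x (tdiff T i k) .: vcpt M T$i m"
 using assms by (intro act_cl tob td_cl) auto

lemma rt_diff:
 assumes "i : sp T"
 shows "df (rt T M) n x i = df (val M T$i) (i + n) (x i) +[vcpt M T$i (i + (n + 1))]
  (\<Oplus>[vcpt M T$i (i + (n + 1))] k:sp T. sg (vcpt M T$i (i + (n + 1))) (n + 1)
   (act M T$i T$k (k + n) (i - k + 1) (x k) (tdiff T i k)))"
 unfolding rt_tcx r.cdiff_tcx[OF assms] ..

text \<open>Precomposition with \<open>tdiff T i k\<close>, which is nonzero only for
  \<open>i < k\<close>, moves component \<open>k\<close> to component \<open>i\<close>. The
  triangular order is therefore by decreasing index, whence \<open>uminus\<close>.\<close>

lemma rt_acyclic:
 assumes ac: "!!i. i : sp T ==> i <= c ==> hz (val M T$i) (i + n)"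
  and x: "x .: cpt (rt T M) n" "df (rt T M) n x = 0[cpt (rt T M) (n + 1)]"
   "!!i. i : sp T ==> c < i ==> x i = 0[vcpt M T$i (i + n)]"
 shows "EX q:carrier (cpt (rt T M) (n - 1)).
  (ALL i:sp T. c < i --> q i = 0[vcpt M T$i (i + (n - 1))]) & df (rt T M) (n - 1) q = x"
proof -
 have "EX q:carrier (cpt r.tcx (n - 1)).
  (ALL i:sp T. uminus i < uminus c --> q i = 0[vcpt M T$i (i + (n - 1))]) & df r.tcx (n - 1) q = x"
 proof (rule r.tuple_acyclic)
  fix i k n x assume ik: "i : sp T" "k : sp T" "- i <= - k" and x: "x .: vcpt M T$k (k + n)"
  have "tdiff T i k = 0[dhom A T$i T$k (i - k + 1)]"
   using tdiff_zero ik by simp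
  moreover have "act M T$i T$k (k + n) (i - k + 1) x 0[dhom A T$i T$k (i - k + 1)]
   = 0[vcpt M T$i (i + (n + 1))]"
   using ik x by (intro am_0[OF hom_ag val_ag act_am_r] tob) auto
  ultimately show "sg (vcpt M T$i (i + (n + 1))) (n + 1)
   (act M T$i T$k (k + n) (i - k + 1) x (tdiff T i k)) = 0[vcpt M T$i (i + (n + 1))]"
   using agrp.sg_0[OF val_ag[OF tob[OF ik(1)]]] by simp
 next
  fix i x assume "i : sp T" "- c <= - i" "x .: vcpt M T$i (i + n)"
   "df (val M T$i) (i + n) x = 0[vcpt M T$i (i + (n + 1))]"
  then show "EX y:carrier (vcpt M T$i (i + (n - 1))). df (val M T$i) (i + (n - 1)) y = x"
   using acyclicE[OF ac, of i x "i + (n + 1)" "i + (n - 1)"] by auto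
 qed (use x in \<open>auto simp: rt_tcx inj_on_def\<close>)
 then show ?thesis by (simp add: rt_tcx)
qed

lemma rt_cohomology_zero:
 assumes "!!i. i : sp T ==> hz (val M T$i) (i + n)"
 shows "hz (rt T M) n"
proof (rule cohomology_zeroI[OF rt_acx])
 fix x assume x: "x .: cpt (rt T M) n" "df (rt T M) n x = 0[cpt (rt T M) (n + 1)]"
 have "EX c. ALL i:sp T. i <= c" using tfin by (metis Max_ge)
 then obtain c where "ALL i:sp T. i <= c" by blast
 then show "EX y:carrier (cpt (rt T M) (n - 1)). df (rt T M) (n - 1) y = x"
  using rt_acyclic[of c n x] assms x by force
qed

end

locale twisted_left = twisted R A T + left_dg R A V la
 for R :: "'k ring" and A :: "('o, 'k, 'a) dgcat" and T :: "('o, 'a) twisted"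
  and V :: "'o => ('k, 'n) cochain" and la +
 fixes s :: int
begin

sublocale l: tuple_complex R "sp T" "%n j. cpt (V T$j) (n + s - j)"
 "%n j y. sg (cpt (V T$j) (n + 1 + s - j)) (j + s) (df (V T$j) (n + s - j) y)"
 "%n j k y. sg (cpt (V T$j) (n + 1 + s - j)) s
   (la T$k T$j (k - j + 1) (n + s - k) (tdiff T k j) y)"
proof (intro tuple_complex.intro tuple_complex_axioms.intro)
 show "cring R" by (rule is_cring)
 show "finite (sp T)" by (rule tfin)
 fix i n assume i: "i : sp T"
 show "Module.module R (cpt (V T$i) (n + s - i))" using i by (intro lval_module tob)
 have e1: "n + s - i + 1 = n + 1 + s - i" and e2: "n + 1 + s - i + 1 = n + 2 + s - i"
  and e3: "n + 1 + 1 + s - i = n + 2 + s - i" by simp_all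
 have lm: "linear_map R (cpt (V T$i) (n + s - i)) (cpt (V T$i) (n + 1 + s - i)) (df (V T$i) (n + s - i))"
  using lval_complex[OF tob[OF i]] unfolding cochain_complex_def e1[symmetric] by blast
 then show "linear_map R (cpt (V T$i) (n + s - i)) (cpt (V T$i) (n + 1 + s - i))
  (%y. sg (cpt (V T$i) (n + 1 + s - i)) (i + s) (df (V T$i) (n + s - i) y))"
  by (intro lin_sg lval_module tob i)
 let ?G = "cpt (V T$i) (n + 2 + s - i)" and ?G1 = "cpt (V T$i) (n + 1 + s - i)"
 interpret G: agrp ?G by (rule lval_ag[OF tob[OF i]])
 interpret G1: agrp ?G1 by (rule lval_ag[OF tob[OF i]])
 have am: "amap ?G1 ?G (df (V T$i) (n + 1 + s - i))"
  using acxD(2)[OF lv_acx[OF tob[OF i]], of "n + 1 + s - i"] unfolding e2 .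
 { fix x assume x: "x .: cpt (V T$i) (n + s - i)"
  have dx: "df (V T$i) (n + s - i) x .: ?G1"
   by (rule acx_cl[OF lv_acx[OF tob[OF i]] x]) simp
  have "df (V T$i) (n + 1 + s - i) (df (V T$i) (n + s - i) x) = 0[?G]"
   by (rule acx_dd[OF lv_acx[OF tob[OF i]] x]) auto
  then show "sg (cpt (V T$i) (n + 1 + 1 + s - i)) (i + s)
   (df (V T$i) (n + 1 + s - i) (sg ?G1 (i + s) (df (V T$i) (n + s - i) x))) = 0[?G]"
   unfolding e3 am_sg[OF G1.ag G.ag am dx] by simp }
 fix k assume k: "k : sp T"
 note o = tob[OF k] tob[OF i]
 have "linear_map R (cpt (V T$k) (n + s - k)) (cpt (V T$i) (k - i + 1 + (n + s - k)))
   (%y. la T$k T$i (k - i + 1) (n + s - k) (tdiff T k i) y)"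
  by (rule la_linear_right[OF o td_cl[OF k i]]) simp
 also have "k - i + 1 + (n + s - k) = n + 1 + s - i" by simp
 finally show "linear_map R (cpt (V T$k) (n + s - k)) ?G1
   (%y. sg ?G1 s (la T$k T$i (k - i + 1) (n + s - k) (tdiff T k i) y))"
  by (intro lin_sg lval_module o)
 fix x assume x: "x .: cpt (V T$k) (n + s - k)"
 let ?a = "tdiff T k i"
 note a = td_cl[OF k i refl]
 let ?ax = "la T$k T$i (k - i + 1) (n + s - k) ?a x"
 let ?Gk = "cpt (V T$k) (n + 1 + s - k)"
 interpret Gk: agrp ?Gk by (rule lval_ag[OF o(1)])
 have ax: "?ax .: ?G1" by (rule la_cl[OF o a x]) simp
 have dx: "df (V T$k) (n + s - k) x .: ?Gk"
  by (rule acx_cl[OF lv_acx[OF o(1)] x]) simp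
 have da: "df (Hom A T$k T$i) (k - i + 1) ?a .: dhom A T$k T$i (k - i + 2)"
  by (rule tdiff_dclosed[OF k i])
 define e where "e = la T$k T$i (k - i + 2) (n + s - k) (df (Hom A T$k T$i) (k - i + 1) ?a) x"
 define f where "f = la T$k T$i (k - i + 1) (n + 1 + s - k) ?a (df (V T$k) (n + s - k) x)"
 have e: "e .: ?G" and f: "f .: ?G"
  unfolding e_def f_def by (rule la_cl[OF o da x], simp, rule la_cl[OF o a dx], simp)
 have "df (V T$i) (n + 1 + s - i) ?ax = e +[?G] sg ?G (k - i + 1) f"
  unfolding e_def f_def by (rule la_leibniz'[OF o a x]) auto
 then have 1: "sg ?G (i + s) (df (V T$i) (n + 1 + s - i) (sg ?G1 s ?ax))
   = sg ?G i e +[?G] sg ?G (k + 1) f"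
  unfolding am_sg[OF G1.ag G.ag am ax]
  using e f sg_parity[of "i + s + s" i ?G e] sg_parity[of "i + s + (s + (k - i + 1))" "k + 1" ?G f]
  by (simp add: G.sg_add G.sg_sg)
 have 2: "sg ?G s (la T$k T$i (k - i + 1) (n + 1 + s - k) ?a
   (sg ?Gk (k + s) (df (V T$k) (n + s - k) x))) = sg ?G k f"
 proof -
  have "la T$k T$i (k - i + 1) (n + 1 + s - k) ?a
   (sg ?Gk (k + s) (df (V T$k) (n + s - k) x)) = sg ?G (k + s) f"
   unfolding f_def by (rule am_sg[OF Gk.ag G.ag la_am_r[OF o a] dx]) simp
  then show ?thesis using f sg_parity[of "s + (k + s)" k ?G f] by (simp add: G.sg_sg)
 qed
 have amx: "amap (dhom A T$k T$i (k - i + 2)) ?G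
   (%g. la T$k T$i (k - i + 2) (n + s - k) g x)"
  by (rule la_am_l[OF o x]) simp
 have 3: "sg ?G s (la T$l T$i (l - i + 1) (n + 1 + s - l) (tdiff T l i)
   (sg (cpt (V T$l) (n + 1 + s - l)) s (la T$k T$l (k - l + 1) (n + s - k) (tdiff T k l) x)))
   = la T$k T$i (k - i + 2) (n + s - k)
   (cmp A T$k T$l T$i (l - i + 1) (k - l + 1) (tdiff T l i) (tdiff T k l)) x"
  if l: "l : sp T" for l
 proof -
  note ol = tob[OF l]
  let ?r = "la T$k T$i (k - i + 2) (n + s - k)
   (cmp A T$k T$l T$i (l - i + 1) (k - l + 1) (tdiff T l i) (tdiff T k l)) x"
  have r: "?r .: ?G" by (rule am_cl[OF amx td_cmp_cl[OF k i l]])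
  have xl: "la T$k T$l (k - l + 1) (n + s - k) (tdiff T k l) x .: cpt (V T$l) (n + 1 + s - l)"
   by (rule la_cl[OF o(1) ol td_cl[OF k l refl] x]) simp
  have r': "?r = la T$l T$i (l - i + 1) (n + 1 + s - l) (tdiff T l i)
   (la T$k T$l (k - l + 1) (n + s - k) (tdiff T k l) x)"
   by (rule la_comp'[OF o(1) ol o(2) td_cl[OF l i refl] td_cl[OF k l refl] x]) auto
  have "la T$l T$i (l - i + 1) (n + 1 + s - l) (tdiff T l i)
   (sg (cpt (V T$l) (n + 1 + s - l)) s (la T$k T$l (k - l + 1) (n + s - k) (tdiff T k l) x))
   = sg ?G s ?r"
   unfolding r'
   by (rule am_sg[OF lval_ag[OF ol] G.ag la_am_r[OF ol o(2) td_cl[OF l i refl]] xl]) simp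
  then show ?thesis using r sg_parity[of "s + s" 0 ?G ?r] by (simp add: G.sg_sg)
 qed
 \<comment> \<open>As on the right, except that the structure maps now act from the left: their
   composites sum to the differential of \<open>?a\<close> acting on \<open>x\<close>, and this
   cancels the first Leibniz term \<open>e\<close>.\<close>
 have "(\<Oplus>[?G] l:sp T. sg ?G s (la T$l T$i (l - i + 1) (n + 1 + s - l) (tdiff T l i)
   (sg (cpt (V T$l) (n + 1 + s - l)) s (la T$k T$l (k - l + 1) (n + s - k) (tdiff T k l) x))))
  = (\<Oplus>[?G] l:sp T. la T$k T$i (k - i + 2) (n + s - k)
   (cmp A T$k T$l T$i (l - i + 1) (k - l + 1) (tdiff T l i) (tdiff T k l)) x)"
  using am_cl[OF amx td_cmp_cl[OF k i]] by (intro G.finsum_cong' 3) auto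
 also have "... = la T$k T$i (k - i + 2) (n + s - k)
  (\<Oplus>[dhom A T$k T$i (k - i + 2)] l:sp T.
   cmp A T$k T$l T$i (l - i + 1) (k - l + 1) (tdiff T l i) (tdiff T k l)) x"
  by (rule am_finsum[OF hom_ag[OF o] G.ag amx td_cmp_cl[OF k i], symmetric])
 also have "... = sg ?G (i + 1) e"
  unfolding maurer_cartan[OF k i] e_def by (rule am_sg[OF hom_ag[OF o] G.ag amx da])
 finally have 4: "(\<Oplus>[?G] l:sp T. sg ?G s (la T$l T$i (l - i + 1) (n + 1 + s - l) (tdiff T l i)
   (sg (cpt (V T$l) (n + 1 + s - l)) s (la T$k T$l (k - l + 1) (n + s - k) (tdiff T k l) x))))
  = sg ?G (i + 1) e" .
 show "sg (cpt (V T$i) (n + 1 + 1 + s - i)) (i + s)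
  (df (V T$i) (n + 1 + s - i) (sg ?G1 s ?ax)) +[?G]
  sg (cpt (V T$i) (n + 1 + 1 + s - i)) s (la T$k T$i (k - i + 1) (n + 1 + s - k) ?a
   (sg ?Gk (k + s) (df (V T$k) (n + s - k) x))) +[?G]
  (\<Oplus>[?G] l:sp T. sg (cpt (V T$i) (n + 1 + 1 + s - i)) s
   (la T$l T$i (l - i + 1) (n + 1 + s - l) (tdiff T l i)
   (sg (cpt (V T$l) (n + 1 + s - l)) s (la T$k T$l (k - l + 1) (n + s - k) (tdiff T k l) x))))
  = 0[?G]"
  unfolding e3 1 2 4 using e f by (intro G.cancel4) auto
qed

lemma lt_tcx: "lt s T V la = l.tcx"
 by (simp add: lt_def)

lemma lt_cochain_complex: "cochain_complex R (lt s T V la)"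
 unfolding lt_tcx by (rule l.cc_tcx)

lemma lt_acx: "acx (lt s T V la)"
 by (rule cc_acx[OF lt_cochain_complex])

lemma lt_cpt: "cpt (lt s T V la) n = pm (sp T) (%j. cpt (V T$j) (n + s - j))"
 by (simp add: lt_tcx l.cpt_tcx)

lemma lt_mem: "x .: cpt (lt s T V la) n ==> j : sp T ==> k = n + s - j ==> x j .: cpt (V T$j) k"
 by (auto simp: lt_cpt)

lemma lt_diff:
 assumes "j : sp T"
 shows "df (lt s T V la) n y j =
  sg (cpt (V T$j) (n + 1 + s - j)) (j + s) (df (V T$j) (n + s - j) (y j))
  +[cpt (V T$j) (n + 1 + s - j)]
  (\<Oplus>[cpt (V T$j) (n + 1 + s - j)] k:sp T. sg (cpt (V T$j) (n + 1 + s - j)) s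
   (la T$k T$j (k - j + 1) (n + s - k) (tdiff T k j) (y k)))"
 unfolding lt_tcx l.cdiff_tcx[OF assms] ..

text \<open>Composition with \<open>tdiff T k j\<close> raises the index, so here the components are
  cleared in increasing order, opposite to \<open>rt_acyclic\<close>.\<close>

lemma lt_acyclic:
 assumes ac: "!!i. i : sp T ==> c <= i ==> hz (V T$i) (n + s - i)"
  and x: "x .: cpt (lt s T V la) n" "df (lt s T V la) n x = 0[cpt (lt s T V la) (n + 1)]"
   "!!i. i : sp T ==> i < c ==> x i = 0[cpt (V T$i) (n + s - i)]"
 shows "EX q:carrier (cpt (lt s T V la) (n - 1)).
  (ALL i:sp T. i < c --> q i = 0[cpt (V T$i) (n - 1 + s - i)]) & df (lt s T V la) (n - 1) q = x"
 unfolding lt_tcx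
proof (rule l.tuple_acyclic[of "%i. i"])
 fix i k n x assume ik: "i : sp T" "k : sp T" "i <= k" and x: "x .: cpt (V T$k) (n + s - k)"
 have "tdiff T k i = 0[dhom A T$k T$i (k - i + 1)]"
  using tdiff_zero ik by simp
 moreover have "la T$k T$i (k - i + 1) (n + s - k) 0[dhom A T$k T$i (k - i + 1)] x
   = 0[cpt (V T$i) (n + 1 + s - i)]"
  using ik x by (intro am_0[OF hom_ag lval_ag la_am_l] tob) auto
 ultimately show "sg (cpt (V T$i) (n + 1 + s - i)) s
   (la T$k T$i (k - i + 1) (n + s - k) (tdiff T k i) x) = 0[cpt (V T$i) (n + 1 + s - i)]"
  using agrp.sg_0[OF lval_ag[OF tob[OF ik(1)]]] by simp
next
 fix i x assume i: "i : sp T" "c <= i" and x: "x .: cpt (V T$i) (n + s - i)"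
  and d: "sg (cpt (V T$i) (n + 1 + s - i)) (i + s) (df (V T$i) (n + s - i) x) = 0[cpt (V T$i) (n + 1 + s - i)]"
 interpret G1: agrp "cpt (V T$i) (n + 1 + s - i)" by (rule lval_ag[OF tob[OF i(1)]])
 interpret G: agrp "cpt (V T$i) (n + s - i)" by (rule lval_ag[OF tob[OF i(1)]])
 interpret G0: agrp "cpt (V T$i) (n - 1 + s - i)" by (rule lval_ag[OF tob[OF i(1)]])
 have "df (V T$i) (n + s - i) x .: cpt (V T$i) (n + 1 + s - i)"
  by (rule acx_cl[OF lv_acx[OF tob[OF i(1)]] x]) simp
 then have "df (V T$i) (n + s - i) x = 0[cpt (V T$i) (n + 1 + s - i)]"
  using d by simp
 then obtain y where y: "y .: cpt (V T$i) (n - 1 + s - i)" "df (V T$i) (n - 1 + s - i) y = x"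
  by (rule acyclicE[OF ac[OF i] x, of "n + 1 + s - i" "n - 1 + s - i"]) auto
 have "n - 1 + s - i + 1 = n + s - i" by simp
 then have am: "amap (cpt (V T$i) (n - 1 + s - i)) (cpt (V T$i) (n + s - i)) (df (V T$i) (n - 1 + s - i))"
  using acxD(2)[OF lv_acx[OF tob[OF i(1)]], of "n - 1 + s - i"] by metis
 have e: "n - 1 + 1 + s - i = n + s - i" by simp
 show "EX y:carrier (cpt (V T$i) (n - 1 + s - i)).
   sg (cpt (V T$i) (n - 1 + 1 + s - i)) (i + s) (df (V T$i) (n - 1 + s - i) y) = x"
  \<comment> \<open>The diagonal of the complex carries the sign \<open>i + s\<close>; it is undone
    by putting the same sign on the primitive.\<close>
  unfolding e using y x am_sg[OF G0.ag G.ag am y(1), of "i + s"]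
  by (intro bexI[of _ "sg (cpt (V T$i) (n - 1 + s - i)) (i + s) y"]) (auto simp: G.sg_sg)
qed (use x in \<open>auto simp: lt_tcx\<close>)

lemma lt_cohomology_zero:
 assumes "!!i. i : sp T ==> hz (V T$i) (n + s - i)"
 shows "hz (lt s T V la) n"
proof (rule cohomology_zeroI[OF lt_acx])
 fix x assume x: "x .: cpt (lt s T V la) n" "df (lt s T V la) n x = 0[cpt (lt s T V la) (n + 1)]"
 have "EX c. ALL i:sp T. c <= i" using tfin by (metis Min_le)
 then obtain c where "ALL i:sp T. c <= i" by blast
 then show "EX y:carrier (cpt (lt s T V la) (n - 1)). df (lt s T V la) (n - 1) y = x"
  using lt_acyclic[of c n x] assms x by force
qed

end

section \<open>Tensor products\<close>

lemma free_module_simps [simp]: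
 "carrier (free_module R G) = {c. c : UNIV \<rightarrow> carrier R & finite {g. c g ~= 0[R]} & {g. c g ~= 0[R]} <= G}"
 "0[free_module R G] = (%_. 0[R])"
 "c +[free_module R G] c' = (%g. c g +[R] c' g)"
 "r *[free_module R G] c = (%g. r \<otimes>\<^bsub>R\<^esub> c g)"
 by (simp_all add: free_module_def)

locale base_ring = cring R for R :: "'k ring" (structure)
begin

lemma free_module_add_support:
 "c : UNIV \<rightarrow> carrier R ==> c' : UNIV \<rightarrow> carrier R ==>
 {g. c g \<oplus> c' g ~= \<zero>} <= {g. c g ~= \<zero>} \<union> {g. c' g ~= \<zero>}"
 by auto

lemma free_module_smult_support:
 "c : UNIV \<rightarrow> carrier R ==> r .: R ==> {g. r \<otimes> c g ~= \<zero>} <= {g. c g ~= \<zero>}"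
 by auto

lemma free_module_module: "Module.module R (free_module R G)"
proof -
 have add: "(%g. c g \<oplus> c' g) .: free_module R G"
  if "c .: free_module R G" "c' .: free_module R G" for c c'
 proof -
  have s: "{g. c g \<oplus> c' g ~= \<zero>} <= {g. c g ~= \<zero>} \<union> {g. c' g ~= \<zero>}"
   using that by (intro free_module_add_support) auto
  then show ?thesis using that finite_subset[OF s] by (auto simp: Pi_iff)
 qed
 have sm: "(%g. r \<otimes> c g) .: free_module R G"
  if "c .: free_module R G" "r .: R" for c r
 proof -
  have s: "{g. r \<otimes> c g ~= \<zero>} <= {g. c g ~= \<zero>}"
   using that by (intro free_module_smult_support) auto
  then show ?thesis using that finite_subset[OF s] by (auto simp: Pi_iff)
 qed
 have ag: "abelian_group (free_module R G)"
 proof (rule abelian_groupI)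
  fix x assume x: "x .: free_module R G"
  have "(%g. (\<ominus> \<one>) \<otimes> x g) .: free_module R G" using x by (intro sm) auto
  moreover have "(%g. (\<ominus> \<one>) \<otimes> x g) +[free_module R G] x = 0[free_module R G]"
   using x by (auto simp: Pi_iff l_minus l_neg)
  ultimately show "EX y:carrier (free_module R G). y +[free_module R G] x = 0[free_module R G]"
   by blast
  fix y assume "y .: free_module R G"
  then show "x +[free_module R G] y .: free_module R G" using add[OF x] by simp
 qed (auto simp: Pi_iff a_ac)
 show ?thesis
  by (rule moduleI[OF is_cring ag]) (use sm in \<open>auto simp: Pi_iff l_distr r_distr m_assoc\<close>)
qed

lemma gen_closed: "g : G ==> gen R g .: free_module R G"
proof -
 assume g: "g : G"
 have "{h. gen R g h ~= \<zero>} <= {g}" by (auto simp: gen_def)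
 then show ?thesis using g by (auto simp: gen_def intro: finite_subset)
qed

lemma free_module_induct [consumes 1, case_names zero add]:
 assumes "c .: free_module R G"
  and "Q (%_. \<zero>)"
  and "!!c r g. c .: free_module R G ==> r .: R ==> g : G ==> Q c ==>
   Q (r *[free_module R G] gen R g +[free_module R G] c)"
 shows "Q c"
 using assms(1)
proof (induction "card {g. c g ~= \<zero>}" arbitrary: c)
 case 0
 then have "c = (%_. \<zero>)" by auto
 then show ?case using assms(2) by simp
next
 case (Suc n)
 then obtain g where g: "c g ~= \<zero>" by (metis (mono_tags, lifting) card.empty empty_Collect_eq nat.distinct(1))
 let ?c = "c(g := \<zero>)"
 have s: "{h. ?c h ~= \<zero>} = {h. c h ~= \<zero>} - {g}" by auto
 have c: "?c .: free_module R G" using Suc.prems unfolding free_module_simps mem_Collect_eq s by auto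
 have "n = card {h. ?c h ~= \<zero>}" unfolding s using Suc.hyps(2) g Suc.prems by simp
 then have "Q ?c" using Suc.hyps(1) c by blast
 then have "Q (c g *[free_module R G] gen R g +[free_module R G] ?c)"
  using Suc.prems g by (intro assms(3) c) auto
 moreover have "c g *[free_module R G] gen R g +[free_module R G] ?c = c"
  using Suc.prems by (auto simp: gen_def fun_eq_iff Pi_iff)
 ultimately show ?case by simp
qed

text \<open>\<open>free_extension\<close> sums over the exact support, which varies with the
  argument; over a common finite superset the sums for \<open>c\<close>, \<open>c'\<close> and their
  sum can be compared termwise.\<close>

lemma free_extension_superset:
 assumes N: "Module.module R N" and \<phi>: "!!g. g : G ==> \<phi> g .: N"
  and c: "c .: free_module R G" and S: "finite S" "S <= G" "{g. c g ~= \<zero>} <= S"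
 shows "free_extension R N \<phi> c = (\<Oplus>[N] g:S. c g *[N] \<phi> g)"
proof -
 interpret N: Module.module R N by fact
 have "c g .: R" for g using c by auto
 then show ?thesis
  unfolding free_extension_def using S \<phi>
  by (intro N.add.finprod_mono_neutral_cong_left) (auto simp: subset_iff)
qed

lemma free_extension_linear:
 assumes N: "Module.module R N" and \<phi>: "!!g. g : G ==> \<phi> g .: N"
 shows "linear_map R (free_module R G) N (free_extension R N \<phi>)"
proof -
 interpret N: Module.module R N by fact
 interpret F: Module.module R "free_module R G" by (rule free_module_module)
 have Nag: "agrp N" by (rule module_agrp[OF N])
 show ?thesis
 proof (rule linI)
  fix c assume c: "c .: free_module R G"
  then have cR: "c g .: R" for g by auto
  let ?S = "{g. c g ~= \<zero>}"
  have S: "finite ?S" "?S <= G" using c by auto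
  have e: "free_extension R N \<phi> c = (\<Oplus>[N] g:?S. c g *[N] \<phi> g)"
   by (simp add: free_extension_def)
  show "free_extension R N \<phi> c .: N"
   unfolding e using S \<phi> cR by (intro N.finsum_closed) auto
  { fix r assume r: "r .: R"
   have "free_extension R N \<phi> (r *[free_module R G] c) = (\<Oplus>[N] g:?S. (r \<otimes> c g) *[N] \<phi> g)"
   using free_extension_superset[OF N, of G \<phi>, OF \<phi> F.smult_closed[OF r c] S]
   free_module_smult_support[of c r] cR r by auto
   also have "... = (\<Oplus>[N] g:?S. r *[N] (c g *[N] \<phi> g))"
   using S \<phi> cR r by (intro N.finsum_cong') (auto simp: N.smult_assoc1)
   also have "... = r *[N] free_extension R N \<phi> c"
   unfolding e using S \<phi> cR r
   by (intro am_finsum[OF Nag Nag, symmetric]) (auto intro!: amI simp: N.smult_r_distr)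
   finally show "free_extension R N \<phi> (r *[free_module R G] c) = r *[N] free_extension R N \<phi> c" .
  }
  fix c' assume c': "c' .: free_module R G"
  then have cR': "c' g .: R" for g by auto
  let ?T = "?S \<union> {g. c' g ~= \<zero>}"
  have T: "finite ?T" "?T <= G" using c c' by auto
  have "free_extension R N \<phi> (c +[free_module R G] c') = (\<Oplus>[N] g:?T. (c g \<oplus> c' g) *[N] \<phi> g)"
   using free_extension_superset[OF N, of G \<phi>, OF \<phi> F.a_closed[OF c c'] T] free_module_add_support[of c c'] c c' by auto
  also have "... = (\<Oplus>[N] g:?T. c g *[N] \<phi> g +[N] c' g *[N] \<phi> g)"
   using T \<phi> cR cR' by (intro N.finsum_cong') (auto simp: N.smult_l_distr)
  also have "... = (\<Oplus>[N] g:?T. c g *[N] \<phi> g) +[N] (\<Oplus>[N] g:?T. c' g *[N] \<phi> g)"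
   using T \<phi> cR cR' by (intro N.finsum_addf) auto
  finally show "free_extension R N \<phi> (c +[free_module R G] c') = free_extension R N \<phi> c +[N] free_extension R N \<phi> c'"
   using free_extension_superset[OF N, of G \<phi>, OF \<phi> c T] free_extension_superset[OF N, of G \<phi>, OF \<phi> c' T] by auto
 qed
qed

lemma free_extension_gen:
 assumes N: "Module.module R N" and \<phi>: "!!g. g : G ==> \<phi> g .: N" and g: "g : G"
 shows "free_extension R N \<phi> (gen R g) = \<phi> g"
proof -
 interpret N: Module.module R N by fact
 have "free_extension R N \<phi> (gen R g) = (\<Oplus>[N] h:{g}. gen R g h *[N] \<phi> h)"
  by (rule free_extension_superset[OF N, of G \<phi>, OF \<phi> gen_closed]) (use g in \<open>auto simp: gen_def\<close>)
 also have "... = \<phi> g" using \<phi>[OF g] by (simp add: gen_def)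
 finally show ?thesis .
qed

end

section \<open>Quotient modules\<close>

lemma qm_simps [simp]:
 "carrier (quotient_module M S) = a_rcosets\<^bsub>M\<^esub> S" "0[quotient_module M S] = S"
 "C +[quotient_module M S] D = C <+>\<^bsub>M\<^esub> D"
 "r *[quotient_module M S] C = (\<Union>x\<in>C. S +>\<^bsub>M\<^esub> (r *[M] x))"
 by (simp_all add: quotient_module_def)

locale quotient_mod = Module.module R M + S: submodule S R M
 for R :: "'k ring" and M :: "('k, 'a) module" and S :: "'a set"
begin

lemma quot_abelian_subgroup: "abelian_subgroup S M"
 using S.subgroup_axioms M.abelian_group_axioms by (intro abelian_subgroupI3 additive_subgroupI)

sublocale Q: abelian_subgroup S M
 by (rule quot_abelian_subgroup)

lemma M_agrp: "agrp M" by (simp add: agrp_def M.abelian_group_axioms)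

lemma quot_carrier: "carrier (quotient_module M S) = (%x. S +>\<^bsub>M\<^esub> x) ` carrier M"
 by (auto simp: A_RCOSETS_def')

lemma quot_add: "x .: M ==> y .: M ==>
 (S +>\<^bsub>M\<^esub> x) +[quotient_module M S] (S +>\<^bsub>M\<^esub> y) = S +>\<^bsub>M\<^esub> (x +[M] y)"
 by (simp add: Q.a_rcos_sum)

lemma quot_zero: "S +>\<^bsub>M\<^esub> 0[M] = S"
 by (simp add: Q.a_rcos_const)

lemma quot_eq_iff:
 assumes "x .: M" "y .: M"
 shows "S +>\<^bsub>M\<^esub> x = S +>\<^bsub>M\<^esub> y \<longleftrightarrow> x -[M] y : S"
 using Q.a_rcos_module[OF assms(2,1)] Q.a_repr_independence'[of x y] Q.a_rcos_self[OF assms(1)] assms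
 by (auto simp: M.minus_eq)

text \<open>Maps on cosets are defined as unions over all representatives. Such a union collapses to
  one value as soon as the map is constant on the coset, which is what well-definedness amounts to
  here.\<close>

lemma quot_UNION:
 assumes "x .: M" "!!y. y .: M ==> x -[M] y : S ==> f y = f x"
 shows "(\<Union>c\<in>S +>\<^bsub>M\<^esub> x. f c) = f x"
proof -
 have "f c = f x" if c: "c : S +>\<^bsub>M\<^esub> x" for c
 proof (rule assms(2))
  show cM: "c .: M" using c Q.a_elemrcos_carrier[OF assms(1)] by simp
  then show "x -[M] c : S"
   using c quot_eq_iff[OF assms(1) cM] Q.a_repr_independence'[OF c assms(1)] by simp
 qed
 then show ?thesis using Q.a_rcos_self[OF assms(1)] by blast
qed

lemma quot_smult:
 assumes r: "r .: R" and x: "x .: M"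
 shows "r *[quotient_module M S] (S +>\<^bsub>M\<^esub> x) = S +>\<^bsub>M\<^esub> (r *[M] x)"
 unfolding qm_simps
proof (rule quot_UNION[OF x])
 fix y assume y: "y .: M" "x -[M] y : S"
 have "r *[M] x -[M] r *[M] y = r *[M] (x -[M] y)"
  using r x y by (simp add: M.minus_eq smult_r_distr smult_r_minus)
 then have "r *[M] x -[M] r *[M] y : S" using y r by simp
 then show "S +>\<^bsub>M\<^esub> (r *[M] y) = S +>\<^bsub>M\<^esub> (r *[M] x)"
  using quot_eq_iff[of "r *[M] x" "r *[M] y"] r x y by simp
qed

lemma quot_module: "Module.module R (quotient_module M S)"
proof (rule moduleI)
 show "cring R" by (rule R.is_cring)
 have ex: "EX x:carrier M. C = S +>\<^bsub>M\<^esub> x" if "C .: quotient_module M S" for C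
  using that unfolding quot_carrier by blast
 have cl: "S +>\<^bsub>M\<^esub> x .: quotient_module M S" if "x .: M" for x
  using that unfolding quot_carrier by blast
 note simps = quot_add quot_smult cl
 show "abelian_group (quotient_module M S)"
 proof (rule abelian_groupI)
  fix x y z
  assume x: "x .: quotient_module M S" and y: "y .: quotient_module M S"
  obtain a b where ab: "a .: M" "x = S +>\<^bsub>M\<^esub> a" "b .: M" "y = S +>\<^bsub>M\<^esub> b"
   using ex x y by blast
  show "x +[quotient_module M S] y .: quotient_module M S"
   using ab by (simp add: simps del: qm_simps)
  show "x +[quotient_module M S] y = y +[quotient_module M S] x"
   using ab by (simp add: simps M.a_comm del: qm_simps)
  assume z: "z .: quotient_module M S"
  obtain c where c: "c .: M" "z = S +>\<^bsub>M\<^esub> c" using ex z by blast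
  show "x +[quotient_module M S] y +[quotient_module M S] z
   = x +[quotient_module M S] (y +[quotient_module M S] z)"
   using ab c by (simp add: simps M.a_assoc del: qm_simps)
 next
  fix x assume x: "x .: quotient_module M S"
  obtain a where a: "a .: M" "x = S +>\<^bsub>M\<^esub> a" using ex x by blast
  have z: "0[quotient_module M S] = S +>\<^bsub>M\<^esub> 0[M]" by (simp add: quot_zero)
  show "0[quotient_module M S] +[quotient_module M S] x = x"
   unfolding z using a by (simp add: quot_add del: qm_simps)
  show "EX y:carrier (quotient_module M S). y +[quotient_module M S] x = 0[quotient_module M S]"
   unfolding z using a
   by (intro bexI[of _ "S +>\<^bsub>M\<^esub> (\<ominus>\<^bsub>M\<^esub> a)"]) (simp_all add: quot_add cl M.l_neg del: qm_simps)
 next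
  show "0[quotient_module M S] .: quotient_module M S"
   using cl[OF M.zero_closed] by (simp add: quot_zero)
 qed
 fix a x assume a: "a .: R" and x: "x .: quotient_module M S"
 obtain u where u: "u .: M" "x = S +>\<^bsub>M\<^esub> u" using ex x by blast
 show "a *[quotient_module M S] x .: quotient_module M S"
  using a u by (simp add: quot_smult cl del: qm_simps)
 { fix b assume b: "b .: R"
  show "(a +[R] b) *[quotient_module M S] x
   = a *[quotient_module M S] x +[quotient_module M S] b *[quotient_module M S] x"
   using a b u by (simp add: quot_smult quot_add smult_l_distr del: qm_simps)
  show "(a \<otimes>\<^bsub>R\<^esub> b) *[quotient_module M S] x = a *[quotient_module M S] (b *[quotient_module M S] x)"
   using a b u by (simp add: quot_smult smult_assoc1 del: qm_simps) }
 { fix y assume y: "y .: quotient_module M S"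
  obtain v where v: "v .: M" "y = S +>\<^bsub>M\<^esub> v" using ex y by blast
  show "a *[quotient_module M S] (x +[quotient_module M S] y)
   = a *[quotient_module M S] x +[quotient_module M S] a *[quotient_module M S] y"
   using a u v by (simp add: quot_smult quot_add smult_r_distr del: qm_simps) }
next
 fix x assume x: "x .: quotient_module M S"
 then obtain u where u: "u .: M" "x = S +>\<^bsub>M\<^esub> u" unfolding quot_carrier by blast
 then show "\<one>\<^bsub>R\<^esub> *[quotient_module M S] x = x" by (simp add: quot_smult del: qm_simps)
qed

lemma quot_linear: "linear_map R M (quotient_module M S) (%x. S +>\<^bsub>M\<^esub> x)"
 by (rule linI) (auto simp: quot_carrier quot_add quot_smult simp del: qm_simps)

lemma quot_lift:
 assumes K: "agrp K" and f: "amap M K f" and S: "!!s. s : S ==> f s = 0[K]"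
 shows "EX g. amap (quotient_module M S) K g & (ALL x:carrier M. g (S +>\<^bsub>M\<^esub> x) = f x)"
proof -
 interpret K: agrp K by fact
 define g where "g C = f (SOME c. c .: M & C = S +>\<^bsub>M\<^esub> c)" for C
 have g: "g (S +>\<^bsub>M\<^esub> x) = f x" if x: "x .: M" for x
 proof -
  let ?c = "SOME c. c .: M & S +>\<^bsub>M\<^esub> x = S +>\<^bsub>M\<^esub> c"
  have c: "?c .: M & S +>\<^bsub>M\<^esub> x = S +>\<^bsub>M\<^esub> ?c"
   by (rule someI[of _ x]) (use x in simp)
  then have "f (x -[M] ?c) = 0[K]" using quot_eq_iff x S by blast
  then show ?thesis unfolding g_def
   using am_minus[OF M_agrp K f x] c am_cl[OF f] x by (simp add: K.minus_eq_zero_iff)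
 qed
 have "amap (quotient_module M S) K g"
  by (rule amI)
   (auto simp: quot_carrier quot_add g am_cl[OF f] am_add[OF f] simp del: qm_simps)
 then show ?thesis using g by blast
qed

end

section \<open>The tensor product of dg modules as a complex\<close>

lemma (in dg_module) val_add_closed:
 "X : Ob A ==> x .: vcpt M X i ==> x' .: vcpt M X i ==> x +[vcpt M X i] x' .: vcpt M X i"
 using val_ag[of X i] by (simp add: agrp_def abelian_group_def abelian_monoid.a_closed)

lemma (in dg_module) val_smult_closed:
 "X : Ob A ==> r .: R ==> x .: vcpt M X i ==> r *[vcpt M X i] x .: vcpt M X i"
 by (rule Module.module.smult_closed[OF val_module])

locale tensor_pair = dg_module R A M + N: dg_module R "op_dgcat A" N
 for R :: "'k ring" and A :: "('o, 'k, 'a) dgcat"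
  and M :: "('o, 'k, 'a, 'u) dgmod" and N :: "('o, 'k, 'a, 'v) dgmod"
begin

sublocale base_ring R by unfold_locales

sublocale L: left_dg R A "val N" "lact N"
 by (rule left_dg_of_op[OF N.dg_module_axioms])

abbreviation F where "F n == tensor_free R A M N n"
abbreviation rel where "rel n == tensor_relations R A M N n"
abbreviation Ten where "Ten == dg_tensor R A M N"

definition tens :: "int => 'o => int => 'u => 'v => (('o, 'u, 'v) tensor_symbol => 'k) set" where
 "tens n X i x y = rel n +>\<^bsub>F n\<^esub> gen R (X, i, x, y)"

lemma F_module: "Module.module R (F n)"
 unfolding tensor_free_def by (rule free_module_module)

lemma F_gen: "X : Ob A ==> x .: vcpt M X i ==> y .: vcpt N X (n - i) ==> gen R (X, i, x, y) .: F n"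
 unfolding tensor_free_def by (rule gen_closed) (simp add: tensor_symbols_def)

lemma lact_mem: "X : Ob A ==> Y : Ob A ==> i + j + l = n ==> f .: dhom A X Y j ==> y .: vcpt N X l ==>
 lact N X Y j l f y .: vcpt N Y (n - i)"
 by (rule L.la_cl) auto

lemma relators_closed: "tensor_relators R A M N n <= carrier (F n)"
proof -
 interpret F: Module.module R "F n" by (rule F_module)
 have la: "sg (vcpt N Y (i + j + l - i)) (j * l) (act N Y X l j y f) = lact N X Y j l f y" for X Y i j l f y
  by (simp add: lact_def)
 show ?thesis
  unfolding tensor_relators_def
 proof (intro Un_least subsetI; clarify)
  fix X Y i j l x f y
  assume o: "X : Ob A" "Y : Ob A" "x .: vcpt M Y i" "f .: dhom A X Y j" "y .: vcpt N X l"
   and n: "n = i + j + l"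
  interpret F': Module.module R "F (i + j + l)" by (rule F_module)
  have "gen R (X, i + j, act M X Y i j x f, y) .: F (i + j + l)"
   using o by (intro F_gen act_cl) auto
  moreover have "gen R (Y, i, x, lact N X Y j l f y) .: F (i + j + l)"
   using o by (intro F_gen lact_mem[where l = l]) auto
  ultimately show "gen R (X, i + j, act M X Y i j x f, y) -[F (i + j + l)]
   gen R (Y, i, x, sg (vcpt N Y (i + j + l - i)) (j * l) (act N Y X l j y f)) .: F (i + j + l)"
   unfolding la by simp
 qed (auto intro!: F_gen F.smult_closed F.a_closed F.minus_closed val_add_closed N.val_add_closed
   val_smult_closed N.val_smult_closed)
qed

lemma rel_submodule: "submodule (rel n) R (F n)"
proof -
 interpret F: Module.module R "F n" by (rule F_module)
 show ?thesis
  unfolding tensor_relations_def submodule_span_def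
 proof (rule F.submoduleI)
  show "\<Inter> {H. submodule H R (F n) & tensor_relators R A M N n <= H} <= carrier (F n)"
   using F.carrier_is_submodule relators_closed by blast
 qed (use F.submoduleE in \<open>auto intro: subgroup.one_closed[of _ "add_monoid (F n)", simplified] simp: submodule_def\<close>)
qed

lemma relators_rel: "tensor_relators R A M N n <= rel n"
 unfolding tensor_relations_def submodule_span_def by blast

text \<open>The kernel of a linear map is a submodule, so it suffices to look at the relators; the
  five hypotheses on \<open>g\<close> match their five families. The separate \<open>g\<close>
  allows these to be stated on symbols.\<close>

lemma rel_kill:
 assumes K: "Module.module R K" and psi: "linear_map R (F n) K \<psi>"
  and g: "!!X i x y. g X i x y = \<psi> (gen R (X, i, x, y))"
  and add_l: "!!X i x x' y. X : Ob A ==> x .: vcpt M X i ==> x' .: vcpt M X i ==>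
   y .: vcpt N X (n - i) ==> g X i (x +[vcpt M X i] x') y = g X i x y +[K] g X i x' y"
  and add_r: "!!X i x y y'. X : Ob A ==> x .: vcpt M X i ==> y .: vcpt N X (n - i) ==>
   y' .: vcpt N X (n - i) ==> g X i x (y +[vcpt N X (n - i)] y') = g X i x y +[K] g X i x y'"
  and sm_l: "!!X i r x y. X : Ob A ==> r .: R ==> x .: vcpt M X i ==> y .: vcpt N X (n - i) ==>
   g X i (r *[vcpt M X i] x) y = r *[K] g X i x y"
  and sm_r: "!!X i r x y. X : Ob A ==> r .: R ==> x .: vcpt M X i ==> y .: vcpt N X (n - i) ==>
   g X i x (r *[vcpt N X (n - i)] y) = r *[K] g X i x y"
  and bal: "!!X Y i j l x f y. X : Ob A ==> Y : Ob A ==> i + j + l = n ==> x .: vcpt M Y i ==>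
   f .: dhom A X Y j ==> y .: vcpt N X l ==>
   g X (i + j) (act M X Y i j x f) y = g Y i x (lact N X Y j l f y)"
  and c: "c : rel n"
 shows "\<psi> c = 0[K]"
proof -
 interpret F: Module.module R "F n" by (rule F_module)
 interpret K: Module.module R K by fact
 interpret Fa: agrp "F n" by (rule module_agrp[OF F_module])
 interpret Ka: agrp K by (rule module_agrp[OF K])
 note am = lin_am[OF psi]
 note cl = am_cl[OF am F_gen, folded g]
 have pm: "\<psi> (a -[F n] b) = 0[K]" if "a .: F n" "b .: F n" "\<psi> a = \<psi> b" for a b
  using am_minus[OF Fa.ag Ka.ag am that(1,2)] that am_cl[OF am that(1)]
  by (simp add: Ka.minus_eq_zero_iff)
 have pa: "\<psi> (a +[F n] b) = \<psi> a +[K] \<psi> b" if "a .: F n" "b .: F n" for a b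
  by (rule am_add[OF am that])
 have ps: "\<psi> (r *[F n] a) = r *[K] \<psi> a" if "a .: F n" "r .: R" for a r
  by (rule lin_smult[OF psi that(2,1)])
 have 1: "\<psi> r = 0[K]" if "r : tensor_relators R A M N n" for r
  using that unfolding tensor_relators_def
 proof (elim UnE CollectE exE conjE)
  fix X i x x' y
  assume "r = gen R (X, i, x +[vcpt M X i] x', y) -[F n] (gen R (X, i, x, y) +[F n] gen R (X, i, x', y))"
   and h: "X : Ob A" "x .: vcpt M X i" "x' .: vcpt M X i" "y .: vcpt N X (n - i)"
  then show ?thesis using add_l[OF h, unfolded g] F_gen val_add_closed[OF h(1-3)]
   by (simp add: pa pm F_gen)
 next
  fix X i x y y'
  assume "r = gen R (X, i, x, y +[vcpt N X (n - i)] y') -[F n] (gen R (X, i, x, y) +[F n] gen R (X, i, x, y'))"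
   and h: "X : Ob A" "x .: vcpt M X i" "y .: vcpt N X (n - i)" "y' .: vcpt N X (n - i)"
  then show ?thesis using add_r[OF h, unfolded g] N.val_add_closed[of X y "n - i" y'] h
   by (simp add: pa pm F_gen)
 next
  fix X i ra x y
  assume "r = gen R (X, i, ra *[vcpt M X i] x, y) -[F n] ra *[F n] gen R (X, i, x, y)"
   and h: "X : Ob A" "ra .: R" "x .: vcpt M X i" "y .: vcpt N X (n - i)"
  then show ?thesis using sm_l[OF h, unfolded g] val_smult_closed[OF h(1-3)]
   by (simp add: ps pm F_gen)
 next
  fix X i ra x y
  assume "r = gen R (X, i, x, ra *[vcpt N X (n - i)] y) -[F n] ra *[F n] gen R (X, i, x, y)"
   and h: "X : Ob A" "ra .: R" "x .: vcpt M X i" "y .: vcpt N X (n - i)"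
  then show ?thesis using sm_r[OF h, unfolded g] N.val_smult_closed[of X ra y "n - i"] h
   by (simp add: ps pm F_gen)
 next
  fix X Y i j l x f y
  assume r: "r = gen R (X, i + j, act M X Y i j x f, y) -[F n]
   gen R (Y, i, x, sg (vcpt N Y (n - i)) (j * l) (act N Y X l j y f))"
   and h: "X : Ob A" "Y : Ob A" "i + j + l = n" "x .: vcpt M Y i"
   "f .: dhom A X Y j" "y .: vcpt N X l"
  have n: "n - i = j + l" using h by simp
  have "gen R (X, i + j, act M X Y i j x f, y) .: F n"
   using h act_cl[OF h(1,2,4,5) refl] by (intro F_gen) auto
  moreover have "gen R (Y, i, x, lact N X Y j l f y) .: F n"
   using h lact_mem by (intro F_gen) auto
  ultimately show ?thesis using bal[OF h, unfolded g] unfolding r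
   by (simp add: pm n flip: lact_def)
 qed
 have "submodule {c : carrier (F n). \<psi> c = 0[K]} R (F n)"
  by (rule F.submoduleI)
   (auto simp: pa ps am_0[OF Fa.ag Ka.ag am] am_neg[OF Fa.ag Ka.ag am])
 then show ?thesis
  using c 1 relators_closed unfolding tensor_relations_def submodule_span_def by blast
qed

lemma quot: "quotient_mod R (F n) (rel n)"
 by (intro quotient_mod.intro F_module rel_submodule)

lemma Ten_cpt: "cpt Ten n = quotient_module (F n) (rel n)"
 by (simp add: dg_tensor_def)

lemma Ten_module: "Module.module R (cpt Ten n)"
 unfolding Ten_cpt by (rule quotient_mod.quot_module[OF quot])

lemma Ten_agrp: "agrp (cpt Ten n)"
 by (rule module_agrp[OF Ten_module])

lemma Ten_class: "linear_map R (F n) (cpt Ten n) (%c. rel n +>\<^bsub>F n\<^esub> c)"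
 unfolding Ten_cpt by (rule quotient_mod.quot_linear[OF quot])

lemma tens_closed:
 "X : Ob A ==> x .: vcpt M X i ==> y .: vcpt N X (n - i) ==> tens n X i x y .: cpt Ten n"
 unfolding tens_def by (rule am_cl[OF lin_am[OF Ten_class] F_gen])

lemma class_eq: "a -[F n] b : tensor_relators R A M N n ==> a .: F n ==> b .: F n ==>
 rel n +>\<^bsub>F n\<^esub> a = rel n +>\<^bsub>F n\<^esub> b"
 using quotient_mod.quot_eq_iff[OF quot] relators_rel by blast

lemma tens_add_left:
 assumes h: "X : Ob A" "x .: vcpt M X i" "x' .: vcpt M X i" "y .: vcpt N X (n - i)"
 shows "tens n X i (x +[vcpt M X i] x') y = tens n X i x y +[cpt Ten n] tens n X i x' y"
proof -
 interpret G: agrp "vcpt M X i" by (rule val_ag[OF h(1)])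
 interpret F: agrp "F n" by (rule module_agrp[OF F_module])
 have "tens n X i (x +[vcpt M X i] x') y = rel n +>\<^bsub>F n\<^esub> (gen R (X, i, x, y) +[F n] gen R (X, i, x', y))"
  unfolding tens_def using h by (intro class_eq F_gen F.a_closed) (auto simp: tensor_relators_def intro: F_gen)
 also have "... = tens n X i x y +[cpt Ten n] tens n X i x' y"
  unfolding tens_def using h by (intro am_add[OF lin_am[OF Ten_class]] F_gen)
 finally show ?thesis .
qed

lemma tens_add_right:
 assumes h: "X : Ob A" "x .: vcpt M X i" "y .: vcpt N X (n - i)" "y' .: vcpt N X (n - i)"
 shows "tens n X i x (y +[vcpt N X (n - i)] y') = tens n X i x y +[cpt Ten n] tens n X i x y'"
proof -
 interpret G: agrp "vcpt N X (n - i)" using N.val_ag h(1) by simp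
 interpret F: agrp "F n" by (rule module_agrp[OF F_module])
 have "tens n X i x (y +[vcpt N X (n - i)] y') = rel n +>\<^bsub>F n\<^esub> (gen R (X, i, x, y) +[F n] gen R (X, i, x, y'))"
  unfolding tens_def using h by (intro class_eq F_gen F.a_closed) (auto simp: tensor_relators_def intro: F_gen)
 also have "... = tens n X i x y +[cpt Ten n] tens n X i x y'"
  unfolding tens_def using h by (intro am_add[OF lin_am[OF Ten_class]] F_gen)
 finally show ?thesis .
qed

lemma tens_smult_left:
 assumes h: "X : Ob A" "r .: R" "x .: vcpt M X i" "y .: vcpt N X (n - i)"
 shows "tens n X i (r *[vcpt M X i] x) y = r *[cpt Ten n] tens n X i x y"
proof -
 interpret G: Module.module R "vcpt M X i" by (rule val_module[OF h(1)])
 interpret F: Module.module R "F n" by (rule F_module)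
 have "tens n X i (r *[vcpt M X i] x) y = rel n +>\<^bsub>F n\<^esub> (r *[F n] gen R (X, i, x, y))"
  unfolding tens_def using h by (intro class_eq F_gen F.smult_closed) (auto simp: tensor_relators_def intro: F_gen)
 also have "... = r *[cpt Ten n] tens n X i x y"
  unfolding tens_def using h by (intro lin_smult[OF Ten_class] F_gen)
 finally show ?thesis .
qed

lemma tens_smult_right:
 assumes h: "X : Ob A" "r .: R" "x .: vcpt M X i" "y .: vcpt N X (n - i)"
 shows "tens n X i x (r *[vcpt N X (n - i)] y) = r *[cpt Ten n] tens n X i x y"
proof -
 interpret G: Module.module R "vcpt N X (n - i)" using N.val_module h(1) by simp
 interpret F: Module.module R "F n" by (rule F_module)
 have "tens n X i x (r *[vcpt N X (n - i)] y) = rel n +>\<^bsub>F n\<^esub> (r *[F n] gen R (X, i, x, y))"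
  unfolding tens_def using h by (intro class_eq F_gen F.smult_closed) (auto simp: tensor_relators_def intro: F_gen)
 also have "... = r *[cpt Ten n] tens n X i x y"
  unfolding tens_def using h by (intro lin_smult[OF Ten_class] F_gen)
 finally show ?thesis .
qed

lemma tens_balanced:
 assumes h: "X : Ob A" "Y : Ob A" "i + j + l = n" "x .: vcpt M Y i"
  "f .: dhom A X Y j" "y .: vcpt N X l" and i': "i' = i + j"
 shows "tens n X i' (act M X Y i j x f) y = tens n Y i x (lact N X Y j l f y)"
 unfolding tens_def
proof (rule class_eq)
 show g1: "gen R (X, i', act M X Y i j x f, y) .: F n"
  using h i' act_cl[OF h(1,2,4,5) refl] by (intro F_gen) auto
 show g2: "gen R (Y, i, x, lact N X Y j l f y) .: F n"
  using h lact_mem by (intro F_gen) auto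
 have n: "n - i = j + l" using h by simp
 show "gen R (X, i', act M X Y i j x f, y) -[F n] gen R (Y, i, x, lact N X Y j l f y) : tensor_relators R A M N n"
  unfolding tensor_relators_def lact_def i' n[symmetric]
  by (rule UnI2) (use h in blast)
qed

text \<open>Additivity and the value on symbols are proved together: the differential is a union
  over the representatives of a coset, and nothing is known about it until the map
  \<open>\<psi>\<close> on the free module has been shown to kill the relations.\<close>

lemma Ten_diff: "!!X i x y. X : Ob A ==> x .: vcpt M X i ==> y .: vcpt N X (n - i) ==>
  df Ten n (tens n X i x y) =
   tens (n + 1) X (i + 1) (df (val M X) i x) y +[cpt Ten (n + 1)]
   sg (cpt Ten (n + 1)) i (tens (n + 1) X i x (df (val N X) (n - i) y))"
  and Ten_addmap: "amap (cpt Ten n) (cpt Ten (n + 1)) (df Ten n)"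
proof -
 interpret F: Module.module R "F n" by (rule F_module)
 interpret F1: Module.module R "F (n + 1)" by (rule F_module)
 interpret F1a: agrp "F (n + 1)" by (rule module_agrp[OF F_module])
 interpret T1: Module.module R "cpt Ten (n + 1)" by (rule Ten_module)
 interpret T1a: agrp "cpt Ten (n + 1)" by (rule Ten_agrp)
 let ?q = "%c. rel (n + 1) +>\<^bsub>F (n + 1)\<^esub> c"
 let ?g = "%(X, i, x, y). gen R (X, i + 1, df (val M X) i x, y) +[F (n + 1)]
   sg (F (n + 1)) i (gen R (X, i, x, df (val N X) (n - i) y))"
 define \<psi> where "\<psi> c = ?q (tensor_free_diff R A M N n c)" for c
 have dM: "df (val M X) i x .: vcpt M X (i + 1)" if "X : Ob A" "x .: vcpt M X i" for X i x
  by (rule acx_cl[OF val_acx[OF that(1)] that(2)]) simp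
 have dN: "df (val N X) i x .: vcpt N X (i + 1)" if "X : Ob A" "x .: vcpt N X i" for X i x
  using acx_cl[OF N.val_acx] that by simp
 have dN': "df (val N X) (n - i) y .: vcpt N X (n + 1 - i)" if "X : Ob A" "y .: vcpt N X (n - i)" for X i y
  using acx_cl[OF N.val_acx, of X y "n - i" "n + 1 - i"] that by simp
 have g1: "gen R (X, i + 1, df (val M X) i x, y) .: F (n + 1)"
  and g2: "gen R (X, i, x, df (val N X) (n - i) y) .: F (n + 1)"
  if "X : Ob A" "x .: vcpt M X i" "y .: vcpt N X (n - i)" for X i x y
  using that dM dN' by (auto intro!: F_gen)
 have gc: "?g s .: F (n + 1)" if "s : tensor_symbols A M N n" for s
  using that g1 g2 by (auto simp: tensor_symbols_def)
 have fl: "linear_map R (F n) (F (n + 1)) (tensor_free_diff R A M N n)"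
  unfolding tensor_free_diff_def tensor_free_def
  by (rule free_extension_linear) (use gc free_module_module in \<open>auto simp: tensor_free_def\<close>)
 have pl: "linear_map R (F n) (cpt Ten (n + 1)) \<psi>"
  unfolding \<psi>_def by (rule lin_comp[OF fl Ten_class])
 have psi_gen: "\<psi> (gen R (X, i, x, y)) = tens (n + 1) X (i + 1) (df (val M X) i x) y +[cpt Ten (n + 1)]
   sg (cpt Ten (n + 1)) i (tens (n + 1) X i x (df (val N X) (n - i) y))"
  if h: "X : Ob A" "x .: vcpt M X i" "y .: vcpt N X (n - i)" for X i x y
 proof -
  have "tensor_free_diff R A M N n (gen R (X, i, x, y)) = ?g (X, i, x, y)"
   unfolding tensor_free_diff_def
   by (rule free_extension_gen[OF F_module, of "tensor_symbols A M N n" ?g, OF gc]) (use h in \<open>auto simp: tensor_symbols_def\<close>)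
  then have "\<psi> (gen R (X, i, x, y)) = ?q (gen R (X, i + 1, df (val M X) i x, y)) +[cpt Ten (n + 1)]
   ?q (sg (F (n + 1)) i (gen R (X, i, x, df (val N X) (n - i) y)))"
   unfolding \<psi>_def using g1[OF h] g2[OF h] by (simp add: am_add[OF lin_am[OF Ten_class]])
  also have "?q (sg (F (n + 1)) i (gen R (X, i, x, df (val N X) (n - i) y)))
   = sg (cpt Ten (n + 1)) i (?q (gen R (X, i, x, df (val N X) (n - i) y)))"
   by (rule am_sg[OF F1a.ag T1a.ag lin_am[OF Ten_class] g2[OF h]])
  finally show ?thesis by (simp add: tens_def)
 qed
 have t1: "tens (n + 1) X (i + 1) (df (val M X) i x) y .: cpt Ten (n + 1)"
  and t2: "tens (n + 1) X i x (df (val N X) (n - i) y) .: cpt Ten (n + 1)"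
  if "X : Ob A" "x .: vcpt M X i" "y .: vcpt N X (n - i)" for X i x y
  using that dM dN' by (auto intro!: tens_closed)
 have kill: "\<psi> c = 0[cpt Ten (n + 1)]" if c: "c : rel n" for c
 proof (rule rel_kill[OF Ten_module pl refl _ _ _ _ _ c])
  fix X i x x' y
  assume h: "X : Ob A" "x .: vcpt M X i" "x' .: vcpt M X i" "y .: vcpt N X (n - i)"
  interpret G: agrp "vcpt M X i" by (rule val_ag[OF h(1)])
  have "n + 1 - (i + 1) = n - i" by simp
  then have y: "y .: vcpt N X (n + 1 - (i + 1))" using h by simp
  show "\<psi> (gen R (X, i, x +[vcpt M X i] x', y)) = \<psi> (gen R (X, i, x, y)) +[cpt Ten (n + 1)] \<psi> (gen R (X, i, x', y))"
   using h t1[of X _ i y] t2[of X _ i y] y dM dN'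
   by (simp add: psi_gen am_add[OF acxD(2)[OF val_acx[OF h(1)]]] tens_add_left T1a.sg_add T1.a_ac)
 next
  fix X i x y y'
  assume h: "X : Ob A" "x .: vcpt M X i" "y .: vcpt N X (n - i)" "y' .: vcpt N X (n - i)"
  interpret G: agrp "vcpt N X (n - i)" using N.val_ag h(1) by simp
  have e: "n + 1 - (i + 1) = n - i" and e2: "n - i + 1 = n + 1 - i" by simp_all
  have a1: "tens (n + 1) X (i + 1) (df (val M X) i x) (y +[vcpt N X (n - i)] y')
   = tens (n + 1) X (i + 1) (df (val M X) i x) y +[cpt Ten (n + 1)] tens (n + 1) X (i + 1) (df (val M X) i x) y'"
   using tens_add_right[OF h(1) dM[OF h(1,2)], of y "n + 1" y'] h unfolding e by simp
  have a2: "tens (n + 1) X i x (df (val N X) (n - i) (y +[vcpt N X (n - i)] y'))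
   = tens (n + 1) X i x (df (val N X) (n - i) y) +[cpt Ten (n + 1)] tens (n + 1) X i x (df (val N X) (n - i) y')"
   using am_add[OF acxD(2)[OF N.val_acx, of X "n - i"]] h tens_add_right[OF h(1,2) dN' dN'] unfolding e2 by simp
  show "\<psi> (gen R (X, i, x, y +[vcpt N X (n - i)] y')) = \<psi> (gen R (X, i, x, y)) +[cpt Ten (n + 1)] \<psi> (gen R (X, i, x, y'))"
   using h t1[OF h(1,2)] t2[OF h(1,2)]
   by (simp add: psi_gen a1 a2 T1a.sg_add T1.a_ac)
 next
  fix X i r x y
  assume h: "X : Ob A" "r .: R" "x .: vcpt M X i" "y .: vcpt N X (n - i)"
  interpret G: Module.module R "vcpt M X i" by (rule val_module[OF h(1)])
  have e: "n + 1 - (i + 1) = n - i" by simp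
  have lm: "linear_map R (vcpt M X i) (vcpt M X (i + 1)) (df (val M X) i)"
   using val_complex[OF h(1)] by (auto simp: cochain_complex_def)
  show "\<psi> (gen R (X, i, r *[vcpt M X i] x, y)) = r *[cpt Ten (n + 1)] \<psi> (gen R (X, i, x, y))"
   using h t1[OF h(1,3,4)] t2[OF h(1,3,4)] tens_smult_left[OF h(1,2) dM[OF h(1,3)], of y "n + 1"]
   tens_smult_left[OF h(1-3) dN'[OF h(1,4)]]
   by (simp add: psi_gen lin_smult[OF lm] T1.smult_r_distr signed_def T1.smult_r_minus)
 next
  fix X i r x y
  assume h: "X : Ob A" "r .: R" "x .: vcpt M X i" "y .: vcpt N X (n - i)"
  interpret G: Module.module R "vcpt N X (n - i)" using N.val_module h(1) by simp
  have e: "n + 1 - (i + 1) = n - i" and e2: "n - i + 1 = n + 1 - i" by simp_all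
  have lm: "linear_map R (vcpt N X (n - i)) (vcpt N X (n + 1 - i)) (df (val N X) (n - i))"
   using N.val_complex[of X] h(1) unfolding cochain_complex_def e2[symmetric] by simp
  show "\<psi> (gen R (X, i, x, r *[vcpt N X (n - i)] y)) = r *[cpt Ten (n + 1)] \<psi> (gen R (X, i, x, y))"
   using h t1[OF h(1,3,4)] t2[OF h(1,3,4)] tens_smult_right[OF h(1,2) dM[OF h(1,3)], of y "n + 1"]
   tens_smult_right[OF h(1-3) dN'[OF h(1,4)]]
   unfolding e
   by (simp add: psi_gen lin_smult[OF lm] T1.smult_r_distr signed_def T1.smult_r_minus)
 next
  fix X Y i j l x f y
  assume h: "X : Ob A" "Y : Ob A" "i + j + l = n" "x .: vcpt M Y i"
   "f .: dhom A X Y j" "y .: vcpt N X l"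
  let ?T = "cpt Ten (n + 1)"
  have ni: "n - i = j + l" "n - (i + j) = l" using h(3) by auto
  have xf: "act M X Y i j x f .: vcpt M X (i + j)" by (rule act_cl[OF h(1,2,4,5) refl])
  have fy: "lact N X Y j l f y .: vcpt N Y (n - i)" by (rule lact_mem[OF h(1-3,5,6)])
  have df: "df (Hom A X Y) j f .: dhom A X Y (j + 1)" by (rule acx_cl[OF hom_acx[OF h(1,2)] h(5) refl])
  note dx = dM[OF h(2,4)] and dy = dN[OF h(1,6)]
  \<comment> \<open>The three terms of the differential of \<open>x f \<otimes> y\<close> (that of
    \<open>x\<close>, that of \<open>f\<close>, that of \<open>y\<close>), each moved to the object
    \<open>Y\<close> by balancing. Both sides of the relator reduce to them with equal
    signs.\<close>
  define p where "p = tens (n + 1) Y (i + 1) (df (val M Y) i x) (lact N X Y j l f y)"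
  define q where "q = tens (n + 1) Y i x (lact N X Y (j + 1) l (df (Hom A X Y) j f) y)"
  define r where "r = tens (n + 1) Y i x (lact N X Y j (l + 1) f (df (val N X) l y))"
  have lq: "lact N X Y (j + 1) l (df (Hom A X Y) j f) y .: vcpt N Y (n + 1 - i)"
   and lr: "lact N X Y j (l + 1) f (df (val N X) l y) .: vcpt N Y (n + 1 - i)"
   using lact_mem[OF h(1,2) _ df h(6), of i "n + 1"] lact_mem[OF h(1,2) _ h(5) dy, of i "n + 1"] h(3) by auto
  have p: "p .: ?T" and q: "q .: ?T" and r: "r .: ?T"
   unfolding p_def q_def r_def using lq lr h dx fy by (auto intro!: tens_closed)
  interpret G: agrp "vcpt M X (i + j + 1)" by (rule val_ag[OF h(1)])
  interpret H: agrp "vcpt N Y (n + 1 - i)" using N.val_ag h(2) by simp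
  have a1: "act M X Y (i + 1) j (df (val M Y) i x) f .: vcpt M X (i + j + 1)"
   and a2: "act M X Y i (j + 1) x (df (Hom A X Y) j f) .: vcpt M X (i + j + 1)"
   by (rule act_cl[OF h(1,2) dx h(5)], simp, rule act_cl[OF h(1,2,4) df], simp)
  have y: "y .: vcpt N X (n + 1 - (i + j + 1))" using h ni by (simp add: algebra_simps)
  have "\<psi> (gen R (X, i + j, act M X Y i j x f, y))
   = tens (n + 1) X (i + j + 1) (df (val M X) (i + j) (act M X Y i j x f)) y +[?T]
   sg ?T (i + j) (tens (n + 1) X (i + j) (act M X Y i j x f) (df (val N X) l y))"
   using psi_gen[OF h(1) xf] h ni by simp
  also have "tens (n + 1) X (i + j) (act M X Y i j x f) (df (val N X) l y) = r"
   unfolding r_def using h dy by (intro tens_balanced) auto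
  also have "tens (n + 1) X (i + j + 1) (df (val M X) (i + j) (act M X Y i j x f)) y = p +[?T] sg ?T i q"
  proof -
   have "tens (n + 1) X (i + j + 1) (df (val M X) (i + j) (act M X Y i j x f)) y
   = tens (n + 1) X (i + j + 1) (act M X Y (i + 1) j (df (val M Y) i x) f) y +[?T]
   tens (n + 1) X (i + j + 1) (sg (vcpt M X (i + j + 1)) i (act M X Y i (j + 1) x (df (Hom A X Y) j f))) y"
   unfolding act_leibniz[OF h(1,2,4,5)] using h a1 a2 y by (intro tens_add_left) auto
   also have "tens (n + 1) X (i + j + 1) (sg (vcpt M X (i + j + 1)) i (act M X Y i (j + 1) x (df (Hom A X Y) j f))) y
   = sg ?T i (tens (n + 1) X (i + j + 1) (act M X Y i (j + 1) x (df (Hom A X Y) j f)) y)"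
   using y h(1) by (intro am_sg[OF G.ag T1a.ag _ a2] amI tens_closed tens_add_left) auto
   also have "tens (n + 1) X (i + j + 1) (act M X Y i (j + 1) x (df (Hom A X Y) j f)) y = q"
   unfolding q_def using h df by (intro tens_balanced) auto
   also have "tens (n + 1) X (i + j + 1) (act M X Y (i + 1) j (df (val M Y) i x) f) y = p"
   unfolding p_def using h dx by (intro tens_balanced) auto
   finally show ?thesis .
  qed
  finally have e1: "\<psi> (gen R (X, i + j, act M X Y i j x f, y)) = p +[?T] sg ?T i q +[?T] sg ?T (i + j) r" .
  have "\<psi> (gen R (Y, i, x, lact N X Y j l f y)) = p +[?T]
   sg ?T i (tens (n + 1) Y i x (df (val N Y) (n - i) (lact N X Y j l f y)))"
   unfolding p_def by (rule psi_gen[OF h(2,4) fy])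
  also have "df (val N Y) (n - i) (lact N X Y j l f y) = lact N X Y (j + 1) l (df (Hom A X Y) j f) y
   +[vcpt N Y (n + 1 - i)] sg (vcpt N Y (n + 1 - i)) j (lact N X Y j (l + 1) f (df (val N X) l y))"
   using h by (intro L.la_leibniz') auto
  also have "tens (n + 1) Y i x ... = q +[?T] tens (n + 1) Y i x (sg (vcpt N Y (n + 1 - i)) j (lact N X Y j (l + 1) f (df (val N X) l y)))"
   unfolding q_def using h lq lr by (intro tens_add_right) auto
  also have "tens (n + 1) Y i x (sg (vcpt N Y (n + 1 - i)) j (lact N X Y j (l + 1) f (df (val N X) l y))) = sg ?T j r"
   unfolding r_def using h
   by (intro am_sg[OF H.ag T1a.ag _ lr] amI tens_closed tens_add_right) auto
  finally have e2: "\<psi> (gen R (Y, i, x, lact N X Y j l f y)) = p +[?T] sg ?T i (q +[?T] sg ?T j r)" .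
  show "\<psi> (gen R (X, i + j, act M X Y i j x f, y)) = \<psi> (gen R (Y, i, x, lact N X Y j l f y))"
   unfolding e1 e2 using p q r by (simp add: T1a.sg_add T1a.sg_sg T1.a_assoc)
 qed
 have psi_eq: "\<psi> b = \<psi> a" if "a .: F n" "b .: F n" "a -[F n] b : rel n" for a b
  using am_minus[OF module_agrp[OF F_module] T1a.ag lin_am[OF pl] that(1,2)] kill[OF that(3)]
   am_cl[OF lin_am[OF pl] that(1)] am_cl[OF lin_am[OF pl] that(2)]
   T1a.minus_eq_zero_iff[of "\<psi> a" "\<psi> b"] by simp
 have cd: "df Ten n (rel n +>\<^bsub>F n\<^esub> c) = \<psi> c" if c: "c .: F n" for c
 proof -
  have "df Ten n (rel n +>\<^bsub>F n\<^esub> c) = (\<Union>c\<in>rel n +>\<^bsub>F n\<^esub> c. \<psi> c)"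
   by (simp add: dg_tensor_def \<psi>_def)
  also have "... = \<psi> c"
   using c psi_eq by (intro quotient_mod.quot_UNION[OF quot, where f = \<psi>]) auto
  finally show ?thesis .
 qed
 show "df Ten n (tens n X i x y) =
   tens (n + 1) X (i + 1) (df (val M X) i x) y +[cpt Ten (n + 1)]
   sg (cpt Ten (n + 1)) i (tens (n + 1) X i x (df (val N X) (n - i) y))"
  if h: "X : Ob A" "x .: vcpt M X i" "y .: vcpt N X (n - i)" for X i x y
  unfolding tens_def[of n] cd[OF F_gen[OF h]] by (rule psi_gen[OF h])
 obtain g where g: "amap (cpt Ten n) (cpt Ten (n + 1)) g" "!!c. c .: F n ==> g (rel n +>\<^bsub>F n\<^esub> c) = \<psi> c"
  using quotient_mod.quot_lift[OF quot T1a.ag lin_am[OF pl] kill] unfolding Ten_cpt[of n] by blast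
 \<comment> \<open>The induced map \<open>g\<close> on the quotient is additive by construction; the
   differential inherits this by agreeing with it on all cosets.\<close>
 have "g C = df Ten n C" if "C .: cpt Ten n" for C
  using that g(2) cd unfolding Ten_cpt quotient_mod.quot_carrier[OF quot] by auto
 then show "amap (cpt Ten n) (cpt Ten (n + 1)) (df Ten n)"
  using g(1) abelian_monoid.a_closed[of "cpt Ten n"] Ten_agrp[of n]
  by (auto simp: amap_def agrp_def abelian_group_def Pi_iff)
qed

text \<open>The universal property of the tensor product, one degree at a time. No compatibility
  with differentials is asked for, since it is applied to functionals that need not be
  closed.\<close>

lemma tens_lift:
 assumes K: "Module.module R K"
  and cl: "!!X i x y. X : Ob A ==> x .: vcpt M X i ==> y .: vcpt N X (n - i) ==> g X i x y .: K"
  and add_l: "!!X i x x' y. X : Ob A ==> x .: vcpt M X i ==> x' .: vcpt M X i ==>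
   y .: vcpt N X (n - i) ==> g X i (x +[vcpt M X i] x') y = g X i x y +[K] g X i x' y"
  and add_r: "!!X i x y y'. X : Ob A ==> x .: vcpt M X i ==> y .: vcpt N X (n - i) ==>
   y' .: vcpt N X (n - i) ==> g X i x (y +[vcpt N X (n - i)] y') = g X i x y +[K] g X i x y'"
  and sm_l: "!!X i r x y. X : Ob A ==> r .: R ==> x .: vcpt M X i ==> y .: vcpt N X (n - i) ==>
   g X i (r *[vcpt M X i] x) y = r *[K] g X i x y"
  and sm_r: "!!X i r x y. X : Ob A ==> r .: R ==> x .: vcpt M X i ==> y .: vcpt N X (n - i) ==>
   g X i x (r *[vcpt N X (n - i)] y) = r *[K] g X i x y"
  and bal: "!!X Y i j l x f y. X : Ob A ==> Y : Ob A ==> i + j + l = n ==> x .: vcpt M Y i ==>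
   f .: dhom A X Y j ==> y .: vcpt N X l ==>
   g X (i + j) (act M X Y i j x f) y = g Y i x (lact N X Y j l f y)"
 shows "EX h. amap (cpt Ten n) K h & (ALL X i x y. X : Ob A --> x .: vcpt M X i -->
   y .: vcpt N X (n - i) --> h (tens n X i x y) = g X i x y)"
proof -
 interpret K: agrp K by (rule module_agrp[OF K])
 define \<psi> where "\<psi> = free_extension R K (%(X, i, x, y). g X i x y)"
 have gc: "(%(X, i, x, y). g X i x y) s .: K" if "s : tensor_symbols A M N n" for s
  using that cl by (auto simp: tensor_symbols_def)
 have pl: "linear_map R (F n) K \<psi>"
  unfolding \<psi>_def tensor_free_def by (rule free_extension_linear[OF K gc])
 have pg: "\<psi> (gen R (X, i, x, y)) = g X i x y"
  if "X : Ob A" "x .: vcpt M X i" "y .: vcpt N X (n - i)" for X i x y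
  unfolding \<psi>_def using free_extension_gen[OF K, of "tensor_symbols A M N n" "%(X, i, x, y). g X i x y" "(X, i, x, y)", OF gc] that by (simp add: tensor_symbols_def)
 have kill: "\<psi> c = 0[K]" if c: "c : rel n" for c
 proof (rule rel_kill[OF K pl refl _ _ _ _ _ c])
  fix X Y i j l x f y
  assume h: "X : Ob A" "Y : Ob A" "i + j + l = n" "x .: vcpt M Y i"
   "f .: dhom A X Y j" "y .: vcpt N X l"
  have l: "n - (i + j) = l" using h by simp
  have y: "y .: vcpt N X (n - (i + j))" unfolding l by (rule h)
  show "\<psi> (gen R (X, i + j, act M X Y i j x f, y)) = \<psi> (gen R (Y, i, x, lact N X Y j l f y))"
   unfolding pg[OF h(1) act_cl[OF h(1,2,4,5) refl] y] pg[OF h(2,4) lact_mem[OF h(1-3,5,6)]] by (rule bal[OF h])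
 qed (use add_l add_r sm_l sm_r val_add_closed N.val_add_closed val_smult_closed N.val_smult_closed in
   \<open>simp_all add: pg\<close>)
 obtain h where "amap (cpt Ten n) K h" "!!c. c .: F n ==> h (rel n +>\<^bsub>F n\<^esub> c) = \<psi> c"
  using quotient_mod.quot_lift[OF quot K.ag lin_am[OF pl] kill] unfolding Ten_cpt[of n] by blast
 then show ?thesis using pg F_gen by (auto simp: tens_def)
qed

text \<open>Scalars are absorbed into the left factor, so every element is a finite sum of symbols
  without coefficients.\<close>

lemma Ten_induct [consumes 1, case_names zero add]:
 assumes z: "z .: cpt Ten n" and zero: "Q 0[cpt Ten n]"
  and add: "!!X i x y z. X : Ob A ==> x .: vcpt M X i ==> y .: vcpt N X (n - i) ==>
   z .: cpt Ten n ==> Q z ==> Q (tens n X i x y +[cpt Ten n] z)"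
 shows "Q z"
proof -
 interpret F: Module.module R "F n" by (rule F_module)
 let ?q = "%c. rel n +>\<^bsub>F n\<^esub> c"
 note am = lin_am[OF Ten_class]
 have "Q (?q c)" if "c .: free_module R (tensor_symbols A M N n)" for c
  using that
 proof (induction rule: free_module_induct)
  case zero
  have "0[F n] = (%_. 0[R])" by (simp add: tensor_free_def)
  then have "?q (%_. 0[R]) = 0[cpt Ten n]"
   using am_0[OF module_agrp[OF F_module] Ten_agrp am, of n] by simp
  then show ?case using assms(2) by simp
 next
  case (add c r s)
  obtain X i x y where s: "s = (X, i, x, y)" "X : Ob A" "x .: vcpt M X i" "y .: vcpt N X (n - i)"
   using add(3) by (auto simp: tensor_symbols_def)
  have c: "c .: F n" using add(1) by (simp add: tensor_free_def)
  have g: "gen R s .: F n" unfolding s(1) by (rule F_gen[OF s(2-4)])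
  have rx: "r *[vcpt M X i] x .: vcpt M X i"
   by (rule Module.module.smult_closed[OF val_module[OF s(2)] add(2) s(3)])
  have "?q (r *[F n] gen R s +[F n] c) = ?q (r *[F n] gen R s) +[cpt Ten n] ?q c"
   using g c add(2) by (intro am_add[OF am]) auto
  also have "?q (r *[F n] gen R s) = r *[cpt Ten n] tens n X i x y"
   using lin_smult[OF Ten_class add(2) g] by (simp add: tens_def s)
  also have "... = tens n X i (r *[vcpt M X i] x) y" by (rule tens_smult_left[OF s(2) add(2) s(3,4), symmetric])
  finally have "?q (r *[F n] gen R s +[F n] c) = tens n X i (r *[vcpt M X i] x) y +[cpt Ten n] ?q c" .
  then show ?case
   using assms(3)[OF s(2) rx s(4) am_cl[OF am c]] add by (simp add: tensor_free_def)
 qed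
 then show ?thesis
  using z unfolding Ten_cpt quotient_mod.quot_carrier[OF quot] by (auto simp: tensor_free_def)
qed

lemma Ten_acx: "acx Ten"
 unfolding acx_def
proof (intro conjI allI ballI)
 fix n z assume "z .: cpt Ten n"
 then show "df Ten (n + 1) (df Ten n z) = 0[cpt Ten (n + 2)]"
 proof (induction rule: Ten_induct)
  case zero
  show ?case
   using am_0[OF Ten_agrp Ten_agrp Ten_addmap[of n]] am_0[OF Ten_agrp Ten_agrp Ten_addmap[of "n + 1"]]
   by (simp add: add.assoc)
 next
  case (add X i x y z)
  interpret T: agrp "cpt Ten (n + 2)" by (rule Ten_agrp)
  interpret T1: agrp "cpt Ten (n + 1)" by (rule Ten_agrp)
  have n2: "n + 1 + 1 = n + 2" and i2: "i + 1 + 1 = i + 2" by simp_all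
  note am = Ten_addmap[of n] and am1 = Ten_addmap[of "n + 1", unfolded n2]
  have dx: "df (val M X) i x .: vcpt M X (i + 1)"
   by (rule acx_cl[OF val_acx[OF add(1)] add(2)]) simp
  have dy: "df (val N X) (n - i) y .: vcpt N X (n + 1 - i)"
   using acx_cl[OF N.val_acx, of X y "n - i" "n + 1 - i"] add by simp
  have e: "n + 1 - (i + 1) = n - i" and e2: "n + 2 - (i + 1) = n + 1 - i" "n + 2 - (i + 2) = n - i" by auto
  have t1: "tens (n + 1) X (i + 1) (df (val M X) i x) y .: cpt Ten (n + 1)"
   and t2: "tens (n + 1) X i x (df (val N X) (n - i) y) .: cpt Ten (n + 1)"
   using add dx dy by (auto intro!: tens_closed)
  \<comment> \<open>The mixed term, in which both factors are differentiated once. It arises in two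
    ways, with signs \<open>i\<close> and \<open>i + 1\<close>.\<close>
  define w where "w = tens (n + 2) X (i + 1) (df (val M X) i x) (df (val N X) (n - i) y)"
  have w: "w .: cpt Ten (n + 2)" unfolding w_def
   by (rule tens_closed[OF add(1) dx dy[folded e2(1)]])
  have ddx: "df (val M X) (i + 1) (df (val M X) i x) = 0[vcpt M X (i + 2)]"
   by (rule acx_dd[OF val_acx[OF add(1)] add(2)]) auto
  have ddy: "df (val N X) (n + 1 - i) (df (val N X) (n - i) y) = 0[vcpt N X (n + 2 - i)]"
   using acx_dd[OF N.val_acx, of X y "n - i" "n + 1 - i" "n + 2 - i"] add by simp
  have z1: "tens (n + 2) X (i + 2) 0[vcpt M X (i + 2)] y = 0[cpt Ten (n + 2)]"
   using add e2 by (intro am_0[OF val_ag[OF add(1)] T.ag] amI tens_closed tens_add_left) auto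
  have z2: "tens (n + 2) X i x 0[vcpt N X (n + 2 - i)] = 0[cpt Ten (n + 2)]"
   using add N.val_ag by (intro am_0[OF _ T.ag] amI tens_closed tens_add_right) auto
  have d1: "df Ten (n + 1) (tens (n + 1) X (i + 1) (df (val M X) i x) y) = sg (cpt Ten (n + 2)) (i + 1) w"
   using Ten_diff[OF add(1) dx, of y "n + 1"] add(3) w unfolding e n2 i2 ddx w_def by (simp add: z1)
  have d2: "df Ten (n + 1) (tens (n + 1) X i x (df (val N X) (n - i) y)) = w"
   using Ten_diff[OF add(1,2) dy] w unfolding n2 ddy w_def by (simp add: z2)
  have "df Ten (n + 1) (df Ten n (tens n X i x y)) = sg (cpt Ten (n + 2)) (i + 1) w +[cpt Ten (n + 2)]
   sg (cpt Ten (n + 2)) i w"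
   unfolding Ten_diff[OF add(1-3)]
   using t1 t2 am_sg[OF Ten_agrp Ten_agrp am1 t2] by (simp add: am_add[OF am1] d1 d2)
  also have "... = 0[cpt Ten (n + 2)]" using w by (intro T.sg_cancel) auto
  finally show ?case
   using add tens_closed[OF add(1-3)] am_cl[OF am]
   by (simp add: am_add[OF am] am_add[OF am1])
 qed
qed (use Ten_agrp Ten_addmap in auto)

end

section \<open>Cells\<close>

text \<open>Finite sums of elements of \<open>S\<close>. Negatives are not generated, because the
  generating sets in use are closed under negation; this leaves a single inductive case for
  sums.\<close>

inductive_set gsp :: "('k, 'c) module => 'c set => 'c set" for G S where
 gsp_zero: "0[G] : gsp G S"
| gsp_add: "s : S ==> x : gsp G S ==> s +[G] x : gsp G S"

lemma gsp_subgroup: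
 assumes "agrp G" "S <= carrier G" "!!s. s : S ==> -[G] s : S"
 shows "additive_subgroup (gsp G S) G"
proof -
 interpret G: agrp G by fact
 have c: "x .: G" if "x : gsp G S" for x
  using that by induction (use assms(2) in auto)
 have a: "x +[G] y : gsp G S" if "x : gsp G S" "y : gsp G S" for x y
  using that(1)
 proof induction
  case gsp_zero
  then show ?case using c that(2) by simp
 next
  case (gsp_add s x)
  then show ?case using c that(2) assms(2) by (auto simp: G.a_assoc subset_iff intro: gsp.gsp_add)
 qed
 have n: "-[G] x : gsp G S" if "x : gsp G S" for x
  using that
 proof induction
  case gsp_zero
  then show ?case by (simp add: gsp.gsp_zero)
 next
  case (gsp_add s x)
  then show ?case using c assms(2,3) by (auto simp: G.minus_add subset_iff intro: gsp.gsp_add)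
 qed
 show ?thesis
  by (rule additive_subgroupI, rule G.add.subgroupI) (use c a n gsp_zero in \<open>auto intro: gsp.gsp_zero\<close>)
qed

lemma (in agrp) add_neg_cancel: "x .: M ==> y .: M ==> x \<oplus> (y \<oplus> \<ominus> x) = y"
 using a_lcomm[of x y "\<ominus> x"] by (simp add: r_neg)

lemma asub_sg:
 assumes "agrp G" "additive_subgroup W G" "x .: G"
 shows "sg G n x : W \<longleftrightarrow> x : W"
proof -
 interpret G: agrp G by fact
 interpret W: additive_subgroup W G by fact
 show ?thesis using assms(3) W.a_inv_closed[of "-[G] x"] by (auto simp: signed_def)
qed

lemma gsp_gen:
 assumes "agrp G" "s : S" "S <= carrier G" shows "s : gsp G S"
proof -
 interpret G: agrp G by fact
 show ?thesis using gsp_add[OF assms(2) gsp_zero, of G] assms(2,3) by (auto simp: subset_iff)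
qed

lemma gsp_mono: "S <= S' ==> gsp G S <= gsp G S'"
proof
 fix x assume S: "S <= S'" and "x : gsp G S"
 from this(2) show "x : gsp G S'" by induction (use S in \<open>auto intro: gsp.intros\<close>)
qed

definition functional :: "'k ring => ('o, 'k, 'a) dgcat => ('o, 'k, 'a, 'p) dgmod => 'o => int =>
  ('o => int => 'p => 'a) => bool" where
 \<comment> \<open>a graded \<open>A\<close>-linear map from \<open>P\<close> to the shifted representable module, not necessarily closed\<close>
 "functional R A P X m c \<longleftrightarrow> X : Ob A &
  (ALL Y:Ob A. ALL i. linear_map R (vcpt P Y i) (dhom A Y X (i - m)) (c Y i)) &
  (ALL Y:Ob A. ALL Z:Ob A. ALL i j. ALL x:carrier (vcpt P Z i). ALL f:carrier (dhom A Y Z j).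
   c Y (i + j) (act P Y Z i j x f) = cmp A Y Z X (i - m) j (c Z i x) f)"

lemma functionalD:
 assumes "functional R A P X m c"
 shows "X : Ob A" "Y : Ob A ==> linear_map R (vcpt P Y i) (dhom A Y X (i - m)) (c Y i)"
  "Y : Ob A ==> Z : Ob A ==> x .: vcpt P Z i ==> f .: dhom A Y Z j ==>
  c Y (i + j) (act P Y Z i j x f) = cmp A Y Z X (i - m) j (c Z i x) f"
 using assms by (auto simp: functional_def)

text \<open>Combinations of the cells in \<open>S\<close> with arbitrary coefficients in the left
  module \<open>V\<close>. Source and target of \<open>pr\<close> are parameters so that one notion
  covers spans in a module, in a tensor product and in a complex of morphisms.\<close>

definition wsp :: "('k, 'c) cochain => ('o => ('k, 'n) cochain) => ('o => int => int => 'p => 'n => 'c) =>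
  ('o \<times> int \<times> 'p) set => int => 'c set" where
 "wsp C V pr S n = gsp (cpt C n) {pr Y m (n - m) p y | Y m p y. (Y, m, p) : S & y .: cpt (V Y) (n - m)}"

abbreviation deg :: "'o \<times> int \<times> 'p => int" where "deg c == fst (snd c)"

definition hi :: "('o \<times> int \<times> 'p) set => int => ('o \<times> int \<times> 'p) set" where
 "hi S b = {c : S. b < deg c}"

lemma hi_subset: "hi S b <= S" and hi_mono: "a <= b ==> hi S b <= hi S a"
 by (auto simp: hi_def)

definition cellset :: "('o, 'k, 'a) dgcat => ('o, 'k, 'a, 'p) dgmod => ('o \<times> int \<times> 'p) set => bool" where
 "cellset A P S \<longleftrightarrow> (ALL (X, m, p):S. X : Ob A & p .: vcpt P X m)"

lemma cells_sub: "cellset A P S' ==> S <= S' ==> cellset A P S"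
 by (auto simp: cellset_def)

abbreviation span :: "('o, 'k, 'a) dgcat => ('o, 'k, 'a, 'p) dgmod => 'o => ('o \<times> int \<times> 'p) set => int => 'p set" where
 "span A P Y S n == wsp (val P Y) (Hom A Y) (act P Y) S n"

text \<open>A coordinate functional: it reads off the coefficient of one cell and ignores the cells
  of \<open>S\<close>. Freeness of the cells is only ever used through the existence of such
  functionals.\<close>

definition dual :: "'k ring => ('o, 'k, 'a) dgcat => ('o, 'k, 'a, 'p) dgmod => ('o \<times> int \<times> 'p) set =>
  'o \<times> int \<times> 'p => ('o => int => 'p => 'a) => bool" where
 "dual R A P S = (%(X, m, p) c. functional R A P X m c & c X m p = ident A X &
  (ALL (Y, l, q):S. c Y l q = 0[dhom A Y X (l - m)]))"

lemma dual_mono: "dual R A P S' s c ==> S <= S' ==> dual R A P S s c"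
 by (cases s) (force simp: dual_def)

text \<open>Cells in normal position: free generators whose differentials only involve cells of
 strictly higher degree.\<close>

definition normal_cells :: "'k ring => ('o, 'k, 'a) dgcat => ('o, 'k, 'a, 'p) dgmod => ('o \<times> int \<times> 'p) set => bool" where
 "normal_cells R A P S \<longleftrightarrow> finite S & cellset A P S &
  (ALL s:S. EX c. dual R A P (S - {s}) s c) &
  (ALL (X, m, p):S. df (val P X) m p : span A P X (hi S m) (m + 1))"

text \<open>What is common to three situations: the tensor product with a left module; the values
  \<open>P(F)\<close>, where \<open>V\<close> is \<open>Hom A F\<close>; and the morphisms from a
  twisted complex to \<open>P\<close>, where \<open>V\<close> is its dual. The assumption
  \<open>pr_lift\<close> says that a functional on \<open>P\<close> induces a map from
  \<open>C\<close> to the values of \<open>V\<close>, so that coefficients of cells can be read off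
  in \<open>C\<close>.\<close>

locale pairing = dg_module R A P + L: left_dg R A V la
 for R :: "'k ring" and A :: "('o, 'k, 'a) dgcat" and P :: "('o, 'k, 'a, 'p) dgmod"
  and V :: "'o => ('k, 'n) cochain" and la +
 fixes C :: "('k, 'c) cochain" and pr :: "'o => int => int => 'p => 'n => 'c"
 assumes C_acx: "acx C"
  and pr_closed': "X : Ob A ==> x .: vcpt P X i ==> y .: cpt (V X) j ==>
   pr X i j x y .: cpt C (i + j)"
  and pr_add_left: "X : Ob A ==> x .: vcpt P X i ==> x' .: vcpt P X i ==>
   y .: cpt (V X) j ==> pr X i j (x +[vcpt P X i] x') y = pr X i j x y +[cpt C (i + j)] pr X i j x' y"
  and pr_add_right: "X : Ob A ==> x .: vcpt P X i ==> y .: cpt (V X) j ==>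
   y' .: cpt (V X) j ==> pr X i j x (y +[cpt (V X) j] y') = pr X i j x y +[cpt C (i + j)] pr X i j x y'"
  and pr_balanced': "X : Ob A ==> Y : Ob A ==> x .: vcpt P Y i ==> f .: dhom A X Y j ==>
   y .: cpt (V X) l ==> pr X (i + j) l (act P X Y i j x f) y = pr Y i (j + l) x (la X Y j l f y)"
  and pr_leibniz': "X : Ob A ==> x .: vcpt P X i ==> y .: cpt (V X) j ==>
   df C (i + j) (pr X i j x y) = pr X (i + 1) j (df (val P X) i x) y +[cpt C (i + j + 1)]
   sg (cpt C (i + j + 1)) i (pr X i (j + 1) x (df (V X) j y))"
  and pr_lift: "functional R A P X m c ==> EX h. ALL n. amap (cpt C n) (cpt (V X) (n - m)) (h n) &
   (ALL Y i j x y. Y : Ob A --> x .: vcpt P Y i --> y .: cpt (V Y) j --> n = i + j -->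
   h n (pr Y i j x y) = la Y X (i - m) j (c Y i x) y)"
begin

lemma C_ag: "agrp (cpt C n)" and C_addmap: "amap (cpt C n) (cpt C (n + 1)) (df C n)"
 using acxD[OF C_acx] by auto

lemma C_addmap': "amap (cpt C (n - 1)) (cpt C n) (df C (n - 1))"
 using C_addmap[of "n - 1"] by simp

lemma pr_cl: "X : Ob A ==> x .: vcpt P X i ==> y .: cpt (V X) j ==> n = i + j ==>
 pr X i j x y .: cpt C n"
 using pr_closed' by simp

lemma pr_am_l: "X : Ob A ==> y .: cpt (V X) j ==> n = i + j ==>
 amap (vcpt P X i) (cpt C n) (%x. pr X i j x y)"
 by (auto intro!: amI pr_cl pr_add_left)

lemma pr_am_r: "X : Ob A ==> x .: vcpt P X i ==> n = i + j ==>
 amap (cpt (V X) j) (cpt C n) (pr X i j x)"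
 by (auto intro!: amI pr_cl pr_add_right)

lemma pr_balanced: "X : Ob A ==> Y : Ob A ==> x .: vcpt P Y i ==> f .: dhom A X Y j ==>
   y .: cpt (V X) l ==> i' = i + j ==> l' = j + l ==>
   pr X i' l (act P X Y i j x f) y = pr Y i l' x (la X Y j l f y)"
 using pr_balanced' by simp

lemma pr_leibniz: "X : Ob A ==> x .: vcpt P X i ==> y .: cpt (V X) j ==>
   n = i + j ==> n' = i + j + 1 ==> i' = i + 1 ==> j' = j + 1 ==>
   df C n (pr X i j x y) = pr X i' j (df (val P X) i x) y +[cpt C n']
   sg (cpt C n') i (pr X i j' x (df (V X) j y))"
 using pr_leibniz' by simp

abbreviation wspan where "wspan == wsp C V pr"

lemma wspan_gens:
 assumes "cellset A P S"
 shows "{pr Y m (n - m) p y | Y m p y. (Y, m, p) : S & y .: cpt (V Y) (n - m)} <= carrier (cpt C n)"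
 using assms by (auto simp: cellset_def intro!: pr_cl)

lemma wspan_sub:
 assumes S: "cellset A P S" shows "additive_subgroup (wspan S n) (cpt C n)"
 unfolding wsp_def
proof (rule gsp_subgroup[OF C_ag wspan_gens[OF S]])
 fix s assume "s : {pr Y m (n - m) p y | Y m p y. (Y, m, p) : S & y .: cpt (V Y) (n - m)}"
 then obtain Y m p y where s: "s = pr Y m (n - m) p y" "(Y, m, p) : S" "y .: cpt (V Y) (n - m)"
  by blast
 then have o: "Y : Ob A" "p .: vcpt P Y m" using S by (auto simp: cellset_def)
 interpret G: agrp "cpt (V Y) (n - m)" by (rule L.lval_ag[OF o(1)])
 have "-[cpt C n] s = pr Y m (n - m) p (\<ominus>\<^bsub>cpt (V Y) (n - m)\<^esub> y)"
  unfolding s(1) using o s by (intro am_neg[OF G.ag C_ag pr_am_r, symmetric]) auto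
 then show "-[cpt C n] s : {pr Y m (n - m) p y | Y m p y. (Y, m, p) : S & y .: cpt (V Y) (n - m)}"
  using s G.a_inv_closed by blast
qed

lemma wspan_cl: "cellset A P S ==> x : wspan S n ==> x .: cpt C n"
 using additive_subgroup.a_subset[OF wspan_sub] by blast

lemma wspan_mono: "S <= S' ==> wspan S n <= wspan S' n"
 unfolding wsp_def by (rule gsp_mono) blast

lemma wspan_gen:
 assumes "cellset A P S" "(X, m, p) : S" "y .: cpt (V X) j" "n = m + j"
 shows "pr X m j p y : wspan S n"
proof -
 have j: "j = n - m" using assms(4) by simp
 show ?thesis
  unfolding wsp_def j by (rule gsp_gen[OF C_ag _ wspan_gens[OF assms(1)]]) (use assms(2,3) j in blast)
qed

lemma wspan_insert:
 assumes S: "cellset A P (insert (X, m, p) S)" and x: "x : wspan (insert (X, m, p) S) n"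
 shows "EX v:wspan S n. EX y:carrier (cpt (V X) (n - m)). x = v +[cpt C n] pr X m (n - m) p y"
proof -
 have S': "cellset A P S" and o: "X : Ob A" "p .: vcpt P X m" using S by (auto simp: cellset_def)
 interpret G: agrp "cpt C n" by (rule C_ag)
 interpret K: agrp "cpt (V X) (n - m)" by (rule L.lval_ag[OF o(1)])
 interpret W: additive_subgroup "wspan S n" "cpt C n" by (rule wspan_sub[OF S'])
 have am: "amap (cpt (V X) (n - m)) (cpt C n) (pr X m (n - m) p)"
  using o by (intro pr_am_r) auto
 show ?thesis
  using x unfolding wsp_def[of C V pr "insert (X, m, p) S"]
 proof induction
  case gsp_zero
  have "0[cpt C n] = 0[cpt C n] +[cpt C n] pr X m (n - m) p 0[cpt (V X) (n - m)]"
   using am_0[OF K.ag G.ag am] by simp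
  then show ?case using W.zero_closed K.zero_closed by blast
 next
  case (gsp_add s x)
  then obtain v y where v: "v : wspan S n" and y: "y .: cpt (V X) (n - m)"
   and x: "x = v +[cpt C n] pr X m (n - m) p y" by blast
  have vc: "v .: cpt C n" using v W.a_subset by blast
  obtain Y l q u where s: "s = pr Y l (n - l) q u" "(Y, l, q) : insert (X, m, p) S" "u .: cpt (V Y) (n - l)"
   using gsp_add(1) by blast
  have py: "pr X m (n - m) p y .: cpt C n" by (rule am_cl[OF am y])
  show ?case
  proof (cases "(Y, l, q) = (X, m, p)")
   case True
   then have u: "u .: cpt (V X) (n - m)" and s': "s = pr X m (n - m) p u" using s by auto
   have "s +[cpt C n] x = v +[cpt C n] pr X m (n - m) p (u +[cpt (V X) (n - m)] y)"
   unfolding x s' am_add[OF am u y] using vc py am_cl[OF am u] by (simp add: G.a_ac)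
   then show ?thesis using v u y K.a_closed by blast
  next
   case False
   then have s': "(Y, l, q) : S" using s by auto
   then have sS: "s : wspan S n" unfolding s(1) by (intro wspan_gen[OF S'] s(3)) auto
   then have sc: "s .: cpt C n" using W.a_subset by blast
   have "s +[cpt C n] x = (s +[cpt C n] v) +[cpt C n] pr X m (n - m) p y"
   unfolding x using vc py sc by (simp add: G.a_assoc)
   then show ?thesis using W.a_closed[OF sS v] y by blast
  qed
 qed
qed

text \<open>Balancing moves the coefficient of each cell in \<open>x\<close> over to
  \<open>y\<close>.\<close>

lemma span_pr:
 assumes S: "cellset A P S" and x: "x : span A P Y S i" and o: "Y : Ob A" and y: "y .: cpt (V Y) j"
  and n: "n = i + j"
 shows "pr Y i j x y : wspan S n"
proof -
 interpret W: additive_subgroup "wspan S n" "cpt C n" by (rule wspan_sub[OF S])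
 have am: "amap (vcpt P Y i) (cpt C n) (%x. pr Y i j x y)" by (rule pr_am_l[OF o y n])
 have "x .: vcpt P Y i & pr Y i j x y : wspan S n"
  using x unfolding wsp_def[of "val P Y"]
 proof induction
  case gsp_zero
  interpret G: agrp "vcpt P Y i" by (rule val_ag[OF o])
  show ?case using am_0[OF G.ag C_ag am] by simp
 next
  case (gsp_add s x)
  then obtain X m p a where s: "s = act P Y X m (i - m) p a" "(X, m, p) : S" "a .: dhom A Y X (i - m)"
   by blast
  have oX: "X : Ob A" "p .: vcpt P X m" using s S by (auto simp: cellset_def)
  have sc: "s .: vcpt P Y i" unfolding s(1) by (rule act_cl[OF o oX s(3)]) simp
  have "pr Y i j s y = pr X m (i - m + j) p (la Y X (i - m) j a y)"
   unfolding s(1) by (rule pr_balanced[OF o oX s(3) y]) auto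
  also have "... : wspan S n"
   using n by (intro wspan_gen[OF S s(2)] L.la_cl[OF o oX(1) s(3) y]) auto
  finally show ?case
   using gsp_add(3) sc am_add[OF am sc] val_add_closed[OF o sc] by auto
 qed
 then show ?thesis by blast
qed

text \<open>By the Leibniz rule a differential hits either the cell, where \<open>cl\<close>
  applies, or its coefficient, where the cell stays the same.\<close>

lemma wspan_diff:
 assumes S: "cellset A P S" "S <= S'" and S': "cellset A P S'"
  and cl: "!!X m p. (X, m, p) : S ==> df (val P X) m p : span A P X S' (m + 1)"
  and x: "x : wspan S n"
 shows "df C n x : wspan S' (n + 1)"
proof -
 interpret G: agrp "cpt C n" by (rule C_ag)
 interpret H: agrp "cpt C (n + 1)" by (rule C_ag)
 interpret W: additive_subgroup "wspan S' (n + 1)" "cpt C (n + 1)" by (rule wspan_sub[OF S'])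
 have "x .: cpt C n & df C n x : wspan S' (n + 1)"
  using x unfolding wsp_def[of C V pr S]
 proof induction
  case gsp_zero
  then show ?case using am_0[OF G.ag H.ag C_addmap] by simp
 next
  case (gsp_add s x)
  then obtain X m p y where s: "s = pr X m (n - m) p y" "(X, m, p) : S" "y .: cpt (V X) (n - m)"
   by blast
  have o: "X : Ob A" "p .: vcpt P X m" using s S by (auto simp: cellset_def)
  have sc: "s .: cpt C n" unfolding s(1) by (rule pr_cl[OF o s(3)]) simp
  have dy: "df (V X) (n - m) y .: cpt (V X) (n - m + 1)"
   by (rule acx_cl[OF L.lv_acx[OF o(1)] s(3) refl])
  have "df C n s = pr X (m + 1) (n - m) (df (val P X) m p) y +[cpt C (n + 1)]
   sg (cpt C (n + 1)) m (pr X m (n - m + 1) p (df (V X) (n - m) y))"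
   unfolding s(1) by (rule pr_leibniz[OF o s(3)]) auto
  moreover have "pr X (m + 1) (n - m) (df (val P X) m p) y : wspan S' (n + 1)"
   by (rule span_pr[OF S' cl[OF s(2)] o(1) s(3)]) simp
  moreover have "pr X m (n - m + 1) p (df (V X) (n - m) y) : wspan S' (n + 1)"
   using s(2) S(2) by (intro wspan_gen[OF S' _ dy]) auto
  ultimately have "df C n s : wspan S' (n + 1)" by (auto simp: signed_def)
  then show ?case using gsp_add(3) sc am_add[OF C_addmap sc] G.a_closed by auto
 qed
 then show ?thesis by blast
qed

text \<open>The dual functional lifts to a map on \<open>C\<close> that kills the span of
  \<open>S\<close> and recovers \<open>y\<close> from the product with \<open>p\<close>.\<close>

lemma pr_inj:
 assumes d: "dual R A P S (X, m, p) c" and S: "cellset A P S" and p: "p .: vcpt P X m"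
  and y: "y .: cpt (V X) j" and w: "pr X m j p y : wspan S n" and n: "n = m + j"
 shows "y = 0[cpt (V X) j]"
proof -
 have c: "functional R A P X m c" "c X m p = ident A X"
  and c0: "!!Y l q. (Y, l, q) : S ==> c Y l q = 0[dhom A Y X (l - m)]"
  using d by (auto simp: dual_def)
 note oX = functionalD(1)[OF c(1)]
 obtain h where am: "amap (cpt C n) (cpt (V X) (n - m)) (h n)"
  and h: "!!Y i j x y. Y : Ob A ==> x .: vcpt P Y i ==> y .: cpt (V Y) j ==> n = i + j ==>
   h n (pr Y i j x y) = la Y X (i - m) j (c Y i x) y"
  using pr_lift[OF c(1)] by blast
 interpret K: agrp "cpt (V X) (n - m)" by (rule L.lval_ag[OF oX])
 interpret W: additive_subgroup "wspan S n" "cpt C n" by (rule wspan_sub[OF S])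
 have "z .: cpt C n & h n z = 0[cpt (V X) (n - m)]" if "z : wspan S n" for z
  using that unfolding wsp_def
 proof induction
  case gsp_zero
  interpret G: agrp "cpt C n" by (rule C_ag)
  show ?case using am_0[OF G.ag K.ag am] by simp
 next
  case (gsp_add s x)
  then obtain Y l q u where s: "s = pr Y l (n - l) q u" "(Y, l, q) : S" "u .: cpt (V Y) (n - l)"
   by blast
  have o: "Y : Ob A" "q .: vcpt P Y l" using s S by (auto simp: cellset_def)
  have sc: "s .: cpt C n" unfolding s(1) by (rule pr_cl[OF o s(3)]) simp
  have "h n s = la Y X (l - m) (n - l) 0[dhom A Y X (l - m)] u"
   unfolding s(1) using h[OF o s(3)] c0[OF s(2)] by simp
  also have "... = 0[cpt (V X) (n - m)]"
   by (rule am_0[OF hom_ag[OF o(1) oX] K.ag L.la_am_l[OF o(1) oX s(3)]]) simp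
  finally show ?case
   using gsp_add(3) sc am_add[OF am sc] C_ag[of n]
   by (auto simp: agrp_def abelian_group_def intro!: abelian_monoid.a_closed)
 qed
 then have "h n (pr X m j p y) = 0[cpt (V X) (n - m)]" using w by blast
 moreover have "h n (pr X m j p y) = y"
  using h[OF oX p y n] c(2) L.la_ident[OF oX y] by simp
 ultimately show ?thesis using n by simp
qed

text \<open>The subquotient spanned by a single cell of degree \<open>m\<close> is a copy of
  \<open>V X\<close> shifted by \<open>m\<close>. It is acyclic in degree \<open>n\<close> when
  \<open>V X\<close> is acyclic in degree \<open>n - m\<close>, and then the cell can be removed by
  \<open>peel_step\<close>; the sign there is the one of the Leibniz rule.\<close>

lemma pr_cell_boundary:
 assumes S: "cellset A P S" and o: "X : Ob A" "p .: vcpt P X m"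
  and dp: "df (val P X) m p : span A P X S (m + 1)"
  and cl: "!!Y l q. (Y, l, q) : S ==> df (val P Y) l q : span A P Y S (l + 1)"
  and d: "dual R A P S (X, m, p) c"
  and ac: "hz (V X) (n - m)"
  and x: "x : wspan (insert (X, m, p) S) n" "df C n x : wspan S (n + 1)"
 shows "EX q:wspan (insert (X, m, p) S) (n - 1). x -[cpt C n] df C (n - 1) q : wspan S n"
proof -
 have S': "cellset A P (insert (X, m, p) S)" using S o by (auto simp: cellset_def)
 obtain v y where vy: "v : wspan S n" "y .: cpt (V X) (n - m)" "x = v +[cpt C n] pr X m (n - m) p y"
  using wspan_insert[OF S' x(1)] by blast
 have nm: "n - m + m = n" "n - m + m + 1 = n + 1" "n - m - 1 + m = n - 1" by auto
 have "EX \<eta>:carrier (cpt (V X) (n - m - 1)).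
   x -[cpt C (n - m + m)] df C (n - m - 1 + m) (pr X m (n - m - 1) p \<eta>) : wspan S (n - m + m)"
 proof (rule peel_step[OF C_acx L.lv_acx[OF o(1)] ac, where W = "wspan S" and \<kappa> = "%j. pr X m j p" and s = m])
  show "additive_subgroup (wspan S i) (cpt C i)" for i by (rule wspan_sub[OF S])
  show "df C i z : wspan S (i + 1)" if "z : wspan S i" for i z
   by (rule wspan_diff[OF S subset_refl S cl that])
  show "amap (cpt (V X) j) (cpt C (j + m)) (pr X m j p)" for j
   using o by (intro pr_am_r) auto
  show "y = 0[cpt (V X) j]" if "y .: cpt (V X) j" "pr X m j p y : wspan S (j + m)" for j y
   using pr_inj[OF d S o(2) that] by simp
  fix j y assume y: "y .: cpt (V X) j"
  interpret H: agrp "cpt C (j + m + 1)" by (rule C_ag)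
  have dy: "df (V X) j y .: cpt (V X) (j + 1)"
   by (rule acx_cl[OF L.lv_acx[OF o(1)] y refl])
  have a: "pr X (m + 1) j (df (val P X) m p) y : wspan S (j + m + 1)"
   by (rule span_pr[OF S dp o(1) y]) simp
  have b: "pr X m (j + 1) p (df (V X) j y) .: cpt C (j + m + 1)"
   by (rule pr_cl[OF o dy]) simp
  have "df C (j + m) (pr X m j p y) = pr X (m + 1) j (df (val P X) m p) y +[cpt C (j + m + 1)]
   sg (cpt C (j + m + 1)) m (pr X m (j + 1) p (df (V X) j y))"
   by (rule pr_leibniz[OF o y]) auto
  then have "df C (j + m) (pr X m j p y) -[cpt C (j + m + 1)] sg (cpt C (j + m + 1)) m (pr X m (j + 1) p (df (V X) j y))
   = pr X (m + 1) j (df (val P X) m p) y"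
   using wspan_cl[OF S a] b by (simp add: H.minus_eq H.a_assoc H.r_neg)
  then show "df C (j + m) (pr X m j p y) -[cpt C (j + m + 1)]
   sg (cpt C (j + m + 1)) m (pr X m (j + 1) p (df (V X) j y)) : wspan S (j + m + 1)"
   using a by simp
 next
  show "v : wspan S (n - m + m)" "df C (n - m + m) x : wspan S (n - m + m + 1)"
   "x = v +[cpt C (n - m + m)] pr X m (n - m) p y"
   using vy x(2) unfolding nm by auto
 qed (rule vy)
 then obtain \<eta> where eta: "\<eta> .: cpt (V X) (n - m - 1)"
  "x -[cpt C n] df C (n - 1) (pr X m (n - m - 1) p \<eta>) : wspan S n"
  unfolding nm by blast
 moreover have "pr X m (n - m - 1) p \<eta> : wspan (insert (X, m, p) S) (n - 1)"
  by (rule wspan_gen[OF S' _ eta(1)]) auto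
 ultimately show ?thesis by blast
qed

lemma span_mono: "S <= S' ==> span A P Y S n <= span A P Y S' n"
 unfolding wsp_def by (rule gsp_mono) blast

text \<open>The cells of degree in the interval from \<open>a + 1\<close> to \<open>b\<close> are
  removed from the lowest degree upwards: a differential only involves cells of higher degree, so
  what remains is stable under the differential at each stage.\<close>

lemma peel_cells:
 assumes nc: "normal_cells R A P S"
  and ac: "!!X m p. (X, m, p) : S ==> a < m ==> m <= b ==> hz (V X) (n - m)"
  and ab: "a <= b"
  and x: "x : wspan (hi S a) n" "df C n x : wspan (hi S b) (n + 1)"
 shows "EX q:wspan (hi S a) (n - 1). x -[cpt C n] df C (n - 1) q : wspan (hi S b) n"
proof -
 define D where "D = {c : S. a < deg c & deg c <= b}"
 \<comment> \<open>The cells left over are closed upwards in degree, which makes their span a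
   subcomplex.\<close>
 define U where "U D' \<longleftrightarrow> (ALL c:S. ALL c':D'. deg c' < deg c --> c : hi S b \<union> D')" for D'
 have fin: "finite S" and cs: "cellset A P S"
  and dual: "!!s. s : S ==> EX c. dual R A P (S - {s}) s c"
  and dn: "!!X m p. (X, m, p) : S ==> df (val P X) m p : span A P X (hi S m) (m + 1)"
  using nc by (auto simp: normal_cells_def)
 have hD: "hi S b \<union> D = hi S a" using ab by (auto simp: hi_def D_def)
 \<comment> \<open>The intersection makes \<open>W J\<close> a span of genuine cells for every set
   \<open>J\<close>, as \<open>peel\<close> quantifies over all of them.\<close>
 define W where "W J = wspan (J \<inter> S)" for J
 have Wc: "cellset A P (J \<inter> S)" for J by (rule cells_sub[OF cs]) auto
 have "EX q:W (hi S b \<union> D) (n - 1). x -[cpt C n] df C (n - 1) q : W (hi S b) n"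
 proof (rule peel[OF C_acx, where U = U and D = D])
  show "finite D" using fin by (simp add: D_def)
  show "additive_subgroup (W J n) (cpt C n)" for J unfolding W_def by (rule wspan_sub[OF Wc])
  show "W J (n - 1) <= carrier (cpt C (n - 1))" for J unfolding W_def using wspan_cl[OF Wc] by blast
  show "x +[cpt C (n - 1)] y : W J (n - 1)" if "x : W J (n - 1)" "y : W J (n - 1)" for J x y
   using that unfolding W_def by (rule additive_subgroup.a_closed[OF wspan_sub[OF Wc]])
  show "0[cpt C (n - 1)] : W J (n - 1)" for J
   unfolding W_def by (rule additive_subgroup.zero_closed[OF wspan_sub[OF Wc]])
  show "W J (n - 1) <= W J' (n - 1)" if "J <= J'" for J J'
   unfolding W_def by (rule wspan_mono) (use that in auto)
  show "U D" by (auto simp: U_def D_def hi_def)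
  have hS: "hi S c \<inter> S = hi S c" for c by (auto simp: hi_def)
  show "x : W (hi S b \<union> D) n" "df C n x : W (hi S b) (n + 1)"
   using x unfolding hD W_def hS by auto
  fix D' assume D': "D' <= D" "D' ~= {}" "U D'"
  have "finite D'" using D'(1) fin by (auto simp: D_def intro: finite_subset)
  then obtain i where i: "i : D'" "!!c. c : D' ==> deg i <= deg c"
   using D'(2) arg_min_if_finite[of D' deg] by (metis not_less)
  obtain X m p where imp: "i = (X, m, p)" by (cases i)
  have iS: "(X, m, p) : S" and am: "a < m" "m <= b" using i(1) D'(1) imp by (auto simp: D_def)
  have o: "X : Ob A" "p .: vcpt P X m" using cs iS by (auto simp: cellset_def)
  have U': "U (D' - {i})"
   unfolding U_def
  proof (intro ballI impI)
   fix c c' assume c: "c : S" "c' : D' - {i}" "deg c' < deg c"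
   then have "c : hi S b \<union> D'" using D'(3) by (auto simp: U_def)
   moreover have "c ~= i" using c i(2)[of c'] by auto
   ultimately show "c : hi S b \<union> (D' - {i})" by blast
  qed
  let ?J = "hi S b \<union> (D' - {i})"
  have JS: "?J <= S" using D'(1) by (auto simp: hi_def D_def)
  have J1: "insert (X, m, p) ?J = hi S b \<union> D'" using i(1) imp by auto
  have up: "hi S (deg c) <= ?J" if c: "c : insert (X, m, p) ?J" for c
  proof
   fix c' assume c': "c' : hi S (deg c)"
   show "c' : ?J"
   proof (cases "c : hi S b")
   case True
   then show ?thesis using c' by (auto simp: hi_def)
   next
   case False
   then have "c : D'" using c J1 by auto
   then have "c' : hi S b \<union> D'" using D'(3) c' by (auto simp: U_def hi_def)
   moreover have "c' ~= i" using i(2)[OF \<open>c : D'\<close>] c' by (auto simp: hi_def)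
   ultimately show ?thesis by blast
   qed
  qed
  have "EX q:W (hi S b \<union> D') (n - 1). x -[cpt C n] df C (n - 1) q : W ?J n"
   if x: "x : W (hi S b \<union> D') n" "df C n x : W (hi S b) (n + 1)" for x
  proof -
   have JJ: "?J \<inter> S = ?J" and JJ': "(hi S b \<union> D') \<inter> S = insert (X, m, p) ?J"
   using JS J1 iS by auto
   obtain c where c: "dual R A P (S - {(X, m, p)}) (X, m, p) c" using dual[OF iS] by blast
   have "?J <= S - {(X, m, p)}" using JS imp am by (auto simp: hi_def)
   then have c': "dual R A P ?J (X, m, p) c" by (rule dual_mono[OF c])
   show ?thesis
   unfolding W_def JJ JJ'
   proof (rule pr_cell_boundary[OF _ o _ _ c' ac[OF iS am]])
   show "cellset A P ?J" by (rule cells_sub[OF cs JS])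
   show "df (val P X) m p : span A P X ?J (m + 1)"
   using dn[OF iS] span_mono[OF up[of "(X, m, p)"]] by auto
   show "df (val P Y) l q : span A P Y ?J (l + 1)" if c: "(Y, l, q) : ?J" for Y l q
   proof -
   have "hi S l <= ?J" using up[of "(Y, l, q)"] c by simp
   moreover have "(Y, l, q) : S" using c JS by blast
   ultimately show ?thesis using dn span_mono by blast
   qed
   show "x : wspan (insert (X, m, p) ?J) n" using x(1) unfolding W_def JJ' .
   show "df C n x : wspan ?J (n + 1)"
   using x(2) wspan_mono[of "hi S b" ?J "n + 1"] unfolding W_def hS by auto
   qed
  qed
  then show "EX i:D'. U (D' - {i}) & (ALL x:W (hi S b \<union> D') n. df C n x : W (hi S b) (n + 1) -->
   (EX q:W (hi S b \<union> D') (n - 1). x -[cpt C n] df C (n - 1) q : W (hi S b \<union> (D' - {i})) n))"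
   using i(1) U' by blast
 qed
 moreover have "hi S c \<inter> S = hi S c" for c by (auto simp: hi_def)
 ultimately show ?thesis unfolding hD W_def by simp
qed

end

text \<open>With \<open>Hom A F\<close> as the left module the pairing is the action of
  \<open>A\<close> on \<open>M\<close>, and its spans are the spans in \<open>M(F)\<close>. The
  removal of cells thus applies inside \<open>M\<close> itself.\<close>

lemma (in dg_module) pairing_yon:
 assumes F: "F : Ob A"
 shows "pairing R A M (Hom A F) (cmp A F) (val M F) (act M F)"
proof -
 interpret L: left_dg R A "Hom A F" "cmp A F" by (rule left_dg_coyon[OF F])
 show ?thesis
 proof unfold_locales
  show "acx (val M F)" by (rule val_acx[OF F])
  fix X x i y j assume o: "X : Ob A" "x .: vcpt M X i" "y .: cpt (Hom A F X) j"
  then show "act M F X i j x y .: vcpt M F (i + j)" using F by (intro act_cl) auto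
  show "df (val M F) (i + j) (act M F X i j x y) = act M F X (i + 1) j (df (val M X) i x) y +[vcpt M F (i + j + 1)]
   sg (vcpt M F (i + j + 1)) i (act M F X i (j + 1) x (df (Hom A F X) j y))"
   using o F by (intro act_leibniz) auto
  show "act M F X i j (x +[vcpt M X i] x') y = act M F X i j x y +[vcpt M F (i + j)] act M F X i j x' y"
   if "x' .: vcpt M X i" for x'
   using o F that by (intro am_add[OF act_am_l]) auto
  show "act M F X i j x (y +[cpt (Hom A F X) j] y') = act M F X i j x y +[vcpt M F (i + j)] act M F X i j x y'"
   if "y' .: cpt (Hom A F X) j" for y'
   using o F that by (intro am_add[OF act_am_r]) auto
 next
  fix X Y x i f j y l
  assume "X : Ob A" "Y : Ob A" "x .: vcpt M Y i" "f .: dhom A X Y j" "y .: cpt (Hom A F X) l"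
  then show "act M F X (i + j) l (act M X Y i j x f) y = act M F Y i (j + l) x (cmp A F X Y j l f y)"
   using F by (intro act_comp) auto
 next
  fix X m c assume c: "functional R A M X m c"
  have "i + j - m = i - m + j" for i j :: int by simp
  then show "EX h. ALL n. amap (vcpt M F n) (cpt (Hom A F X) (n - m)) (h n) &
   (ALL Y i j x y. Y : Ob A --> x .: vcpt M Y i --> y .: cpt (Hom A F Y) j --> n = i + j -->
   h n (act M F Y i j x y) = cmp A F Y X (i - m) j (c Y i x) y)"
   using lin_am[OF functionalD(2)[OF c F]] functionalD(3)[OF c F]
   \<comment> \<open>The lift of a functional is its own component at \<open>F\<close>.\<close>
   by (intro exI[of _ "c F"]) auto
 qed
qed

context dg_module
begin

lemma span_sub: "F : Ob A ==> cellset A M S ==> additive_subgroup (span A M F S n) (vcpt M F n)"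
 by (rule pairing.wspan_sub[OF pairing_yon])

lemma span_carrier: "F : Ob A ==> cellset A M S ==> x : span A M F S n ==> x .: vcpt M F n"
 by (rule pairing.wspan_cl[OF pairing_yon])

lemma span_mono: "S <= S' ==> span A M F S n <= span A M F S' n"
 unfolding wsp_def by (rule gsp_mono) blast

lemma span_gen: "F : Ob A ==> cellset A M S ==> (X, m, p) : S ==> a .: dhom A F X j ==> n = m + j ==>
 act M F X m j p a : span A M F S n"
 by (rule pairing.wspan_gen[OF pairing_yon])

lemma span_act: "cellset A M S ==> x : span A M Y S i ==> Y : Ob A ==> F : Ob A ==> f .: dhom A F Y j ==>
 n = i + j ==> act M F Y i j x f : span A M F S n"
 by (rule pairing.span_pr[OF pairing_yon])

lemma span_cell: "cellset A M S ==> (X, m, p) : S ==> p : span A M X S m"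
 using span_gen[of X S X m p "ident A X" 0 m] act_ident[of X p m] ident_closed[of X]
 by (auto simp: cellset_def)

end

section \<open>Merging the cells of one degree\<close>

context pairing
begin

text \<open>The error allowed when cells of degree \<open>e\<close> are merged: combinations of
  cells of degree above \<open>e\<close>, plus differentials of combinations of cells of degree at
  least \<open>e\<close>. The latter are needed because the identities of a biproduct only hold up
  to homotopy.\<close>

definition bd :: "('o \<times> int \<times> 'p) set => int => 'c set" where
 "bd S e = {z : carrier (cpt C e). EX q:wspan (hi S (e - 1)) (e - 1). z -[cpt C e] df C (e - 1) q : wspan (hi S e) e}"

lemma bd_subgroup:
 assumes S: "cellset A P S" shows "additive_subgroup (bd S e) (cpt C e)"
proof -
 note S0 = cells_sub[OF S hi_subset]
 interpret G: agrp "cpt C e" by (rule C_ag)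
 interpret G0: agrp "cpt C (e - 1)" by (rule C_ag)
 interpret W: additive_subgroup "wspan (hi S e) e" "cpt C e" by (rule wspan_sub[OF S0])
 interpret W0: additive_subgroup "wspan (hi S (e - 1)) (e - 1)" "cpt C (e - 1)" by (rule wspan_sub[OF S0])
 note am = C_addmap'[of e]
 note aa = G0.ag G.ag am
 have mem: "z : bd S e" if "q : wspan (hi S (e - 1)) (e - 1)" "r : wspan (hi S e) e" "z = df C (e - 1) q +[cpt C e] r" for z q r
 proof -
  have c: "q .: cpt C (e - 1)" "r .: cpt C e" using that W.a_subset W0.a_subset by auto
  then have dc: "df C (e - 1) q .: cpt C e" by (intro am_cl[OF am])
  then have "z -[cpt C e] df C (e - 1) q = r"
   unfolding that(3) using c by (simp add: G.minus_eq G.a_ac G.r_neg)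
  moreover have "z .: cpt C e" unfolding that(3) using dc c by simp
  ultimately show ?thesis using that(1,2) unfolding bd_def by auto
 qed
 have ex: "EX q r. q : wspan (hi S (e - 1)) (e - 1) & r : wspan (hi S e) e & z = df C (e - 1) q +[cpt C e] r" if z: "z : bd S e" for z
 proof -
  obtain q where q: "q : wspan (hi S (e - 1)) (e - 1)" "z -[cpt C e] df C (e - 1) q : wspan (hi S e) e" "z .: cpt C e"
   using z by (auto simp: bd_def)
  have dc: "df C (e - 1) q .: cpt C e" using q W0.a_subset by (intro am_cl[OF am]) auto
  have "z = df C (e - 1) q +[cpt C e] (z -[cpt C e] df C (e - 1) q)"
   using q(3) dc by (simp add: G.minus_eq G.a_lcomm G.r_neg)
  then show ?thesis using q by blast
 qed
 show ?thesis
 proof (rule additive_subgroupI, rule G.add.subgroupI)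
  show "bd S e <= carrier (cpt C e)" by (auto simp: bd_def)
  show "bd S e ~= {}" using mem[OF W0.zero_closed W.zero_closed refl] by blast
  fix a assume "a : bd S e"
  then obtain q r where a: "q : wspan (hi S (e - 1)) (e - 1)" "r : wspan (hi S e) e" "a = df C (e - 1) q +[cpt C e] r"
   using ex by blast
  have c: "q .: cpt C (e - 1)" "r .: cpt C e" using a W.a_subset W0.a_subset by auto
  note dc = am_cl[OF am c(1)]
  show "-[cpt C e] a : bd S e"
   by (rule mem[of "-[cpt C (e - 1)] q" "-[cpt C e] r"])
   (use a c dc in \<open>auto simp: am_neg[OF aa] G.minus_add\<close>)
  fix b assume "b : bd S e"
  then obtain q' r' where b: "q' : wspan (hi S (e - 1)) (e - 1)" "r' : wspan (hi S e) e" "b = df C (e - 1) q' +[cpt C e] r'"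
   using ex by blast
  have c': "q' .: cpt C (e - 1)" "r' .: cpt C e" using b W.a_subset W0.a_subset by auto
  note dc' = am_cl[OF am c'(1)]
  show "a +[cpt C e] b : bd S e"
   by (rule mem[of "q +[cpt C (e - 1)] q'" "r +[cpt C e] r'"])
   (use a b c c' dc dc' in \<open>auto simp: am_add[OF am] G.a_ac\<close>)
 qed
qed

lemma bd_diff:
 assumes S: "cellset A P S" and q: "q : wspan (hi S (e - 1)) (e - 1)"
 shows "df C (e - 1) q : bd S e"
proof -
 note S0 = cells_sub[OF S hi_subset]
 interpret G: agrp "cpt C e" by (rule C_ag)
 interpret W: additive_subgroup "wspan (hi S e) e" "cpt C e" by (rule wspan_sub[OF S0])
 have "df C (e - 1) q .: cpt C e" using q wspan_cl[OF S0] by (intro am_cl[OF C_addmap']) auto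
 then show ?thesis using q by (auto simp: bd_def G.minus_eq G.r_neg intro!: bexI[of _ q])
qed

lemma bd_wspan:
 assumes S: "cellset A P S" and z: "z : wspan (hi S e) e"
 shows "z : bd S e"
proof -
 note S0 = cells_sub[OF S hi_subset]
 interpret G: agrp "cpt C e" by (rule C_ag)
 interpret G0: agrp "cpt C (e - 1)" by (rule C_ag)
 interpret W0: additive_subgroup "wspan (hi S (e - 1)) (e - 1)" "cpt C (e - 1)" by (rule wspan_sub[OF S0])
 have "z .: cpt C e" using z wspan_cl[OF S0] by blast
 then show ?thesis
  using z am_0[OF G0.ag G.ag C_addmap'] W0.zero_closed
  by (auto simp: bd_def G.minus_eq intro!: bexI[of _ "0[cpt C (e - 1)]"])
qed

text \<open>If \<open>\<eta>\<close> is a primitive of \<open>g\<close> and \<open>w\<close> is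
  closed, then \<open>\<eta> w\<close> is a primitive of \<open>g w\<close>. The differential of the
  product of \<open>x\<close> and \<open>\<eta> w\<close> is the product in question up to sign,
  plus a term with the differential of \<open>x\<close>, which only involves cells of degree above
  \<open>e\<close>.\<close>

lemma bd_null_homotopic:
 assumes S: "cellset A P S" and o: "F : Ob A" "Y : Ob A"
  and x: "x : span A P F (hi S (e - 1)) e" "df (val P F) e x : span A P F (hi S e) (e + 1)"
  and g: "g : cobd (Hom A Y F) 0" and w: "w : cocycles (V Y) 0"
 shows "pr F e 0 x (la Y F 0 0 g w) : bd S e"
proof -
 note S0 = cells_sub[OF S hi_subset]
 interpret G: agrp "cpt C e" by (rule C_ag)
 interpret B: additive_subgroup "bd S e" "cpt C e" by (rule bd_subgroup[OF S])
 obtain \<eta> where eta: "\<eta> .: dhom A Y F (-1)" "g = df (Hom A Y F) (-1) \<eta>"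
  by (rule coboundariesE[OF g]) auto
 have wc: "w .: cpt (V Y) 0" "df (V Y) 0 w = 0[cpt (V Y) 1]" using w by (auto simp: cocycles_def)
 have xc: "x .: vcpt P F e" by (rule span_carrier[OF o(1) S0 x(1)])
 define u where "u = la Y F (-1) 0 \<eta> w"
 have u: "u .: cpt (V F) (-1)" unfolding u_def by (rule L.la_cl[OF o(2,1) eta(1) wc(1)]) simp
 have gc: "g .: dhom A Y F 0" unfolding eta(2) by (rule acx_cl[OF hom_acx[OF o(2,1)] eta(1)]) simp
 have gw: "la Y F 0 0 g w .: cpt (V F) 0" by (rule L.la_cl[OF o(2,1) gc wc(1)]) simp
 have "df (V F) (-1) u = la Y F 0 0 g w +[cpt (V F) 0] sg (cpt (V F) 0) (-1) (la Y F (-1) 1 \<eta> (df (V Y) 0 w))"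
  unfolding u_def eta(2) by (rule L.la_leibniz'[OF o(2,1) eta(1) wc(1)]) auto
 also have "la Y F (-1) 1 \<eta> (df (V Y) 0 w) = 0[cpt (V F) 0]"
  unfolding wc(2) by (rule am_0[OF L.lval_ag[OF o(2)] L.lval_ag[OF o(1)] L.la_am_r[OF o(2,1) eta(1)]]) simp
 finally have du: "df (V F) (-1) u = la Y F 0 0 g w"
  using gw L.lval_ag[OF o(1), of 0] by (simp add: agrp.sg_0 agrp_def abelian_group_def abelian_monoid.r_zero)
 have q: "pr F e (-1) x u : wspan (hi S (e - 1)) (e - 1)" by (rule span_pr[OF S0 x(1) o(1) u]) simp
 have dx: "pr F (e + 1) (-1) (df (val P F) e x) u : wspan (hi S e) e"
  by (rule span_pr[OF S0 x(2) o(1) u]) simp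
 have pc: "pr F e 0 x (la Y F 0 0 g w) .: cpt C e" by (rule pr_cl[OF o(1) xc gw]) simp
 have "df C (e - 1) (pr F e (-1) x u) = pr F (e + 1) (-1) (df (val P F) e x) u +[cpt C e]
   sg (cpt C e) e (pr F e 0 x (df (V F) (-1) u))"
  by (rule pr_leibniz[OF o(1) xc u]) auto
 then have "sg (cpt C e) e (pr F e 0 x (la Y F 0 0 g w))
   = -[cpt C e] pr F (e + 1) (-1) (df (val P F) e x) u +[cpt C e] df C (e - 1) (pr F e (-1) x u)"
  unfolding du using wspan_cl[OF S0 dx] pc by (simp add: G.r_neg1)
 also have "... : bd S e" using bd_wspan[OF S dx] bd_diff[OF S q] by simp
 finally show ?thesis by (simp add: asub_sg[OF G.ag B.additive_subgroup_axioms pc])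
qed

lemma bd_homotopic:
 assumes S: "cellset A P S" and o: "F : Ob A" "Y : Ob A"
  and x: "x : span A P F (hi S (e - 1)) e" "df (val P F) e x : span A P F (hi S e) (e + 1)"
  and g: "g .: dhom A Y F 0" "g' .: dhom A Y F 0" "h0_eq A Y F g g'" and w: "w : cocycles (V Y) 0"
 shows "pr F e 0 x (la Y F 0 0 g w) -[cpt C e] pr F e 0 x (la Y F 0 0 g' w) : bd S e"
proof -
 note S0 = cells_sub[OF S hi_subset]
 have wc: "w .: cpt (V Y) 0" using w by (auto simp: cocycles_def)
 have xc: "x .: vcpt P F e" by (rule span_carrier[OF o(1) S0 x(1)])
 have am: "amap (dhom A Y F 0) (cpt (V F) 0) (%g. la Y F 0 0 g w)" by (rule L.la_am_l[OF o(2,1) wc]) simp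
 have am2: "amap (cpt (V F) 0) (cpt C e) (pr F e 0 x)" by (rule pr_am_r[OF o(1) xc]) simp
 have "pr F e 0 x (la Y F 0 0 (g -[dhom A Y F 0] g') w) : bd S e"
  using g by (intro bd_null_homotopic[OF S o x _ w]) (simp add: h0_eq_def)
 then show ?thesis
  by (simp add: am_minus[OF hom_ag[OF o(2,1)] L.lval_ag[OF o(1)] am g(1,2)]
   am_minus[OF L.lval_ag[OF o(1)] C_ag am2 am_cl[OF am g(1)] am_cl[OF am g(2)]])
qed

text \<open>Cells of one degree are merged into a single one, along a biproduct of their objects. The
 last clause records that \<open>w\<close> is a combination of the coordinates of \<open>z\<close>.\<close>

lemma merge:
 assumes add: "additive_dgcat A" and nc: "normal_cells R A P S" and I: "I <= {c : S. deg c = e}"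
  and z: "z : wspan (I \<union> hi S e) e" "df C e z : wspan (hi S e) (e + 1)"
 shows "EX F x w. F : Ob A & x : span A P F (hi S (e - 1)) e & df (val P F) e x : span A P F (hi S e) (e + 1) &
  w : cocycles (V F) 0 & z -[cpt C e] pr F e 0 x w : bd S e &
  (ALL G. (ALL Y:Ob A. additive_subgroup (G Y) (cpt (V Y) 0)) -->
   (ALL Y:Ob A. ALL Z:Ob A. ALL f:Z0 A Y Z. ALL u:G Y. la Y Z 0 0 f u : G Z) -->
   (ALL (X, m, p):I. ALL y:cocycles (V X) 0. z -[cpt C e] pr X e 0 p y : wspan (S - {(X, m, p)}) e --> y : G X) -->
   w : G F)"
proof -
 have fin: "finite S" and S: "cellset A P S"
  and dual: "!!s. s : S ==> EX c. dual R A P (S - {s}) s c"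
  and dn: "!!X m p. (X, m, p) : S ==> df (val P X) m p : span A P X (hi S m) (m + 1)"
  using nc by (auto simp: normal_cells_def)
 note S0 = cells_sub[OF S hi_subset]
 interpret G: agrp "cpt C e" by (rule C_ag)
 interpret H: agrp "cpt C (e + 1)" by (rule C_ag)
 interpret B: additive_subgroup "bd S e" "cpt C e" by (rule bd_subgroup[OF S])
 have fI: "finite I" using I fin by (auto intro: finite_subset)
 show ?thesis using fI I z
 proof (induction I arbitrary: z)
  case empty
  \<comment> \<open>Nothing is to be merged, and zero data over an arbitrary object serve;
    additivity supplies the object.\<close>
  obtain F where F: "F : Ob A" using add by (auto simp: additive_dgcat_def h0_zero_object_def)
  interpret GP: agrp "vcpt P F e" by (rule val_ag[OF F])
  interpret GV: agrp "cpt (V F) 0" by (rule L.lval_ag[OF F])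
  interpret GV1: agrp "cpt (V F) 1" by (rule L.lval_ag[OF F])
  let ?x = "0[vcpt P F e]" and ?w = "0[cpt (V F) 0]"
  have "?x : span A P F (hi S (e - 1)) e"
   by (rule additive_subgroup.zero_closed[OF span_sub[OF F S0]])
  moreover have "df (val P F) e ?x = 0[vcpt P F (e + 1)]"
   by (rule am_0[OF GP.ag val_ag[OF F] acxD(2)[OF val_acx[OF F]]])
  moreover have "0[vcpt P F (e + 1)] : span A P F (hi S e) (e + 1)"
   by (rule additive_subgroup.zero_closed[OF span_sub[OF F S0]])
  moreover have "?w : cocycles (V F) 0"
   by (rule additive_subgroup.zero_closed[OF cocycles_subgroup[OF L.lv_acx[OF F]]])
  moreover have "pr F e 0 ?x ?w = 0[cpt C e]"
   by (rule am_0[OF GV.ag G.ag pr_am_r[OF F]]) auto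
  moreover have "z -[cpt C e] 0[cpt C e] = z"
   using empty wspan_cl[OF S0] by (simp add: G.minus_eq)
  moreover have "z : bd S e" using empty bd_wspan[OF S] by simp
  ultimately show ?case using F
   by (intro exI[of _ F] exI[of _ ?x] exI[of _ ?w]) (auto intro: additive_subgroup.zero_closed)
 next
  case (insert c I)
  obtain X p where c: "c = (X, e, p)" using insert(4) by (cases c) auto
  have cS: "(X, e, p) : S" using insert(4) c by auto
  have oX: "X : Ob A" and pc: "p .: vcpt P X e" using S cS by (auto simp: cellset_def)
  have IS: "cellset A P (I \<union> hi S e)" "cellset A P (insert (X, e, p) (I \<union> hi S e))" "cellset A P (S - {c})"
   using S insert(4) cS by (auto simp: cellset_def hi_def)
  have "z : wspan (insert (X, e, p) (I \<union> hi S e)) e" using insert(5) c by simp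
  then obtain v y where v: "v : wspan (I \<union> hi S e) e" and y: "y .: cpt (V X) 0"
   and z: "z = v +[cpt C e] pr X e 0 p y"
   using wspan_insert[OF IS(2)] by fastforce
  have vc: "v .: cpt C e" by (rule wspan_cl[OF IS(1) v])
  have py: "pr X e 0 p y .: cpt C e" by (rule pr_cl[OF oX pc y]) simp
  have sub: "I \<union> hi S e <= S - {c}" using insert(2,4) c by (auto simp: hi_def)
  have dv': "df C e v : wspan (S - {c}) (e + 1)"
  proof (rule wspan_diff[OF IS(1) sub IS(3) _ v])
   fix X' m p' assume "(X', m, p') : I \<union> hi S e"
   then have "(X', m, p') : S" "e <= m" using insert(4) by (auto simp: hi_def)
   moreover then have "hi S m <= S - {c}" using c by (auto simp: hi_def)
   ultimately show "df (val P X') m p' : span A P X' (S - {c}) (m + 1)"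
   using dn span_mono by blast
  qed
  have dy: "df (V X) 0 y .: cpt (V X) 1" by (rule acx_cl[OF L.lv_acx[OF oX] y]) simp
  have dpy: "pr X (e + 1) 0 (df (val P X) e p) y : wspan (hi S e) (e + 1)"
   by (rule span_pr[OF S0 dn[OF cS] oX y]) simp
  have pdy: "pr X e 1 p (df (V X) 0 y) .: cpt C (e + 1)" by (rule pr_cl[OF oX pc dy]) simp
  have dpyc: "pr X (e + 1) 0 (df (val P X) e p) y .: cpt C (e + 1)" by (rule wspan_cl[OF S0 dpy])
  have dz: "df C e z = df C e v +[cpt C (e + 1)] (pr X (e + 1) 0 (df (val P X) e p) y +[cpt C (e + 1)]
   sg (cpt C (e + 1)) e (pr X e 1 p (df (V X) 0 y)))"
   unfolding z am_add[OF C_addmap vc py] using pr_leibniz[OF oX pc y, of e "e + 1" "e + 1" 1] by simp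
  interpret W1: additive_subgroup "wspan (S - {c}) (e + 1)" "cpt C (e + 1)" by (rule wspan_sub[OF IS(3)])
  interpret W2: additive_subgroup "wspan (hi S e) (e + 1)" "cpt C (e + 1)" by (rule wspan_sub[OF S0])
  have hsub: "wspan (hi S e) (e + 1) <= wspan (S - {c}) (e + 1)" by (rule wspan_mono) (use sub in auto)
  have dvc: "df C e v .: cpt C (e + 1)" by (rule am_cl[OF C_addmap vc])
  have "sg (cpt C (e + 1)) e (pr X e 1 p (df (V X) 0 y))
   = -[cpt C (e + 1)] pr X (e + 1) 0 (df (val P X) e p) y +[cpt C (e + 1)] (\<ominus>\<^bsub>cpt C (e + 1)\<^esub> df C e v +[cpt C (e + 1)] df C e z)"
   unfolding dz using dvc dpyc pdy by (simp add: H.r_neg1)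
  also have "... : wspan (S - {c}) (e + 1)" using dv' dpy insert(6) hsub by (auto intro!: W1.a_closed)
  finally have "pr X e 1 p (df (V X) 0 y) : wspan (S - {c}) (e + 1)"
   by (simp add: asub_sg[OF H.ag W1.additive_subgroup_axioms pdy])
  moreover obtain cc where "dual R A P (S - {c}) (X, e, p) cc" using dual[OF cS] c by auto
  \<comment> \<open>All other summands of the differential of \<open>z\<close> avoid the cell
    \<open>c\<close>, so its dual functional forces the differential of the coefficient
    \<open>y\<close> to vanish. Only closed coefficients can be transported along
    homotopies.\<close>
  ultimately have dy0: "df (V X) 0 y = 0[cpt (V X) 1]"
   using pr_inj[OF _ IS(3) pc dy] by simp
  have yZ: "y : cocycles (V X) 0" using y dy0 by (simp add: cocycles_def)
  have "pr X e 1 p 0[cpt (V X) 1] = 0[cpt C (e + 1)]"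
   by (rule am_0[OF L.lval_ag[OF oX] H.ag pr_am_r[OF oX pc]]) simp
  then have "df C e v = df C e z -[cpt C (e + 1)] pr X (e + 1) 0 (df (val P X) e p) y"
   unfolding dz dy0 using dvc dpyc by (simp add: H.minus_eq H.a_assoc H.r_neg)
  also have "... : wspan (hi S e) (e + 1)" using insert(6) dpy by (simp add: H.minus_eq)
  finally have dv: "df C e v : wspan (hi S e) (e + 1)" .
  obtain F x w where F: "F : Ob A" and x: "x : span A P F (hi S (e - 1)) e" "df (val P F) e x : span A P F (hi S e) (e + 1)"
   and w: "w : cocycles (V F) 0" and vx: "v -[cpt C e] pr F e 0 x w : bd S e"
   and coord: "!!G. (ALL Y:Ob A. additive_subgroup (G Y) (cpt (V Y) 0)) ==>
   (ALL Y:Ob A. ALL Z:Ob A. ALL f:Z0 A Y Z. ALL u:G Y. la Y Z 0 0 f u : G Z) ==>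
   (ALL (X, m, p):I. ALL y:cocycles (V X) 0. v -[cpt C e] pr X e 0 p y : wspan (S - {(X, m, p)}) e --> y : G X) ==>
   w : G F"
  proof -
   have "I <= {c : S. deg c = e}" using insert(4) by blast
   from insert.IH[OF this v dv] show ?thesis using that by blast
  qed
  obtain E i j r s where E: "E : Ob A" and i: "i : Z0 A F E" and j: "j : Z0 A X E" and r: "r : Z0 A E F" and s: "s : Z0 A E X"
   and ri: "h0_eq A F F (cmp A F E F 0 0 r i) (ident A F)" and sj: "h0_eq A X X (cmp A X E X 0 0 s j) (ident A X)"
   and rj: "h0_eq A X F (cmp A X E F 0 0 r j) 0[dhom A X F 0]"
   and si: "h0_eq A F X (cmp A F E X 0 0 s i) 0[dhom A F X 0]"
  proof -
   obtain E i j r s where "h0_biproduct A F X E i j r s"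
   using add F oX unfolding additive_dgcat_def by blast
   then show ?thesis using that unfolding h0_biproduct_def by blast
  qed
  have ic: "i .: dhom A F E 0" "j .: dhom A X E 0" "r .: dhom A E F 0" "s .: dhom A E X 0"
   and id0: "df (Hom A F E) 0 i = 0[dhom A F E 1]" "df (Hom A X E) 0 j = 0[dhom A X E 1]"
   "df (Hom A E F) 0 r = 0[dhom A E F 1]" "df (Hom A E X) 0 s = 0[dhom A E X 1]"
   using i j r s by (auto simp: cocycles_def)
  have wc: "w .: cpt (V F) 0" and dw: "df (V F) 0 w = 0[cpt (V F) 1]" using w by (auto simp: cocycles_def)
  have xc: "x .: vcpt P F e" by (rule span_carrier[OF F S0 x(1)])
  have ceh: "(X, e, p) : hi S (e - 1)" using cS by (simp add: hi_def)
  have px: "p : span A P X (hi S (e - 1)) e" by (rule span_cell[OF S0 ceh])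
  note dp = dn[OF cS]
  \<comment> \<open>A row over the biproduct, built with the projections, and a column, built with
    the injections. Their product has four terms, through \<open>r i\<close>, \<open>r j\<close>,
    \<open>s i\<close> and \<open>s j\<close>.\<close>
  define x' where "x' = act P E F e 0 x r +[vcpt P E e] act P E X e 0 p s"
  define w' where "w' = la F E 0 0 i w +[cpt (V E) 0] la X E 0 0 j y"
  interpret E0: agrp "vcpt P E e" by (rule val_ag[OF E])
  interpret E1: agrp "vcpt P E (e + 1)" by (rule val_ag[OF E])
  interpret VE: agrp "cpt (V E) 0" by (rule L.lval_ag[OF E])
  interpret SE: additive_subgroup "span A P E (hi S (e - 1)) e" "vcpt P E e" by (rule span_sub[OF E S0])
  interpret SE1: additive_subgroup "span A P E (hi S e) (e + 1)" "vcpt P E (e + 1)" by (rule span_sub[OF E S0])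
  interpret ZE: additive_subgroup "cocycles (V E) 0" "cpt (V E) 0" by (rule cocycles_subgroup[OF L.lv_acx[OF E]])
  have xr: "act P E F e 0 x r : span A P E (hi S (e - 1)) e" by (rule span_act[OF S0 x(1) F E ic(3)]) simp
  have ps: "act P E X e 0 p s : span A P E (hi S (e - 1)) e" by (rule span_act[OF S0 px oX E ic(4)]) simp
  have x'1: "x' : span A P E (hi S (e - 1)) e" unfolding x'_def by (rule SE.a_closed[OF xr ps])
  have xrc: "act P E F e 0 x r .: vcpt P E e" and psc: "act P E X e 0 p s .: vcpt P E e"
   using xr ps SE.a_subset by auto
  have closed_act: "df (val P E) e (act P E Z e 0 u f) = act P E Z (e + 1) 0 (df (val P Z) e u) f"
   if "Z : Ob A" "u .: vcpt P Z e" "f .: dhom A E Z 0" "df (Hom A E Z) 0 f = 0[dhom A E Z 1]" for Z u f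
  proof -
   have du: "df (val P Z) e u .: vcpt P Z (e + 1)" by (rule acx_cl[OF val_acx[OF that(1)] that(2) refl])
   have "df (val P E) e (act P E Z e 0 u f) = act P E Z (e + 1) 0 (df (val P Z) e u) f +[vcpt P E (e + 1)]
   sg (vcpt P E (e + 1)) e (act P E Z e 1 u (df (Hom A E Z) 0 f))"
   by (rule act_leibniz'[OF E that(1-3)]) auto
   also have "act P E Z e 1 u (df (Hom A E Z) 0 f) = 0[vcpt P E (e + 1)]"
   unfolding that(4) by (rule am_0[OF hom_ag[OF E that(1)] E1.ag act_am_r[OF E that(1,2)]]) simp
   finally show ?thesis using act_cl[OF E that(1) du that(3), of "e + 1"] by simp
  qed
  have "df (val P E) e x' = act P E F (e + 1) 0 (df (val P F) e x) r +[vcpt P E (e + 1)]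
   act P E X (e + 1) 0 (df (val P X) e p) s"
   unfolding x'_def am_add[OF acxD(2)[OF val_acx[OF E]] xrc psc]
   using closed_act[OF F xc ic(3) id0(3)] closed_act[OF oX pc ic(4) id0(4)] by simp
  moreover have "act P E F (e + 1) 0 (df (val P F) e x) r : span A P E (hi S e) (e + 1)"
   by (rule span_act[OF S0 x(2) F E ic(3)]) simp
  moreover have "act P E X (e + 1) 0 (df (val P X) e p) s : span A P E (hi S e) (e + 1)"
   by (rule span_act[OF S0 dp oX E ic(4)]) simp
  ultimately have x'2: "df (val P E) e x' : span A P E (hi S e) (e + 1)" by simp
  have closed_la: "la Z E 0 0 f u : cocycles (V E) 0"
   if "Z : Ob A" "u : cocycles (V Z) 0" "f : Z0 A Z E" for Z u f
  proof -
   have uc: "u .: cpt (V Z) 0" "df (V Z) 0 u = 0[cpt (V Z) 1]"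
   and fc: "f .: dhom A Z E 0" "df (Hom A Z E) 0 f = 0[dhom A Z E 1]"
   using that by (auto simp: cocycles_def)
   interpret V1: agrp "cpt (V E) 1" by (rule L.lval_ag[OF E])
   have "df (V E) 0 (la Z E 0 0 f u) = la Z E 1 0 (df (Hom A Z E) 0 f) u +[cpt (V E) 1]
   sg (cpt (V E) 1) 0 (la Z E 0 1 f (df (V Z) 0 u))"
   by (rule L.la_leibniz'[OF that(1) E fc(1) uc(1)]) auto
   also have "la Z E 1 0 (df (Hom A Z E) 0 f) u = 0[cpt (V E) 1]"
   unfolding fc(2) by (rule am_0[OF hom_ag[OF that(1) E] V1.ag L.la_am_l[OF that(1) E uc(1)]]) simp
   also have "la Z E 0 1 f (df (V Z) 0 u) = 0[cpt (V E) 1]"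
   unfolding uc(2) by (rule am_0[OF L.lval_ag[OF that(1)] V1.ag L.la_am_r[OF that(1) E fc(1)]]) simp
   also have "0[cpt (V E) 1] +[cpt (V E) 1] sg (cpt (V E) 1) 0 0[cpt (V E) 1] = 0[cpt (V E) 1]"
   by simp
   finally have "df (V E) 0 (la Z E 0 0 f u) = 0[cpt (V E) 1]" .
   moreover have "la Z E 0 0 f u .: cpt (V E) 0"
   by (rule L.la_cl[OF that(1) E fc(1) uc(1)]) simp
   ultimately show ?thesis unfolding cocycles_def by simp
  qed
  have iw: "la F E 0 0 i w : cocycles (V E) 0" by (rule closed_la[OF F w i])
  have jy: "la X E 0 0 j y : cocycles (V E) 0" by (rule closed_la[OF oX yZ j])
  have w'1: "w' : cocycles (V E) 0" unfolding w'_def by (rule ZE.a_closed[OF iw jy])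
  have iwc: "la F E 0 0 i w .: cpt (V E) 0" and jyc: "la X E 0 0 j y .: cpt (V E) 0"
   using iw jy ZE.a_subset by auto
  have tm: "pr E e 0 (act P E Z e 0 u f) (la Y E 0 0 g t) = pr Z e 0 u (la Y Z 0 0 (cmp A Y E Z 0 0 f g) t)"
   if "Z : Ob A" "Y : Ob A" "u .: vcpt P Z e" "t .: cpt (V Y) 0"
   "f .: dhom A E Z 0" "g .: dhom A Y E 0" for Z Y u t f g
  proof -
   have gt: "la Y E 0 0 g t .: cpt (V E) 0" by (rule L.la_cl[OF that(2) E that(6,4)]) simp
   have "pr E e 0 (act P E Z e 0 u f) (la Y E 0 0 g t) = pr Z e 0 u (la E Z 0 0 f (la Y E 0 0 g t))"
   by (rule pr_balanced[OF E that(1,3,5) gt]) auto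
   also have "la E Z 0 0 f (la Y E 0 0 g t) = la Y Z 0 0 (cmp A Y E Z 0 0 f g) t"
   by (rule L.la_comp'[OF that(2) E that(1,5,6,4), symmetric]) auto
   finally show ?thesis .
  qed
  have cc: "cmp A Y E Z 0 0 f g .: dhom A Y Z 0"
   if "Z : Ob A" "Y : Ob A" "f .: dhom A E Z 0" "g .: dhom A Y E 0" for Z Y f g
   by (rule cmp_cl[OF that(2) E that(1,3,4)]) simp
  have zero_la: "pr Z e 0 u (la Y Z 0 0 0[dhom A Y Z 0] t) = 0[cpt C e]"
   if "Z : Ob A" "Y : Ob A" "u .: vcpt P Z e" "t .: cpt (V Y) 0" for Z Y u t
  proof -
   have "la Y Z 0 0 0[dhom A Y Z 0] t = 0[cpt (V Z) 0]"
   by (rule am_0[OF hom_ag[OF that(2,1)] L.lval_ag[OF that(1)] L.la_am_l[OF that(2,1,4)]]) simp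
   moreover have "pr Z e 0 u 0[cpt (V Z) 0] = 0[cpt C e]"
   by (rule am_0[OF L.lval_ag[OF that(1)] G.ag pr_am_r[OF that(1,3)]]) simp
   ultimately show ?thesis by simp
  qed
  \<comment> \<open>The diagonal terms \<open>t1\<close> and \<open>t4\<close> agree modulo
    \<open>bd\<close> with the two products to be merged; the off-diagonal terms \<open>t2\<close>
    and \<open>t3\<close> lie in \<open>bd\<close>.\<close>
  define t1 where "t1 = pr E e 0 (act P E F e 0 x r) (la F E 0 0 i w)"
  define t2 where "t2 = pr E e 0 (act P E F e 0 x r) (la X E 0 0 j y)"
  define t3 where "t3 = pr E e 0 (act P E X e 0 p s) (la F E 0 0 i w)"
  define t4 where "t4 = pr E e 0 (act P E X e 0 p s) (la X E 0 0 j y)"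
  have tc: "t1 .: cpt C e" "t2 .: cpt C e" "t3 .: cpt C e" "t4 .: cpt C e"
   unfolding t1_def t2_def t3_def t4_def using xrc psc iwc jyc E by (auto intro!: pr_cl)
  have xw: "pr F e 0 x w .: cpt C e" by (rule pr_cl[OF F xc wc]) simp
  have b1: "t1 -[cpt C e] pr F e 0 x w : bd S e"
   using bd_homotopic[OF S F F x cc[OF F F ic(3,1)] ident_closed[OF F] ri w] tm[OF F F xc wc ic(3,1)] L.la_ident[OF F wc]
   by (simp add: t1_def)
  have b2: "t2 : bd S e"
   using bd_homotopic[OF S F oX x cc[OF F oX ic(3,2)] _ rj yZ] tm[OF F oX xc y ic(3,2)] zero_la[OF F oX xc y] tc(2)
   abelian_monoid.zero_closed[of "dhom A X F 0"] hom_ag[OF oX F, of 0]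
   by (simp add: t2_def[symmetric] agrp_def abelian_group_def G.minus_eq)
  have b3: "t3 : bd S e"
   using bd_homotopic[OF S oX F px dp cc[OF oX F ic(4,1)] _ si w] tm[OF oX F pc wc ic(4,1)] zero_la[OF oX F pc wc] tc(3)
   abelian_monoid.zero_closed[of "dhom A F X 0"] hom_ag[OF F oX, of 0]
   by (simp add: t3_def[symmetric] agrp_def abelian_group_def G.minus_eq)
  have b4: "t4 -[cpt C e] pr X e 0 p y : bd S e"
   using bd_homotopic[OF S oX oX px dp cc[OF oX oX ic(4,2)] ident_closed[OF oX] sj yZ] tm[OF oX oX pc y ic(4,2)] L.la_ident[OF oX y]
   by (simp add: t4_def)
  have "pr E e 0 x' w' = (t1 +[cpt C e] t3) +[cpt C e] (t2 +[cpt C e] t4)"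
   unfolding t1_def t2_def t3_def t4_def x'_def w'_def
   using xrc psc iwc jyc E VE.a_closed[OF iwc jyc] by (simp add: pr_add_left pr_add_right)
  then have "z -[cpt C e] pr E e 0 x' w' = (v -[cpt C e] pr F e 0 x w) +[cpt C e]
   (\<ominus>\<^bsub>cpt C e\<^esub> (t1 -[cpt C e] pr F e 0 x w) +[cpt C e] (\<ominus>\<^bsub>cpt C e\<^esub> t2 +[cpt C e] (\<ominus>\<^bsub>cpt C e\<^esub> t3 +[cpt C e]
   -[cpt C e] (t4 -[cpt C e] pr X e 0 p y))))"
   unfolding z using vc py xw tc
   by (simp add: G.minus_eq G.minus_add G.a_ac G.r_neg1 G.r_neg2 G.add_neg_cancel)
  also have "... : bd S e" using vx b1 b2 b3 b4 by simp
  finally have zz: "z -[cpt C e] pr E e 0 x' w' : bd S e" .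
  \<comment> \<open>\<open>w'\<close> arises from \<open>w\<close> and \<open>y\<close> by closed
    morphisms, under which \<open>G\<close> is stable. For the cells of \<open>I\<close> the test on
    \<open>z\<close> is implied by that on \<open>v\<close>, because the two differ by a multiple of
    the other cell \<open>p\<close>.\<close>
  have co: "w' : G E" if G: "ALL Y:Ob A. additive_subgroup (G Y) (cpt (V Y) 0)"
   "ALL Y:Ob A. ALL Z:Ob A. ALL f:Z0 A Y Z. ALL u:G Y. la Y Z 0 0 f u : G Z"
   "ALL (X, m, p):insert c I. ALL y:cocycles (V X) 0. z -[cpt C e] pr X e 0 p y : wspan (S - {(X, m, p)}) e --> y : G X" for G
  proof -
   have vS: "v : wspan (S - {c}) e" using v wspan_mono[OF sub] by blast
   have "z -[cpt C e] pr X e 0 p y = v" unfolding z using vc py by (simp add: G.minus_eq G.a_assoc G.r_neg)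
   then have yG: "y : G X" using G(3) yZ vS c by auto
   have "w : G F"
   proof (rule coord[OF G(1,2)], clarify)
   fix X' m p' y' assume c': "(X', m, p') : I" and y': "y' : cocycles (V X') 0"
   and vv: "v -[cpt C e] pr X' e 0 p' y' : wspan (S - {(X', m, p')}) e"
   have me: "m = e" and cS': "(X', e, p') : S" using c' insert(4) by auto
   have ne: "(X', m, p') ~= c" using c' insert(2) by auto
   have o': "X' : Ob A" "p' .: vcpt P X' e" using S cS' by (auto simp: cellset_def)
   have cs': "cellset A P (S - {(X', m, p')})" by (rule cells_sub[OF S]) auto
   interpret W': additive_subgroup "wspan (S - {(X', m, p')}) e" "cpt C e" by (rule wspan_sub[OF cs'])
   have py': "pr X' e 0 p' y' .: cpt C e" using o' y' by (auto intro!: pr_cl simp: cocycles_def)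
   have pyw: "pr X e 0 p y : wspan (S - {(X', m, p')}) e"
   using cS ne c by (intro wspan_gen[OF cs' _ y]) auto
   have "z -[cpt C e] pr X' e 0 p' y' = (v -[cpt C e] pr X' e 0 p' y') +[cpt C e] pr X e 0 p y"
   unfolding z using vc py py' by (simp add: G.minus_eq G.a_ac)
   also have "... : wspan (S - {(X', m, p')}) e" using vv pyw by simp
   finally show "y' : G X'" using G(3) c' y' by auto
   qed
   then have "la F E 0 0 i w : G E" using G(2) F E i by blast
   moreover have "la X E 0 0 j y : G E" using G(2) oX E j yG by blast
   ultimately show ?thesis unfolding w'_def using G(1) E by (metis additive_subgroup.a_closed)
  qed
  show ?case
   by (intro exI[of _ E] exI[of _ x'] exI[of _ w'] conjI allI impI E x'1 x'2 w'1 zz) (rule co)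
 qed
qed

end

text \<open>A functional \<open>c\<close> lifts by sending \<open>x \<otimes> y\<close> to the
  action of \<open>c x\<close> on \<open>y\<close>; this is balanced because \<open>c\<close> is
  \<open>A\<close>-linear.\<close>

lemma (in tensor_pair) pairing_tensor:
 "pairing R A M (val N) (lact N) Ten (%X i j x y. tens (i + j) X i x y)"
proof unfold_locales
 show "acx Ten" by (rule Ten_acx)
next
 fix X x i y j assume "X : Ob A" "x .: vcpt M X i" "y .: vcpt N X j"
 then show "tens (i + j) X i x y .: cpt Ten (i + j)" by (intro tens_closed) auto
next
 fix X x i x' y j
 assume "X : Ob A" "x .: vcpt M X i" "x' .: vcpt M X i" "y .: vcpt N X j"
 then show "tens (i + j) X i (x +[vcpt M X i] x') y = tens (i + j) X i x y +[cpt Ten (i + j)] tens (i + j) X i x' y"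
  by (intro tens_add_left) auto
next
 fix X x i y j y'
 assume "X : Ob A" "x .: vcpt M X i" "y .: vcpt N X j" "y' .: vcpt N X j"
 then show "tens (i + j) X i x (y +[vcpt N X j] y') = tens (i + j) X i x y +[cpt Ten (i + j)] tens (i + j) X i x y'"
  using tens_add_right[of X x i y "i + j" y'] by simp
next
 fix X Y x i f j y l
 assume "X : Ob A" "Y : Ob A" "x .: vcpt M Y i" "f .: dhom A X Y j" "y .: vcpt N X l"
 then show "tens (i + j + l) X (i + j) (act M X Y i j x f) y = tens (i + (j + l)) Y i x (lact N X Y j l f y)"
  using tens_balanced[of X Y i j l "i + j + l" x f y "i + j"] by (simp add: add.assoc)
next
 fix X x i y j
 assume "X : Ob A" "x .: vcpt M X i" "y .: vcpt N X j"
 moreover have "i + 1 + j = i + j + 1" "i + (j + 1) = i + j + 1" by auto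
 ultimately show "df Ten (i + j) (tens (i + j) X i x y) = tens (i + 1 + j) X (i + 1) (df (val M X) i x) y
   +[cpt Ten (i + j + 1)] sg (cpt Ten (i + j + 1)) i (tens (i + (j + 1)) X i x (df (val N X) j y))"
  using Ten_diff[of X x i y "i + j"] by (simp only: add_diff_cancel_left')
next
 fix X m c assume c: "functional R A M X m c"
 note oX = functionalD(1)[OF c]
 have "EX h. amap (cpt Ten n) (vcpt N X (n - m)) h & (ALL Y i x y. Y : Ob A --> x .: vcpt M Y i -->
   y .: vcpt N Y (n - i) --> h (tens n Y i x y) = lact N Y X (i - m) (n - i) (c Y i x) y)" for n
 proof (rule tens_lift)
  show "Module.module R (vcpt N X (n - m))" using L.lval_module[OF oX] .
  have e: "i - m + (n - i) = n - m" for i by simp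
  have cc: "c Y i x .: dhom A Y X (i - m)" if "Y : Ob A" "x .: vcpt M Y i" for Y i x
   by (rule am_cl[OF lin_am[OF functionalD(2)[OF c that(1)]] that(2)])
  fix Y i x y assume o: "Y : Ob A" "x .: vcpt M Y i" "y .: vcpt N Y (n - i)"
  have aml: "amap (dhom A Y X (i - m)) (vcpt N X (n - m)) (%f. lact N Y X (i - m) (n - i) f y)"
   by (rule L.la_am_l[OF o(1) oX o(3)]) simp
  have amr: "amap (vcpt N Y (n - i)) (vcpt N X (n - m)) (lact N Y X (i - m) (n - i) (c Y i x))"
   by (rule L.la_am_r[OF o(1) oX cc[OF o(1,2)]]) simp
  show "lact N Y X (i - m) (n - i) (c Y i x) y .: vcpt N X (n - m)"
   by (rule am_cl[OF amr o(3)])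
  show "lact N Y X (i - m) (n - i) (c Y i (x +[vcpt M Y i] x')) y = lact N Y X (i - m) (n - i) (c Y i x) y
   +[vcpt N X (n - m)] lact N Y X (i - m) (n - i) (c Y i x') y" if "x' .: vcpt M Y i" for x'
   using am_add[OF lin_am[OF functionalD(2)[OF c o(1)]] o(2) that]
   am_add[OF aml cc[OF o(1,2)] cc[OF o(1) that]] by simp
  show "lact N Y X (i - m) (n - i) (c Y i x) (y +[vcpt N Y (n - i)] y') = lact N Y X (i - m) (n - i) (c Y i x) y
   +[vcpt N X (n - m)] lact N Y X (i - m) (n - i) (c Y i x) y'" if "y' .: vcpt N Y (n - i)" for y'
   by (rule am_add[OF amr o(3) that])
  show "lact N Y X (i - m) (n - i) (c Y i (r *[vcpt M Y i] x)) y = r *[vcpt N X (n - m)] lact N Y X (i - m) (n - i) (c Y i x) y"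
   if "r .: R" for r
   using lin_smult[OF functionalD(2)[OF c o(1)] that o(2)]
   lin_smult[OF L.la_linear_left[OF o(1) oX o(3), of "i - m"] that cc[OF o(1,2)]] unfolding e by simp
  show "lact N Y X (i - m) (n - i) (c Y i x) (r *[vcpt N Y (n - i)] y) = r *[vcpt N X (n - m)] lact N Y X (i - m) (n - i) (c Y i x) y"
   if "r .: R" for r
   using lin_smult[OF L.la_linear_right[OF o(1) oX cc[OF o(1,2)], of "n - i"] that o(3)] unfolding e by simp
 next
  fix Y Z i j l x f y
  assume o: "Y : Ob A" "Z : Ob A" "i + j + l = n" "x .: vcpt M Z i" "f .: dhom A Y Z j" "y .: vcpt N Y l"
  have cc: "c Z i x .: dhom A Z X (i - m)"
   by (rule am_cl[OF lin_am[OF functionalD(2)[OF c o(2)]] o(4)])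
  have n: "n - (i + j) = l" "n - i = j + l" using o(3) by auto
  have "lact N Y X (i + j - m) l (cmp A Y Z X (i - m) j (c Z i x) f) y = lact N Z X (i - m) (j + l) (c Z i x) (lact N Y Z j l f y)"
   by (rule L.la_comp'[OF o(1,2) oX cc o(5,6)]) auto
  then show "lact N Y X (i + j - m) (n - (i + j)) (c Y (i + j) (act M Y Z i j x f)) y
   = lact N Z X (i - m) (n - i) (c Z i x) (lact N Y Z j l f y)"
   unfolding n functionalD(3)[OF c o(1,2,4,5)] .
 qed
 then obtain h where "!!n. amap (cpt Ten n) (vcpt N X (n - m)) (h n) & (ALL Y i x y. Y : Ob A --> x .: vcpt M Y i -->
   y .: vcpt N Y (n - i) --> h n (tens n Y i x y) = lact N Y X (i - m) (n - i) (c Y i x) y)"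
  by metis
 then show "EX h. ALL n. amap (cpt Ten n) (vcpt N X (n - m)) (h n) &
   (ALL Y i j x y. Y : Ob A --> x .: vcpt M Y i --> y .: vcpt N Y j --> n = i + j -->
   h n (tens (i + j) Y i x y) = lact N Y X (i - m) j (c Y i x) y)"
  by (intro exI[of _ h]) auto
qed

section \<open>The dual of a twisted complex\<close>

lemma linear_map_tuple:
 assumes "!!k. k : I ==> linear_map R N (F k) (g k)"
 shows "linear_map R N (pm I F) (%x. %k:I. g k x)"
 by (rule linI)
  (use assms in \<open>auto simp: linear_map_def Pi_iff cong: restrict_cong\<close>)

lemma linear_map_tuple_component:
 assumes "k : I" "linear_map R (E k) N g"
 shows "linear_map R (pm I E) N (%x. g (x k))"
proof -
 have "x k .: E k" if "x .: pm I E" for x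
  using that assms(1) by auto
 then show ?thesis
  by (intro linI)
   (use assms in \<open>auto simp: am_cl[OF lin_am] am_add[OF lin_am] lin_smult
   simp del: pm_simps(1)\<close>)
qed

context twisted_right
begin

text \<open>An element of \<open>M(X)\<close> is a morphism from the representable module of
  \<open>X\<close> to \<open>M\<close>; the pairing is its composite with a morphism from
  \<open>T\<close> to \<open>X\<close>.\<close>

definition tpr :: "'o => int => int => 'u => (int => 'a) => int => 'u" where
 "tpr X i j x \<alpha> = (%k:sp T. act M T$k X i (k + j) x (\<alpha> k))"

lemma yon_right: "X : Ob A ==> twisted_right R A T (yon A X)"
 by (intro twisted_right.intro twisted_axioms dg_module_yon)

lemma dual_mem: "X : Ob A ==> \<alpha> .: cpt (rt T (yon A X)) j ==> k : sp T ==> l = k + j ==>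
 \<alpha> k .: dhom A T$k X l"
 using twisted_right.rt_mem[OF yon_right] by fastforce

lemma tpr_linear_left:
 assumes "X : Ob A" "\<alpha> .: cpt (rt T (yon A X)) j"
 shows "linear_map R (vcpt M X i) (cpt (rt T M) (i + j)) (%x. tpr X i j x \<alpha>)"
 unfolding rt_cpt tpr_def
proof (rule linear_map_tuple)
 fix k assume k: "k : sp T"
 have e: "i + (k + j) = k + (i + j)" by simp
 show "linear_map R (vcpt M X i) (vcpt M T$k (k + (i + j))) (%x. act M T$k X i (k + j) x (\<alpha> k))"
  using act_linear_left[OF tob[OF k] assms(1) dual_mem[OF assms k refl], of i] unfolding e .
qed

lemma tpr_linear_right:
 assumes "X : Ob A" "x .: vcpt M X i"
 shows "linear_map R (cpt (rt T (yon A X)) j) (cpt (rt T M) (i + j)) (%\<alpha>. tpr X i j x \<alpha>)"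
 unfolding rt_cpt tpr_def twisted_right.rt_cpt[OF yon_right[OF assms(1)]]
proof (rule linear_map_tuple, rule linear_map_tuple_component)
 fix k assume k: "k : sp T"
 have e: "i + (k + j) = k + (i + j)" by simp
 show "linear_map R (vcpt (yon A X) T$k (k + j)) (vcpt M T$k (k + (i + j))) (act M T$k X i (k + j) x)"
  using act_linear_right[OF tob[OF k] assms, of "k + j"] unfolding e by simp
qed

lemma tpr_closed: "X : Ob A ==> x .: vcpt M X i ==> \<alpha> .: cpt (rt T (yon A X)) j ==>
 tpr X i j x \<alpha> .: cpt (rt T M) (i + j)"
 by (rule am_cl[OF lin_am[OF tpr_linear_left]])

lemma rt_add: "k : sp T ==> (x +[cpt (rt T M) n] y) k = x k +[vcpt M T$k (k + n)] y k"
 by (simp add: rt_cpt)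

lemma rt_signed:
 assumes "k : sp T" "x .: cpt (rt T M) n"
 shows "sg (cpt (rt T M) n) s x k = sg (vcpt M T$k (k + n)) s (x k)"
proof (rule am_sg[OF acxD(1)[OF rt_acx] val_ag[OF tob[OF assms(1)]] _ assms(2)])
 show "amap (cpt (rt T M) n) (vcpt M T$k (k + n)) (%x. x k)"
  unfolding rt_cpt by (rule pm_eval[OF assms(1), of "%i. vcpt M T$i (i + n)"])
qed

lemma rt_ext:
 assumes "x .: cpt (rt T M) n" "y .: cpt (rt T M) n" "!!k. k : sp T ==> x k = y k"
 shows "x = y"
 using assms by (intro PiE_ext[of x "sp T" _ y]) (auto simp: rt_cpt)

text \<open>The off-diagonal part of the differential is precomposition with the structure maps of
  \<open>T\<close>. It commutes with the action on \<open>x\<close>, so only the diagonal part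
  produces two terms.\<close>

lemma tpr_leibniz:
 assumes X: "X : Ob A" and x: "x .: vcpt M X i" and \<alpha>: "\<alpha> .: cpt (rt T (yon A X)) j"
 shows "df (rt T M) (i + j) (tpr X i j x \<alpha>) = tpr X (i + 1) j (df (val M X) i x) \<alpha> +[cpt (rt T M) (i + j + 1)]
  sg (cpt (rt T M) (i + j + 1)) i (tpr X i (j + 1) x (df (rt T (yon A X)) j \<alpha>))"
proof -
 interpret Y: twisted_right R A T "yon A X" by (rule yon_right[OF X])
 interpret RT: agrp "cpt (rt T M) (i + j + 1)" by (rule acxD(1)[OF rt_acx])
 have dx: "df (val M X) i x .: vcpt M X (i + 1)" by (rule acx_cl[OF val_acx[OF X] x refl])
 have d\<alpha>: "df (rt T (yon A X)) j \<alpha> .: cpt (rt T (yon A X)) (j + 1)" by (rule acx_cl[OF Y.rt_acx \<alpha> refl])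
 have e: "i + 1 + j = i + j + 1" "i + (j + 1) = i + j + 1" by auto
 have c1: "tpr X (i + 1) j (df (val M X) i x) \<alpha> .: cpt (rt T M) (i + j + 1)"
  using tpr_closed[OF X dx \<alpha>] unfolding e .
 have c2: "tpr X i (j + 1) x (df (rt T (yon A X)) j \<alpha>) .: cpt (rt T M) (i + j + 1)"
  using tpr_closed[OF X x d\<alpha>] unfolding e .
 show ?thesis
 proof (rule rt_ext)
  show "df (rt T M) (i + j) (tpr X i j x \<alpha>) .: cpt (rt T M) (i + j + 1)"
   by (rule acx_cl[OF rt_acx tpr_closed[OF X x \<alpha>] refl])
  show "tpr X (i + 1) j (df (val M X) i x) \<alpha> +[cpt (rt T M) (i + j + 1)]
  sg (cpt (rt T M) (i + j + 1)) i (tpr X i (j + 1) x (df (rt T (yon A X)) j \<alpha>)) .: cpt (rt T M) (i + j + 1)"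
   using c1 c2 by (intro RT.a_closed RT.sg_cl)
  fix t assume t: "t : sp T"
  note ot = tob[OF t]
  let ?G = "vcpt M T$t (t + (i + j + 1))"
  interpret G: agrp ?G by (rule val_ag[OF ot])
  let ?H = "dhom A T$t X (t + (j + 1))"
  interpret H: agrp ?H by (rule hom_ag[OF ot X])
  note at = dual_mem[OF X \<alpha> t refl]
  have dat: "df (Hom A T$t X) (t + j) (\<alpha> t) .: ?H"
   by (rule acx_cl[OF hom_acx[OF ot X] at]) simp
  have ax: "amap ?H ?G (act M T$t X i (t + (j + 1)) x)" by (rule act_am_r[OF ot X x]) simp
  define u where "u k = act M T$t X i (t + (j + 1)) x
   (cmp A T$t T$k X (k + j) (t - k + 1) (\<alpha> k) (tdiff T t k))" for k
  have ca: "cmp A T$t T$k X (k + j) (t - k + 1) (\<alpha> k) (tdiff T t k) .: ?H" if k: "k : sp T" for k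
   by (rule cmp_cl[OF ot tob[OF k] X dual_mem[OF X \<alpha> k refl] td_cl[OF t k refl]]) simp
  have u: "u k .: ?G" if "k : sp T" for k unfolding u_def by (rule am_cl[OF ax ca[OF that]])
  have u': "act M T$t T$k (k + (i + j)) (t - k + 1) (tpr X i j x \<alpha> k) (tdiff T t k) = u k" if k: "k : sp T" for k
  proof -
   have "act M T$t T$k (k + (i + j)) (t - k + 1) (act M T$k X i (k + j) x (\<alpha> k)) (tdiff T t k) = u k"
   unfolding u_def by (rule act_comp'[OF ot tob[OF k] X x dual_mem[OF X \<alpha> k refl] td_cl[OF t k refl]]) auto
   then show ?thesis using k by (simp add: tpr_def)
  qed
  define p where "p = act M T$t X (i + 1) (t + j) (df (val M X) i x) (\<alpha> t)"
  define q where "q = act M T$t X i (t + (j + 1)) x (df (Hom A T$t X) (t + j) (\<alpha> t))"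
  have p: "p .: ?G" unfolding p_def by (rule act_cl[OF ot X dx at]) simp
  have q: "q .: ?G" unfolding q_def by (rule am_cl[OF ax dat])
  have 1: "df (val M T$t) (t + (i + j)) (tpr X i j x \<alpha> t) = p +[?G] sg ?G i q"
  proof -
   have "df (val M T$t) (t + (i + j)) (act M T$t X i (t + j) x (\<alpha> t)) = p +[?G] sg ?G i q"
   unfolding p_def q_def by (rule act_leibniz'[OF ot X x at]) auto
   then show ?thesis using t by (simp add: tpr_def)
  qed
  have 2: "(\<Oplus>[?G] k:sp T. sg ?G (i + j + 1)
   (act M T$t T$k (k + (i + j)) (t - k + 1) (tpr X i j x \<alpha> k) (tdiff T t k)))
   = (\<Oplus>[?G] k:sp T. sg ?G (i + j + 1) (u k))"
   using u u' by (intro G.finsum_cong') auto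
  have "df (rt T M) (i + j) (tpr X i j x \<alpha>) t = (p +[?G] sg ?G i q) +[?G] (\<Oplus>[?G] k:sp T. sg ?G (i + j + 1) (u k))"
   using rt_diff[OF t, of "i + j" "tpr X i j x \<alpha>"] unfolding 1 2 .
  moreover have "tpr X (i + 1) j (df (val M X) i x) \<alpha> t = p" using t by (simp add: tpr_def p_def)
  moreover have "tpr X i (j + 1) x (df (rt T (yon A X)) j \<alpha>) t = q +[?G] (\<Oplus>[?G] k:sp T. sg ?G (j + 1) (u k))"
  proof -
   let ?s = "%k. sg ?H (j + 1) (cmp A T$t T$k X (k + j) (t - k + 1) (\<alpha> k) (tdiff T t k))"
   have "df (rt T (yon A X)) j \<alpha> t = df (Hom A T$t X) (t + j) (\<alpha> t) +[?H] (\<Oplus>[?H] k:sp T. ?s k)"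
   using Y.rt_diff[OF t, of j \<alpha>] by simp
   then have "tpr X i (j + 1) x (df (rt T (yon A X)) j \<alpha>) t
   = act M T$t X i (t + (j + 1)) x (df (Hom A T$t X) (t + j) (\<alpha> t) +[?H] (\<Oplus>[?H] k:sp T. ?s k))"
   using t by (simp add: tpr_def)
   also have "... = q +[?G] act M T$t X i (t + (j + 1)) x (\<Oplus>[?H] k:sp T. ?s k)"
   unfolding q_def using ca by (intro am_add[OF ax dat] H.finsum_closed) auto
   also have "act M T$t X i (t + (j + 1)) x (\<Oplus>[?H] k:sp T. ?s k)
   = (\<Oplus>[?G] k:sp T. act M T$t X i (t + (j + 1)) x (?s k))"
   using ca by (intro am_finsum[OF H.ag G.ag ax]) auto
   also have "... = (\<Oplus>[?G] k:sp T. sg ?G (j + 1) (u k))"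
   using u am_sg[OF H.ag G.ag ax ca] by (intro G.finsum_cong') (auto simp: u_def)
   finally show ?thesis .
  qed
  moreover have "sg ?G i (q +[?G] (\<Oplus>[?G] k:sp T. sg ?G (j + 1) (u k)))
   = sg ?G i q +[?G] (\<Oplus>[?G] k:sp T. sg ?G (i + j + 1) (u k))"
  proof -
   have "sg ?G i (\<Oplus>[?G] k:sp T. sg ?G (j + 1) (u k)) = (\<Oplus>[?G] k:sp T. sg ?G i (sg ?G (j + 1) (u k)))"
   using u by (intro sg_finsum[OF G.ag]) auto
   also have "... = (\<Oplus>[?G] k:sp T. sg ?G (i + j + 1) (u k))"
   using u by (intro G.finsum_cong') (auto simp: G.sg_sg e)
   finally show ?thesis using q u by (subst G.sg_add) (auto intro!: G.finsum_closed)
  qed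
  ultimately show "df (rt T M) (i + j) (tpr X i j x \<alpha>) t = (tpr X (i + 1) j (df (val M X) i x) \<alpha> +[cpt (rt T M) (i + j + 1)]
  sg (cpt (rt T M) (i + j + 1)) i (tpr X i (j + 1) x (df (rt T (yon A X)) j \<alpha>))) t"
   using p q u by (simp add: rt_add[OF t] rt_signed[OF t c2] G.a_assoc G.finsum_closed Pi_iff)
 qed
qed

lemma tpr_comp:
 assumes "X : Ob A" "Y : Ob A" "x .: vcpt M Y i" "f .: dhom A X Y j" "\<alpha> .: cpt (rt T (yon A X)) l"
 shows "tpr X (i + j) l (act M X Y i j x f) \<alpha> = tpr Y i (j + l) x (twisted_right.tpr T (yon A Y) X j l f \<alpha>)"
 unfolding tpr_def twisted_right.tpr_def[OF yon_right[OF assms(2)]]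
proof (rule restrict_ext)
 fix k assume k: "k : sp T"
 have "act M T$k X (i + j) (k + l) (act M X Y i j x f) (\<alpha> k)
  = act M T$k Y i (k + (j + l)) x (cmp A T$k X Y j (k + l) f (\<alpha> k))"
  by (rule act_comp'[OF tob[OF k] assms(1-4) dual_mem[OF assms(1,5) k refl]]) auto
 then show "act M T$k X (i + j) (k + l) (act M X Y i j x f) (\<alpha> k) =
  act M T$k Y i (k + (j + l)) x ((%k:sp T. act (yon A Y) T$k X j (k + l) f (\<alpha> k)) k)"
  using k by simp
qed

end

definition dla :: "('o, 'k, 'a) dgcat => ('o, 'a) twisted => 'o => 'o => int => int => 'a => (int => 'a) => int => 'a" where
 "dla A T X Y j l f \<alpha> = (%k:sp T. cmp A T$k X Y j (k + l) f (\<alpha> k))"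

context twisted
begin

lemma tr_yon: "X : Ob A ==> twisted_right R A T (yon A X)"
 by (intro twisted_right.intro twisted_axioms dg_module_yon)

text \<open>Postcomposition in the dual of \<open>T\<close> is \<open>tpr\<close> for a
  representable module, so the axioms of a left module are special cases of the facts on
  \<open>tpr\<close>.\<close>

lemma dla_tpr: "Y : Ob A ==> dla A T X Y = twisted_right.tpr T (yon A Y) X"
 by (intro ext) (simp add: dla_def twisted_right.tpr_def[OF tr_yon])

lemma left_dg_dual: "left_dg R A (%X. rt T (yon A X)) (dla A T)"
proof unfold_locales
 fix X assume "X : Ob A"
 then show "cochain_complex R (rt T (yon A X))" by (rule twisted_right.rt_cochain_complex[OF tr_yon])
next
 fix X Y y l j assume "X : Ob A" "Y : Ob A" "y .: cpt (rt T (yon A X)) l"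
 then show "linear_map R (dhom A X Y j) (cpt (rt T (yon A Y)) (j + l)) (%f. dla A T X Y j l f y)"
  using twisted_right.tpr_linear_left[OF tr_yon, of Y X y l j] by (simp add: dla_tpr)
next
 fix X Y f l j assume "X : Ob A" "Y : Ob A" "f .: dhom A X Y j"
 then show "linear_map R (cpt (rt T (yon A X)) l) (cpt (rt T (yon A Y)) (j + l)) (%y. dla A T X Y j l f y)"
  using twisted_right.tpr_linear_right[OF tr_yon, of Y X f j l] by (simp add: dla_tpr)
next
 fix X Y Z g m f n y l
 assume o: "X : Ob A" "Y : Ob A" "Z : Ob A" "g .: dhom A Y Z m" "f .: dhom A X Y n"
  "y .: cpt (rt T (yon A X)) l"
 then show "dla A T X Z (m + n) l (cmp A X Y Z m n g f) y = dla A T Y Z m (n + l) g (dla A T X Y n l f y)"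
  using twisted_right.tpr_comp[OF tr_yon, of Z X Y g m f n y l] by (simp add: dla_tpr)
next
 fix X y l assume o: "X : Ob A" "y .: cpt (rt T (yon A X)) l"
 interpret Y: twisted_right R A T "yon A X" by (rule tr_yon[OF o(1)])
 have "dla A T X X 0 l (ident A X) y k = y k" if k: "k : sp T" for k
  using k comp_ident_left[OF tob[OF k] o(1)] Y.rt_mem[OF o(2) k] by (simp add: dla_def)
 then show "dla A T X X 0 l (ident A X) y = y"
  using Y.tpr_closed[OF o(1), of "ident A X" 0 y l] ident_closed[OF o(1)] o
  by (intro Y.rt_ext[of _ l]) (auto simp: dla_tpr)
next
 fix X Y f j y l
 assume "X : Ob A" "Y : Ob A" "f .: dhom A X Y j" "y .: cpt (rt T (yon A X)) l"
 then show "df (rt T (yon A Y)) (j + l) (dla A T X Y j l f y) =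
   dla A T X Y (j + 1) l (df (Hom A X Y) j f) y +[cpt (rt T (yon A Y)) (j + l + 1)]
   sg (cpt (rt T (yon A Y)) (j + l + 1)) j (dla A T X Y j (l + 1) f (df (rt T (yon A X)) l y))"
  using twisted_right.tpr_leibniz[OF tr_yon, of Y X f j y l] by (simp add: dla_tpr)
qed

end

text \<open>This makes the removal of cells available for morphisms from \<open>T\<close> into
  \<open>M\<close>: the coefficients of a cell over \<open>X\<close> are then the morphisms from
  \<open>T\<close> to \<open>X\<close>, whose cohomology is controlled by exactness of
  \<open>T\<close>.\<close>

lemma (in twisted_right) pairing_dual:
 "pairing R A M (%X. rt T (yon A X)) (dla A T) (rt T M) tpr"
proof -
 interpret L: left_dg R A "%X. rt T (yon A X)" "dla A T" by (rule left_dg_dual)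
 show ?thesis
 proof unfold_locales
  show "acx (rt T M)" by (rule rt_acx)
 next
  fix X x i y j assume "X : Ob A" "x .: vcpt M X i" "y .: cpt (rt T (yon A X)) j"
  then show "tpr X i j x y .: cpt (rt T M) (i + j)" by (rule tpr_closed)
 next
  fix X x i x' y j
  assume "X : Ob A" "x .: vcpt M X i" "x' .: vcpt M X i" "y .: cpt (rt T (yon A X)) j"
  then show "tpr X i j (x +[vcpt M X i] x') y = tpr X i j x y +[cpt (rt T M) (i + j)] tpr X i j x' y"
   by (intro am_add[OF lin_am[OF tpr_linear_left]])
 next
  fix X x i y j y'
  assume "X : Ob A" "x .: vcpt M X i" "y .: cpt (rt T (yon A X)) j" "y' .: cpt (rt T (yon A X)) j"
  then show "tpr X i j x (y +[cpt (rt T (yon A X)) j] y') = tpr X i j x y +[cpt (rt T M) (i + j)] tpr X i j x y'"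
   by (intro am_add[OF lin_am[OF tpr_linear_right]])
 next
  fix X Y x i f j y l
  assume "X : Ob A" "Y : Ob A" "x .: vcpt M Y i" "f .: dhom A X Y j" "y .: cpt (rt T (yon A X)) l"
  then show "tpr X (i + j) l (act M X Y i j x f) y = tpr Y i (j + l) x (dla A T X Y j l f y)"
   using tpr_comp by (simp add: dla_tpr)
 next
  fix X x i y j
  assume "X : Ob A" "x .: vcpt M X i" "y .: cpt (rt T (yon A X)) j"
  then show "df (rt T M) (i + j) (tpr X i j x y) = tpr X (i + 1) j (df (val M X) i x) y +[cpt (rt T M) (i + j + 1)]
   sg (cpt (rt T M) (i + j + 1)) i (tpr X i (j + 1) x (df (rt T (yon A X)) j y))"
   by (rule tpr_leibniz)
 next
  fix X m c assume c: "functional R A M X m c"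
  note oX = functionalD(1)[OF c]
  \<comment> \<open>A functional is lifted by applying it in every component of the tuple.\<close>
  define h where "h n z = (%k:sp T. c T$k (k + n) (z k))" for n z
  have "linear_map R (cpt (rt T M) n) (cpt (rt T (yon A X)) (n - m)) (h n)" for n
   unfolding h_def rt_cpt twisted_right.rt_cpt[OF tr_yon[OF oX]]
  proof (rule linear_map_tuple, rule linear_map_tuple_component)
   fix k assume k: "k : sp T"
   have e: "k + n - m = k + (n - m)" by simp
   show "linear_map R (vcpt M T$k (k + n)) (vcpt (yon A X) T$k (k + (n - m))) (c T$k (k + n))"
   using functionalD(2)[OF c tob[OF k], of "k + n"] unfolding e by simp
  qed
  moreover have "h n (tpr Y i j x y) = dla A T Y X (i - m) j (c Y i x) y"
   if o: "Y : Ob A" "x .: vcpt M Y i" "y .: cpt (rt T (yon A Y)) j" "n = i + j" for n Y i j x y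
   unfolding h_def dla_def tpr_def
  proof (rule restrict_ext)
   fix k assume k: "k : sp T"
   have e: "i + (k + j) = k + n" using o by simp
   show "c T$k (k + n) ((%k:sp T. act M T$k Y i (k + j) x (y k)) k) = cmp A T$k Y X (i - m) (k + j) (c Y i x) (y k)"
   using functionalD(3)[OF c tob[OF k] o(1,2) dual_mem[OF o(1,3) k refl]] k unfolding e by simp
  qed
  ultimately show "EX h. ALL n. amap (cpt (rt T M) n) (cpt (rt T (yon A X)) (n - m)) (h n) &
   (ALL Y i j x y. Y : Ob A --> x .: vcpt M Y i --> y .: cpt (rt T (yon A Y)) j --> n = i + j -->
   h n (tpr Y i j x y) = dla A T Y X (i - m) j (c Y i x) y)"
   using lin_am by blast
 qed
qed

section \<open>Normal cells in semi-free modules\<close>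

lemma asub_finsum:
 assumes "agrp G" "additive_subgroup W G" "!!i. i : I ==> f i : W"
 shows "(\<Oplus>[G] i:I. f i) : W"
proof -
 interpret G: agrp G by fact
 interpret W: additive_subgroup W G by fact
 show ?thesis
 proof (cases "finite I")
  case True
  then show ?thesis using assms(3)
  proof (induction I)
   case (insert i I)
   moreover have "f j .: G" if "j : insert i I" for j using insert(4)[OF that] W.a_subset by blast
   ultimately show ?case by (simp add: Pi_iff)
  qed simp
 qed simp
qed

lemma hi_all:
 assumes "finite S"
 shows "EX a<=m. hi S a = S"
proof -
 let ?D = "insert (m + 1) (deg ` S)"
 have "Min ?D <= x" if "x : ?D" for x using assms that by (intro Min_le) auto
 note le = this
 have "Min ?D - 1 < deg s" if "s : S" for s using le[of "deg s"] that by simp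
 then show ?thesis using le[of "m + 1"] by (intro exI[of _ "Min ?D - 1"]) (auto simp: hi_def simp del: Min_le_iff)
qed

lemma functional_cl:
 "functional R A P X m c ==> Y : Ob A ==> x .: vcpt P Y n ==> k = n - m ==> c Y n x .: dhom A Y X k"
 by (simp add: am_cl[OF lin_am[OF functionalD(2)]])

context dg_module
begin

lemma functional_span:
 assumes c: "functional R A M X m c" and S: "cellset A M S" and Y: "Y : Ob A"
  and c0: "!!Z l q. (Z, l, q) : S ==> c Z l q = 0[dhom A Z X (l - m)]"
  and x: "x : span A M Y S n"
 shows "c Y n x = 0[dhom A Y X (n - m)]"
proof -
 note X = functionalD(1)[OF c]
 interpret G: agrp "vcpt M Y n" by (rule val_ag[OF Y])
 interpret H: agrp "dhom A Y X (n - m)" by (rule hom_ag[OF Y X])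
 note am = lin_am[OF functionalD(2)[OF c Y]]
 have "x .: vcpt M Y n & c Y n x = 0[dhom A Y X (n - m)]"
  using x unfolding wsp_def
 proof induction
  case gsp_zero
  then show ?case using am_0[OF G.ag H.ag am] by simp
 next
  case (gsp_add s x)
  then obtain Z l q a where s: "s = act M Y Z l (n - l) q a" "(Z, l, q) : S" "a .: dhom A Y Z (n - l)"
   by blast
  have o: "Z : Ob A" "q .: vcpt M Z l" using s S by (auto simp: cellset_def)
  have sc: "s .: vcpt M Y n" unfolding s(1) by (rule act_cl[OF Y o s(3)]) simp
  have "l + (n - l) = n" by simp
  then have "c Y n s = cmp A Y Z X (l - m) (n - l) 0[dhom A Z X (l - m)] a"
   using functionalD(3)[OF c Y o s(3)] c0[OF s(2)] s(1) by simp
  also have "... = 0[dhom A Y X (n - m)]"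
   by (rule am_0[OF hom_ag[OF o(1) X] H.ag cmp_am_l[OF Y o(1) X s(3)]]) simp
  finally show ?case using gsp_add sc by (simp add: am_add[OF am])
 qed
 then show ?thesis by simp
qed

text \<open>The elementary operation that makes an existing coordinate functional vanish on a newly
  added cell.\<close>

lemma functional_diff:
 assumes c1: "functional R A M X m c1" and c2: "functional R A M Z l c2" and g: "g .: dhom A Z X (l - m)"
 shows "functional R A M X m (%Y n x. c1 Y n x -[dhom A Y X (n - m)] cmp A Y Z X (l - m) (n - l) g (c2 Y n x))"
proof -
 note X = functionalD(1)[OF c1] and Z = functionalD(1)[OF c2]
 show ?thesis
  unfolding functional_def
 proof (intro conjI ballI allI X)
  fix Y i assume Y: "Y : Ob A"
  interpret H: agrp "dhom A Y X (i - m)" by (rule hom_ag[OF Y X])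
  interpret HM: Module.module R "dhom A Y X (i - m)" by (rule hom_module[OF Y X])
  note l1 = functionalD(2)[OF c1 Y, of i]
  have e: "l - m + (i - l) = i - m" by simp
  have l2: "linear_map R (vcpt M Y i) (dhom A Y X (i - m)) (%x. cmp A Y Z X (l - m) (i - l) g (c2 Y i x))"
   using lin_comp[OF functionalD(2)[OF c2 Y, of i] comp_linear_right[OF Y Z X g, of "i - l"]] unfolding e .
  show "linear_map R (vcpt M Y i) (dhom A Y X (i - m))
   (%x. c1 Y i x -[dhom A Y X (i - m)] cmp A Y Z X (l - m) (i - l) g (c2 Y i x))"
   by (rule linI)
   (auto simp: am_add[OF lin_am[OF l1]] am_add[OF lin_am[OF l2]]
   am_cl[OF lin_am[OF l1]] am_cl[OF lin_am[OF l2]]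
   lin_smult[OF l1] lin_smult[OF l2] H.minus_eq H.minus_add H.a_ac HM.smult_r_distr HM.smult_r_minus)
 next
  fix Y W i j x f
  assume o: "Y : Ob A" "W : Ob A" and x: "x .: vcpt M W i" and f: "f .: dhom A Y W j"
  have e: "i + j - m = i - m + j" "i + j - l = i - l + j" by auto
  have c1x: "c1 W i x .: dhom A W X (i - m)" and c2x: "c2 W i x .: dhom A W Z (i - l)"
   using functional_cl[OF c1 o(2) x] functional_cl[OF c2 o(2) x] by auto
  have gc: "cmp A W Z X (l - m) (i - l) g (c2 W i x) .: dhom A W X (i - m)"
   by (rule cmp_cl[OF o(2) Z X g c2x]) simp
  have "cmp A Y Z X (l - m) (i - l + j) g (cmp A Y W Z (i - l) j (c2 W i x) f)
   = cmp A Y W X (i - m) j (cmp A W Z X (l - m) (i - l) g (c2 W i x)) f"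
   by (rule comp_assoc'[OF o(1,2) Z X g c2x f, symmetric]) auto
  then show "c1 Y (i + j) (act M Y W i j x f) -[dhom A Y X (i + j - m)]
   cmp A Y Z X (l - m) (i + j - l) g (c2 Y (i + j) (act M Y W i j x f)) =
   cmp A Y W X (i - m) j (c1 W i x -[dhom A W X (i - m)] cmp A W Z X (l - m) (i - l) g (c2 W i x)) f"
   unfolding functionalD(3)[OF c1 o x f] functionalD(3)[OF c2 o x f] e
   using am_minus[OF hom_ag[OF o(2) X] hom_ag[OF o(1) X] cmp_am_l[OF o(1,2) X f, of "i - m + j" "i - m"] c1x gc] by simp
 qed
qed

end

section \<open>Coordinates with respect to a semi-basis\<close>

abbreviation bhom :: "('o, 'k, 'a) dgcat => 'o => int => 'o \<times> int \<times> 'p => ('k, 'a) module" where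
 "bhom A Y n \<beta> == dhom A Y (fst \<beta>) (n - deg \<beta>)"

abbreviation bact :: "('o, 'k, 'a, 'p) dgmod => 'o => int => 'o \<times> int \<times> 'p => 'a => 'p" where
 "bact P Y n \<beta> == act P Y (fst \<beta>) (deg \<beta>) (n - deg \<beta>) (snd (snd \<beta>))"

text \<open>Patterns on triples are replaced by projections, so that a basis element can be treated
  as a single index in sums and function spaces.\<close>

lemma coefficients_eq:
 "coefficients A B Y n = {a : \<Pi>\<^sub>E \<beta>\<in>B. carrier (bhom A Y n \<beta>). finite {\<beta> : B. a \<beta> ~= 0[bhom A Y n \<beta>]}}"
proof -
 have 1: "(%(X, m, b). carrier (dhom A Y X (n - m))) = (%\<beta>. carrier (bhom A Y n \<beta>))"
  and 2: "!!a. {(X, m, b). (X, m, b) : B & a (X, m, b) ~= 0[dhom A Y X (n - m)]} = {\<beta> : B. a \<beta> ~= 0[bhom A Y n \<beta>]}"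
  by auto
 show ?thesis unfolding coefficients_def 1 2 by (rule refl)
qed

lemma combination_eq:
 "combination A P B Y n a = (\<Oplus>[vcpt P Y n] \<beta>:{\<beta> : B. a \<beta> ~= 0[bhom A Y n \<beta>]}. bact P Y n \<beta> (a \<beta>))"
proof -
 have "(%\<beta>. case \<beta> of (X, m, b) => act P Y X m (n - m) b (a (X, m, b))) = (%\<beta>. bact P Y n \<beta> (a \<beta>))"
  "{(X, m, b). (X, m, b) : B & a (X, m, b) ~= 0[dhom A Y X (n - m)]} = {\<beta> : B. a \<beta> ~= 0[bhom A Y n \<beta>]}"
  by auto
 then show ?thesis unfolding combination_def by simp
qed

context dg_module
begin

lemma bact_addmap:
 "cellset A M B ==> \<beta> : B ==> Y : Ob A ==> amap (bhom A Y n \<beta>) (vcpt M Y n) (bact M Y n \<beta>)"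
 by (cases \<beta>) (auto simp: cellset_def intro!: act_am_r)

lemma bhom_agrp: "cellset A M B ==> \<beta> : B ==> Y : Ob A ==> agrp (bhom A Y n \<beta>)"
 by (cases \<beta>) (auto simp: cellset_def intro!: hom_ag)

lemma comb_superset:
 assumes B: "cellset A M B" and Y: "Y : Ob A" and a: "!!\<beta>. \<beta> : F ==> a \<beta> .: bhom A Y n \<beta>"
  and F: "finite F" "F <= B" "{\<beta> : B. a \<beta> ~= 0[bhom A Y n \<beta>]} <= F"
 shows "combination A M B Y n a = (\<Oplus>[vcpt M Y n] \<beta>:F. bact M Y n \<beta> (a \<beta>))"
proof -
 interpret G: agrp "vcpt M Y n" by (rule val_ag[OF Y])
 have "bact M Y n \<beta> 0[bhom A Y n \<beta>] = 0[vcpt M Y n]" if "\<beta> : B" for \<beta>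
  by (rule am_0[OF bhom_agrp[OF B that Y] G.ag bact_addmap[OF B that Y]])
 moreover have "bact M Y n \<beta> (a \<beta>) .: vcpt M Y n" if "\<beta> : F" for \<beta>
  using am_cl[OF bact_addmap[OF B _ Y] a[OF that]] that F by blast
 ultimately show ?thesis
  unfolding combination_eq using F by (intro G.add.finprod_mono_neutral_cong_left) (auto simp: subset_iff)
qed

lemma combination_span:
 assumes B: "cellset A M B" and Y: "Y : Ob A" and a: "a : coefficients A B Y n"
 shows "EX F. finite F & F <= B & combination A M B Y n a : span A M Y F n"
proof -
 let ?F = "{\<beta> : B. a \<beta> ~= 0[bhom A Y n \<beta>]}"
 have F: "finite ?F" using a by (auto simp: coefficients_eq)
 have cs: "cellset A M ?F" using B by (auto simp: cellset_def)
 have "bact M Y n \<beta> (a \<beta>) : span A M Y ?F n" if "\<beta> : ?F" for \<beta>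
  using that a by (intro span_gen[OF Y cs]) (auto simp: coefficients_eq)
 then have "combination A M B Y n a : span A M Y ?F n"
  unfolding combination_eq by (rule asub_finsum[OF val_ag[OF Y] span_sub[OF Y cs]])
 then show ?thesis using F by blast
qed

end

text \<open>Replaces basis elements by the normal cells that span them, without changing the
  coefficients' side of the pairing.\<close>

lemma (in pairing) wspan_trans:
 assumes F: "cellset A P F" and S: "cellset A P S" and FS: "!!X m b. (X, m, b) : F ==> b : span A P X S m"
  and x: "x : wspan F n"
 shows "x : wspan S n"
proof -
 interpret W: additive_subgroup "wspan S n" "cpt C n" by (rule wspan_sub[OF S])
 show ?thesis
  using x unfolding wsp_def[of _ _ _ F]
 proof induction
  case (gsp_add s x)
  then obtain X m p a where s: "s = pr X m (n - m) p a" "(X, m, p) : F" "a .: cpt (V X) (n - m)"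
   by blast
  have "X : Ob A" using s F by (auto simp: cellset_def)
  then have "s : wspan S n" unfolding s(1) by (intro span_pr[OF S FS[OF s(2)] _ s(3)]) auto
  then show ?case using gsp_add by simp
 qed simp
qed

locale semifree = dg_module R A P for R :: "'k ring" and A :: "('o, 'k, 'a) dgcat" and P :: "('o, 'k, 'a, 'p) dgmod" +
 fixes B lev
 assumes semi_basis: "semi_basis A P B lev"
begin

lemma B_cells: "cellset A P B"
 using semi_basis by (auto simp: semi_basis_def cellset_def)

definition cf :: "'o => int => 'p => 'o \<times> int \<times> 'p => 'a" where
 "cf Y n = inv_into (coefficients A B Y n) (combination A P B Y n)"

lemma bij: "Y : Ob A ==> bij_betw (combination A P B Y n) (coefficients A B Y n) (carrier (vcpt P Y n))"
 using semi_basis by (auto simp: semi_basis_def)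

lemma cf_closed: "Y : Ob A ==> x .: vcpt P Y n ==> cf Y n x : coefficients A B Y n"
 unfolding cf_def using bij[of Y n] by (metis bij_betw_def inv_into_into)

lemma combination_cf: "Y : Ob A ==> x .: vcpt P Y n ==> combination A P B Y n (cf Y n x) = x"
 unfolding cf_def using bij[of Y n] by (simp add: bij_betw_inv_into_right)

lemma cf_eqI: "Y : Ob A ==> a : coefficients A B Y n ==> combination A P B Y n a = x ==> cf Y n x = a"
 unfolding cf_def using bij[of Y n] by (auto simp: bij_betw_inv_into_left)

lemma cf_mem: "Y : Ob A ==> x .: vcpt P Y n ==> \<beta> : B ==> cf Y n x \<beta> .: bhom A Y n \<beta>"
 using cf_closed[of Y x n] by (auto simp: coefficients_eq)

lemma cf_support: "Y : Ob A ==> x .: vcpt P Y n ==> finite {\<beta> : B. cf Y n x \<beta> ~= 0[bhom A Y n \<beta>]}"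
 using cf_closed[of Y x n] by (auto simp: coefficients_eq)

text \<open>A map that acts on multiples of basis elements through their coefficients does so on
  coordinates, since coordinates are unique. It is applied to scalars and to the action of a
  morphism, which together with \<open>cf_add\<close> shows that coordinates are
  functionals.\<close>

lemma cf_map:
 assumes Y: "Y : Ob A" and Z: "Z : Ob A" and x: "x .: vcpt P Y n"
  and \<Phi>: "amap (vcpt P Y n) (vcpt P Z l) \<Phi>"
  and \<phi>: "!!\<beta>. \<beta> : B ==> amap (bhom A Y n \<beta>) (bhom A Z l \<beta>) (\<phi> \<beta>)"
  and comm: "!!\<beta> a. \<beta> : B ==> a .: bhom A Y n \<beta> ==> \<Phi> (bact P Y n \<beta> a) = bact P Z l \<beta> (\<phi> \<beta> a)"
 shows "cf Z l (\<Phi> x) = (%\<beta>:B. \<phi> \<beta> (cf Y n x \<beta>))"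
proof (rule cf_eqI[OF Z])
 let ?a = "cf Y n x" and ?b = "%\<beta>:B. \<phi> \<beta> (cf Y n x \<beta>)"
 let ?F = "{\<beta> : B. ?a \<beta> ~= 0[bhom A Y n \<beta>]}"
 note a = cf_mem[OF Y x] and F = cf_support[OF Y x]
 have b: "\<phi> \<beta> (?a \<beta>) .: bhom A Z l \<beta>" if "\<beta> : B" for \<beta> by (rule am_cl[OF \<phi>[OF that] a[OF that]])
 have sub: "{\<beta> : B. ?b \<beta> ~= 0[bhom A Z l \<beta>]} <= ?F"
  using am_0[OF bhom_agrp[OF B_cells _ Y] bhom_agrp[OF B_cells _ Z] \<phi>] by auto
 show "?b : coefficients A B Z l"
  using b finite_subset[OF sub F] by (auto simp: coefficients_eq)
 have "combination A P B Z l ?b = (\<Oplus>[vcpt P Z l] \<beta>:?F. bact P Z l \<beta> (?b \<beta>))"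
  by (rule comb_superset[OF B_cells Z _ F _ sub]) (use b in auto)
 also have "... = (\<Oplus>[vcpt P Z l] \<beta>:?F. \<Phi> (bact P Y n \<beta> (?a \<beta>)))"
  using a comm b am_cl[OF bact_addmap[OF B_cells _ Z]]
  by (intro abelian_monoid.finsum_cong') (use val_ag[OF Z] in \<open>auto simp: agrp_def abelian_group_def\<close>)
 also have "... = \<Phi> (\<Oplus>[vcpt P Y n] \<beta>:?F. bact P Y n \<beta> (?a \<beta>))"
  using a am_cl[OF bact_addmap[OF B_cells _ Y]]
  by (intro am_finsum[OF val_ag[OF Y] val_ag[OF Z] \<Phi>, symmetric]) auto
 also have "(\<Oplus>[vcpt P Y n] \<beta>:?F. bact P Y n \<beta> (?a \<beta>)) = x"
  using combination_cf[OF Y x] unfolding combination_eq .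
 finally show "combination A P B Z l ?b = \<Phi> x" .
qed

lemma cf_add:
 assumes Y: "Y : Ob A" and x: "x .: vcpt P Y n" and y: "y .: vcpt P Y n" and \<beta>: "\<beta> : B"
 shows "cf Y n (x +[vcpt P Y n] y) \<beta> = cf Y n x \<beta> +[bhom A Y n \<beta>] cf Y n y \<beta>"
proof -
 interpret G: agrp "vcpt P Y n" by (rule val_ag[OF Y])
 let ?a = "%\<beta>:B. cf Y n x \<beta> +[bhom A Y n \<beta>] cf Y n y \<beta>"
 let ?F = "{\<beta> : B. cf Y n x \<beta> ~= 0[bhom A Y n \<beta>]} \<union> {\<beta> : B. cf Y n y \<beta> ~= 0[bhom A Y n \<beta>]}"
 have F: "finite ?F" "?F <= B" using cf_support[OF Y x] cf_support[OF Y y] by auto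
 note xm = cf_mem[OF Y x] and ym = cf_mem[OF Y y]
 have ag: "abelian_monoid (bhom A Y n \<beta>)" if "\<beta> : B" for \<beta>
  using bhom_agrp[OF B_cells that Y] by (simp add: agrp_def abelian_group_def)
 have am: "?a \<beta> .: bhom A Y n \<beta>" if "\<beta> : B" for \<beta>
  using abelian_monoid.a_closed[OF ag xm ym] that by simp
 have sub: "{\<beta> : B. ?a \<beta> ~= 0[bhom A Y n \<beta>]} <= ?F"
  using abelian_monoid.l_zero[OF ag abelian_monoid.zero_closed[OF ag]] by auto
 have "cf Y n (x +[vcpt P Y n] y) = ?a"
 proof (rule cf_eqI[OF Y])
  show "?a : coefficients A B Y n"
   using am finite_subset[OF sub F(1)] by (auto simp: coefficients_eq)
  note bc = am_cl[OF bact_addmap[OF B_cells _ Y]]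
  have "combination A P B Y n ?a = (\<Oplus>[vcpt P Y n] \<beta>:?F. bact P Y n \<beta> (?a \<beta>))"
   by (rule comb_superset[OF B_cells Y _ F sub]) (use am F in blast)
  also have "... = (\<Oplus>[vcpt P Y n] \<beta>:?F. bact P Y n \<beta> (cf Y n x \<beta>) +[vcpt P Y n] bact P Y n \<beta> (cf Y n y \<beta>))"
   using F xm ym bc by (intro G.finsum_cong') (auto simp: am_add[OF bact_addmap[OF B_cells _ Y]])
  also have "... = (\<Oplus>[vcpt P Y n] \<beta>:?F. bact P Y n \<beta> (cf Y n x \<beta>)) +[vcpt P Y n] (\<Oplus>[vcpt P Y n] \<beta>:?F. bact P Y n \<beta> (cf Y n y \<beta>))"
   using F xm ym bc by (intro G.finsum_addf) auto
  also have "(\<Oplus>[vcpt P Y n] \<beta>:?F. bact P Y n \<beta> (cf Y n x \<beta>)) = combination A P B Y n (cf Y n x)"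
   by (rule comb_superset[OF B_cells Y _ F, symmetric]) (use xm F(2) in blast)+
  also have "... = x" by (rule combination_cf[OF Y x])
  also have "(\<Oplus>[vcpt P Y n] \<beta>:?F. bact P Y n \<beta> (cf Y n y \<beta>)) = combination A P B Y n (cf Y n y)"
   by (rule comb_superset[OF B_cells Y _ F, symmetric]) (use ym F(2) in blast)+
  also have "... = y" by (rule combination_cf[OF Y y])
  finally show "combination A P B Y n ?a = x +[vcpt P Y n] y" .
 qed
 then show ?thesis using \<beta> by simp
qed

lemma functional_cf:
 assumes \<beta>: "(X, m, b) : B"
 shows "functional R A P X m (%Y n x. cf Y n x (X, m, b))"
proof -
 have X: "X : Ob A" using B_cells \<beta> by (auto simp: cellset_def)
 show ?thesis
  unfolding functional_def
 proof (intro conjI ballI allI X linI)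
  fix Y i x assume Y: "Y : Ob A" and x: "x .: vcpt P Y i"
  show "cf Y i x (X, m, b) .: dhom A Y X (i - m)" using cf_mem[OF Y x \<beta>] by simp
  show "cf Y i (x +[vcpt P Y i] y) (X, m, b) = cf Y i x (X, m, b) +[dhom A Y X (i - m)] cf Y i y (X, m, b)"
   if "y .: vcpt P Y i" for y
   using cf_add[OF Y x that \<beta>] by simp
  fix r assume r: "r .: R"
  interpret G: Module.module R "vcpt P Y i" by (rule val_module[OF Y])
  have "cf Y i (r *[vcpt P Y i] x) = (%\<beta>:B. r *[bhom A Y i \<beta>] cf Y i x \<beta>)"
  proof (rule cf_map[OF Y Y x])
   show "amap (vcpt P Y i) (vcpt P Y i) ((\<odot>\<^bsub>vcpt P Y i\<^esub>) r)"
   using r by (auto intro!: amI simp: G.smult_r_distr)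
   fix \<beta> assume \<beta>: "\<beta> : B"
   have o: "fst \<beta> : Ob A" "snd (snd \<beta>) .: vcpt P (fst \<beta>) (deg \<beta>)" using B_cells \<beta> by (auto simp: cellset_def)
   interpret H: Module.module R "bhom A Y i \<beta>" by (rule hom_module[OF Y o(1)])
   show "amap (bhom A Y i \<beta>) (bhom A Y i \<beta>) ((\<odot>\<^bsub>bhom A Y i \<beta>\<^esub>) r)"
   using r by (auto intro!: amI simp: H.smult_r_distr)
   show "r *[vcpt P Y i] bact P Y i \<beta> a = bact P Y i \<beta> (r *[bhom A Y i \<beta>] a)" if "a .: bhom A Y i \<beta>" for a
   using lin_smult[OF act_linear_right[OF Y o] r that] by simp
  qed
  then show "cf Y i (r *[vcpt P Y i] x) (X, m, b) = r *[dhom A Y X (i - m)] cf Y i x (X, m, b)"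
   using \<beta> by simp
 next
  fix Y Z i j x f
  assume Y: "Y : Ob A" and Z: "Z : Ob A" and x: "x .: vcpt P Z i" and f: "f .: dhom A Y Z j"
  have "cf Y (i + j) (act P Y Z i j x f) = (%\<beta>:B. cmp A Y Z (fst \<beta>) (i - deg \<beta>) j (cf Z i x \<beta>) f)"
  proof (rule cf_map[OF Z Y x])
   show "amap (vcpt P Z i) (vcpt P Y (i + j)) (%x. act P Y Z i j x f)"
   by (rule act_am_l[OF Y Z f refl])
   fix \<beta> assume \<beta>: "\<beta> : B"
   have o: "fst \<beta> : Ob A" "snd (snd \<beta>) .: vcpt P (fst \<beta>) (deg \<beta>)" using B_cells \<beta> by (auto simp: cellset_def)
   show "amap (bhom A Z i \<beta>) (bhom A Y (i + j) \<beta>) (%a. cmp A Y Z (fst \<beta>) (i - deg \<beta>) j a f)"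
   by (rule cmp_am_l[OF Y Z o(1) f]) simp
   show "act P Y Z i j (bact P Z i \<beta> a) f = bact P Y (i + j) \<beta> (cmp A Y Z (fst \<beta>) (i - deg \<beta>) j a f)"
   if "a .: bhom A Z i \<beta>" for a
   by (rule act_comp'[OF Y Z o that f]) auto
  qed
  then show "cf Y (i + j) (act P Y Z i j x f) (X, m, b) = cmp A Y Z X (i - m) j (cf Z i x (X, m, b)) f"
   using \<beta> by simp
 qed
qed

lemma cf_basis:
 assumes \<beta>: "(X, m, b) : B" and \<gamma>: "\<gamma> : B"
 shows "cf X m b \<gamma> = (if \<gamma> = (X, m, b) then ident A X else 0[bhom A X m \<gamma>])"
proof -
 have o: "X : Ob A" "b .: vcpt P X m" using B_cells \<beta> by (auto simp: cellset_def)
 let ?e = "%\<gamma>:B. if \<gamma> = (X, m, b) then ident A X else 0[bhom A X m \<gamma>]"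
 interpret G: agrp "vcpt P X m" by (rule val_ag[OF o(1)])
 have z: "0[bhom A X m \<gamma>] .: bhom A X m \<gamma>" if "\<gamma> : B" for \<gamma>
  using bhom_agrp[OF B_cells that o(1), of m] by (simp add: agrp_def abelian_group_def abelian_monoid.zero_closed)
 have e: "?e \<gamma> .: bhom A X m \<gamma>" if "\<gamma> : B" for \<gamma> using z[OF that] ident_closed[OF o(1)] that by simp
 have sub: "{\<gamma> : B. ?e \<gamma> ~= 0[bhom A X m \<gamma>]} <= {(X, m, b)}" by auto
 have "cf X m b = ?e"
 proof (rule cf_eqI[OF o(1)])
  have "?e : (\<Pi>\<^sub>E \<gamma>\<in>B. carrier (bhom A X m \<gamma>))"
   using e by (intro PiE_I) (assumption, simp only: restrict_apply if_False)
  then show "?e : coefficients A B X m" using finite_subset[OF sub] unfolding coefficients_eq by blast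
  have "combination A P B X m ?e = (\<Oplus>[vcpt P X m] \<gamma>:{(X, m, b)}. bact P X m \<gamma> (?e \<gamma>))"
   by (rule comb_superset[OF B_cells o(1) _ _ _ sub]) (use e \<beta> in blast)+
  also have "... = b" using \<beta> o by (simp add: act_ident)
  finally show "combination A P B X m ?e = b" .
 qed
 then show ?thesis using \<gamma> by simp
qed

lemma elt_span: "Y : Ob A ==> x .: vcpt P Y n ==> EX F. finite F & F <= B & x : span A P Y F n"
 using combination_span[OF B_cells _ cf_closed] combination_cf by metis

lemma basis_diff_span:
 assumes "(X, m, b) : B"
 shows "EX F. finite F & F <= {\<beta> : B. lev \<beta> < lev (X, m, b)} & df (val P X) m b : span A P X F (m + 1)"
proof -
 let ?B = "{\<beta> : B. lev \<beta> < lev (X, m, b)}"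
 have "df (val P X) m b : combination A P ?B X (m + 1) ` coefficients A ?B X (m + 1)"
  using semi_basis assms by (auto simp: semi_basis_def Let_def)
 then obtain a where a: "a : coefficients A ?B X (m + 1)" "df (val P X) m b = combination A P ?B X (m + 1) a"
  by auto
 have "cellset A P ?B" "X : Ob A" using B_cells assms by (auto simp: cellset_def)
 from combination_span[OF this a(1)] show ?thesis unfolding a(2) .
qed

text \<open>A stage of the normalisation: the basis elements in \<open>G\<close> have been replaced
  by the normal cells \<open>S\<close>. The last clause says that \<open>S\<close> has no
  coordinates outside \<open>G\<close>; it makes the coordinate of the next basis element a dual
  functional for the next cell.\<close>

definition nf :: "('o \<times> int \<times> 'p) set => ('o \<times> int \<times> 'p) set => bool" where
 "nf G S \<longleftrightarrow> finite G & G <= B & normal_cells R A P S & (ALL (X, m, b):G. b : span A P X S m) &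
  (ALL \<beta>:B - G. ALL (Y, l, q):S. cf Y l q \<beta> = 0[bhom A Y l \<beta>])"

text \<open>The part of the differential of \<open>b\<close> on cells of degree at most
  \<open>m\<close> has coefficients in degrees \<open>m + 1 - l > 0\<close>, where connectivity
  makes morphisms acyclic. It can be removed by subtracting some \<open>q\<close> from
  \<open>b\<close>, and \<open>b - q\<close> is the new cell.\<close>

lemma nf_insert:
 assumes con: "connective A" and n: "nf G S" and \<beta>: "(X, m, b) : B" "(X, m, b) ~: G"
  and db: "df (val P X) m b : span A P X S (m + 1)"
 shows "EX S'. nf (insert (X, m, b) G) S'"
proof -
 have fG: "finite G" "G <= B" and nc: "normal_cells R A P S"
  and GS: "!!X m b. (X, m, b) : G ==> b : span A P X S m"
  and van: "!!\<beta> Y l q. \<beta> : B - G ==> (Y, l, q) : S ==> cf Y l q \<beta> = 0[bhom A Y l \<beta>]"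
  using n by (auto simp: nf_def)
 have fin: "finite S" and S: "cellset A P S"
  and dual: "!!s. s : S ==> EX c. dual R A P (S - {s}) s c"
  and dn: "!!X m p. (X, m, p) : S ==> df (val P X) m p : span A P X (hi S m) (m + 1)"
  using nc by (auto simp: normal_cells_def)
 have o: "X : Ob A" "b .: vcpt P X m" using B_cells \<beta> by (auto simp: cellset_def)
 interpret Y: pairing R A P "Hom A X" "cmp A X" "val P X" "act P X" by (rule pairing_yon[OF o(1)])
 interpret G: agrp "vcpt P X m" by (rule val_ag[OF o(1)])
 interpret G1: agrp "vcpt P X (m + 1)" by (rule val_ag[OF o(1)])
 \<comment> \<open>A threshold below all degrees of cells, so that peeling from \<open>a\<close> to
   \<open>m\<close> starts with the whole of \<open>S\<close>.\<close>
 obtain a where a: "a <= m" "hi S a = S" using hi_all[OF fin] by blast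
 have ddb: "df (val P X) (m + 1) (df (val P X) m b) = 0[vcpt P X (m + 1 + 1)]"
  by (rule acx_dd[OF val_acx[OF o(1)] o(2)]) auto
 have "EX q:span A P X (hi S a) (m + 1 - 1). df (val P X) m b -[vcpt P X (m + 1)] df (val P X) (m + 1 - 1) q
   : span A P X (hi S m) (m + 1)"
 proof (rule Y.peel_cells[OF nc _ a(1)])
  fix Y l p assume "(Y, l, p) : S" "l <= m"
  then show "hz (Hom A X Y) (m + 1 - l)"
   using con o S by (auto simp: connective_def cellset_def)
 next
  show "df (val P X) m b : span A P X (hi S a) (m + 1)" using db a by simp
  show "df (val P X) (m + 1) (df (val P X) m b) : span A P X (hi S m) (m + 1 + 1)"
   unfolding ddb by (rule additive_subgroup.zero_closed[OF span_sub[OF o(1) cells_sub[OF S hi_subset]]])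
 qed
 then obtain q where q: "q : span A P X S m"
  and dq: "df (val P X) m b -[vcpt P X (m + 1)] df (val P X) m q : span A P X (hi S m) (m + 1)"
  unfolding a(2) by auto
 have qc: "q .: vcpt P X m" by (rule span_carrier[OF o(1) S q])
 define p where "p = b -[vcpt P X m] q"
 have p: "p .: vcpt P X m" using o qc by (simp add: p_def)
 have dp: "df (val P X) m p : span A P X (hi S m) (m + 1)"
  unfolding p_def am_minus[OF G.ag G1.ag acxD(2)[OF val_acx[OF o(1)]] o(2) qc] by (rule dq)
 let ?S = "insert (X, m, p) S"
 have S': "cellset A P ?S" using S o p by (auto simp: cellset_def)
 \<comment> \<open>The correction \<open>q\<close> is supported on cells without coordinates outside
   \<open>G\<close>, so \<open>p\<close> and \<open>b\<close> have the same coordinates there; in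
   particular the coordinate of \<open>p\<close> at \<open>b\<close> is the identity.\<close>
 have cfp: "cf X m p \<gamma> = cf X m b \<gamma>" if \<gamma>: "\<gamma> : B - G" for \<gamma>
 proof -
  obtain Z k u where \<gamma>': "\<gamma> = (Z, k, u)" by (cases \<gamma>)
  have f: "functional R A P Z k (%Y n x. cf Y n x \<gamma>)" unfolding \<gamma>' by (rule functional_cf) (use \<gamma> \<gamma>' in auto)
  interpret H: agrp "dhom A X Z (m - k)" by (rule hom_ag[OF o(1) functionalD(1)[OF f]])
  have "cf X m q \<gamma> = 0[dhom A X Z (m - k)]"
   by (rule functional_span[OF f S o(1) _ q]) (use van[OF \<gamma>] \<gamma>' in auto)
  then show ?thesis
   unfolding p_def \<gamma>'
   using am_minus[OF G.ag H.ag lin_am[OF functionalD(2)[OF f o(1)]] o(2) qc]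
   functional_cl[OF f o(1,2) refl] \<gamma>' by (simp add: H.minus_eq)
 qed
 let ?c = "%Y n x. cf Y n x (X, m, b)"
 have fc: "functional R A P X m ?c" by (rule functional_cf[OF \<beta>(1)])
 have cp: "?c X m p = ident A X" using cfp[of "(X, m, b)"] \<beta> cf_basis[OF \<beta>(1) \<beta>(1)] by auto
 have dual': "EX c. dual R A P (?S - {s}) s c" if s: "s : ?S" for s
 proof (cases "s = (X, m, p)")
  case True
  have "dual R A P (?S - {s}) s ?c"
   unfolding dual_def True using fc cp van[of "(X, m, b)"] \<beta> by auto
  then show ?thesis by blast
 next
  case False
  then have sS: "s : S" using s by auto
  obtain Y l r where s': "s = (Y, l, r)" by (cases s)
  obtain c where c: "dual R A P (S - {s}) s c" using dual[OF sS] by blast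
  have f: "functional R A P Y l c" and cr: "c Y l r = ident A Y"
   and c0: "!!Z k u. (Z, k, u) : S - {s} ==> c Z k u = 0[dhom A Z Y (k - l)]"
   using c unfolding dual_def s' by fastforce+
  note Yo = functionalD(1)[OF f]
  have rc: "r .: vcpt P Y l" using S sS s' by (auto simp: cellset_def)
  define g where "g = c X m p"
  have g: "g .: dhom A X Y (m - l)" unfolding g_def by (rule functional_cl[OF f o(1) p refl])
  \<comment> \<open>The old functional may be nonzero on the new cell. Subtracting its value
    \<open>g\<close> there times the coordinate at \<open>b\<close> corrects this, and changes
    nothing on \<open>S\<close>, where that coordinate vanishes.\<close>
  define c' where "c' W n x = c W n x -[dhom A W Y (n - l)] cmp A W X Y (m - l) (n - m) g (?c W n x)" for W n x
  have f': "functional R A P Y l c'"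
   unfolding c'_def by (rule functional_diff[OF f fc g])
  have zero: "c' Z k u = c Z k u" if u: "(Z, k, u) : S" for Z k u
  proof -
   have oZ: "Z : Ob A" "u .: vcpt P Z k" using S u by (auto simp: cellset_def)
   interpret H: agrp "dhom A Z Y (k - l)" by (rule hom_ag[OF oZ(1) Yo])
   have "?c Z k u = 0[dhom A Z X (k - m)]" using van[of "(X, m, b)"] \<beta> u by auto
   moreover have "cmp A Z X Y (m - l) (k - m) g 0[dhom A Z X (k - m)] = 0[dhom A Z Y (k - l)]"
   by (rule am_0[OF hom_ag[OF oZ(1) o(1)] H.ag cmp_am_r[OF oZ(1) o(1) Yo g]]) simp
   ultimately show ?thesis
   using functional_cl[OF f oZ refl] by (simp add: c'_def H.minus_eq)
  qed
  have "c' X m p = 0[dhom A X Y (m - l)]"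
  proof -
   interpret H: agrp "dhom A X Y (m - l)" by (rule hom_ag[OF o(1) Yo])
   show ?thesis
   unfolding c'_def cp g_def[symmetric] using g comp_ident_right[OF o(1) Yo g] by (simp add: H.minus_eq H.r_neg)
  qed
  moreover have "c' Z k u = 0[dhom A Z Y (k - l)]" if "(Z, k, u) : S - {s}" for Z k u
   using zero[of Z k u] c0[OF that] that by simp
  ultimately have "c' Z k u = 0[dhom A Z Y (k - l)]" if "(Z, k, u) : ?S - {s}" for Z k u
   using that by blast
  then have "dual R A P (?S - {s}) s c'"
   unfolding dual_def s' using f' zero[of Y l r] sS cr s' by auto
  then show ?thesis by blast
 qed
 have dn': "df (val P Y) l r : span A P Y (hi ?S l) (l + 1)" if r: "(Y, l, r) : ?S" for Y l r
 proof -
  have sub: "hi S k <= hi ?S k" for k by (auto simp: hi_def)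
  show ?thesis
   using r dn[of Y l r] dp span_mono[OF sub[of l], of Y "l + 1"] span_mono[OF sub[of m], of X "m + 1"] by auto
 qed
 have "normal_cells R A P ?S"
  unfolding normal_cells_def using fin S' dual' dn' by auto
 moreover have "u : span A P Z ?S k" if "(Z, k, u) : insert (X, m, b) G" for Z k u
 proof (cases "(Z, k, u) : G")
  case True
  then show ?thesis using GS span_mono[of S ?S] by blast
 next
  case False
  then have e: "Z = X" "k = m" "u = b" using that by auto
  interpret W: additive_subgroup "span A P X ?S m" "vcpt P X m" by (rule span_sub[OF o(1) S'])
  have "p : span A P X ?S m" by (rule span_cell[OF S']) simp
  moreover have "q : span A P X ?S m" using q span_mono[of S ?S X m] by blast
  ultimately have "p +[vcpt P X m] q : span A P X ?S m" by (rule W.a_closed)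
  then show ?thesis unfolding e p_def using o qc by (simp add: G.add_diff_self)
 qed
 moreover have van': "cf Y l u \<gamma> = 0[bhom A Y l \<gamma>]" if "\<gamma> : B - insert (X, m, b) G" "(Y, l, u) : ?S" for \<gamma> Y l u
  using that van[of \<gamma> Y l u] cfp[of \<gamma>] cf_basis[OF \<beta>(1), of \<gamma>] by auto
 moreover have "ALL (Y, l, u):?S. cf Y l u \<gamma> = 0[bhom A Y l \<gamma>]" if "\<gamma> : B - insert (X, m, b) G" for \<gamma>
 proof
  fix s assume s: "s : ?S"
  obtain Y l u where "s = (Y, l, u)" by (cases s)
  then show "case s of (Y, l, u) => cf Y l u \<gamma> = 0[bhom A Y l \<gamma>]" using van'[OF that, of Y l u] s by simp
 qed
 moreover have "insert (X, m, b) G <= B" using fG \<beta> by blast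
 ultimately have "nf (insert (X, m, b) G) ?S"
  unfolding nf_def using fG(1) by blast
 then show ?thesis by blast
qed

text \<open>The differential of \<open>\<beta>\<close> involves finitely many basis elements of
  strictly lower level. These are absorbed first, by induction on the level; then the differential
  lies in the span of the normal cells and \<open>nf_insert\<close> applies.\<close>

lemma nf_extend:
 assumes con: "connective A"
 shows "\<beta> : B ==> nf G S ==> EX G' S'. nf G' S' & G <= G' & \<beta> : G'"
proof (induction "lev \<beta>" arbitrary: \<beta> G S rule: less_induct)
 case less
 obtain X m b where b: "\<beta> = (X, m, b)" by (cases \<beta>)
 obtain F where F: "finite F" "F <= {\<gamma> : B. lev \<gamma> < lev \<beta>}" "df (val P X) m b : span A P X F (m + 1)"
  using basis_diff_span[of X m b] less.prems(1) unfolding b by auto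
 \<comment> \<open>An inner induction over the finite set \<open>F\<close>: each absorption may
   enlarge \<open>G\<close> and \<open>S\<close>, so both are rebuilt at every step.\<close>
 have "EX G' S'. nf G' S' & G <= G' & F <= G'"
  using F(1,2)
 proof (induction F)
  case empty
  then show ?case using less.prems(2) by blast
 next
  case (insert \<gamma> F)
  then obtain G' S' where 1: "nf G' S'" "G <= G'" "F <= G'" by blast
  obtain G'' S'' where "nf G'' S''" "G' <= G''" "\<gamma> : G''"
   using less.hyps[OF _ _ 1(1), of \<gamma>] insert.prems by blast
  then show ?case using 1 by blast
 qed
 then obtain G' S' where G': "nf G' S'" "G <= G'" "F <= G'" by blast
 show ?case
 proof (cases "\<beta> : G'")
  case True
  then show ?thesis using G' by blast
 next
  case False
  have "cellset A P S'" "!!X m b. (X, m, b) : G' ==> b : span A P X S' m"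
   using G'(1) by (auto simp: nf_def normal_cells_def)
  moreover have "cellset A P F" "X : Ob A" using B_cells F(2) less.prems(1) b by (auto simp: cellset_def)
  ultimately have "df (val P X) m b : span A P X S' (m + 1)"
   using pairing.wspan_trans[OF pairing_yon _ _ _ F(3)] G'(3) by blast
  then show ?thesis
   using nf_insert[OF con G'(1), of X m b] less.prems(1) False G'(2) b by blast
 qed
qed

lemma nf_exists:
 assumes "connective A" "finite F" "F <= B"
 shows "EX G S. nf G S & F <= G"
 using assms(2,3)
proof (induction F)
 case empty
 have "nf {} {}" by (auto simp: nf_def normal_cells_def cellset_def)
 then show ?case by blast
next
 case (insert \<beta> F)
 then obtain G S where 1: "nf G S" "F <= G" "\<beta> : B" by blast
 obtain G' S' where "nf G' S'" "G <= G'" "\<beta> : G'" using nf_extend[OF assms(1) 1(3,1)] by blast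
 then show ?case using 1(2) by blast
qed

end

section \<open>Pairing twisted complexes\<close>

context twisted
begin

text \<open>The sign \<open>i\<close>, put on every component, converts the convention of
  \<open>tw_Hom\<close> into that of \<open>rt\<close>; the degree drops by \<open>i\<close> because
  the target sits in degree \<open>i\<close>.\<close>

lemma tw_right_diff:
 assumes X: "X : Ob A" and k: "k : sp T"
  and f: "!!l. l : sp T ==> f (l, i) .: dhom A T$l X (l - i + m)"
 shows "df (tw_Hom A T (in_degree A X i)) m f (k, i) =
  df (rt T (yon A X)) (m - i) (%l:sp T. sg (dhom A T$l X (l - i + m)) i (f (l, i))) k"
proof -
 interpret Y: twisted_right R A T "yon A X" by (rule tr_yon[OF X])
 note o = tob[OF k]
 let ?H = "dhom A T$k X (k - i + m + 1)"
 interpret H: agrp ?H by (rule hom_ag[OF o X])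
 have e: "l + (m - i) = l - i + m" "k + (m - i + 1) = k - i + m + 1" "l - i + m + (k - l + 1) = k - i + m + 1" for l by auto
 have df: "df (Hom A T$k X) (k - i + m) (f (k, i)) .: ?H"
  by (rule acx_cl[OF hom_acx[OF o X] f[OF k]]) simp
 have zf: "cmp A T$k X X (i - i + 1) (k - i + m) 0[dhom A X X 1] (f (k, i)) = 0[?H]"
  using am_0[OF hom_ag[OF X X] H.ag cmp_am_l[OF o X X f[OF k], of "k - i + m + 1" 1]] by simp
 have cf: "cmp A T$k T$l X (l - i + m) (k - l + 1) (f (l, i)) (tdiff T k l) .: ?H" if "l : sp T" for l
  by (rule cmp_cl[OF o tob[OF that] X f[OF that] td_cl[OF k that refl]]) simp
 have "df (tw_Hom A T (in_degree A X i)) m f (k, i) =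
  sg ?H i (df (Hom A T$k X) (k - i + m) (f (k, i))) +[?H]
   sg ?H (m + 1) (\<Oplus>[?H] l:sp T. cmp A T$k T$l X (l - i + m) (k - l + 1) (f (l, i)) (tdiff T k l))"
  using k zf cf by (simp add: tw_Hom_def in_degree_def Let_def H.minus_eq H.neg_signed)
 also have "... = df (rt T (yon A X)) (m - i) (%l:sp T. sg (dhom A T$l X (l - i + m)) i (f (l, i))) k"
 proof -
  have "df (Hom A T$k X) (k - i + m) (sg (dhom A T$k X (k - i + m)) i (f (k, i)))
   = sg ?H i (df (Hom A T$k X) (k - i + m) (f (k, i)))"
   by (rule am_sg[OF hom_ag[OF o X] H.ag acxD(2)[OF hom_acx[OF o X]] f[OF k]])
  moreover have "sg ?H (m - i + 1) (cmp A T$k T$l X (l - i + m) (k - l + 1)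
   (sg (dhom A T$l X (l - i + m)) i (f (l, i))) (tdiff T k l)) =
   sg ?H (m + 1) (cmp A T$k T$l X (l - i + m) (k - l + 1) (f (l, i)) (tdiff T k l))" if l: "l : sp T" for l
  proof -
   have "cmp A T$k T$l X (l - i + m) (k - l + 1)
   (sg (dhom A T$l X (l - i + m)) i (f (l, i))) (tdiff T k l) =
   sg ?H i (cmp A T$k T$l X (l - i + m) (k - l + 1) (f (l, i)) (tdiff T k l))"
   by (rule am_sg[OF hom_ag[OF tob[OF l] X] H.ag cmp_am_l[OF o tob[OF l] X td_cl[OF k l refl]] f[OF l]]) simp
   then show ?thesis using cf[OF l] by (simp add: H.sg_sg)
  qed
  ultimately show ?thesis
  proof -
   assume 1: "df (Hom A T$k X) (k - i + m) (sg (dhom A T$k X (k - i + m)) i (f (k, i)))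
   = sg ?H i (df (Hom A T$k X) (k - i + m) (f (k, i)))"
   and 2: "!!l. l : sp T ==> sg ?H (m - i + 1) (cmp A T$k T$l X (l - i + m) (k - l + 1)
   (sg (dhom A T$l X (l - i + m)) i (f (l, i))) (tdiff T k l)) =
   sg ?H (m + 1) (cmp A T$k T$l X (l - i + m) (k - l + 1) (f (l, i)) (tdiff T k l))"
   have "(\<Oplus>[?H] l:sp T. sg ?H (m - i + 1) (cmp A T$k T$l X (l - i + m) (k - l + 1)
   ((%l:sp T. sg (dhom A T$l X (l - i + m)) i (f (l, i))) l) (tdiff T k l))) =
   (\<Oplus>[?H] l:sp T. sg ?H (m + 1) (cmp A T$k T$l X (l - i + m) (k - l + 1) (f (l, i)) (tdiff T k l)))"
   using cf 2 by (intro H.finsum_cong') auto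
   also have "... = sg ?H (m + 1) (\<Oplus>[?H] l:sp T. cmp A T$k T$l X (l - i + m) (k - l + 1) (f (l, i)) (tdiff T k l))"
   by (rule sg_finsum[OF H.ag cf, symmetric])
   finally show ?thesis
   unfolding Y.rt_diff[OF k] yon_simps e using 1 k by simp
  qed
 qed
 finally show ?thesis .
qed

lemma htw_zero_right:
 assumes X: "X : Ob A" and h: "htw_zero A T (in_degree A X i)"
 shows "hz (rt T (yon A X)) (- i)"
proof (rule cohomology_zeroI)
 interpret Y: twisted_right R A T "yon A X" by (rule tr_yon[OF X])
 show "acx (rt T (yon A X))" by (rule Y.rt_acx)
 fix x assume x: "x .: cpt (rt T (yon A X)) (- i)"
  and dx: "df (rt T (yon A X)) (- i) x = 0[cpt (rt T (yon A X)) (- i + 1)]"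
 let ?T = "tw_Hom A T (in_degree A X i)"
 have xm: "x k .: dhom A T$k X (k - i)" if "k : sp T" for k
  using Y.rt_mem[OF x that, of "k - i"] by simp
 have ag: "agrp (dhom A T$k X n)" if "k : sp T" for k n by (rule hom_ag[OF tob[OF that] X])
 have cT: "carrier (cpt ?T m) = (\<Pi>\<^sub>E (k, j)\<in>sp T \<times> {i}. carrier (dhom A T$k X (k - j + m)))" for m
  by (simp add: tw_Hom_def in_degree_def split_beta')
 \<comment> \<open>It carries the sign that \<open>tw_right_diff\<close> introduces, so that the
   tuple compared there is \<open>x\<close> itself.\<close>
 define f where "f = (%(k, j):sp T \<times> {i}. sg (dhom A T$k X (k - i)) i (x k))"
 have fm: "f (k, i) .: dhom A T$k X (k - i)" if "k : sp T" for k
  using agrp.sg_cl[OF ag[OF that] xm[OF that]] that by (simp add: f_def)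
 have fc: "f .: cpt ?T 0"
  unfolding cT using agrp.sg_cl[OF ag xm] by (auto simp: f_def)
 have xf: "(%l:sp T. sg (dhom A T$l X (l - i + 0)) i (f (l, i))) = x"
 proof (rule Y.rt_ext[OF _ x])
  show sx: "(%l:sp T. sg (dhom A T$l X (l - i + 0)) i (f (l, i))) l = x l" if "l : sp T" for l
   using that agrp.sg_sg[OF ag xm, OF that that] by (simp add: f_def)
  show "(%l:sp T. sg (dhom A T$l X (l - i + 0)) i (f (l, i))) .: cpt (rt T (yon A X)) (- i)"
   unfolding Y.rt_cpt using sx xm by (simp add: Pi_iff)
 qed
 have "df ?T 0 f (k, i) = 0[dhom A T$k X (k - i + 1)]" if k: "k : sp T" for k
  using tw_right_diff[OF X k, of f i 0] fm dx k unfolding xf by (simp add: Y.rt_cpt algebra_simps)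
 then have "df ?T 0 f = 0[cpt ?T (0 + 1)]"
  by (auto simp: tw_Hom_def in_degree_def restrict_def fun_eq_iff Let_def)
 then have "f : cobd ?T 0"
  using h fc by (auto simp: htw_zero_def tw_def cohomology_zero_def cocycles_def)
 then obtain g where g: "g .: cpt ?T (-1)" "f = df ?T (-1) g" by (rule coboundariesE) auto
 have gm: "g (l, i) .: dhom A T$l X (l - i + - 1)" if "l : sp T" for l
  using PiE_mem[OF g(1)[unfolded cT], of "(l, i)"] that by simp
 define b where "b = (%l:sp T. sg (dhom A T$l X (l - i + - 1)) i (g (l, i)))"
 have b: "b .: cpt (rt T (yon A X)) (- i - 1)"
  unfolding Y.rt_cpt using agrp.sg_cl[OF ag gm] by (auto simp: b_def algebra_simps)
 have e: "- 1 - i = - i - 1" by simp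
 have Db: "df (rt T (yon A X)) (- i - 1) b k = sg (dhom A T$k X (k - i)) i (x k)" if k: "k : sp T" for k
  using tw_right_diff[OF X k gm] k unfolding g(2)[symmetric] b_def[symmetric] by (simp add: f_def e)
 interpret G: agrp "cpt (rt T (yon A X)) (- i)" by (rule acxD(1)[OF Y.rt_acx])
 interpret G1: agrp "cpt (rt T (yon A X)) (- i - 1)" by (rule acxD(1)[OF Y.rt_acx])
 have am: "amap (cpt (rt T (yon A X)) (- i - 1)) (cpt (rt T (yon A X)) (- i)) (df (rt T (yon A X)) (- i - 1))"
  using acxD(2)[OF Y.rt_acx, of "- i - 1"] by simp
 note Dbc = am_cl[OF am b]
 have "x = sg (cpt (rt T (yon A X)) (- i)) i (df (rt T (yon A X)) (- i - 1) b)"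
 proof (rule Y.rt_ext[OF x])
  show "sg (cpt (rt T (yon A X)) (- i)) i (df (rt T (yon A X)) (- i - 1) b) .: cpt (rt T (yon A X)) (- i)"
   using Dbc by simp
  show "x k = sg (cpt (rt T (yon A X)) (- i)) i (df (rt T (yon A X)) (- i - 1) b) k" if "k : sp T" for k
   using Y.rt_signed[OF that Dbc, of i] Db[OF that] agrp.sg_sg[OF ag xm, OF that that] by simp
 qed
 also have "... = df (rt T (yon A X)) (- i - 1) (sg (cpt (rt T (yon A X)) (- i - 1)) i b)"
  by (rule am_sg[OF G1.ag G.ag am b, symmetric])
 finally show "EX y:carrier (cpt (rt T (yon A X)) (- i - 1)). df (rt T (yon A X)) (- i - 1) y = x"
  using b by (intro bexI[of _ "sg (cpt (rt T (yon A X)) (- i - 1)) i b"]) auto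
qed

text \<open>On this side the conventions differ only by the global sign of the shift
  \<open>s\<close>.\<close>

lemma tw_left_diff:
 assumes X: "X : Ob A" and j: "j : sp T"
  and f: "!!l. l : sp T ==> f (i, l) .: dhom A X T$l (i - l + m)"
 shows "df (tw_Hom A (in_degree A X i) T) m f (i, j) =
  sg (dhom A X T$j (i - j + m + 1)) s (df (lt s T (Hom A X) (cmp A X)) (m + i - s) (%l:sp T. f (i, l)) j)"
proof -
 interpret V: left_dg R A "Hom A X" "cmp A X" by (rule left_dg_coyon[OF X])
 interpret L: twisted_left R A T "Hom A X" "cmp A X" s by unfold_locales
 note o = tob[OF j]
 let ?H = "dhom A X T$j (i - j + m + 1)"
 interpret H: agrp ?H by (rule hom_ag[OF X o])
 have e: "m + i - s + s - l = i - l + m" "m + i - s + 1 + s - j = i - j + m + 1" for l by auto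
 have df: "df (Hom A X T$j) (i - j + m) (f (i, j)) .: ?H"
  by (rule acx_cl[OF hom_acx[OF X o] f[OF j]]) simp
 have zf: "cmp A X X T$j (i - j + m) (i - i + 1) (f (i, j)) 0[dhom A X X 1] = 0[?H]"
  using am_0[OF hom_ag[OF X X] H.ag cmp_am_r[OF X X o f[OF j], of "i - j + m + 1" 1]] by simp
 have cf: "cmp A X T$l T$j (l - j + 1) (i - l + m) (tdiff T l j) (f (i, l)) .: ?H" if "l : sp T" for l
  by (rule cmp_cl[OF X tob[OF that] o td_cl[OF that j refl] f[OF that]]) simp
 have "df (tw_Hom A (in_degree A X i) T) m f (i, j) =
  sg ?H j (df (Hom A X T$j) (i - j + m) (f (i, j))) +[?H]
   (\<Oplus>[?H] l:sp T. cmp A X T$l T$j (l - j + 1) (i - l + m) (tdiff T l j) (f (i, l)))"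
  using j zf cf by (simp add: tw_Hom_def in_degree_def Let_def H.minus_eq)
 also have "... = sg ?H s (df (lt s T (Hom A X) (cmp A X)) (m + i - s) (%l:sp T. f (i, l)) j)"
 proof -
  have "sg ?H s (sg ?H (j + s) (df (Hom A X T$j) (i - j + m) (f (i, j)))) =
   sg ?H j (df (Hom A X T$j) (i - j + m) (f (i, j)))"
   using df by (simp add: H.sg_sg) (rule sg_parity, simp)
  moreover have "sg ?H s (sg ?H s (cmp A X T$l T$j (l - j + 1) (i - l + m) (tdiff T l j) (f (i, l)))) =
   cmp A X T$l T$j (l - j + 1) (i - l + m) (tdiff T l j) (f (i, l))" if "l : sp T" for l
   using cf[OF that] by (simp add: H.sg_sg)
  ultimately show ?thesis
  proof -
   let ?t = "%l. cmp A X T$l T$j (l - j + 1) (i - l + m) (tdiff T l j) (f (i, l))"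
   assume 1: "sg ?H s (sg ?H (j + s) (df (Hom A X T$j) (i - j + m) (f (i, j)))) =
   sg ?H j (df (Hom A X T$j) (i - j + m) (f (i, j)))"
   and 2: "!!l. l : sp T ==> sg ?H s (sg ?H s (?t l)) = ?t l"
   have 3: "(\<Oplus>[?H] l:sp T. sg ?H s (cmp A X T$l T$j (l - j + 1) (i - l + m) (tdiff T l j)
   ((%l:sp T. f (i, l)) l))) = (\<Oplus>[?H] l:sp T. sg ?H s (?t l))"
   using cf by (intro H.finsum_cong') auto
   have c: "(\<Oplus>[?H] l:sp T. sg ?H s (?t l)) .: ?H" using cf by (auto intro!: H.finsum_closed)
   have "sg ?H s (\<Oplus>[?H] l:sp T. sg ?H s (?t l)) = (\<Oplus>[?H] l:sp T. sg ?H s (sg ?H s (?t l)))"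
   by (rule sg_finsum[OF H.ag]) (use cf in auto)
   also have "... = (\<Oplus>[?H] l:sp T. ?t l)" using cf 2 by (intro H.finsum_cong') auto
   finally show ?thesis
   unfolding L.lt_diff[OF j] e 3 using 1 j df c by (simp add: H.sg_add)
  qed
 qed
 finally show ?thesis .
qed

lemma htw_zero_left:
 assumes X: "X : Ob A" and h: "htw_zero A (in_degree A X i) T"
 shows "hz (lt s T (Hom A X) (cmp A X)) (i - s)"
proof (rule cohomology_zeroI)
 interpret V: left_dg R A "Hom A X" "cmp A X" by (rule left_dg_coyon[OF X])
 interpret L: twisted_left R A T "Hom A X" "cmp A X" s by unfold_locales
 let ?L = "lt s T (Hom A X) (cmp A X)"
 show "acx ?L" by (rule L.lt_acx)
 fix x assume x: "x .: cpt ?L (i - s)" and dx: "df ?L (i - s) x = 0[cpt ?L (i - s + 1)]"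
 let ?T = "tw_Hom A (in_degree A X i) T"
 have xm: "x j .: dhom A X T$j (i - j)" if "j : sp T" for j
  using L.lt_mem[OF x that, of "i - j"] by simp
 have ag: "agrp (dhom A X T$k n)" if "k : sp T" for k n by (rule hom_ag[OF X tob[OF that]])
 have cT: "carrier (cpt ?T m) = (\<Pi>\<^sub>E (k, j)\<in>{i} \<times> sp T. carrier (dhom A X T$j (k - j + m)))" for m
  by (simp add: tw_Hom_def in_degree_def split_beta')
 have xr: "restrict x (sp T) = x" using x unfolding L.lt_cpt by (auto simp: PiE_def intro: extensional_restrict)
 define f where "f = (%(k, j):{i} \<times> sp T. x j)"
 have fx: "(%l:sp T. f (i, l)) = x" by (rule trans[OF _ xr]) (auto simp: f_def)
 have fc: "f .: cpt ?T 0" unfolding cT using xm by (auto simp: f_def)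
 have "df ?T 0 f (i, j) = 0[dhom A X T$j (i - j + 1)]" if j: "j : sp T" for j
 proof -
  have "df ?T 0 f (i, j) = sg (dhom A X T$j (i - j + 1)) s (df ?L (i - s) x j)"
   using tw_left_diff[OF X j, of f i 0 s] xm unfolding fx by (simp add: f_def)
  moreover have "df ?L (i - s) x j = 0[dhom A X T$j (i - j + 1)]"
   using dx j by (simp add: L.lt_cpt algebra_simps)
  ultimately show ?thesis using agrp.sg_0[OF ag[OF j]] by simp
 qed
 then have "df ?T 0 f = 0[cpt ?T (0 + 1)]"
  by (auto simp: tw_Hom_def in_degree_def restrict_def fun_eq_iff Let_def)
 then have "f : cobd ?T 0"
  using h fc by (auto simp: htw_zero_def tw_def cohomology_zero_def cocycles_def)
 then obtain g where g: "g .: cpt ?T (-1)" "f = df ?T (-1) g" by (rule coboundariesE) auto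
 have gm: "g (i, l) .: dhom A X T$l (i - l + - 1)" if "l : sp T" for l
  using PiE_mem[OF g(1)[unfolded cT], of "(i, l)"] that by simp
 define b where "b = (%l:sp T. g (i, l))"
 have b: "b .: cpt ?L (i - s - 1)"
  unfolding L.lt_cpt using gm by (auto simp: b_def algebra_simps)
 have Db: "sg (dhom A X T$k (i - k)) s (df ?L (i - s - 1) b k) = x k" if k: "k : sp T" for k
  using tw_left_diff[OF X k gm, where s = s] k unfolding g(2)[symmetric] b_def[symmetric] by (simp add: f_def algebra_simps)
 interpret G: agrp "cpt ?L (i - s)" by (rule acxD(1)[OF L.lt_acx])
 interpret G1: agrp "cpt ?L (i - s - 1)" by (rule acxD(1)[OF L.lt_acx])
 have am: "amap (cpt ?L (i - s - 1)) (cpt ?L (i - s)) (df ?L (i - s - 1))"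
  using acxD(2)[OF L.lt_acx, of "i - s - 1"] by simp
 note Dbc = am_cl[OF am b]
 have ev: "amap (cpt ?L (i - s)) (dhom A X T$k (i - k)) (%x. x k)" if "k : sp T" for k
  using pm_eval[OF that, of "%j. dhom A X T$j (i - s + s - j)"] by (simp add: L.lt_cpt)
 have "sg (cpt ?L (i - s)) s (df ?L (i - s - 1) b) = x"
 proof (rule PiE_ext)
  show "sg (cpt ?L (i - s)) s (df ?L (i - s - 1) b) : (\<Pi>\<^sub>E j\<in>sp T. carrier (dhom A X T$j (i - s + s - j)))"
   using G.sg_cl[OF Dbc] unfolding L.lt_cpt by simp
  show "x : (\<Pi>\<^sub>E j\<in>sp T. carrier (dhom A X T$j (i - s + s - j)))"
   using x unfolding L.lt_cpt by simp
  show "sg (cpt ?L (i - s)) s (df ?L (i - s - 1) b) k = x k" if k: "k : sp T" for k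
   using am_sg[OF G.ag ag[OF k] ev[OF k] Dbc, of s] Db[OF k] by simp
 qed
 also have "sg (cpt ?L (i - s)) s (df ?L (i - s - 1) b) = df ?L (i - s - 1) (sg (cpt ?L (i - s - 1)) s b)"
  by (rule am_sg[OF G1.ag G.ag am b, symmetric])
 finally show "EX y:carrier (cpt ?L (i - s - 1)). df ?L (i - s - 1) y = x"
  using b by (intro bexI[of _ "sg (cpt ?L (i - s - 1)) s b"]) auto
qed

end

section \<open>Evaluating morphisms from T on T with coefficients\<close>

locale twisted_pairing = twisted R A T + pairing R A P V la C pr
 for R :: "'k ring" and A :: "('o, 'k, 'a) dgcat" and T :: "('o, 'a) twisted" and P :: "('o, 'k, 'a, 'p) dgmod"
  and V :: "'o => ('k, 'n) cochain" and la and C :: "('k, 'c) cochain" and pr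
begin

sublocale tr: twisted_right R A T P by unfold_locales
sublocale tl: twisted_left R A T V la 0 by unfold_locales

abbreviation "TP == rt T P"
abbreviation "TV == lt 0 T V la"

text \<open>The map from \<open>Hom(T, P) \<otimes> (T \<otimes> V)\<close> to
  \<open>P \<otimes> V\<close>, written in components. It turns a primitive of a closed morphism
  from \<open>T\<close> to \<open>P\<close> into a primitive in \<open>C\<close>.\<close>

definition tpair :: "int => int => (int => 'p) => (int => 'n) => 'c" where
 "tpair m l x y = (\<Oplus>[cpt C (m + l)] k:sp T. pr T$k (k + m) (l - k) (x k) (y k))"

lemma TV_mem: "y .: cpt TV l ==> k : sp T ==> j = l - k ==> y k .: cpt (V T$k) j"
 using tl.lt_mem[of y l k j] by simp

lemma tpair_term:
 "x .: cpt TP m ==> y .: cpt TV l ==> k : sp T ==> n = m + l ==>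
 pr T$k (k + m) (l - k) (x k) (y k) .: cpt C n"
 by (intro pr_cl tob tr.rt_mem TV_mem) auto

lemma tpair_closed: "x .: cpt TP m ==> y .: cpt TV l ==> n = m + l ==> tpair m l x y .: cpt C n"
proof -
 interpret G: agrp "cpt C (m + l)" by (rule C_ag)
 show "x .: cpt TP m ==> y .: cpt TV l ==> n = m + l ==> tpair m l x y .: cpt C n"
  using tpair_term by (auto simp: tpair_def intro!: G.finsum_closed)
qed

lemma tpair_leibniz:
 assumes x: "x .: cpt TP m" and y: "y .: cpt TV l"
 shows "df C (m + l) (tpair m l x y) = tpair (m + 1) l (df TP m x) y +[cpt C (m + l + 1)]
  sg (cpt C (m + l + 1)) m (tpair m (l + 1) x (df TV l y))"
proof -
 let ?G = "cpt C (m + l + 1)"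
 interpret G0: agrp "cpt C (m + l)" by (rule C_ag)
 interpret G: agrp ?G by (rule C_ag)
 define e where "e k = pr T$k (k + m + 1) (l - k) (df (val P T$k) (k + m) (x k)) (y k)" for k
 define f where "f k = pr T$k (k + m) (l - k + 1) (x k) (df (V T$k) (l - k) (y k))" for k
 \<comment> \<open>The terms through a structure map of \<open>T\<close>. By balancing, the same
   term comes from differentiating either argument, with signs \<open>m + 1\<close> and
   \<open>m\<close>; hence they cancel in the Leibniz rule.\<close>
 define g where "g k j = pr T$j (j + m) (l - j + 1) (x j) (la T$k T$j (k - j + 1) (l - k) (tdiff T k j) (y k))" for k j
 have xm: "x k .: vcpt P T$k (k + m)" if "k : sp T" for k by (rule tr.rt_mem[OF x that refl])
 have ym: "y k .: cpt (V T$k) (l - k)" if "k : sp T" for k by (rule TV_mem[OF y that refl])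
 have dxm: "df (val P T$k) (k + m) (x k) .: vcpt P T$k (k + m + 1)" if "k : sp T" for k
  by (rule acx_cl[OF val_acx[OF tob[OF that]] xm[OF that] refl])
 have dym: "df (V T$k) (l - k) (y k) .: cpt (V T$k) (l - k + 1)" if "k : sp T" for k
  by (rule acx_cl[OF L.lv_acx[OF tob[OF that]] ym[OF that] refl])
 have ay: "la T$k T$j (k - j + 1) (l - k) (tdiff T k j) (y k) .: cpt (V T$j) (l - j + 1)"
  if "k : sp T" "j : sp T" for k j
  by (rule L.la_cl[OF tob[OF that(1)] tob[OF that(2)] td_cl[OF that refl] ym[OF that(1)]]) simp
 have xa: "act P T$k T$j (j + m) (k - j + 1) (x j) (tdiff T k j) .: vcpt P T$k (k + m + 1)"
  if "k : sp T" "j : sp T" for k j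
  by (rule act_cl[OF tob[OF that(1)] tob[OF that(2)] xm[OF that(2)] td_cl[OF that refl]]) simp
 have em: "e k .: ?G" if "k : sp T" for k
  unfolding e_def by (rule pr_cl[OF tob[OF that] dxm[OF that] ym[OF that]]) simp
 have fm: "f k .: ?G" if "k : sp T" for k
  unfolding f_def by (rule pr_cl[OF tob[OF that] xm[OF that] dym[OF that]]) simp
 have gm: "g k j .: ?G" if "k : sp T" "j : sp T" for k j
  unfolding g_def by (rule pr_cl[OF tob[OF that(2)] xm[OF that(2)] ay[OF that]]) simp
 have gb: "pr T$k (k + m + 1) (l - k) (act P T$k T$j (j + m) (k - j + 1) (x j) (tdiff T k j)) (y k) = g k j"
  if "k : sp T" "j : sp T" for k j
  unfolding g_def
  by (rule pr_balanced[OF tob[OF that(1)] tob[OF that(2)] xm[OF that(2)] td_cl[OF that refl] ym[OF that(1)]]) auto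
 define E where "E = (\<Oplus>[?G] k:sp T. e k)"
 define F where "F = (\<Oplus>[?G] k:sp T. sg ?G (m + k) (f k))"
 define W where "W = (\<Oplus>[?G] k:sp T. \<Oplus>[?G] j:sp T. g k j)"
 have EFW: "E .: ?G" "F .: ?G" "W .: ?G"
  unfolding E_def F_def W_def using em fm gm by (auto intro!: G.finsum_closed G.sg_cl)
 have ml: "m + 1 + l = m + l + 1" "m + (l + 1) = m + l + 1" by simp_all
 have 1: "df C (m + l) (tpair m l x y) = E +[?G] F"
 proof -
  have "df C (m + l) (tpair m l x y) = (\<Oplus>[?G] k:sp T. df C (m + l) (pr T$k (k + m) (l - k) (x k) (y k)))"
   unfolding tpair_def by (rule am_finsum[OF G0.ag G.ag C_addmap]) (rule tpair_term[OF x y _ refl])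
  also have "... = (\<Oplus>[?G] k:sp T. e k +[?G] sg ?G (m + k) (f k))"
  proof (rule G.finsum_cong')
   fix k assume k: "k : sp T"
   show "df C (m + l) (pr T$k (k + m) (l - k) (x k) (y k)) = e k +[?G] sg ?G (m + k) (f k)"
   unfolding e_def f_def add.commute[of m k]
   by (rule pr_leibniz[OF tob[OF k] xm[OF k] ym[OF k]]) auto
  qed (use em fm in auto)
  also have "... = E +[?G] F"
   unfolding E_def F_def by (rule G.finsum_addf) (use em fm in auto)
  finally show ?thesis .
 qed
 have 2: "tpair (m + 1) l (df TP m x) y = E +[?G] sg ?G (m + 1) W"
 proof -
  have "pr T$k (k + (m + 1)) (l - k) (df TP m x k) (y k) = e k +[?G] (\<Oplus>[?G] j:sp T. sg ?G (m + 1) (g k j))"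
   if k: "k : sp T" for k
  proof -
   let ?H = "vcpt P T$k (k + m + 1)"
   interpret H: agrp ?H by (rule val_ag[OF tob[OF k]])
   have c: "k + (m + 1) = k + m + 1" by simp
   have am: "amap ?H ?G (%x. pr T$k (k + m + 1) (l - k) x (y k))"
   by (rule pr_am_l[OF tob[OF k] ym[OF k]]) simp
   have "pr T$k (k + m + 1) (l - k) (\<Oplus>[?H] j:sp T. sg ?H (m + 1) (act P T$k T$j (j + m) (k - j + 1) (x j) (tdiff T k j))) (y k)
   = (\<Oplus>[?G] j:sp T. sg ?G (m + 1) (g k j))"
   using xa[OF k] gm[OF k] by (subst am_finsum[OF H.ag G.ag am])
   (auto simp: am_sg[OF H.ag G.ag am] gb[OF k] intro!: G.finsum_cong')
   moreover have "(\<Oplus>[?H] j:sp T. sg ?H (m + 1) (act P T$k T$j (j + m) (k - j + 1) (x j) (tdiff T k j))) .: ?H"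
   using xa[OF k] by (auto intro!: H.finsum_closed)
   ultimately show ?thesis
   unfolding tr.rt_diff[OF k] c e_def using am_add[OF am dxm[OF k]] by simp
  qed
  then have "tpair (m + 1) l (df TP m x) y = (\<Oplus>[?G] k:sp T. e k +[?G] (\<Oplus>[?G] j:sp T. sg ?G (m + 1) (g k j)))"
   unfolding tpair_def ml using em gm by (intro G.finsum_cong') (auto intro!: G.finsum_closed)
  also have "... = E +[?G] (\<Oplus>[?G] k:sp T. \<Oplus>[?G] j:sp T. sg ?G (m + 1) (g k j))"
   unfolding E_def by (rule G.finsum_addf) (use em gm in \<open>auto intro!: G.finsum_closed\<close>)
  also have "(\<Oplus>[?G] k:sp T. \<Oplus>[?G] j:sp T. sg ?G (m + 1) (g k j)) = sg ?G (m + 1) W"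
   unfolding W_def using gm
   by (subst sg_finsum[OF G.ag]) (auto intro!: G.finsum_closed G.finsum_cong' simp: sg_finsum[OF G.ag])
  finally show ?thesis .
 qed
 have 3: "sg ?G m (tpair m (l + 1) x (df TV l y)) = F +[?G] sg ?G m W"
 proof -
  have "pr T$j (j + m) (l + 1 - j) (x j) (df TV l y j) = sg ?G j (f j) +[?G] (\<Oplus>[?G] k:sp T. g k j)"
   if j: "j : sp T" for j
  proof -
   let ?H = "cpt (V T$j) (l - j + 1)"
   interpret H: agrp ?H by (rule L.lval_ag[OF tob[OF j]])
   have c: "l + 1 - j = l - j + 1" "l + 1 + 0 - j = l - j + 1" "l + 0 - k = l - k" "j + 0 = j" for k by simp_all
   have am: "amap ?H ?G (pr T$j (j + m) (l - j + 1) (x j))"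
   by (rule pr_am_r[OF tob[OF j] xm[OF j]]) simp
   have "pr T$j (j + m) (l - j + 1) (x j) (\<Oplus>[?H] k:sp T. la T$k T$j (k - j + 1) (l - k) (tdiff T k j) (y k))
   = (\<Oplus>[?G] k:sp T. g k j)"
   using ay[OF _ j] by (subst am_finsum[OF H.ag G.ag am]) (auto simp: g_def)
   moreover have "(\<Oplus>[?H] k:sp T. la T$k T$j (k - j + 1) (l - k) (tdiff T k j) (y k)) .: ?H"
   using ay[OF _ j] by (auto intro!: H.finsum_closed)
   ultimately show ?thesis
   unfolding tl.lt_diff[OF j] c f_def
   using am_add[OF am H.sg_cl[OF dym[OF j]]] am_sg[OF H.ag G.ag am dym[OF j]] by simp
  qed
  then have "tpair m (l + 1) x (df TV l y) = (\<Oplus>[?G] j:sp T. sg ?G j (f j) +[?G] (\<Oplus>[?G] k:sp T. g k j))"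
   unfolding tpair_def ml using fm gm by (intro G.finsum_cong') (auto intro!: G.finsum_closed)
  also have "... = (\<Oplus>[?G] j:sp T. sg ?G j (f j)) +[?G] (\<Oplus>[?G] j:sp T. \<Oplus>[?G] k:sp T. g k j)"
   by (rule G.finsum_addf) (use fm gm in \<open>auto intro!: G.finsum_closed\<close>)
  also have "(\<Oplus>[?G] j:sp T. \<Oplus>[?G] k:sp T. g k j) = W"
   unfolding W_def by (rule G.finsum_swap) (use tfin gm in auto)
  finally have "sg ?G m (tpair m (l + 1) x (df TV l y)) =
   sg ?G m (\<Oplus>[?G] j:sp T. sg ?G j (f j)) +[?G] sg ?G m W"
   using fm EFW by (simp add: G.sg_add G.finsum_closed)
  also have "sg ?G m (\<Oplus>[?G] j:sp T. sg ?G j (f j)) = F"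
   unfolding F_def using fm by (auto simp: sg_finsum[OF G.ag] G.sg_sg intro!: G.finsum_cong')
  finally show ?thesis .
 qed
 show ?thesis
  unfolding 1 2 3 using EFW G.signed_cancel'[of W F "m + 1" m]
  by (simp add: G.a_assoc G.a_comm[of F])
qed

lemma tpair_addmap:
 assumes y: "y .: cpt TV l" and n: "n = m + l"
 shows "amap (cpt TP m) (cpt C n) (%x. tpair m l x y)"
proof (rule amI)
 interpret G: agrp "cpt C (m + l)" by (rule C_ag)
 fix x x' assume x: "x .: cpt TP m" and x': "x' .: cpt TP m"
 show "tpair m l x y .: cpt C n" by (rule tpair_closed[OF x y n])
 have "pr T$k (k + m) (l - k) ((x +[cpt TP m] x') k) (y k) =
  pr T$k (k + m) (l - k) (x k) (y k) +[cpt C (m + l)] pr T$k (k + m) (l - k) (x' k) (y k)" if k: "k : sp T" for k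
  unfolding tr.rt_add[OF k]
  using am_add[OF pr_am_l[OF tob[OF k] TV_mem[OF y k refl]] tr.rt_mem[OF x k refl] tr.rt_mem[OF x' k refl]] by simp
 then have "tpair m l (x +[cpt TP m] x') y = (\<Oplus>[cpt C (m + l)] k:sp T.
   pr T$k (k + m) (l - k) (x k) (y k) +[cpt C (m + l)] pr T$k (k + m) (l - k) (x' k) (y k))"
  unfolding tpair_def using tpair_term[OF x y _ refl] tpair_term[OF x' y _ refl] by (intro G.finsum_cong') auto
 also have "... = tpair m l x y +[cpt C n] tpair m l x' y"
  unfolding tpair_def n by (rule G.finsum_addf) (use tpair_term[OF x y _ refl] tpair_term[OF x' y _ refl] in auto)
 finally show "tpair m l (x +[cpt TP m] x') y = tpair m l x y +[cpt C n] tpair m l x' y" .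
qed

end

section \<open>The upper bound\<close>

lemma hi_none:
 assumes "finite S"
 shows "EX b>=a. hi S b = {}"
proof -
 let ?D = "insert a (deg ` S)"
 have le: "x <= Max ?D" if "x : ?D" for x using assms that by (intro Max_ge) auto
 have "deg s <= Max ?D" if "s : S" for s using le[of "deg s"] that by simp
 then show ?thesis using le[of a] by (intro exI[of _ "Max ?D"]) (force simp: hi_def simp del: Max_ge_iff)
qed

lemma (in left_dg) la_coboundary:
 assumes o: "X : Ob A" "Y : Ob A" and f: "f : Z0 A X Y" and y: "y : cobd (V X) n"
 shows "la X Y 0 n f y : cobd (V Y) n"
proof -
 obtain u where u: "u .: cpt (V X) (n - 1)" "y = df (V X) (n - 1) u" by (rule coboundariesE[OF y refl])
 have fc: "f .: dhom A X Y 0" "df (Hom A X Y) 0 f = 0[dhom A X Y 1]" using f by (auto simp: cocycles_def)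
 interpret G: agrp "cpt (V Y) n" by (rule lval_ag[OF o(2)])
 have z: "la X Y 1 (n - 1) 0[dhom A X Y 1] u = 0[cpt (V Y) n]"
  by (rule am_0[OF hom_ag[OF o] G.ag la_am_l[OF o u(1)]]) simp
 have yc: "y .: cpt (V X) n" unfolding u(2) by (rule acx_cl[OF lv_acx[OF o(1)] u(1)]) simp
 have "la X Y 0 n f y .: cpt (V Y) n" by (rule la_cl[OF o fc(1) yc]) simp
 moreover have "df (V Y) (n - 1) (la X Y 0 (n - 1) f u) = la X Y 1 (n - 1) (df (Hom A X Y) 0 f) u +[cpt (V Y) n]
   sg (cpt (V Y) n) 0 (la X Y 0 n f (df (V X) (n - 1) u))"
  by (rule la_leibniz'[OF o fc(1) u(1)]) auto
 ultimately have "la X Y 0 n f y = df (V Y) (n - 1) (la X Y 0 (n - 1) f u)"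
  using fc(2) z u(2) by simp
 moreover have "la X Y 0 (n - 1) f u .: cpt (V Y) (n - 1)" by (rule la_cl[OF o fc(1) u(1)]) simp
 ultimately show ?thesis by (simp add: coboundariesI)
qed

section \<open>Complete removal of cells and comparison of coefficients\<close>

context pairing
begin

lemma wspan_empty: "x : wspan {} n ==> x = 0[cpt C n]"
 unfolding wsp_def by (erule gsp.cases) auto

lemma peel_all:
 assumes nc: "normal_cells R A P S"
  and ac: "!!X m p. (X, m, p) : S ==> a < m ==> hz (V X) (n - m)"
  and x: "x : wspan (hi S a) n" "df C n x = 0[cpt C (n + 1)]"
 shows "EX q:wspan (hi S a) (n - 1). df C (n - 1) q = x"
proof -
 have fin: "finite S" and cs: "cellset A P S" using nc by (auto simp: normal_cells_def)
 note cs' = cells_sub[OF cs hi_subset]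
 obtain b where b: "a <= b" "hi S b = {}" using hi_none[OF fin] by blast
 interpret G: agrp "cpt C n" by (rule C_ag)
 have "df C n x : wspan (hi S b) (n + 1)"
  unfolding x(2) by (rule additive_subgroup.zero_closed[OF wspan_sub[OF cs']])
 then obtain q where q: "q : wspan (hi S a) (n - 1)" "x -[cpt C n] df C (n - 1) q : wspan (hi S b) n"
  using peel_cells[OF nc _ b(1) x(1)] ac by blast
 have "df C (n - 1) q .: cpt C n" using am_cl[OF C_addmap'] wspan_cl[OF cs' q(1)] by blast
 then show ?thesis
  using wspan_empty q wspan_cl[OF cs' x(1)] G.minus_eq_zero_iff unfolding b(2) by metis
qed

text \<open>Let \<open>u\<close> be the coefficient of the cell in \<open>r\<close>. The cell enters
  the differential of \<open>r\<close> only through the differential of \<open>u\<close>, as the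
  cells of degree at least \<open>m\<close> have differentials in degrees above \<open>m\<close>. If
  \<open>h\<close> cancels this coefficient, it is that differential up to sign.\<close>

lemma coefficient_boundary:
 assumes nc: "normal_cells R A P S" and s: "(X, m, p) : S" and r: "r : wspan (hi S (m - 1)) n"
  and h: "h .: cpt (V X) (n + 1 - m)"
  and e: "df C n r +[cpt C (n + 1)] pr X m (n + 1 - m) p h : wspan (S - {(X, m, p)}) (n + 1)"
 shows "h : cobd (V X) (n + 1 - m)"
proof -
 let ?s = "(X, m, p)" and ?G = "cpt C (n + 1)" and ?K = "cpt (V X) (n + 1 - m)"
 have cs: "cellset A P S" and dual: "EX c. dual R A P (S - {?s}) ?s c"
  and dn: "!!X m p. (X, m, p) : S ==> df (val P X) m p : span A P X (hi S m) (m + 1)"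
  using nc s by (auto simp: normal_cells_def)
 have o: "X : Ob A" "p .: vcpt P X m" using cs s by (auto simp: cellset_def)
 have cs': "cellset A P (S - {?s})" "cellset A P (hi S (m - 1) - {?s})" by (rule cells_sub[OF cs]; auto simp: hi_def)+
 interpret G0: agrp "cpt C n" by (rule C_ag)
 interpret G: agrp ?G by (rule C_ag)
 interpret K: agrp ?K by (rule L.lval_ag[OF o(1)])
 interpret W: additive_subgroup "wspan (S - {?s}) (n + 1)" ?G by (rule wspan_sub[OF cs'(1)])
 \<comment> \<open>The cell has degree \<open>m\<close>, so it belongs to
   \<open>hi S (m - 1)\<close>; singling it out exposes its coefficient in \<open>r\<close>.\<close>
 have ins: "insert ?s (hi S (m - 1) - {?s}) = hi S (m - 1)" using s by (auto simp: hi_def)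
 have "cellset A P (insert ?s (hi S (m - 1) - {?s}))" unfolding ins by (rule cells_sub[OF cs hi_subset])
 then obtain v u where v: "v : wspan (hi S (m - 1) - {?s}) n" and u: "u .: cpt (V X) (n - m)"
  and r': "r = v +[cpt C n] pr X m (n - m) p u"
  using wspan_insert[of X m p "hi S (m - 1) - {?s}" r n] r unfolding ins by blast
 have du: "df (V X) (n - m) u .: ?K" by (rule acx_cl[OF L.lv_acx[OF o(1)] u]) simp
 have dv: "df C n v : wspan (S - {?s}) (n + 1)"
 proof (rule wspan_diff[OF cs'(2) _ cs'(1) _ v])
  fix Y l q assume "(Y, l, q) : hi S (m - 1) - {?s}"
  then have "(Y, l, q) : S" "hi S l <= S - {?s}" by (auto simp: hi_def)
  then show "df (val P Y) l q : span A P Y (S - {?s}) (l + 1)" using dn span_mono by blast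
 qed (auto simp: hi_def)
 have "hi S m <= S - {?s}" by (auto simp: hi_def)
 then have "df (val P X) m p : span A P X (S - {?s}) (m + 1)" using dn[OF s] span_mono by blast
 then have dp: "pr X (m + 1) (n - m) (df (val P X) m p) u : wspan (S - {?s}) (n + 1)"
  by (rule span_pr[OF cs'(1) _ o(1) u]) simp
 have pc: "pr X m (n - m) p u .: cpt C n" by (rule pr_cl[OF o u]) simp
 have vc: "v .: cpt C n" by (rule wspan_cl[OF cs'(2) v])
 have am: "amap ?K ?G (pr X m (n + 1 - m) p)" by (rule pr_am_r[OF o]) simp
 have "df C n (pr X m (n - m) p u) = pr X (m + 1) (n - m) (df (val P X) m p) u +[?G]
   sg ?G m (pr X m (n + 1 - m) p (df (V X) (n - m) u))"
  by (rule pr_leibniz[OF o u]) auto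
 moreover have "sg ?G m (pr X m (n + 1 - m) p (df (V X) (n - m) u)) = pr X m (n + 1 - m) p (sg ?K m (df (V X) (n - m) u))"
  by (rule am_sg[OF K.ag G.ag am du, symmetric])
 ultimately have dr: "df C n r = df C n v +[?G] (pr X (m + 1) (n - m) (df (val P X) m p) u +[?G]
   pr X m (n + 1 - m) p (sg ?K m (df (V X) (n - m) u)))"
  unfolding r' am_add[OF C_addmap vc pc] by simp
 define E where "E = df C n v +[?G] pr X (m + 1) (n - m) (df (val P X) m p) u"
 have E: "E : wspan (S - {?s}) (n + 1)" unfolding E_def by (rule W.a_closed[OF dv dp])
 let ?h = "sg ?K m (df (V X) (n - m) u) +[?K] h"
 have hc: "?h .: ?K" using du h by simp
 have hp: "pr X m (n + 1 - m) p ?h .: ?G" by (rule am_cl[OF am hc])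
 have "df C n r +[?G] pr X m (n + 1 - m) p h = E +[?G] pr X m (n + 1 - m) p ?h"
  unfolding dr E_def am_add[OF am K.sg_cl[OF du] h]
  using W.a_subset dv dp am_cl[OF am K.sg_cl[OF du]] am_cl[OF am h] by (simp add: G.a_assoc subset_iff)
 then have 1: "E +[?G] pr X m (n + 1 - m) p ?h : wspan (S - {?s}) (n + 1)" using e by simp
 have "pr X m (n + 1 - m) p ?h = -[?G] E +[?G] (E +[?G] pr X m (n + 1 - m) p ?h)"
  using hp E W.a_subset by (simp add: G.r_neg1 subset_iff)
 then have "pr X m (n + 1 - m) p ?h : wspan (S - {?s}) (n + 1)"
  using W.a_closed[OF W.a_inv_closed[OF E] 1] by simp
 then have "?h = 0[?K]" using dual pr_inj[OF _ cs'(1) o(2) hc] by (metis add.commute diff_add_cancel)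
 then have "h = -[?K] sg ?K m (df (V X) (n - m) u)"
  using h du by (metis K.minus_equality K.a_comm K.minus_minus K.sg_cl)
 moreover interpret B: additive_subgroup "cobd (V X) (n + 1 - m)" ?K by (rule cobd_sub[OF L.lv_acx[OF o(1)]])
 have "df (V X) (n - m) u : cobd (V X) (n + 1 - m)" by (rule coboundariesI[OF u]) simp
 then have "-[?K] sg ?K m (df (V X) (n - m) u) : cobd (V X) (n + 1 - m)"
  using asub_sg[OF K.ag B.additive_subgroup_axioms du] B.a_inv_closed by blast
 ultimately show ?thesis by simp
qed

end

section \<open>Morphisms from T, component by component\<close>

context twisted_right
begin

lemma act_tdiff_zero:
 assumes "i : sp T" "k : sp T" "k <= i" "x .: vcpt M T$k l" "j = l + (i - k + 1)"
 shows "act M T$i T$k l (i - k + 1) x (tdiff T i k) = 0[vcpt M T$i j]"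
 unfolding tdiff_zero[OF assms(1-3)]
 by (rule am_0[OF hom_ag[OF tob tob] val_ag[OF tob] act_am_r[OF tob tob assms(4,5)]]) (use assms in auto)

text \<open>Structure maps only carry components to smaller indices. For a tuple living in indices
  \<open>0\<close> and \<open>1\<close> the sole off-diagonal contribution is therefore the one of
  \<open>tdiff T 0 1\<close>.\<close>

lemma rt_diff_low:
 assumes pos: "sp T <= {0..}" and i: "0 : sp T" "1 : sp T" and x: "x .: cpt (rt T M) n"
  and x0: "!!k. k : sp T ==> 2 <= k ==> x k = 0[vcpt M T$k (k + n)]"
 shows "df (rt T M) n x 0 = df (val M T$0) n (x 0) +[vcpt M T$0 (n + 1)]
   sg (vcpt M T$0 (n + 1)) (n + 1) (act M T$0 T$1 (1 + n) 0 (x 1) (tdiff T 0 1))" (is ?A)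
  and "df (rt T M) n x 1 = df (val M T$1) (1 + n) (x 1)" (is ?B)
  and "!!k. k : sp T ==> 2 <= k ==> df (rt T M) n x k = 0[vcpt M T$k (k + (n + 1))]"
proof -
 have z: "act M T$i T$k (k + n) (i - k + 1) (x k) (tdiff T i k) = 0[vcpt M T$i (i + (n + 1))]"
  if "i : sp T" "k : sp T" "k <= i \<or> 2 <= k" for i k
 proof (cases "k <= i")
  case True
  then show ?thesis using that by (intro act_tdiff_zero rt_mem[OF x]) auto
 next
  case False
  then have "x k = 0[vcpt M T$k (k + n)]" using that x0 by auto
  then show ?thesis
   using am_0[OF val_ag[OF tob[OF that(2)]] val_ag[OF tob[OF that(1)]] act_am_l[OF tob[OF that(1)] tob[OF that(2)]
   td_cl[OF that(1,2) refl]], of "i + (n + 1)" "k + n"] by simp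
 qed
 have am: "abelian_monoid (vcpt M T$k l)" "agrp (vcpt M T$k l)" if "k : sp T" for k l
  using val_ag[OF tob[OF that], of l] by (auto simp: agrp_def abelian_group_def)
 have dx: "df (val M T$k) (k + n) (x k) .: vcpt M T$k (k + (n + 1))" if "k : sp T" for k
  by (rule acx_cl[OF val_acx[OF tob[OF that]] rt_mem[OF x that refl]]) simp
 have sum0: "(\<Oplus>[vcpt M T$i (i + (n + 1))] k:sp T. sg (vcpt M T$i (i + (n + 1))) (n + 1)
   (act M T$i T$k (k + n) (i - k + 1) (x k) (tdiff T i k))) = 0[vcpt M T$i (i + (n + 1))]"
  if "i : sp T" "1 <= i" for i
 proof (rule abelian_monoid.finsum_all_0[OF am(1)[OF that(1)]])
  fix k assume k: "k : sp T"
  have "k <= i \<or> 2 <= k" using that(2) by linarith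
  then show "sg (vcpt M T$i (i + (n + 1))) (n + 1)
   (act M T$i T$k (k + n) (i - k + 1) (x k) (tdiff T i k)) = 0[vcpt M T$i (i + (n + 1))]"
   using z[OF that(1) k] agrp.sg_0[OF am(2)[OF that(1)]] by simp
 qed
 let ?H = "vcpt M T$0 (0 + (n + 1))"
 have "(\<Oplus>[?H] k:sp T. sg ?H (n + 1) (act M T$0 T$k (k + n) (0 - k + 1) (x k) (tdiff T 0 k))) =
  sg ?H (n + 1) (act M T$0 T$1 (1 + n) (0 - 1 + 1) (x 1) (tdiff T 0 1))"
 proof (rule abelian_monoid.finsum_single[OF am(1)[OF i(1)] tfin i(2)])
  show "sg ?H (n + 1) (act M T$0 T$1 (1 + n) (0 - 1 + 1) (x 1) (tdiff T 0 1)) .: ?H"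
   by (rule agrp.sg_cl[OF am(2)[OF i(1)] rt_term_closed[OF i rt_mem[OF x i(2) refl] refl]])
  fix k assume k: "k : sp T" "k ~= 1"
  then have "k <= 0 \<or> 2 <= k" by linarith
  then show "sg ?H (n + 1) (act M T$0 T$k (k + n) (0 - k + 1) (x k) (tdiff T 0 k)) = 0[?H]"
   using z[OF i(1) k(1)] agrp.sg_0[OF am(2)[OF i(1)]] by simp
 qed
 then show ?A unfolding rt_diff[OF i(1)] by simp
 show ?B unfolding rt_diff[OF i(2)] using sum0[OF i(2)] dx[OF i(2)] abelian_monoid.r_zero[OF am(1)[OF i(2)]] by simp
 show "df (rt T M) n x k = 0[vcpt M T$k (k + (n + 1))]" if k: "k : sp T" "2 <= k" for k
 proof -
  have "1 <= k" using k(2) by simp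
  moreover have "amap (vcpt M T$k (k + n)) (vcpt M T$k (k + (n + 1))) (df (val M T$k) (k + n))"
   using acxD(2)[OF val_acx[OF tob[OF k(1)]], of "k + n"] by (simp add: add.assoc)
  ultimately show ?thesis
   unfolding rt_diff[OF k(1)] x0[OF k] using sum0[OF k(1)] abelian_monoid.l_zero[OF am(1)[OF k(1)] abelian_monoid.zero_closed[OF am(1)[OF k(1)]]]
   by (simp add: am_0[OF am(2)[OF k(1)] am(2)[OF k(1)]])
 qed
qed

abbreviation dspan where "dspan == wsp (rt T M) (%X. rt T (yon A X)) tpr"

lemma rt_single:
 assumes "i : sp T" "u .: vcpt M T$i (i + n)"
 shows "(%k:sp T. if k = i then u else 0[vcpt M T$k (k + n)]) .: cpt (rt T M) n"
proof -
 have "0[vcpt M T$k (k + n)] .: vcpt M T$k (k + n)" if "k : sp T" for k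
  using val_ag[OF tob[OF that]] by (simp add: agrp_def abelian_group_def abelian_monoid.zero_closed)
 then show ?thesis using assms by (auto simp: rt_cpt)
qed

lemma dspan_component:
 assumes S: "cellset A M S" and x: "x : dspan S n" and i: "i : sp T"
 shows "x i : span A M T$i S (i + n)"
proof -
 interpret D: pairing R A M "%X. rt T (yon A X)" "dla A T" "rt T M" tpr by (rule pairing_dual)
 interpret W: additive_subgroup "span A M T$i S (i + n)" "vcpt M T$i (i + n)" by (rule span_sub[OF tob[OF i] S])
 show ?thesis
  using x unfolding wsp_def[of "rt T M"]
 proof induction
  case gsp_zero
  then show ?case using i by (simp add: rt_cpt)
 next
  case (gsp_add s x)
  then obtain X m p a where s: "s = tpr X m (n - m) p a" "(X, m, p) : S" "a .: cpt (rt T (yon A X)) (n - m)"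
   by blast
  have X: "X : Ob A" using s S by (auto simp: cellset_def)
  have "a i .: dhom A T$i X (i + (n - m))" by (rule dual_mem[OF X s(3) i refl])
  then have "s i : span A M T$i S (i + n)"
   unfolding s(1) tpr_def using i by (auto intro!: span_gen[OF tob[OF i] S s(2)])
  then show ?case unfolding rt_add[OF i] using gsp_add by simp
 qed
qed

text \<open>A tuple is the finite sum of its components placed alone, and a cell with a coefficient
  at one index is such a tuple. So spans of cells in morphisms from \<open>T\<close> are detected
  componentwise.\<close>

lemma dspanI:
 assumes S: "cellset A M S" and x: "x .: cpt (rt T M) n"
  and xi: "!!i. i : sp T ==> x i : span A M T$i S (i + n)"
 shows "x : dspan S n"
proof -
 interpret D: pairing R A M "%X. rt T (yon A X)" "dla A T" "rt T M" tpr by (rule pairing_dual)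
 interpret W: additive_subgroup "dspan S n" "cpt (rt T M) n" by (rule D.wspan_sub[OF S])
 interpret G: agrp "cpt (rt T M) n" by (rule D.C_ag)
 define e where "e i u = (%k:sp T. if k = i then u else 0[vcpt M T$k (k + n)])" for i u
 have ec: "e i u .: cpt (rt T M) n" if "i : sp T" "u .: vcpt M T$i (i + n)" for i u
  unfolding e_def by (rule rt_single[OF that])
 have zc: "agrp (vcpt M T$k l)" "0[vcpt M T$k l] .: vcpt M T$k l" if "k : sp T" for k l
  using val_ag[OF tob[OF that], of l] by (auto simp: agrp_def abelian_group_def abelian_monoid.zero_closed)
 have e: "e i u : dspan S n" if i: "i : sp T" and u: "u : span A M T$i S (i + n)" for i u
 proof -
  interpret I: agrp "vcpt M T$i (i + n)" by (rule zc(1)[OF i])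
  interpret WI: additive_subgroup "span A M T$i S (i + n)" "vcpt M T$i (i + n)" by (rule span_sub[OF tob[OF i] S])
  show ?thesis
   using u unfolding wsp_def[of "val M T$i"]
  proof induction
   case gsp_zero
   have "e i 0[vcpt M T$i (i + n)] = 0[cpt (rt T M) n]"
   by (rule rt_ext[OF ec[OF i I.zero_closed]]) (auto simp: e_def rt_cpt zc)
   then show ?case by simp
  next
   case (gsp_add s x)
   then obtain X m p a where s: "s = act M T$i X m (i + n - m) p a" "(X, m, p) : S" "a .: dhom A T$i X (i + n - m)"
   by blast
   have o: "X : Ob A" "p .: vcpt M X m" using s S by (auto simp: cellset_def)
   interpret Y: twisted_right R A T "yon A X" by (rule yon_right[OF o(1)])
   \<comment> \<open>The coefficient \<open>a\<close> is regarded as a morphism from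
     \<open>T\<close> that is zero outside index \<open>i\<close>.\<close>
   let ?a = "%k:sp T. if k = i then a else 0[vcpt (yon A X) T$k (k + (n - m))]"
   have ii: "i + (n - m) = i + n - m" by simp
   have a: "?a .: cpt (rt T (yon A X)) (n - m)"
   by (rule Y.rt_single[OF i]) (unfold ii yon_simps, rule s(3))
   have sc: "s .: vcpt M T$i (i + n)" unfolding s(1) by (rule act_cl[OF tob[OF i] o s(3)]) simp
   have xc: "x .: vcpt M T$i (i + n)"
   using gsp_add(2) WI.a_subset unfolding wsp_def[of "val M T$i"] by blast
   have tc: "tpr X m (n - m) p ?a .: cpt (rt T M) n" using tpr_closed[OF o a] by simp
   have "e i s k = tpr X m (n - m) p ?a k" if k: "k : sp T" for k
   proof (cases "k = i")
   case True
   then show ?thesis using i by (simp add: e_def tpr_def s(1) ii)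
   next
   case False
   have "act M T$k X m (k + (n - m)) p 0[dhom A T$k X (k + (n - m))] = 0[vcpt M T$k (k + n)]"
   by (rule am_0[OF hom_ag[OF tob[OF k] o(1)] zc(1)[OF k] act_am_r[OF tob[OF k] o]]) simp
   then show ?thesis using False k by (simp add: e_def tpr_def)
   qed
   then have "e i s = tpr X m (n - m) p ?a" by (rule rt_ext[OF ec[OF i sc] tc])
   then have "e i s : dspan S n" using D.wspan_gen[OF S s(2) a, of n] by simp
   moreover have "e i (s +[vcpt M T$i (i + n)] x) = e i s +[cpt (rt T M) n] e i x"
   proof (rule rt_ext)
   show "e i (s +[vcpt M T$i (i + n)] x) .: cpt (rt T M) n" using ec[OF i] sc xc by simp
   show "e i s +[cpt (rt T M) n] e i x .: cpt (rt T M) n" using ec[OF i sc] ec[OF i xc] by (rule G.a_closed)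
   show "e i (s +[vcpt M T$i (i + n)] x) k = (e i s +[cpt (rt T M) n] e i x) k" if k: "k : sp T" for k
   unfolding rt_add[OF k] using k abelian_monoid.l_zero[of "vcpt M T$k (k + n)"] zc[OF k]
   by (auto simp: e_def agrp_def abelian_group_def)
   qed
   ultimately show ?case using W.a_closed gsp_add(3) by simp
  qed
 qed
 have xc: "x i .: vcpt M T$i (i + n)" if "i : sp T" for i by (rule rt_mem[OF x that refl])
 have "x = (\<Oplus>[cpt (rt T M) n] i:sp T. e i (x i))"
 proof (rule rt_ext[OF x])
  show "(\<Oplus>[cpt (rt T M) n] i:sp T. e i (x i)) .: cpt (rt T M) n"
   using ec xc by (auto intro!: G.finsum_closed)
  fix k assume k: "k : sp T"
  have "amap (cpt (rt T M) n) (vcpt M T$k (k + n)) (%x. x k)"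
   unfolding rt_cpt by (rule pm_eval[OF k])
  then have "(\<Oplus>[cpt (rt T M) n] i:sp T. e i (x i)) k = (\<Oplus>[vcpt M T$k (k + n)] i:sp T. e i (x i) k)"
   by (rule am_finsum[OF G.ag zc(1)[OF k]]) (use ec xc in auto)
  also have "... = e k (x k) k"
   by (rule abelian_monoid.finsum_single[OF _ tfin k]) (use zc[OF k] xc[OF k] k in \<open>auto simp: e_def agrp_def abelian_group_def\<close>)
  finally show "x k = (\<Oplus>[cpt (rt T M) n] i:sp T. e i (x i)) k" using k by (simp add: e_def)
 qed
 also have "... : dspan S n"
  by (rule asub_finsum[OF G.ag W.additive_subgroup_axioms]) (use e xi in auto)
 finally show ?thesis .
qed

end

section \<open>Cocycles on a homotopy cokernel\<close>

context twisted_pairing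
begin

lemma la_tdiff_zero:
 assumes "k : sp T" "j : sp T" "j <= k" "y .: cpt (V T$k) l" "m = k - j + 1 + l"
 shows "la T$k T$j (k - j + 1) l (tdiff T k j) y = 0[cpt (V T$j) m]"
 unfolding tdiff_zero[OF assms(1-3)]
 by (rule am_0[OF hom_ag[OF tob tob] L.lval_ag[OF tob] L.la_am_l[OF tob tob assms(4,5)]]) (use assms in auto)

text \<open>The obstruction at index \<open>j\<close> lies in degree \<open>1 - j\<close> of
  \<open>V\<close>. For \<open>j >= 2\<close> this degree is negative and acyclicity suffices; at
  index \<open>1\<close> the obstruction is the class of \<open>f w0\<close>, which has to be
  assumed zero.\<close>

lemma extend_cocycle:
 assumes pos: "sp T <= {0..}" and i: "0 : sp T" "1 : sp T"
  and ac: "!!X i. X : Ob A ==> i < 0 ==> hz (V X) i"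
  and w0: "w0 : cocycles (V T$0) 0"
  and f: "la T$0 T$1 0 0 (tdiff T 0 1) w0 : cobd (V T$1) 0"
 shows "EX w:carrier (cpt TV 0). df TV 0 w = 0[cpt TV 1] & w 0 = w0"
proof -
 obtain \<theta> where th: "\<theta> .: cpt (V T$1) (-1)"
   "la T$0 T$1 0 0 (tdiff T 0 1) w0 = df (V T$1) (-1) \<theta>"
  by (rule coboundariesE[OF f, of "-1"]) auto
 have w0c: "w0 .: cpt (V T$0) 0" "df (V T$0) 0 w0 = 0[cpt (V T$0) 1]"
  using w0 by (auto simp: cocycles_def)
 have ag: "agrp (cpt (V T$k) l)" "abelian_monoid (cpt (V T$k) l)" if "k : sp T" for k l
  using L.lval_ag[OF tob[OF that], of l] by (auto simp: agrp_def abelian_group_def)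
 \<comment> \<open>At index \<open>1\<close> the diagonal sign is odd, so \<open>\<theta>\<close>
   enters without a sign: its differential cancels the image of \<open>w0\<close>.\<close>
 define v where "v = (%k:sp T. if k = 0 then w0 else if k = 1 then \<theta> else 0[cpt (V T$k) (- k)])"
 have v: "v .: cpt TV 0"
  using w0c(1) th(1) abelian_monoid.zero_closed[OF ag(2)] by (auto simp: v_def tl.lt_cpt)
 note vm = TV_mem[OF v]
 interpret G0: agrp "cpt TV 0" by (rule acxD(1)[OF tl.lt_acx])
 interpret G1: agrp "cpt TV 1" by (rule acxD(1)[OF tl.lt_acx])
 have am: "amap (cpt TV 0) (cpt TV 1) (df TV 0)" using acxD(2)[OF tl.lt_acx, of 0] by simp
 have z: "la T$k T$j (k - j + 1) (0 + 0 - k) (tdiff T k j) (v k) = 0[cpt (V T$j) (0 + 1 + 0 - j)]"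
  if "k : sp T" "j : sp T" "j <= k" for k j
  by (rule la_tdiff_zero[OF that vm[OF that(1)]]) auto
 have low: "df TV 0 v j = 0[cpt (V T$j) (1 - j)]" if j: "j : sp T" "j < 2" for j
 proof -
  have "j = 0 \<or> j = 1" using pos j by fastforce
  then show ?thesis
  proof
   assume j0: "j = 0"
   let ?H = "cpt (V T$0) (0 + 1 + 0 - 0)"
   interpret H: agrp ?H by (rule ag(1)[OF i(1)])
   have "(\<Oplus>[?H] k:sp T. sg ?H 0 (la T$k T$0 (k - 0 + 1) (0 + 0 - k) (tdiff T k 0) (v k))) = 0[?H]"
   by (rule H.finsum_all_0) (use z[OF _ i(1)] pos in auto)
   then show ?thesis
   unfolding j0 tl.lt_diff[OF i(1)] using w0c i H.l_zero[OF H.zero_closed] by (simp add: v_def)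
  next
   assume j1: "j = 1"
   let ?H = "cpt (V T$1) (0 + 1 + 0 - 1)"
   interpret H: agrp ?H by (rule ag(1)[OF i(2)])
   have d: "df (V T$1) (-1) \<theta> .: cpt (V T$1) 0"
   by (rule acx_cl[OF L.lv_acx[OF tob[OF i(2)]] th(1)]) simp
   have "(\<Oplus>[?H] k:sp T. sg ?H 0 (la T$k T$1 (k - 1 + 1) (0 + 0 - k) (tdiff T k 1) (v k))) =
   sg ?H 0 (la T$0 T$1 (0 - 1 + 1) (0 + 0 - 0) (tdiff T 0 1) (v 0))"
   proof (rule H.finsum_single[OF tfin i(1)])
   show "sg ?H 0 (la T$0 T$1 (0 - 1 + 1) (0 + 0 - 0) (tdiff T 0 1) (v 0)) .: ?H"
   using th(2) d i by (simp add: v_def)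
   fix k assume k: "k : sp T" "k ~= 0"
   then have "1 <= k" using pos by force
   then show "sg ?H 0 (la T$k T$1 (k - 1 + 1) (0 + 0 - k) (tdiff T k 1) (v k)) = 0[?H]"
   using z[OF k(1) i(2)] by simp
   qed
   also have "... = df (V T$1) (-1) \<theta>" using th(2) i by (simp add: v_def)
   finally show ?thesis
   unfolding j1 tl.lt_diff[OF i(2)] using i d H.l_neg by (simp add: v_def sg_odd)
  qed
 qed
 \<comment> \<open>The remaining error sits in indices at least \<open>2\<close>, and so does its
   primitive \<open>q\<close>; subtracting \<open>q\<close> does not disturb the component
   \<open>w0\<close>.\<close>
 have "EX q:carrier (cpt TV (1 - 1)). (ALL i:sp T. i < 2 --> q i = 0[cpt (V T$i) (1 - 1 + 0 - i)]) &
   df TV (1 - 1) q = df TV 0 v"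
 proof (rule tl.lt_acyclic)
  show "hz (V T$i) (1 + 0 - i)" if "i : sp T" "2 <= i" for i
   using ac[OF tob[OF that(1)]] that by simp
  show "df TV 0 v .: cpt TV 1" by (rule am_cl[OF am v])
  show "df TV 1 (df TV 0 v) = 0[cpt TV (1 + 1)]" by (rule acx_dd[OF tl.lt_acx v]) auto
 qed (use low in auto)
 then obtain q where q: "q .: cpt TV 0" "!!i. i : sp T ==> i < 2 ==> q i = 0[cpt (V T$i) (- i)]"
  "df TV 0 q = df TV 0 v" by auto
 have "(v -[cpt TV 0] q) 0 = w0"
 proof -
  interpret H: agrp "cpt (V T$0) 0" by (rule ag(1)[OF i(1)])
  have "amap (cpt TV 0) (cpt (V T$0) 0) (%x. x 0)"
   using pm_eval[OF i(1), of "%j. cpt (V T$j) (0 + 0 - j)"] by (simp add: tl.lt_cpt)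
  from am_minus[OF G0.ag H.ag this v q(1)] show ?thesis
   using q(2)[OF i(1)] i w0c by (simp add: v_def H.minus_eq)
 qed
 moreover have "df TV 0 (v -[cpt TV 0] q) = 0[cpt TV 1]"
  using am_cl[OF am v] q(3) by (simp add: am_minus[OF G0.ag G1.ag am v q(1)] G1.minus_eq G1.r_neg)
 ultimately show ?thesis using v q(1) by (intro bexI[of _ "v -[cpt TV 0] q"]) auto
qed

lemma tpair_span:
 assumes S: "cellset A P S" and y: "y .: cpt TV l" and n: "n = m + l"
  and x: "!!k. k : sp T ==> x k : span A P T$k S (k + m)"
 shows "tpair m l x y : wspan S n"
proof -
 have "pr T$k (k + m) (l - k) (x k) (y k) : wspan S (m + l)" if k: "k : sp T" for k
  by (rule span_pr[OF S x[OF k] tob[OF k] TV_mem[OF y k refl]]) simp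
 then show ?thesis
  unfolding tpair_def n by (rule asub_finsum[OF C_ag wspan_sub[OF S]])
qed

lemma tpair_single:
 assumes i: "i : sp T" and u: "u .: vcpt P T$i (i + m)" and y: "y .: cpt TV l"
 shows "tpair m l (%k:sp T. if k = i then u else 0[vcpt P T$k (k + m)]) y = pr T$i (i + m) (l - i) u (y i)"
proof -
 interpret G: agrp "cpt C (m + l)" by (rule C_ag)
 have z: "pr T$k (k + m) (l - k) 0[vcpt P T$k (k + m)] (y k) = 0[cpt C (m + l)]" if k: "k : sp T" for k
  by (rule am_0[OF val_ag[OF tob[OF k]] G.ag pr_am_l[OF tob[OF k] TV_mem[OF y k refl]]]) simp
 have "pr T$i (i + m) (l - i) u (y i) .: cpt C (m + l)"
  by (rule pr_cl[OF tob[OF i] u TV_mem[OF y i refl]]) simp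
 then show ?thesis
  unfolding tpair_def using G.finsum_single[OF tfin i, of "%k. pr T$k (k + m) (l - k)
   ((%k:sp T. if k = i then u else 0[vcpt P T$k (k + m)]) k) (y k)"] i z by simp
qed

lemma tpair_diff:
 assumes x: "x .: cpt TP m" and y: "y .: cpt TV l" "df TV l y = 0[cpt TV (l + 1)]"
 shows "df C (m + l) (tpair m l x y) = tpair (m + 1) l (df TP m x) y"
proof -
 interpret G: agrp "cpt C (m + l + 1)" by (rule C_ag)
 have "pr T$k (k + m) (l + 1 - k) (x k) (0[cpt TV (l + 1)] k) = 0[cpt C (m + l + 1)]" if k: "k : sp T" for k
  using am_0[OF L.lval_ag[OF tob[OF k]] G.ag pr_am_r[OF tob[OF k] tr.rt_mem[OF x k refl]], of "l + 1 - k"] k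
  by (simp add: tl.lt_cpt)
 then have "tpair m (l + 1) x 0[cpt TV (l + 1)] = 0[cpt C (m + l + 1)]"
  unfolding tpair_def add.assoc[symmetric] by (rule G.finsum_all_0)
 moreover have "tpair (m + 1) l (df TP m x) y .: cpt C (m + l + 1)"
  by (rule tpair_closed[OF acx_cl[OF tr.rt_acx x refl] y(1)]) simp
 ultimately show ?thesis unfolding tpair_leibniz[OF x y(1)] y(2) by simp
qed

end

lemma (in abelian_group) minus_swap:
 "a .: G ==> b .: G ==> c .: G ==> a \<ominus> b \<ominus> c = a \<ominus> c \<ominus> b"
 by (simp add: minus_eq a_assoc a_comm[of "\<ominus> b"])

section \<open>Vanishing of the tensor product below degree -d-1\<close>

locale vanishing = semifree R A P B lev + tensor_pair R A P N
 for R :: "'k ring" and A :: "('o, 'k, 'a) dgcat" and P :: "('o, 'k, 'a, 'p) dgmod" and B lev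
  and N :: "('o, 'k, 'a, 'v) dgmod" +
 fixes d :: nat
 assumes additive: "additive_dgcat A" and connective: "connective A"
  and cokernels: "X : Ob A ==> Y : Ob A ==> f : Z0 A X Y ==> EX T. homotopy_cokernel d A X Y f T"
  and P_acyclic: "X : Ob A ==> i < 0 ==> hz (val P X) i"
  and N_acyclic: "X : Ob A ==> i ~= 0 ==> hz (val N X) i"
begin

abbreviation pt where "pt == %X i j x y. tens (i + j) X i x y"

sublocale tn: pairing R A P "val N" "lact N" Ten pt
 by (rule pairing_tensor)

text \<open>An element of the tensor product is a finite sum of symbols, and each left factor
  involves finitely many basis elements. So the normalisation of finite sets of basis elements is
  enough.\<close>

lemma element_nf:
 assumes z: "z .: cpt Ten n"
 shows "EX G S. nf G S & z : tn.wspan S n"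
proof -
 have "EX F. finite F & F <= B & z : tn.wspan F n"
  using z
 proof (induction rule: Ten_induct)
  case zero
  then show ?case by (intro exI[of _ "{}"]) (auto simp: wsp_def intro: gsp.intros)
 next
  case (add X i x y z)
  obtain F1 where F1: "finite F1" "F1 <= B" "x : span A P X F1 i" using elt_span[OF add(1,2)] by blast
  obtain F2 where F2: "finite F2" "F2 <= B" "z : tn.wspan F2 n" using add(5) by blast
  have cs: "cellset A P (F1 \<union> F2)" "cellset A P F1" using cells_sub[OF B_cells] F1 F2 by simp_all
  have "pt X i (n - i) x y : tn.wspan F1 n" by (rule tn.span_pr[OF cs(2) F1(3) add(1,3)]) simp
  then have "tens n X i x y : tn.wspan (F1 \<union> F2) n" using tn.wspan_mono[of F1 "F1 \<union> F2" n] by auto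
  moreover have "z : tn.wspan (F1 \<union> F2) n" using F2(3) tn.wspan_mono[of F2 "F1 \<union> F2" n] by auto
  ultimately have "tens n X i x y +[cpt Ten n] z : tn.wspan (F1 \<union> F2) n"
   by (rule additive_subgroup.a_closed[OF tn.wspan_sub[OF cs(1)]])
  then show ?case using F1(1,2) F2(1,2) by (intro exI[of _ "F1 \<union> F2"]) simp
 qed
 then obtain F where F: "finite F" "F <= B" "z : tn.wspan F n" by blast
 obtain G S where G: "nf G S" "F <= G" using nf_exists[OF connective F(1,2)] by blast
 have "cellset A P S" "!!X m b. (X, m, b) : F ==> b : span A P X S m" using G by (auto simp: nf_def normal_cells_def)
 then have "z : tn.wspan S n" by (rule tn.wspan_trans[OF cells_sub[OF B_cells F(2)] _ _ F(3)])
 then show ?thesis using G by blast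
qed

text \<open>The homotopy cokernel of \<open>f\<close> turns \<open>x\<close> and \<open>x1\<close> into a closed morphism to \<open>P\<close>, which is
 null-homotopic because \<open>P\<close> has no cohomology in negative degrees.\<close>

lemma cokernel_boundary:
 fixes F G :: 'o
 assumes e: "e <= - int d - 2" and nc: "normal_cells R A P S" and o: "F : Ob A" "G : Ob A"
  and x: "x .: vcpt P F e"
  and x1: "x1 : span A P G (hi S e) (e + 1)" "df (val P G) (e + 1) x1 : span A P G (hi S (e + 1)) (e + 2)"
  and q: "q : span A P F (hi S e) e"
  and xq: "df (val P F) e x -[vcpt P F (e + 1)] act P F G (e + 1) 0 x1 f -[vcpt P F (e + 1)] df (val P F) e q
   : span A P F (hi S (e + 1)) (e + 1)"
  and f: "f : Z0 A F G" and w0: "w0 : cocycles (val N F) 0" and fw: "lact N F G 0 0 f w0 : cobd (val N G) 0"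
 shows "EX y:cobd Ten e. y -[cpt Ten e] pt F e 0 x w0 : tn.wspan (hi S e) e"
proof -
 have fin: "finite S" and cs: "cellset A P S" using nc by (auto simp: normal_cells_def)
 have cs': "cellset A P (hi S b)" for b by (rule cells_sub[OF cs hi_subset])
 obtain T where T: "homotopy_cokernel d A F G f T" using cokernels[OF o f] by blast
 then have twc: "twisted_complex A T" and sup: "sp T <= {0..int d + 1}"
  and i: "0 : sp T" "1 : sp T" and T01: "T$0 = F" "T$1 = G" "tdiff T 0 1 = f"
  and re: "!!X i. X : Ob A ==> 1 <= i ==> htw_zero A T (in_degree A X i)"
  by (auto simp: homotopy_cokernel_def right_exact_def d_twisted_def component_is_def tw_def)
 interpret T: twisted R A T by unfold_locales (rule twc)
 interpret tp: twisted_pairing R A T P "val N" "lact N" Ten pt by unfold_locales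
 interpret D: pairing R A P "%X. rt T (yon A X)" "dla A T" "rt T P" tp.tr.tpr by (rule tp.tr.pairing_dual)
 have pos: "sp T <= {0..}" using sup by auto
 obtain w where w: "w .: cpt tp.TV 0" "df tp.TV 0 w = 0[cpt tp.TV (0 + 1)]" "w 0 = w0"
  using tp.extend_cocycle[OF pos i _ w0[folded T01] fw[folded T01]] N_acyclic by auto
 interpret P0: agrp "vcpt P F e" by (rule val_ag[OF o(1)])
 interpret P0': agrp "vcpt P F (e + 1)" by (rule val_ag[OF o(1)])
 interpret P1: agrp "vcpt P G (e + 1)" by (rule val_ag[OF o(2)])
 interpret P1': agrp "vcpt P G (e + 2)" by (rule val_ag[OF o(2)])
 interpret Z: agrp "cpt tp.TP e" by (rule acxD(1)[OF tp.tr.rt_acx])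
 interpret Z': agrp "cpt tp.TP (e + 1)" by (rule acxD(1)[OF tp.tr.rt_acx])
 interpret C: agrp "cpt Ten e" by (rule tn.C_ag)
 have x1c: "x1 .: vcpt P G (e + 1)" by (rule span_carrier[OF o(2) cs' x1(1)])
 have qc: "q .: vcpt P F e" by (rule span_carrier[OF o(1) cs' q])
 have fc: "f .: dhom A F G 0" using f by (auto simp: cocycles_def)
 have zc: "agrp (vcpt P T$k l)" "0[vcpt P T$k l] .: vcpt P T$k l" if "k : sp T" for k l
  using val_ag[OF T.tob[OF that], of l] by (auto simp: agrp_def abelian_group_def abelian_monoid.zero_closed)
 have z_span: "0[vcpt P T$k l] : span A P T$k (hi S b) l" if "k : sp T" for k l b
  by (rule additive_subgroup.zero_closed[OF span_sub[OF T.tob[OF that] cs']])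
 \<comment> \<open>A first approximation to a closed morphism from \<open>T\<close> to
   \<open>P\<close>. The sign \<open>e\<close> on \<open>x1\<close> meets the sign
   \<open>e + 1\<close> of the off-diagonal differential, so that \<open>x1 f\<close> is subtracted
   from the differential of \<open>x - q\<close>, as \<open>xq\<close> requires.\<close>
 define y0 where "y0 = (%k:sp T. if k = 0 then x -[vcpt P F e] q else if k = 1 then sg (vcpt P G (e + 1)) e x1 else 0[vcpt P T$k (k + e)])"
 have y0: "y0 .: cpt tp.TP e"
 proof -
  have "y0 k .: vcpt P T$k (k + e)" if "k : sp T" for k
   using P0.minus_closed[OF x qc] P1.sg_cl[OF x1c, of e] zc(2)[OF that] that T01 by (simp add: y0_def add.commute[of 1])
  then show ?thesis unfolding tp.tr.rt_cpt pm_simps by (intro PiE_I) (auto simp: y0_def)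
 qed
 have y0z: "y0 k = 0[vcpt P T$k (k + e)]" if "k : sp T" "2 <= k" for k using that by (simp add: y0_def)
 have low: "df tp.TP e y0 0 = df (val P F) e (y0 0) +[vcpt P F (e + 1)]
   sg (vcpt P F (e + 1)) (e + 1) (act P F G (e + 1) 0 (y0 1) f)"
  "df tp.TP e y0 1 = df (val P G) (e + 1) (y0 1)"
  "!!k. k : sp T ==> 2 <= k ==> df tp.TP e y0 k = 0[vcpt P T$k (k + (e + 1))]"
  using tp.tr.rt_diff_low[OF pos i y0, OF y0z] T01 by (simp_all add: add.commute[of 1])
 have k012: "k = 0 \<or> k = 1 \<or> 2 <= k" if "k : sp T" for k using pos that by fastforce
 have dx: "df (val P F) e x .: vcpt P F (e + 1)" and dq: "df (val P F) e q .: vcpt P F (e + 1)"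
  using x qc by (auto intro: acx_cl[OF val_acx[OF o(1)]])
 have dx1: "df (val P G) (e + 1) x1 .: vcpt P G (e + 2)"
  by (rule acx_cl[OF val_acx[OF o(2)] x1c]) simp
 have x1f: "act P F G (e + 1) 0 x1 f .: vcpt P F (e + 1)" by (rule act_cl[OF o x1c fc]) simp
 have Dy0: "df tp.TP e y0 k : span A P T$k (hi S (e + 1)) (k + (e + 1))" if k: "k : sp T" for k
  using k012[OF k]
 proof (elim disjE)
  assume k0: "k = 0"
  have "act P F G (e + 1) 0 (sg (vcpt P G (e + 1)) e x1) f = sg (vcpt P F (e + 1)) e (act P F G (e + 1) 0 x1 f)"
   by (rule am_sg[OF P1.ag P0'.ag act_am_l[OF o fc] x1c]) simp
  moreover have "df (val P F) e (x -[vcpt P F e] q) = df (val P F) e x -[vcpt P F (e + 1)] df (val P F) e q"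
   by (rule am_minus[OF P0.ag P0'.ag acxD(2)[OF val_acx[OF o(1)]] x qc])
  moreover have "1 + e = e + 1" by simp
  ultimately have "df tp.TP e y0 0 = (df (val P F) e x -[vcpt P F (e + 1)] df (val P F) e q) +[vcpt P F (e + 1)]
   sg (vcpt P F (e + 1)) (e + 1) (sg (vcpt P F (e + 1)) e (act P F G (e + 1) 0 x1 f))"
   unfolding low(1) using T01 i by (simp add: y0_def)
  also have "sg (vcpt P F (e + 1)) (e + 1) (sg (vcpt P F (e + 1)) e (act P F G (e + 1) 0 x1 f)) = -[vcpt P F (e + 1)] act P F G (e + 1) 0 x1 f"
   unfolding P0'.sg_sg[OF x1f] by (rule sg_odd) simp
  finally have "df tp.TP e y0 0 = df (val P F) e x -[vcpt P F (e + 1)] act P F G (e + 1) 0 x1 f -[vcpt P F (e + 1)] df (val P F) e q"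
   using P0'.minus_swap[OF dx dq x1f] by (simp add: P0'.minus_eq)
  then show ?thesis using xq T01 k0 by simp
 next
  assume k1: "k = 1"
  have "df (val P G) (e + 1) (sg (vcpt P G (e + 1)) e x1) = sg (vcpt P G (e + 1 + 1)) e (df (val P G) (e + 1) x1)"
   by (rule am_sg[OF P1.ag val_ag[OF o(2)] acxD(2)[OF val_acx[OF o(2)]] x1c])
  moreover have "1 + e = e + 1" "e + 1 + 1 = e + 2" by simp_all
  ultimately have "df tp.TP e y0 1 = sg (vcpt P G (e + 2)) e (df (val P G) (e + 1) x1)"
   unfolding low(2) using T01 i by (simp add: y0_def)
  moreover have "sg (vcpt P G (e + 2)) e (df (val P G) (e + 1) x1) : span A P G (hi S (e + 1)) (e + 2)"
   using asub_sg[OF P1'.ag span_sub[OF o(2) cs'] dx1] x1(2) by blast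
  ultimately show ?thesis using T01 k1 by (simp add: algebra_simps)
 next
  assume k2: "2 <= k"
  show ?thesis unfolding low(3)[OF k k2] by (rule z_span[OF k])
 qed
 have DyD: "df tp.TP e y0 .: cpt tp.TP (e + 1)" by (rule acx_cl[OF tp.tr.rt_acx y0 refl])
 \<comment> \<open>The defect only involves cells of degree \<open>m > e + 1\<close>. Their
   coefficients are morphisms from \<open>T\<close> to objects in degree
   \<open>e + 1 - m < 0\<close>, where right exactness gives acyclicity; so the defect is removed
   entirely.\<close>
 have "EX b:D.wspan (hi S (e + 1)) (e + 1 - 1). df tp.TP (e + 1 - 1) b = df tp.TP e y0"
 proof (rule D.peel_all[OF nc])
  fix X m p assume "(X, m, p) : S" "e + 1 < m"
  then have "X : Ob A" "1 <= m - (e + 1)" using cs by (auto simp: cellset_def)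
  from T.htw_zero_right[OF this(1) re[OF this]] show "hz (rt T (yon A X)) (e + 1 - m)" by simp
 next
  show "df tp.TP e y0 : D.wspan (hi S (e + 1)) (e + 1)" by (rule tp.tr.dspanI[OF cs' DyD Dy0])
  show "df tp.TP (e + 1) (df tp.TP e y0) = 0[cpt tp.TP (e + 1 + 1)]" by (rule acx_dd[OF tp.tr.rt_acx y0]) auto
 qed
 then obtain b where b: "b : D.wspan (hi S (e + 1)) e" "df tp.TP e b = df tp.TP e y0" by auto
 have bc: "b .: cpt tp.TP e" by (rule D.wspan_cl[OF cs' b(1)])
 have bs: "b k : span A P T$k (hi S e) (k + e)" if k: "k : sp T" for k
 proof -
  have "hi S (e + 1) <= hi S e" by (rule hi_mono) simp
  then show ?thesis using tp.tr.dspan_component[OF cs' b(1) k] span_mono by blast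
 qed
 define y where "y = y0 -[cpt tp.TP e] b"
 have y: "y .: cpt tp.TP e" unfolding y_def using y0 bc by simp
 have "df tp.TP e y = 0[cpt tp.TP (e + 1)]"
  unfolding y_def am_minus[OF Z.ag Z'.ag acxD(2)[OF tp.tr.rt_acx] y0 bc] b(2)
  using DyD by (simp add: Z'.minus_eq Z'.r_neg)
 moreover have "hz tp.TP e"
 proof (rule tp.tr.rt_cohomology_zero)
  fix k assume k: "k : sp T"
  \<comment> \<open>This is where the bound on \<open>e\<close> is used: \<open>k\<close> is at most
    \<open>d + 1\<close> and \<open>e\<close> at most \<open>- d - 2\<close>.\<close>
  then have "k + e < 0" using sup e by fastforce
  then show "hz (val P T$k) (k + e)" by (rule P_acyclic[OF T.tob[OF k]])
 qed
 ultimately obtain h where h: "h .: cpt tp.TP (e - 1)" "df tp.TP (e - 1) h = y"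
  using acyclicE[OF _ y] by metis
 \<comment> \<open>As \<open>w\<close> is closed, the primitive \<open>h\<close> of \<open>y\<close>
   paired with \<open>w\<close> is a primitive of the pairing of \<open>y\<close> with
   \<open>w\<close>.\<close>
 have bound: "tp.tpair e 0 y w : cobd Ten e"
 proof -
  have "df Ten (e - 1 + 0) (tp.tpair (e - 1) 0 h w) = tp.tpair (e - 1 + 1) 0 (df tp.TP (e - 1) h) w"
   by (rule tp.tpair_diff[OF h(1) w(1,2)])
  moreover have "tp.tpair (e - 1) 0 h w .: cpt Ten (e - 1)" by (rule tp.tpair_closed[OF h(1) w(1)]) simp
  ultimately show ?thesis using h(2) coboundariesI[of "tp.tpair (e - 1) 0 h w" Ten "e - 1" e] by simp
 qed
 \<comment> \<open>Paired with \<open>w\<close>, it gives the symbol of \<open>x\<close> and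
   \<open>w0\<close>. The difference of \<open>y\<close> and \<open>s\<close> only involves
   \<open>q\<close>, \<open>x1\<close> and \<open>b\<close>, all of which are spanned by cells of
   degree above \<open>e\<close>.\<close>
 define s where "s = (%k:sp T. if k = 0 then x else 0[vcpt P T$k (k + e)])"
 have s: "s .: cpt tp.TP e"
  unfolding s_def by (rule tp.tr.rt_single[OF i(1)]) (simp add: T01 x)
 have "tp.tpair e 0 s w = pt F e 0 x w0"
  unfolding s_def using tp.tpair_single[OF i(1) _ w(1), of x e] x T01 w(3) by simp
 then have "tp.tpair e 0 y w -[cpt Ten e] pt F e 0 x w0 = tp.tpair e 0 (y -[cpt tp.TP e] s) w"
  using am_minus[OF Z.ag C.ag tp.tpair_addmap[OF w(1)] y s] by simp
 also have "... : tn.wspan (hi S e) e"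
 proof (rule tp.tpair_span[OF cs' w(1)])
  fix k assume k: "k : sp T"
  interpret K: agrp "vcpt P T$k (k + e)" by (rule zc(1)[OF k])
  interpret W: additive_subgroup "span A P T$k (hi S e) (k + e)" "vcpt P T$k (k + e)"
   by (rule span_sub[OF T.tob[OF k] cs'])
  have am: "amap (cpt tp.TP e) (vcpt P T$k (k + e)) (%x. x k)"
   unfolding tp.tr.rt_cpt by (rule pm_eval[OF k])
  have c: "y0 k .: vcpt P T$k (k + e)" "b k .: vcpt P T$k (k + e)" "s k .: vcpt P T$k (k + e)"
   using am_cl[OF am] y0 bc s by auto
  have "(y -[cpt tp.TP e] s) k = y0 k -[vcpt P T$k (k + e)] b k -[vcpt P T$k (k + e)] s k"
   using am_minus[OF Z.ag K.ag am y s] am_minus[OF Z.ag K.ag am y0 bc] by (simp add: y_def)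
  also have "... = y0 k -[vcpt P T$k (k + e)] s k -[vcpt P T$k (k + e)] b k"
   by (rule K.minus_swap[OF c])
  finally have 1: "(y -[cpt tp.TP e] s) k = y0 k -[vcpt P T$k (k + e)] s k -[vcpt P T$k (k + e)] b k" .
  have "y0 k -[vcpt P T$k (k + e)] s k : span A P T$k (hi S e) (k + e)"
   using k012[OF k]
  proof (elim disjE)
   assume k0: "k = 0"
   interpret W0: additive_subgroup "span A P F (hi S e) e" "vcpt P F e" by (rule span_sub[OF o(1) cs'])
   have "x -[vcpt P F e] q -[vcpt P F e] x = -[vcpt P F e] q"
   using x qc P0.minus_swap[OF x qc x] by (simp add: P0.minus_eq P0.r_neg)
   then show ?thesis using k0 i T01 W0.a_inv_closed[OF q] by (simp add: y0_def s_def)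
  next
   assume k1: "k = 1"
   have "sg (vcpt P G (e + 1)) e x1 : span A P G (hi S e) (e + 1)"
   using asub_sg[OF P1.ag span_sub[OF o(2) cs'] x1c] x1(1) by blast
   then show ?thesis using k1 i T01 P1.sg_cl[OF x1c, of e] by (simp add: y0_def s_def P1.minus_eq add.commute[of 1])
  next
   assume "2 <= k"
   then show ?thesis using k K.minus_eq_zero_iff[of "0[vcpt P T$k (k + e)]" "0[vcpt P T$k (k + e)]"] W.zero_closed
   by (simp add: y0_def s_def)
  qed
  then show "(y -[cpt tp.TP e] s) k : span A P T$k (hi S e) (k + e)"
   unfolding 1 K.minus_eq[of _ "b k"] using W.a_inv_closed[OF bs[OF k]] by (intro W.a_closed)
 qed simp
 finally show ?thesis using bound by blast
qed

text \<open>The cells of degree \<open>e\<close> carry coefficients in degree \<open>0\<close>,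
  where \<open>N\<close> has cohomology; acyclicity of \<open>N\<close> cannot remove them. A
  homotopy cokernel does so instead, and then acyclicity handles the cells above.\<close>

lemma top_cells_boundary:
 assumes e: "e <= - int d - 2" and nc: "normal_cells R A P S"
  and z: "z : tn.wspan (hi S (e - 1)) e" "df Ten e z = 0[cpt Ten (e + 1)]"
 shows "z : cobd Ten e"
proof -
 have fin: "finite S" and cs: "cellset A P S" and dual: "!!s. s : S ==> EX c. dual R A P (S - {s}) s c"
  using nc by (auto simp: normal_cells_def)
 have cs': "cellset A P (hi S b)" for b by (rule cells_sub[OF cs hi_subset])
 have split: "{c : S. deg c = b + 1} \<union> hi S (b + 1) = hi S b" for b by (auto simp: hi_def)
 interpret C: agrp "cpt Ten e" by (rule tn.C_ag)
 interpret C1: agrp "cpt Ten (e + 1)" by (rule tn.C_ag)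
 interpret Bd: additive_subgroup "cobd Ten e" "cpt Ten e" by (rule cobd_sub[OF tn.C_acx])
 interpret We: additive_subgroup "tn.wspan (hi S e) e" "cpt Ten e" by (rule tn.wspan_sub[OF cs'])
 have am: "amap (cpt Ten e) (cpt Ten (e + 1)) (df Ten e)" by (rule tn.C_addmap)
 have "EX F x w. F : Ob A & x : span A P F (hi S (e - 1)) e & df (val P F) e x : span A P F (hi S e) (e + 1) &
  w : cocycles (val N F) 0 & z -[cpt Ten e] pt F e 0 x w : tn.bd S e"
  using tn.merge[OF additive nc, of "{c : S. deg c = e}" e z] z split[of "e - 1"]
   additive_subgroup.zero_closed[OF tn.wspan_sub[OF cs']] by force
 then obtain F x w0 where F: "F : Ob A" and x: "x : span A P F (hi S (e - 1)) e" "df (val P F) e x : span A P F (hi S e) (e + 1)"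
  and w0: "w0 : cocycles (val N F) 0" and zb: "z -[cpt Ten e] pt F e 0 x w0 : tn.bd S e" by blast
 obtain q where q: "q : tn.wspan (hi S (e - 1)) (e - 1)"
  and r: "z -[cpt Ten e] pt F e 0 x w0 -[cpt Ten e] df Ten (e - 1) q : tn.wspan (hi S e) e"
  using zb by (auto simp: tn.bd_def)
 have xc: "x .: vcpt P F e" by (rule span_carrier[OF F cs' x(1)])
 have dxc: "df (val P F) e x .: vcpt P F (e + 1)" by (rule acx_cl[OF val_acx[OF F] xc refl])
 have w0c: "w0 .: vcpt N F 0" "df (val N F) 0 w0 = 0[vcpt N F 1]" using w0 by (auto simp: cocycles_def)
 have qc: "q .: cpt Ten (e - 1)" by (rule tn.wspan_cl[OF cs' q])
 have dqc: "df Ten (e - 1) q .: cpt Ten e" by (rule acx_cl[OF tn.C_acx qc]) simp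
 have zc: "z .: cpt Ten e" by (rule tn.wspan_cl[OF cs' z(1)])
 have xw: "pt F e 0 x w0 .: cpt Ten e" by (rule tn.pr_cl[OF F xc w0c(1)]) simp
 have dxw: "df Ten e (pt F e 0 x w0) = pt F (e + 1) 0 (df (val P F) e x) w0"
 proof -
  have "df Ten e (pt F e 0 x w0) = pt F (e + 1) 0 (df (val P F) e x) w0 +[cpt Ten (e + 1)]
   sg (cpt Ten (e + 1)) e (pt F e 1 x (df (val N F) 0 w0))"
   by (rule tn.pr_leibniz[OF F xc w0c(1)]) auto
  moreover have "pt F e 1 x 0[vcpt N F 1] = 0[cpt Ten (e + 1)]"
   by (rule am_0[OF L.lval_ag[OF F] C1.ag tn.pr_am_r[OF F xc]]) simp
  moreover have "pt F (e + 1) 0 (df (val P F) e x) w0 .: cpt Ten (e + 1)"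
   by (rule tn.pr_cl[OF F dxc w0c(1)]) simp
  ultimately show ?thesis using w0c(2) by simp
 qed
 have xwc: "pt F (e + 1) 0 (df (val P F) e x) w0 .: cpt Ten (e + 1)" by (rule tn.pr_cl[OF F dxc w0c(1)]) simp
 \<comment> \<open>Closedness of \<open>z\<close> says that the remainder, which only involves cells
   of degree above \<open>e\<close>, has to cancel the differential of \<open>x\<close> paired with
   \<open>w0\<close>.\<close>
 have dr: "df Ten e (z -[cpt Ten e] pt F e 0 x w0 -[cpt Ten e] df Ten (e - 1) q) =
   -[cpt Ten (e + 1)] pt F (e + 1) 0 (df (val P F) e x) w0"
 proof -
  have "df Ten e (df Ten (e - 1) q) = 0[cpt Ten (e + 1)]" by (rule acx_dd[OF tn.C_acx qc]) auto
  then show ?thesis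
   using zc xw dqc xwc z(2) dxw
   by (simp add: am_minus[OF C.ag C1.ag am] C1.minus_eq)
 qed
 interpret Y: pairing R A P "Hom A F" "cmp A F" "val P F" "act P F" by (rule pairing_yon[OF F])
 \<comment> \<open>The morphisms that send \<open>w0\<close> to a coboundary. They form a family of
   subgroups stable under closed morphisms, as the last clause of \<open>merge\<close>
   demands.\<close>
 define K where "K Y = {g : carrier (dhom A F Y 0). lact N F Y 0 0 g w0 : cobd (val N Y) 0}" for Y
 have ddx: "df (val P F) (e + 1) (df (val P F) e x) : span A P F (hi S (e + 1)) (e + 1 + 1)"
  using acx_dd[OF val_acx[OF F] xc, of "e + 1" "e + 1 + 1"] additive_subgroup.zero_closed[OF span_sub[OF F cs']] by simp
 \<comment> \<open>The second merging takes place in \<open>P(F)\<close>: the cells of degree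
   \<open>e + 1\<close> in the differential of \<open>x\<close> are combined into \<open>x1\<close>,
   with a single coefficient \<open>f\<close>.\<close>
 have "df (val P F) e x : span A P F ({c : S. deg c = e + 1} \<union> hi S (e + 1)) (e + 1)" unfolding split by (rule x(2))
 from Y.merge[OF additive nc subset_refl this ddx]
 obtain G x1 f where G: "G : Ob A" and x1: "x1 : span A P G (hi S (e + 1 - 1)) (e + 1)"
   "df (val P G) (e + 1) x1 : span A P G (hi S (e + 1)) (e + 1 + 1)"
  and f: "f : Z0 A F G" and xb: "df (val P F) e x -[vcpt P F (e + 1)] act P F G (e + 1) 0 x1 f : Y.bd S (e + 1)"
  and cl: "!!K. (ALL Y:Ob A. additive_subgroup (K Y) (dhom A F Y 0)) ==>
   (ALL Y:Ob A. ALL Z:Ob A. ALL f:Z0 A Y Z. ALL u:K Y. cmp A F Y Z 0 0 f u : K Z) ==>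
   (ALL (X, m, p):{c : S. deg c = e + 1}. ALL y:cocycles (Hom A F X) 0.
   df (val P F) e x -[vcpt P F (e + 1)] act P F X (e + 1) 0 p y : span A P F (S - {(X, m, p)}) (e + 1) --> y : K X) ==>
   f : K G" by blast
 \<comment> \<open>By the clause on coordinates it suffices to look at the coefficient
   \<open>y\<close> of each cell of degree \<open>e + 1\<close>. In the equation for the remainder,
   \<open>y w0\<close> is the coefficient to be cancelled, so \<open>coefficient_boundary\<close>
   makes it a coboundary.\<close>
 have "f : K G"
 proof (rule cl)
  show "ALL Y:Ob A. additive_subgroup (K Y) (dhom A F Y 0)"
  proof
   fix Y assume Y: "Y : Ob A"
   interpret H: agrp "dhom A F Y 0" by (rule hom_ag[OF F Y])
   interpret V: agrp "vcpt N Y 0" by (rule L.lval_ag[OF Y])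
   interpret Cb: additive_subgroup "cobd (val N Y) 0" "vcpt N Y 0" by (rule cobd_sub[OF L.lv_acx[OF Y]])
   have la: "amap (dhom A F Y 0) (vcpt N Y 0) (%g. lact N F Y 0 0 g w0)" by (rule L.la_am_l[OF F Y w0c(1)]) simp
   show "additive_subgroup (K Y) (dhom A F Y 0)"
   proof (rule additive_subgroup.intro, rule H.add.subgroupI)
   have "0[dhom A F Y 0] : K Y"
   using am_0[OF H.ag V.ag la] Cb.zero_closed by (simp add: K_def)
   then show "K Y ~= {}" by blast
   qed (auto simp: K_def am_add[OF la] am_neg[OF H.ag V.ag la] a_inv_def[symmetric] Cb.a_closed Cb.a_inv_closed)
  qed
  show "ALL Y:Ob A. ALL Z:Ob A. ALL f:Z0 A Y Z. ALL u:K Y. cmp A F Y Z 0 0 f u : K Z"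
  proof (intro ballI)
   fix Y Z f u assume o: "Y : Ob A" "Z : Ob A" and f: "f : Z0 A Y Z" and u: "u : K Y"
   have fc: "f .: dhom A Y Z 0" using f by (auto simp: cocycles_def)
   have uc: "u .: dhom A F Y 0" "lact N F Y 0 0 u w0 : cobd (val N Y) 0" using u by (auto simp: K_def)
   have "lact N F Z 0 0 (cmp A F Y Z 0 0 f u) w0 = lact N Y Z 0 0 f (lact N F Y 0 0 u w0)"
   by (rule L.la_comp'[OF F o fc uc(1) w0c(1)]) auto
   then show "cmp A F Y Z 0 0 f u : K Z"
   using L.la_coboundary[OF o f uc(2)] cmp_cl[OF F o fc uc(1)] by (simp add: K_def)
  qed
  show "ALL (X, m, p):{c : S. deg c = e + 1}. ALL y:cocycles (Hom A F X) 0.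
   df (val P F) e x -[vcpt P F (e + 1)] act P F X (e + 1) 0 p y : span A P F (S - {(X, m, p)}) (e + 1) --> y : K X"
  proof (clarsimp)
   fix X p y assume s: "(X, e + 1, p) : S" and y: "y : cocycles (Hom A F X) 0"
   and sp: "df (val P F) e x -[vcpt P F (e + 1)] act P F X (e + 1) 0 p y : span A P F (S - {(X, e + 1, p)}) (e + 1)"
   have o: "X : Ob A" "p .: vcpt P X (e + 1)" using cs s by (auto simp: cellset_def)
   have cm: "cellset A P (S - {(X, e + 1, p)})" by (rule cells_sub[OF cs]) auto
   have yc: "y .: dhom A F X 0" using y by (auto simp: cocycles_def)
   have yw: "lact N F X 0 0 y w0 .: vcpt N X 0" by (rule L.la_cl[OF F o(1) yc w0c(1)]) simp
   have py: "act P F X (e + 1) 0 p y .: vcpt P F (e + 1)" by (rule act_cl[OF F o yc]) simp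
   have pyw: "pt X (e + 1) 0 p (lact N F X 0 0 y w0) .: cpt Ten (e + 1)" by (rule tn.pr_cl[OF o yw]) simp
   have "pt F (e + 1) 0 (act P F X (e + 1) 0 p y) w0 = pt X (e + 1) 0 p (lact N F X 0 0 y w0)"
   by (rule tn.pr_balanced[OF F o yc w0c(1)]) auto
   moreover have "pt F (e + 1) 0 (df (val P F) e x -[vcpt P F (e + 1)] act P F X (e + 1) 0 p y) w0 =
   pt F (e + 1) 0 (df (val P F) e x) w0 -[cpt Ten (e + 1)] pt F (e + 1) 0 (act P F X (e + 1) 0 p y) w0"
   by (rule am_minus[OF val_ag[OF F] C1.ag tn.pr_am_l[OF F w0c(1)] dxc py]) simp
   moreover have "pt F (e + 1) 0 (df (val P F) e x -[vcpt P F (e + 1)] act P F X (e + 1) 0 p y) w0 : tn.wspan (S - {(X, e + 1, p)}) (e + 1)"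
   by (rule tn.span_pr[OF cm sp F w0c(1)]) simp
   ultimately have "-[cpt Ten (e + 1)] (pt F (e + 1) 0 (df (val P F) e x) w0 -[cpt Ten (e + 1)] pt X (e + 1) 0 p (lact N F X 0 0 y w0))
   : tn.wspan (S - {(X, e + 1, p)}) (e + 1)"
   using additive_subgroup.a_inv_closed[OF tn.wspan_sub[OF cm]] by simp
   moreover have "-[cpt Ten (e + 1)] (pt F (e + 1) 0 (df (val P F) e x) w0 -[cpt Ten (e + 1)] pt X (e + 1) 0 p (lact N F X 0 0 y w0))
   = -[cpt Ten (e + 1)] pt F (e + 1) 0 (df (val P F) e x) w0 +[cpt Ten (e + 1)] pt X (e + 1) 0 p (lact N F X 0 0 y w0)"
   using xwc pyw by (simp only: C1.minus_eq C1.minus_add C1.minus_minus C1.a_inv_closed)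
   ultimately have "df Ten e (z -[cpt Ten e] pt F e 0 x w0 -[cpt Ten e] df Ten (e - 1) q) +[cpt Ten (e + 1)]
   pt X (e + 1) 0 p (lact N F X 0 0 y w0) : tn.wspan (S - {(X, e + 1, p)}) (e + 1)"
   unfolding dr by simp
   then have "lact N F X 0 0 y w0 : cobd (val N X) 0"
   using tn.coefficient_boundary[OF nc s, of _ e "lact N F X 0 0 y w0"] r yw by simp
   then show "y : K X" using yc by (simp add: K_def)
  qed
 qed
 then have fw: "lact N F G 0 0 f w0 : cobd (val N G) 0" by (simp add: K_def)
 obtain q' where q': "q' : span A P F (hi S e) e" and xq: "df (val P F) e x -[vcpt P F (e + 1)] act P F G (e + 1) 0 x1 f
   -[vcpt P F (e + 1)] df (val P F) e q' : span A P F (hi S (e + 1)) (e + 1)"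
  using xb by (auto simp: Y.bd_def)
 obtain y where y: "y : cobd Ten e" and yx: "y -[cpt Ten e] pt F e 0 x w0 : tn.wspan (hi S e) e"
  using cokernel_boundary[OF e nc F G xc _ _ q' xq f w0 fw] x1 by (auto simp: add.assoc)
 have yc: "y .: cpt Ten e" using y Bd.a_subset by blast
 \<comment> \<open>Once the coboundary \<open>y\<close> replaces the symbol of \<open>x\<close> and
   \<open>w0\<close>, only cells of degree \<open>m > e\<close> are left. Their coefficients lie in
   degree \<open>e - m < 0\<close>, where \<open>N\<close> is acyclic.\<close>
 define r' where "r' = z -[cpt Ten e] df Ten (e - 1) q -[cpt Ten e] y"
 have "r' = (z -[cpt Ten e] pt F e 0 x w0 -[cpt Ten e] df Ten (e - 1) q) -[cpt Ten e] (y -[cpt Ten e] pt F e 0 x w0)"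
  unfolding r'_def C.minus_swap[OF zc xw dqc] using zc xw dqc yc
  by (simp add: C.minus_eq C.minus_add C.a_assoc C.a_comm[of "-[cpt Ten e] y"] C.r_neg1 C.r_neg2)
 then have r's: "r' : tn.wspan (hi S e) e"
  using r yx unfolding C.minus_eq[of _ "y -[cpt Ten e] pt F e 0 x w0"] by (simp add: We.a_closed We.a_inv_closed)
 have dqb: "df Ten (e - 1) q : cobd Ten e" by (rule coboundariesI[OF qc refl])
 have cy: "df Ten e u = 0[cpt Ten (e + 1)]" if "u : cobd Ten e" for u
  using acx_coboundary_cocycle[OF tn.C_acx] that by (auto simp: cocycles_def)
 have "df Ten e r' = 0[cpt Ten (e + 1)]"
  unfolding r'_def using zc dqc yc z(2) cy[OF dqb] cy[OF y]
  by (simp add: am_minus[OF C.ag C1.ag am] C1.minus_eq)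
 then have "EX u:tn.wspan (hi S e) (e - 1). df Ten (e - 1) u = r'"
  using N_acyclic cs by (intro tn.peel_all[OF nc _ r's]) (auto simp: cellset_def)
 then have "r' : cobd Ten e" using coboundariesI[OF tn.wspan_cl[OF cs']] by blast
 then have "r' +[cpt Ten e] y +[cpt Ten e] df Ten (e - 1) q : cobd Ten e"
  using y dqb by (simp add: Bd.a_closed)
 moreover have "r' +[cpt Ten e] y +[cpt Ten e] df Ten (e - 1) q = z"
  unfolding r'_def using zc yc dqc by (simp add: C.add_diff_self)
 ultimately show ?thesis by simp
qed

text \<open>It remains to treat the cells of degree \<open>m < e\<close>: their coefficients lie in
  degree \<open>e - m > 0\<close>, where \<open>N\<close> is acyclic, so they can be peeled off
  before \<open>top_cells_boundary\<close> is applied.\<close>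

theorem tensor_vanishing:
 assumes e: "e <= - int d - 2"
 shows "hz Ten e"
proof (rule cohomology_zeroI[OF tn.C_acx])
 fix z assume z: "z .: cpt Ten e" "df Ten e z = 0[cpt Ten (e + 1)]"
 obtain G S where S: "nf G S" "z : tn.wspan S e" using element_nf[OF z(1)] by blast
 then have nc: "normal_cells R A P S" by (simp add: nf_def)
 then have fin: "finite S" and cs: "cellset A P S" by (auto simp: normal_cells_def)
 have cs': "cellset A P (hi S b)" for b by (rule cells_sub[OF cs hi_subset])
 obtain a where a: "a <= e - 1" "hi S a = S" using hi_all[OF fin] by blast
 interpret C: agrp "cpt Ten e" by (rule tn.C_ag)
 interpret Bd: additive_subgroup "cobd Ten e" "cpt Ten e" by (rule cobd_sub[OF tn.C_acx])
 interpret C1: agrp "cpt Ten (e + 1)" by (rule tn.C_ag)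
 have "EX q:tn.wspan (hi S a) (e - 1). z -[cpt Ten e] df Ten (e - 1) q : tn.wspan (hi S (e - 1)) e"
 proof (rule tn.peel_cells[OF nc _ a(1)])
  show "hz (val N X) (e - m)" if "(X, m, p) : S" "m <= e - 1" for X m p
   using that cs by (intro N_acyclic) (auto simp: cellset_def)
  show "df Ten e z : tn.wspan (hi S (e - 1)) (e + 1)"
   unfolding z(2) by (rule additive_subgroup.zero_closed[OF tn.wspan_sub[OF cs']])
 qed (use S a in auto)
 then obtain q where q: "q : tn.wspan S (e - 1)" "z -[cpt Ten e] df Ten (e - 1) q : tn.wspan (hi S (e - 1)) e"
  unfolding a(2) by blast
 have qc: "q .: cpt Ten (e - 1)" by (rule tn.wspan_cl[OF cs q(1)])
 have dq: "df Ten (e - 1) q : cobd Ten e" by (rule coboundariesI[OF qc refl])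
 then have dqc: "df Ten (e - 1) q .: cpt Ten e" "df Ten e (df Ten (e - 1) q) = 0[cpt Ten (e + 1)]"
  using acx_coboundary_cocycle[OF tn.C_acx] by (auto simp: cocycles_def)
 have "df Ten e (z -[cpt Ten e] df Ten (e - 1) q) = 0[cpt Ten (e + 1)]"
  unfolding am_minus[OF C.ag tn.C_ag tn.C_addmap z(1) dqc(1)] z(2) dqc(2)
  by (simp add: C1.minus_eq)
 then have "z -[cpt Ten e] df Ten (e - 1) q : cobd Ten e"
  by (rule top_cells_boundary[OF e nc q(2)])
 then have "(z -[cpt Ten e] df Ten (e - 1) q) +[cpt Ten e] df Ten (e - 1) q : cobd Ten e"
  by (rule Bd.a_closed[OF _ dq])
 then have "z : cobd Ten e" using C.add_diff_self[OF z(1) dqc(1)] by simp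
 then show "EX y:carrier (cpt Ten (e - 1)). df Ten (e - 1) y = z" by (auto simp: coboundaries_def)
qed

end

section \<open>Transport of modules along injections\<close>

text \<open>Elements of modules built from a twisted complex are tuples, but the weak dimension only
  tests modules with elements in \<open>'u\<close>. An infinite type absorbs its finite powers, by
  repeated use of a bijection between the type and its square.\<close>

lemma infinite_tuples_inj:
 fixes I :: "'i set"
 assumes inf: "infinite (UNIV :: 'u set)" and I: "finite I"
 shows "EX g :: ('i => 'u) => 'u. inj_on g (\<Pi>\<^sub>E i\<in>I. UNIV)"
 using I
proof induction
 case empty
 then show ?case by (intro exI[of _ "%_. undefined"]) simp
next
 case (insert i I)
 then obtain g :: "('i => 'u) => 'u" where g: "inj_on g (\<Pi>\<^sub>E i\<in>I. UNIV)" by blast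
 obtain p :: "'u \<times> 'u => 'u" where p: "bij_betw p (UNIV \<times> UNIV) UNIV"
  using card_of_ordIso[THEN iffD2, OF card_of_Times_same_infinite[OF inf]] by blast
 have "inj_on (%f. p (f i, g (restrict f I))) (\<Pi>\<^sub>E i\<in>insert i I. UNIV)"
 proof (rule inj_onI)
  fix f f' :: "'i => 'u"
  assume f: "f : (\<Pi>\<^sub>E i\<in>insert i I. UNIV)" "f' : (\<Pi>\<^sub>E i\<in>insert i I. UNIV)"
   and e: "p (f i, g (restrict f I)) = p (f' i, g (restrict f' I))"
  have "(f i, g (restrict f I)) = (f' i, g (restrict f' I))"
   using inj_onD[OF bij_betw_imp_inj_on[OF p] e] by simp
  then have 1: "f i = f' i" and "g (restrict f I) = g (restrict f' I)" by auto
  then have "restrict f I = restrict f' I" using inj_onD[OF g] by simp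
  then have "f k = f' k" if "k : insert i I" for k using 1 that by (metis insertE restrict_apply')
  then show "f = f'" using PiE_ext[OF f] by blast
 qed
 then show ?case by blast
qed

text \<open>Injectivity is only required on \<open>U\<close>, the set of elements that occur: an
  injection defined on all functions from \<open>int\<close> need not exist. Structure is copied
  along \<open>\<iota>\<close> by means of its partial inverse.\<close>

locale transport =
 fixes \<iota> :: "'w => 'u" and U :: "'w set"
 assumes iota_inj: "inj_on \<iota> U"
begin

definition retr :: "'u => 'w" where "retr = inv_into U \<iota>"

lemma retr_iota [simp]: "x : U ==> retr (\<iota> x) = x"
 by (simp add: retr_def inv_into_f_f[OF iota_inj])

definition trm :: "('k, 'w) module => ('k, 'u) module" where
 "trm K = \<lparr>carrier = \<iota> ` carrier K, mult = undefined, one = undefined, zero = \<iota> 0[K],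
  add = (%x y. \<iota> (retr x +[K] retr y)), smult = (%r x. \<iota> (r *[K] retr x))\<rparr>"

definition trc :: "('k, 'w) cochain => ('k, 'u) cochain" where
 "trc C = \<lparr>cpt = (%n. trm (cpt C n)), cdiff = (%n x. \<iota> (df C n (retr x)))\<rparr>"

definition trd :: "('o, 'k, 'a, 'w) dgmod => ('o, 'k, 'a, 'u) dgmod" where
 "trd M = \<lparr>val = (%X. trc (val M X)), act = (%X Y m n x f. \<iota> (act M X Y m n (retr x) f))\<rparr>"

lemma trm_simps [simp]: "carrier (trm K) = \<iota> ` carrier K" "0[trm K] = \<iota> 0[K]"
  "x +[trm K] y = \<iota> (retr x +[K] retr y)" "r *[trm K] x = \<iota> (r *[K] retr x)"
 and trc_simps [simp]: "cpt (trc C) n = trm (cpt C n)" "df (trc C) n x = \<iota> (df C n (retr x))"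
 and trd_simps [simp]: "val (trd M) X = trc (val M X)" "act (trd M) X Y m n x f = \<iota> (act M X Y m n (retr x) f)"
 by (simp_all add: trm_def trc_def trd_def)

lemma trm_module:
 assumes M: "Module.module R K" and U: "carrier K <= U"
 shows "Module.module R (trm K)"
proof -
 interpret K: Module.module R K by fact
 have U': "x .: K ==> x : U" for x using U by blast
 show ?thesis
 proof (rule moduleI)
  show "cring R" by unfold_locales
  show "abelian_group (trm K)"
  proof (rule abelian_groupI)
   fix x assume "x .: trm K"
   then show "EX y:carrier (trm K). y +[trm K] x = 0[trm K]"
   by (auto simp: U' K.l_neg intro!: bexI[of _ "-[K] _"])
  qed (auto simp: U' K.a_ac)
 qed (auto simp: U' K.smult_l_distr K.smult_r_distr K.smult_assoc1)
qed

lemma iota_linear: "carrier K <= U ==> linear_map R K (trm K) \<iota>"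
 by (rule linI) (auto simp: subset_iff)

lemma retr_linear: "Module.module R K ==> carrier K <= U ==> linear_map R (trm K) K retr"
proof -
 assume M: "Module.module R K" and U: "carrier K <= U"
 interpret K: Module.module R K by fact
 show ?thesis using U by (intro linI) (auto simp: subset_iff)
qed

lemma linear_map_trm:
 assumes "Module.module R K" "carrier K <= U" "carrier L <= U" "linear_map R K L f"
 shows "linear_map R (trm K) (trm L) (%x. \<iota> (f (retr x)))"
 using lin_comp[OF lin_comp[OF retr_linear[OF assms(1,2)] assms(4)] iota_linear[OF assms(3)]] .

lemma iota_signed:
 fixes R :: "'k ring"
 assumes "Module.module R K" "carrier K <= U" "x .: K"
 shows "sg (trm K) n (\<iota> x) = \<iota> (sg K n x)"
 using am_sg[OF module_agrp[OF assms(1)] module_agrp[OF trm_module[OF assms(1,2)]] lin_am[OF iota_linear[OF assms(2), of R]] assms(3)]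
 by simp

lemma trc_complex:
 assumes C: "cochain_complex R C" and U: "!!n. carrier (cpt C n) <= U"
 shows "cochain_complex R (trc C)"
proof -
 have M: "Module.module R (cpt C n)" and d: "linear_map R (cpt C n) (cpt C (n + 1)) (df C n)" for n
  using C by (auto simp: cochain_complex_def)
 note acx = cc_acx[OF C]
 have "df C n x : U" if "x .: cpt C n" for n x
  using acx_cl[OF acx that refl] U by blast
 moreover have "df (trc C) n = (%x. \<iota> (df C n (retr x)))" for n by auto
 ultimately show ?thesis
  unfolding cochain_complex_def using trm_module[OF M U] linear_map_trm[OF M U U d] acx_dd[OF acx] U
  by (auto simp: subset_iff)
qed

lemma trc_cohomology_zero:
 assumes C: "cochain_complex R C" and U: "!!n. carrier (cpt C n) <= U" and z: "hz C n"
 shows "hz (trc C) n"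
proof (rule cohomology_zeroI[OF cc_acx[OF trc_complex[OF C U]]])
 note acx = cc_acx[OF C]
 fix x assume "x .: cpt (trc C) n" and dx: "df (trc C) n x = 0[cpt (trc C) (n + 1)]"
 then obtain y where y: "y .: cpt C n" "x = \<iota> y" by auto
 have U': "z .: cpt C m ==> z : U" for z m using U by blast
 have "0[cpt C (n + 1)] .: cpt C (n + 1)" "df C n y .: cpt C (n + 1)"
  using acxD(1)[OF acx, of "n + 1"] acx_cl[OF acx y(1) refl] by (auto simp: agrp_def abelian_group_def abelian_monoid.zero_closed)
 then have "df C n y = 0[cpt C (n + 1)]"
  using dx y inj_onD[OF iota_inj] U' by auto
 then obtain u where "u .: cpt C (n - 1)" "df C (n - 1) u = y" using acyclicE[OF z y(1)] by blast
 then show "EX u:carrier (cpt (trc C) (n - 1)). df (trc C) (n - 1) u = x"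
  using y U' by (auto intro!: bexI[of _ u])
qed

lemma dg_module_trd:
 assumes M: "dg_module R A M" and U: "!!X n. X : Ob A ==> carrier (vcpt M X n) <= U"
 shows "dg_module R A (trd M)"
proof -
 interpret M: dg_module R A M by fact
 have U': "X : Ob A ==> x .: vcpt M X m ==> x : U" for x X m using U by blast
 show ?thesis
 proof unfold_locales
  fix X assume X: "X : Ob A"
  show "cochain_complex R (val (trd M) X)" using trc_complex[OF M.val_complex[OF X] U[OF X]] by simp
 next
  fix X Y f n m assume o: "X : Ob A" "Y : Ob A" and f: "f .: dhom A X Y n"
  show "linear_map R (vcpt (trd M) Y m) (vcpt (trd M) X (m + n)) (%x. act (trd M) X Y m n x f)"
   using linear_map_trm[OF M.val_module[OF o(2)] U[OF o(2)] U[OF o(1)] M.act_linear_left[OF o f]] by simp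
 next
  fix X Y x m n assume o: "X : Ob A" "Y : Ob A" and "x .: vcpt (trd M) Y m"
  then obtain y where y: "y .: vcpt M Y m" "x = \<iota> y" by auto
  show "linear_map R (dhom A X Y n) (vcpt (trd M) X (m + n)) (%f. act (trd M) X Y m n x f)"
   using lin_comp[OF M.act_linear_right[OF o y(1)] iota_linear[OF U[OF o(1)]]] y U'[OF o(2)] by simp
 next
  fix X Y Z x g f l m n
  assume o: "X : Ob A" "Y : Ob A" "Z : Ob A" and "x .: vcpt (trd M) Z l"
   and g: "g .: dhom A Y Z m" and f: "f .: dhom A X Y n"
  then obtain y where y: "y .: vcpt M Z l" "x = \<iota> y" by auto
  have "act M Y Z l m y g : U" by (rule U'[OF o(2) M.act_cl[OF o(2,3) y(1) g refl]])
  then show "act (trd M) X Y (l + m) n (act (trd M) Y Z l m x g) f = act (trd M) X Z l (m + n) x (cmp A X Y Z m n g f)"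
   using y U'[OF o(3) y(1)] M.act_comp[OF o y(1) g f] by simp
 next
  fix X x m assume X: "X : Ob A" and "x .: vcpt (trd M) X m"
  then show "act (trd M) X X m 0 x (ident A X) = x" using U' M.act_ident by auto
 next
  fix X Y x f m n
  assume o: "X : Ob A" "Y : Ob A" and "x .: vcpt (trd M) Y m" and f: "f .: dhom A X Y n"
  then obtain y where y: "y .: vcpt M Y m" "x = \<iota> y" by auto
  have df: "df (Hom A X Y) n f .: dhom A X Y (n + 1)" by (rule acx_cl[OF M.hom_acx[OF o] f refl])
  have dy: "df (val M Y) m y .: vcpt M Y (m + 1)" by (rule acx_cl[OF M.val_acx[OF o(2)] y(1) refl])
  have c: "act M X Y m n y f .: vcpt M X (m + n)" "act M X Y (m + 1) n (df (val M Y) m y) f .: vcpt M X (m + n + 1)"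
   "act M X Y m (n + 1) y (df (Hom A X Y) n f) .: vcpt M X (m + n + 1)"
   using o y(1) f df dy by (auto intro!: M.act_cl)
  interpret G: agrp "vcpt M X (m + n + 1)" by (rule M.val_ag[OF o(1)])
  show "df (val (trd M) X) (m + n) (act (trd M) X Y m n x f) =
   act (trd M) X Y (m + 1) n (df (val (trd M) Y) m x) f +[vcpt (trd M) X (m + n + 1)]
   sg (vcpt (trd M) X (m + n + 1)) m (act (trd M) X Y m (n + 1) x (df (Hom A X Y) n f))"
   using M.act_leibniz[OF o y(1) f] U'[OF o(2) y(1)] U'[OF o(2) dy] U'[OF o(1) c(1)] U'[OF o(1) c(2)] U'[OF o(1) G.sg_cl[OF c(3)]]
   iota_signed[OF M.val_module[OF o(1)] U[OF o(1)] c(3)] y(2) by simp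
 qed
qed

end

section \<open>Representable modules of twisted complexes\<close>

text \<open>The functor sending \<open>X\<close> to the morphisms from \<open>X\<close> to
  \<open>T[s]\<close>; the action is precomposition and needs no sign.\<close>

definition tmod :: "int => ('o, 'k, 'a) dgcat => ('o, 'a) twisted => ('o, 'k, 'a, int => 'a) dgmod" where
 "tmod s A T = \<lparr>val = (%X. lt s T (Hom A X) (cmp A X)),
  act = (%X Y m n x f. %k:sp T. cmp A X Y T$k (m + s - k) n (x k) f)\<rparr>"

lemma tmod_simps [simp]: "val (tmod s A T) X = lt s T (Hom A X) (cmp A X)"
 "act (tmod s A T) X Y m n x f = (%k:sp T. cmp A X Y T$k (m + s - k) n (x k) f)"
 by (simp_all add: tmod_def)

context twisted
begin

lemma tl_coyon: "X : Ob A ==> twisted_left R A T (Hom A X) (cmp A X)"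
 by (intro twisted_left.intro twisted_axioms left_dg_coyon)

lemma tmod_cpt: "X : Ob A ==> cpt (lt s T (Hom A X) (cmp A X)) n = pm (sp T) (%j. dhom A X T$j (n + s - j))"
 using twisted_left.lt_cpt[OF tl_coyon] by blast

lemma tmod_mem: "X : Ob A ==> x .: cpt (lt s T (Hom A X) (cmp A X)) n ==> j : sp T ==> k = n + s - j ==>
 x j .: dhom A X T$j k"
 using twisted_left.lt_mem[OF tl_coyon] by blast

lemma tmod_eval: "X : Ob A ==> j : sp T ==> k = n + s - j ==>
 amap (cpt (lt s T (Hom A X) (cmp A X)) n) (dhom A X T$j k) (%x. x j)"
 unfolding tmod_cpt using pm_eval[of j "sp T" "%j. dhom A X T$j (n + s - j)"] by simp

lemma tmod_ext:
 assumes "X : Ob A" "x .: cpt (lt s T (Hom A X) (cmp A X)) n" "y .: cpt (lt s T (Hom A X) (cmp A X)) n"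
  "!!k. k : sp T ==> x k = y k"
 shows "x = y"
 using assms unfolding tmod_cpt[OF assms(1)] pm_simps by (intro PiE_ext[of x "sp T" _ y]) auto

lemma tmod_act_closed:
 assumes o: "X : Ob A" "Y : Ob A" and x: "x .: cpt (lt s T (Hom A Y) (cmp A Y)) m" and f: "f .: dhom A X Y n"
  and p: "p = m + n"
 shows "(%k:sp T. cmp A X Y T$k (m + s - k) n (x k) f) .: cpt (lt s T (Hom A X) (cmp A X)) p"
proof -
 have "cmp A X Y T$k (m + s - k) n (x k) f .: dhom A X T$k (p + s - k)" if "k : sp T" for k
  by (rule cmp_cl[OF o tob[OF that] tmod_mem[OF o(2) x that refl] f]) (simp add: p)
 then show ?thesis unfolding tmod_cpt[OF o(1)] by auto
qed

lemma dg_module_tmod: "dg_module R A (tmod s A T)"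
proof unfold_locales
 fix X assume X: "X : Ob A"
 interpret L: twisted_left R A T "Hom A X" "cmp A X" s by (rule tl_coyon[OF X])
 show "cochain_complex R (val (tmod s A T) X)" using L.lt_cochain_complex by simp
next
 fix X Y f n m assume o: "X : Ob A" "Y : Ob A" and f: "f .: dhom A X Y n"
 have "linear_map R (pm (sp T) (%j. dhom A Y T$j (m + s - j)))
   (pm (sp T) (%j. dhom A X T$j (m + n + s - j)))
   (%x. %k:sp T. cmp A X Y T$k (m + s - k) n (x k) f)"
 proof (rule linear_map_tuple, rule linear_map_tuple_component)
  fix k assume k: "k : sp T"
  have "m + s - k + n = m + n + s - k" by simp
  then show "linear_map R (dhom A Y T$k (m + s - k)) (dhom A X T$k (m + n + s - k)) (%u. cmp A X Y T$k (m + s - k) n u f)"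
   using comp_linear_left[OF o tob[OF k] f, of "m + s - k"] by (simp only:)
 qed
 then show "linear_map R (vcpt (tmod s A T) Y m) (vcpt (tmod s A T) X (m + n)) (%x. act (tmod s A T) X Y m n x f)"
  unfolding tmod_simps tmod_cpt[OF o(1)] tmod_cpt[OF o(2)] .
next
 fix X Y x m n assume o: "X : Ob A" "Y : Ob A" and x: "x .: vcpt (tmod s A T) Y m"
 have "linear_map R (dhom A X Y n) (pm (sp T) (%j. dhom A X T$j (m + n + s - j)))
   (%f. %k:sp T. cmp A X Y T$k (m + s - k) n (x k) f)"
 proof (rule linear_map_tuple)
  fix k assume k: "k : sp T"
  have "x k .: dhom A Y T$k (m + s - k)" using tmod_mem[OF o(2) _ k refl] x by simp
  moreover have "m + s - k + n = m + n + s - k" by simp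
  ultimately show "linear_map R (dhom A X Y n) (dhom A X T$k (m + n + s - k)) (%f. cmp A X Y T$k (m + s - k) n (x k) f)"
   using comp_linear_right[OF o tob[OF k], of "x k" "m + s - k" n] by (simp only:)
 qed
 then show "linear_map R (dhom A X Y n) (vcpt (tmod s A T) X (m + n)) (%f. act (tmod s A T) X Y m n x f)"
  unfolding tmod_simps tmod_cpt[OF o(1)] .
next
 fix X Y Z x g f l m n
 assume o: "X : Ob A" "Y : Ob A" "Z : Ob A" and x: "x .: vcpt (tmod s A T) Z l"
  and g: "g .: dhom A Y Z m" and f: "f .: dhom A X Y n"
 have "cmp A X Y T$k (l + m + s - k) n (cmp A Y Z T$k (l + s - k) m (x k) g) f =
   cmp A X Z T$k (l + s - k) (m + n) (x k) (cmp A X Y Z m n g f)" if k: "k : sp T" for k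
  by (rule comp_assoc'[OF o tob[OF k] tmod_mem[OF o(3) _ k refl] g f]) (use x in auto)
 then show "act (tmod s A T) X Y (l + m) n (act (tmod s A T) Y Z l m x g) f = act (tmod s A T) X Z l (m + n) x (cmp A X Y Z m n g f)"
  by (auto simp: restrict_def)
next
 fix X x m assume X: "X : Ob A" and x: "x .: vcpt (tmod s A T) X m"
 have "x : extensional (sp T)" using x unfolding tmod_simps tmod_cpt[OF X] by (simp add: PiE_def)
 moreover have "cmp A X X T$k (m + s - k) 0 (x k) (ident A X) = x k" if "k : sp T" for k
  using comp_ident_right[OF X tob[OF that] tmod_mem[OF X _ that refl]] x by simp
 ultimately show "act (tmod s A T) X X m 0 x (ident A X) = x"
  by (simp add: extensional_restrict cong: restrict_cong)
next
 fix X Y x f m n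
 assume o: "X : Ob A" "Y : Ob A" and x': "x .: vcpt (tmod s A T) Y m" and f: "f .: dhom A X Y n"
 interpret LX: twisted_left R A T "Hom A X" "cmp A X" s by (rule tl_coyon[OF o(1)])
 interpret LY: twisted_left R A T "Hom A Y" "cmp A Y" s by (rule tl_coyon[OF o(2)])
 let ?X = "lt s T (Hom A X) (cmp A X)" and ?Y = "lt s T (Hom A Y) (cmp A Y)"
 have x: "x .: cpt ?Y m" using x' by simp
 let ?act = "act (tmod s A T) X Y"
 interpret G: agrp "cpt ?X (m + n + 1)" by (rule acxD(1)[OF LX.lt_acx])
 have df: "df (Hom A X Y) n f .: dhom A X Y (n + 1)" by (rule acx_cl[OF hom_acx[OF o] f refl])
 have dx: "df ?Y m x .: cpt ?Y (m + 1)" by (rule acx_cl[OF LY.lt_acx x refl])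
 have c: "?act m n x f .: cpt ?X (m + n)" "?act (m + 1) n (df ?Y m x) f .: cpt ?X (m + n + 1)"
   "?act m (n + 1) x (df (Hom A X Y) n f) .: cpt ?X (m + n + 1)"
  unfolding tmod_simps by (rule tmod_act_closed[OF o x f] tmod_act_closed[OF o dx f] tmod_act_closed[OF o x df]; simp)+
 show "df (val (tmod s A T) X) (m + n) (?act m n x f) =
   ?act (m + 1) n (df (val (tmod s A T) Y) m x) f +[vcpt (tmod s A T) X (m + n + 1)]
   sg (vcpt (tmod s A T) X (m + n + 1)) m (?act m (n + 1) x (df (Hom A X Y) n f))"
  unfolding tmod_simps(1)
 proof (rule tmod_ext[OF o(1)])
  show "df ?X (m + n) (?act m n x f) .: cpt ?X (m + n + 1)" by (rule acx_cl[OF LX.lt_acx c(1) refl])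
  show "?act (m + 1) n (df ?Y m x) f +[cpt ?X (m + n + 1)] sg (cpt ?X (m + n + 1)) m (?act m (n + 1) x (df (Hom A X Y) n f))
   .: cpt ?X (m + n + 1)" by (rule G.a_closed[OF c(2) G.sg_cl[OF c(3)]])
  fix j assume j: "j : sp T"
  let ?H = "dhom A X T$j (m + n + 1 + s - j)" and ?K = "dhom A Y T$j (m + 1 + s - j)"
  interpret H: agrp ?H by (rule hom_ag[OF o(1) tob[OF j]])
  interpret K: agrp ?K by (rule hom_ag[OF o(2) tob[OF j]])
  note ev = tmod_eval[OF o(1) j, of "m + n + 1 + s - j" "m + n + 1" s, OF refl]
  have xm: "x k .: dhom A Y T$k (m + s - k)" if "k : sp T" for k by (rule tmod_mem[OF o(2) x that refl])
  have am: "amap ?K ?H (%u. cmp A X Y T$j (m + 1 + s - j) n u f)"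
   by (rule cmp_am_l[OF o tob[OF j] f]) simp
  let ?dx = "df (Hom A Y T$j) (m + s - j) (x j)"
  have dxj: "?dx .: ?K" by (rule acx_cl[OF hom_acx[OF o(2) tob[OF j]] xm[OF j]]) simp
  have ax: "cmp A Y T$k T$j (k - j + 1) (m + s - k) (tdiff T k j) (x k) .: ?K" if "k : sp T" for k
   by (rule cmp_cl[OF o(2) tob[OF that] tob[OF j] td_cl[OF that j refl] xm[OF that]]) simp
  let ?S = "\<Oplus>[?K] k:sp T. sg ?K s (cmp A Y T$k T$j (k - j + 1) (m + s - k) (tdiff T k j) (x k))"
  have S: "?S .: ?K" using ax by (auto intro!: K.finsum_closed)
  let ?E = "cmp A X Y T$j (m + 1 + s - j) n ?dx f"
   and ?F = "cmp A X Y T$j (m + s - j) (n + 1) (x j) (df (Hom A X Y) n f)"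
   and ?W = "\<Oplus>[?H] k:sp T. sg ?H s (cmp A X Y T$j (m + 1 + s - j) n (cmp A Y T$k T$j (k - j + 1) (m + s - k) (tdiff T k j) (x k)) f)"
  have E: "?E .: ?H" by (rule am_cl[OF am dxj])
  have F: "?F .: ?H" by (rule cmp_cl[OF o tob[OF j] xm[OF j] df]) simp
  have W: "?W .: ?H" using am_cl[OF am ax] by (auto intro!: H.finsum_closed)
  have l1: "df (Hom A X T$j) (m + n + s - j) (cmp A X Y T$j (m + s - j) n (x j) f) = ?E +[?H] sg ?H (m + s - j) ?F"
  proof -
   have "df (Hom A X T$j) (m + s - j + n) (cmp A X Y T$j (m + s - j) n (x j) f) =
   cmp A X Y T$j (m + s - j + 1) n ?dx f +[dhom A X T$j (m + s - j + n + 1)]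
   sg (dhom A X T$j (m + s - j + n + 1)) (m + s - j) ?F"
   by (rule leibniz[OF o tob[OF j] xm[OF j] f])
   moreover have "m + s - j + n = m + n + s - j" "m + n + s - j + 1 = m + n + 1 + s - j" "m + s - j + 1 = m + 1 + s - j" by simp_all
   ultimately show ?thesis by simp
  qed
  have l2: "(\<Oplus>[?H] k:sp T. sg ?H s (cmp A X T$k T$j (k - j + 1) (m + n + s - k) (tdiff T k j) (?act m n x f k))) = ?W"
  proof (rule H.finsum_cong')
   fix k assume k: "k : sp T"
   have "cmp A X Y T$j (m + 1 + s - j) n (cmp A Y T$k T$j (k - j + 1) (m + s - k) (tdiff T k j) (x k)) f =
   cmp A X T$k T$j (k - j + 1) (m + n + s - k) (tdiff T k j) (cmp A X Y T$k (m + s - k) n (x k) f)"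
   by (rule comp_assoc'[OF o tob[OF k] tob[OF j] td_cl[OF k j refl] xm[OF k] f]) auto
   then show "sg ?H s (cmp A X T$k T$j (k - j + 1) (m + n + s - k) (tdiff T k j) (?act m n x f k)) =
   sg ?H s (cmp A X Y T$j (m + 1 + s - j) n (cmp A Y T$k T$j (k - j + 1) (m + s - k) (tdiff T k j) (x k)) f)"
   using k by simp
  qed (use am_cl[OF am ax] in auto)
  have L: "df ?X (m + n) (?act m n x f) j = sg ?H (j + s) (?E +[?H] sg ?H (m + s - j) ?F) +[?H] ?W"
   unfolding LX.lt_diff[OF j] l2 using l1 j by simp
  have "?act (m + 1) n (df ?Y m x) f j = cmp A X Y T$j (m + 1 + s - j) n (sg ?K (j + s) ?dx +[?K] ?S) f"
   unfolding tmod_simps using j by (simp add: LY.lt_diff[OF j])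
  also have "... = sg ?H (j + s) ?E +[?H] cmp A X Y T$j (m + 1 + s - j) n ?S f"
   using am_add[OF am K.sg_cl[OF dxj] S] am_sg[OF K.ag H.ag am dxj] by simp
  also have "cmp A X Y T$j (m + 1 + s - j) n ?S f = ?W"
   using ax by (subst am_finsum[OF K.ag H.ag am])
   (auto intro!: H.finsum_cong' am_cl[OF am] simp: am_sg[OF K.ag H.ag am, symmetric])
  finally have R1: "?act (m + 1) n (df ?Y m x) f j = sg ?H (j + s) ?E +[?H] ?W" .
  have R2: "sg (cpt ?X (m + n + 1)) m (?act m (n + 1) x (df (Hom A X Y) n f)) j = sg ?H m ?F"
   using am_sg[OF G.ag H.ag ev c(3), of m] j by simp
  \<comment> \<open>The diagonal sign \<open>j + s\<close> meets the Leibniz sign of a component of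
    degree \<open>m + s - j\<close>; their product is the sign \<open>m\<close> of the
    tuple.\<close>
  have sg: "sg ?H (j + s) (sg ?H (m + s - j) ?F) = sg ?H m ?F"
   unfolding H.sg_sg[OF F] by (rule sg_parity) simp
  have "df ?X (m + n) (?act m n x f) j = sg ?H (j + s) ?E +[?H] ?W +[?H] sg ?H m ?F"
   unfolding L H.sg_add[OF E H.sg_cl[OF F]] sg using E F W by (simp add: H.a_ac)
  then show "df ?X (m + n) (?act m n x f) j = (?act (m + 1) n (df ?Y m x) f +[cpt ?X (m + n + 1)]
   sg (cpt ?X (m + n + 1)) m (?act m (n + 1) x (df (Hom A X Y) n f))) j"
   using am_add[OF ev c(2) G.sg_cl[OF c(3)]] R1 R2 by simp
 qed
qed

end

section \<open>The lower bound\<close>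

context dg_category
begin

text \<open>The Leibniz rule for the identity composed with itself reads
  \<open>?d = ?d + ?d\<close>.\<close>

lemma ident_cocycle: "X : Ob A ==> df (Hom A X X) 0 (ident A X) = 0[dhom A X X 1]"
proof -
 assume X: "X : Ob A"
 note i = ident_closed[OF X]
 interpret G: agrp "dhom A X X 1" by (rule hom_ag[OF X X])
 let ?d = "df (Hom A X X) 0 (ident A X)"
 have d: "?d .: dhom A X X 1" by (rule acx_cl[OF hom_acx[OF X X] i]) simp
 have "?d = ?d +[dhom A X X 1] ?d"
  using leibniz[OF X X X i i] comp_ident_left[OF X X i] comp_ident_left[OF X X d] comp_ident_right[OF X X d] by simp
 then show ?thesis using d by (metis G.a_assoc G.r_neg G.r_zero G.a_inv_closed)
qed

text \<open>A contraction \<open>\<eta>\<close> of the identity, composed with a closed morphism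
  from or to \<open>X\<close>, is a primitive of that morphism.\<close>

lemma null_ident_zero_object:
 assumes X: "X : Ob A" and n: "ident A X : cobd (Hom A X X) 0"
 shows "h0_zero_object A X"
proof -
 obtain \<eta> where e: "\<eta> .: dhom A X X (-1)" "ident A X = df (Hom A X X) (-1) \<eta>"
  by (rule coboundariesE[OF n, of "-1"]) auto
 have "hz (Hom A Y X) 0 & hz (Hom A X Y) 0" if Y: "Y : Ob A" for Y
 proof (intro conjI cohomology_zeroI hom_acx X Y)
  interpret G: agrp "dhom A Y X 0" by (rule hom_ag[OF Y X])
  fix f assume f: "f .: dhom A Y X 0" "df (Hom A Y X) 0 f = 0[dhom A Y X (0 + 1)]"
  have z: "cmp A Y X X (-1) 1 \<eta> 0[dhom A Y X 1] = 0[dhom A Y X 0]"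
   by (rule am_0[OF hom_ag[OF Y X] G.ag cmp_am_r[OF Y X X e(1)]]) simp
  have "df (Hom A Y X) (-1) (cmp A Y X X (-1) 0 \<eta> f) = f"
   using leibniz[OF Y X X e(1) f(1)] f z comp_ident_left[OF Y X f(1)] e(2) by simp
  then show "EX y:carrier (dhom A Y X (0 - 1)). df (Hom A Y X) (0 - 1) y = f"
   using cmp_cl[OF Y X X e(1) f(1), of "-1"] by (intro bexI[of _ "cmp A Y X X (-1) 0 \<eta> f"]) auto
 next
  interpret G: agrp "dhom A X Y 0" by (rule hom_ag[OF X Y])
  fix f assume f: "f .: dhom A X Y 0" "df (Hom A X Y) 0 f = 0[dhom A X Y (0 + 1)]"
  have z: "cmp A X X Y 1 (-1) 0[dhom A X Y 1] \<eta> = 0[dhom A X Y 0]"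
   by (rule am_0[OF hom_ag[OF X Y] G.ag cmp_am_l[OF X X Y e(1)]]) simp
  have "df (Hom A X Y) (-1) (cmp A X X Y 0 (-1) f \<eta>) = f"
   using leibniz[OF X X Y f(1) e(1)] f z comp_ident_right[OF X Y f(1)] e(2) by simp
  then show "EX y:carrier (dhom A X Y (0 - 1)). df (Hom A X Y) (0 - 1) y = f"
   using cmp_cl[OF X X Y f(1) e(1), of "-1"] by (intro bexI[of _ "cmp A X X Y 0 (-1) f \<eta>"]) auto
 qed
 then show ?thesis using X by (auto simp: h0_zero_object_def)
qed

end

text \<open>Assembles a tuple from its entries. The set \<open>J\<close> is needed for the
  differential of a basis element, whose coefficients only live on a subset of the indices.\<close>

lemma pm_sum_single:
 assumes I: "finite I" and ag: "!!k. k : I ==> agrp (F k)" and P: "agrp (pm I F)"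
  and J: "J <= I" and f: "!!k. k : J ==> f k .: F k"
 shows "(\<Oplus>[pm I F] k:J. (%j:I. if j = k then f k else 0[F j])) = (%j:I. if j : J then f j else 0[F j])"
proof -
 interpret P: agrp "pm I F" by fact
 have z: "0[F j] .: F j" "abelian_monoid (F j)" if "j : I" for j
  using ag[OF that] by (auto simp: agrp_def abelian_group_def abelian_monoid.zero_closed)
 have e: "(%j:I. if j = k then f k else 0[F j]) .: pm I F" if "k : J" for k
  using that z f J by auto
 have t: "(%j:I. if j : J then f j else 0[F j]) .: pm I F"
  using z f J by auto
 show ?thesis
 proof (rule PiE_ext)
  show "(\<Oplus>[pm I F] k:J. (%j:I. if j = k then f k else 0[F j])) : (\<Pi>\<^sub>E i\<in>I. carrier (F i))"
   using P.finsum_closed[of "%k. %j:I. if j = k then f k else 0[F j]" J] e by simp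
  show "(%j:I. if j : J then f j else 0[F j]) : (\<Pi>\<^sub>E i\<in>I. carrier (F i))" using t by simp
  fix i assume i: "i : I"
  have "(\<Oplus>[pm I F] k:J. (%j:I. if j = k then f k else 0[F j])) i =
   (\<Oplus>[F i] k:J. (%j:I. if j = k then f k else 0[F j]) i)"
   by (rule am_finsum[OF P.ag ag[OF i] pm_eval[OF i] e])
  also have "... = (if i : J then f i else 0[F i])"
  proof (cases "i : J")
   case True
   have "(\<Oplus>[F i] k:J. (%j:I. if j = k then f k else 0[F j]) i) = (%j:I. if j = i then f i else 0[F j]) i"
   by (rule abelian_monoid.finsum_single[OF z(2)[OF i] finite_subset[OF J I] True]) (use i f[OF True] in auto)
   then show ?thesis using True i by simp
  next
   case False
   have "(\<Oplus>[F i] k:J. (%j:I. if j = k then f k else 0[F j]) i) = 0[F i]"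
   by (rule abelian_monoid.finsum_all_0[OF z(2)[OF i]]) (use i False in auto)
   then show ?thesis using False by simp
  qed
  finally show "(\<Oplus>[pm I F] k:J. (%j:I. if j = k then f k else 0[F j])) i =
   (%j:I. if j : J then f j else 0[F j]) i" using i by simp
 qed
qed

section \<open>Truncation of T to positive indices\<close>

context twisted
begin

abbreviation "Tpos == T\<lparr>tsupp := sp T \<inter> {1..}\<rparr>"

text \<open>For indices \<open>i >= 1\<close> a structure map from \<open>i\<close> to an index
  \<open>k <= 0\<close> is zero, so dropping such \<open>k\<close> does not change the Maurer-Cartan
  sums.\<close>

lemma twisted_truncated: "twisted_complex A Tpos"
proof -
 have "(\<Oplus>[dhom A T$i T$j (i - j + 2)] k:sp T \<inter> {1..}.
   cmp A T$i T$k T$j (k - j + 1) (i - k + 1) (tdiff T k j) (tdiff T i k)) =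
  (\<Oplus>[dhom A T$i T$j (i - j + 2)] k:sp T.
   cmp A T$i T$k T$j (k - j + 1) (i - k + 1) (tdiff T k j) (tdiff T i k))"
  if i: "i : sp T" "1 <= i" and j: "j : sp T" for i j
 proof -
  interpret H: agrp "dhom A T$i T$j (i - j + 2)" by (rule hom_ag[OF tob[OF i(1)] tob[OF j]])
  show ?thesis
  proof (rule H.add.finprod_mono_neutral_cong_left[OF tfin])
   {
   fix k assume "k : sp T - (sp T \<inter> {1..})"
   then have k: "k : sp T" "k <= i" using i by auto
   show "cmp A T$i T$k T$j (k - j + 1) (i - k + 1) (tdiff T k j) (tdiff T i k) = 0[dhom A T$i T$j (i - j + 2)]"
   unfolding tdiff_zero[OF i(1) k]
   by (rule am_0[OF hom_ag[OF tob[OF i(1)] tob[OF k(1)]] H.ag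
   cmp_am_r[OF tob[OF i(1)] tob[OF k(1)] tob[OF j] td_cl[OF k(1) j refl]]]) simp
   }
  qed (use td_cmp_cl[OF i(1) j] in auto)
 qed
 then show ?thesis using twc by (auto simp: twisted_complex_def Let_def)
qed

end

context twisted_right
begin

lemma truncated_right: "twisted_right R A Tpos M"
 by (intro twisted_right.intro twisted.intro twisted_axioms.intro twisted_truncated dg_module_axioms dg_category_axioms)

lemma truncated_diff:
 assumes x: "x .: cpt (rt T M) n" and i: "i : sp T" "1 <= i"
 shows "df (rt Tpos M) n (restrict x (sp Tpos)) i = df (rt T M) n x i"
proof -
 interpret T1: twisted_right R A Tpos M by (rule truncated_right)
 let ?H = "vcpt M T$i (i + (n + 1))"
 interpret H: agrp ?H by (rule val_ag[OF tob[OF i(1)]])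
 have "(\<Oplus>[?H] k:sp T \<inter> {1..}. sg ?H (n + 1) (act M T$i T$k (k + n) (i - k + 1) (restrict x (sp T \<inter> {1..}) k) (tdiff T i k))) =
  (\<Oplus>[?H] k:sp T. sg ?H (n + 1) (act M T$i T$k (k + n) (i - k + 1) (x k) (tdiff T i k)))"
 proof (rule H.add.finprod_mono_neutral_cong_left[OF tfin])
  {
   fix k assume "k : sp T - (sp T \<inter> {1..})"
   then have k: "k : sp T" "k <= i" using i by auto
   show "sg ?H (n + 1) (act M T$i T$k (k + n) (i - k + 1) (x k) (tdiff T i k)) = 0[?H]"
   using act_tdiff_zero[OF i(1) k rt_mem[OF x k(1) refl], of "i + (n + 1)"] by simp
  }
 qed (use rt_term_closed[OF i(1) _ rt_mem[OF x _ refl] refl] in auto)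
 then show ?thesis using i by (simp add: T1.rt_diff rt_diff)
qed

text \<open>The components of index at least one form a quotient complex; when it is acyclic in the
 relevant degree, a primitive of a cocycle supported in index zero can be moved into index zero.\<close>

lemma index_zero_boundary:
 assumes pos: "sp T <= {0..}" and i0: "0 : sp T"
  and ac: "!!k. k : sp T ==> 1 <= k ==> hz (val M T$k) (k + n)"
  and x: "x .: cpt (rt T M) n"
  and dx: "!!k. k : sp T ==> 1 <= k ==> df (rt T M) n x k = 0[vcpt M T$k (k + (n + 1))]"
 shows "df (rt T M) n x 0 : cobd (val M T$0) (n + 1)"
proof -
 interpret T1: twisted_right R A Tpos M by (rule truncated_right)
 have am: "agrp (vcpt M T$k l)" "abelian_monoid (vcpt M T$k l)" if "k : sp T" for k l
  using val_ag[OF tob[OF that], of l] by (auto simp: agrp_def abelian_group_def)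
 let ?x = "restrict x (sp Tpos)"
 have xc: "?x .: cpt (rt Tpos M) n"
  unfolding T1.rt_cpt using rt_mem[OF x _ refl] by auto
 have "df (rt Tpos M) n ?x = 0[cpt (rt Tpos M) (n + 1)]"
 proof (rule T1.rt_ext)
  show "df (rt Tpos M) n ?x .: cpt (rt Tpos M) (n + 1)" by (rule acx_cl[OF T1.rt_acx xc refl])
  show "0[cpt (rt Tpos M) (n + 1)] .: cpt (rt Tpos M) (n + 1)"
   using acxD(1)[OF T1.rt_acx, of "n + 1"] by (simp add: agrp_def abelian_group_def abelian_monoid.zero_closed)
  show "df (rt Tpos M) n ?x k = 0[cpt (rt Tpos M) (n + 1)] k" if "k : sp Tpos" for k
   using that truncated_diff[OF x, of k] dx[of k] by (simp add: T1.rt_cpt)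
 qed
 moreover have "hz (rt Tpos M) n"
  by (rule T1.rt_cohomology_zero) (use ac in auto)
 ultimately obtain y where y: "y .: cpt (rt Tpos M) (n - 1)" "df (rt Tpos M) (n - 1) y = ?x"
  using acyclicE[OF _ xc] by metis
 \<comment> \<open>The primitive of the truncated tuple, extended by zero. Its differential agrees
   with \<open>x\<close> at all positive indices, so the difference is supported in index
   \<open>0\<close> and has the same differential as \<open>x\<close>.\<close>
 define v where "v = (%k:sp T. if 1 <= k then y k else 0[vcpt M T$k (k + (n - 1))])"
 have v: "v .: cpt (rt T M) (n - 1)"
  unfolding rt_cpt using T1.rt_mem[OF y(1) _ refl] abelian_monoid.zero_closed[OF am(2)] by (auto simp: v_def)
 have "restrict v (sp Tpos) = y"
  using y(1) unfolding T1.rt_cpt by (auto simp: v_def fun_eq_iff restrict_def PiE_def extensional_def)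
 then have dv: "df (rt T M) (n - 1) v k = x k" if "k : sp T" "1 <= k" for k
  using truncated_diff[OF v that] y(2) that by simp
 interpret G: agrp "cpt (rt T M) n" by (rule acxD(1)[OF rt_acx])
 interpret G1: agrp "cpt (rt T M) (n + 1)" by (rule acxD(1)[OF rt_acx])
 note D = acxD(2)[OF rt_acx]
 have dvc: "df (rt T M) (n - 1) v .: cpt (rt T M) n" by (rule acx_cl[OF rt_acx v]) simp
 define u where "u = x -[cpt (rt T M) n] df (rt T M) (n - 1) v"
 have u: "u .: cpt (rt T M) n" unfolding u_def using x dvc by simp
 have "df (rt T M) n (df (rt T M) (n - 1) v) = 0[cpt (rt T M) (n + 1)]" by (rule acx_dd[OF rt_acx v]) auto
 then have du: "df (rt T M) n u = df (rt T M) n x"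
  unfolding u_def am_minus[OF G.ag G1.ag D x dvc]
  using am_cl[OF D x] by (simp add: G1.minus_eq)
 have u0: "u k = 0[vcpt M T$k (k + n)]" if k: "k : sp T" "1 <= k" for k
 proof -
  interpret K: agrp "vcpt M T$k (k + n)" by (rule am(1)[OF k(1)])
  have "amap (cpt (rt T M) n) (vcpt M T$k (k + n)) (%x. x k)" unfolding rt_cpt by (rule pm_eval[OF k(1)])
  from am_minus[OF G.ag K.ag this x dvc] show ?thesis
   using dv[OF k] K.minus_eq_zero_iff rt_mem[OF x k(1) refl] by (simp add: u_def)
 qed
 let ?H = "vcpt M T$0 (0 + (n + 1))"
 interpret H: agrp ?H by (rule am(1)[OF i0])
 have "(\<Oplus>[?H] k:sp T. sg ?H (n + 1) (act M T$0 T$k (k + n) (0 - k + 1) (u k) (tdiff T 0 k))) = 0[?H]"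
 proof (rule H.finsum_all_0)
  fix k assume k: "k : sp T"
  have "act M T$0 T$k (k + n) (0 - k + 1) (u k) (tdiff T 0 k) = 0[?H]"
  proof (cases "k <= 0")
   case True
   show ?thesis by (rule act_tdiff_zero[OF i0 k True rt_mem[OF u k refl]]) simp
  next
   case False
   then have "u k = 0[vcpt M T$k (k + n)]" using u0[OF k] by simp
   then show ?thesis
   using am_0[OF am(1)[OF k] H.ag act_am_l[OF tob[OF i0] tob[OF k] td_cl[OF i0 k refl]], of "k + n"] by simp
  qed
  then show "sg ?H (n + 1) (act M T$0 T$k (k + n) (0 - k + 1) (u k) (tdiff T 0 k)) = 0[?H]" by (simp only: H.sg_0)
 qed
 moreover have "df (val M T$0) (0 + n) (u 0) .: ?H"
  by (rule acx_cl[OF val_acx[OF tob[OF i0]] rt_mem[OF u i0 refl]]) simp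
 ultimately have "df (rt T M) n x 0 = df (val M T$0) (0 + n) (u 0)"
  unfolding du[symmetric] rt_diff[OF i0] by (simp only: H.r_zero)
 then show ?thesis using coboundariesI[OF rt_mem[OF u i0 refl], of "n + 1"] by simp
qed

end

text \<open>Applied with \<open>s = d + 1\<close>, the largest index \<open>T\<close> may have. This
  shift brings the right module of \<open>T\<close> into degree \<open>0\<close>, while the dual is
  already there. \<open>U\<close> is a set of tuples containing the elements of both
  modules.\<close>

locale lower = twisted R A T + transport \<iota> U
 for R :: "'k ring" and A :: "('o, 'k, 'a) dgcat" and T :: "('o, 'a) twisted"
  and \<iota> :: "(int => 'a) => 'u" and U +
 fixes s :: int
 assumes U_tmod: "X : Ob A ==> carrier (cpt (lt s T (Hom A X) (cmp A X)) n) <= U"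
  and U_dual: "X : Ob A ==> carrier (cpt (rt T (yon A X)) n) <= U"
  and support: "sp T <= {0..s}" and zero_support: "0 : sp T"
begin

abbreviation "Pm == trd (tmod s A T)"
abbreviation "Nm == trd (op_mod (%X. rt T (yon A X)) (dla A T))"

sublocale V: left_dg R A "%X. rt T (yon A X)" "dla A T" by (rule left_dg_dual)
sublocale Pt: dg_module R A "tmod s A T" by (rule dg_module_tmod)
sublocale tp: tensor_pair R A Pm Nm
proof -
 have "dg_module R A Pm" by (rule dg_module_trd[OF dg_module_tmod]) (use U_tmod in auto)
 moreover have "dg_module R (op_dgcat A) Nm" by (rule dg_module_trd[OF V.dg_module_op_mod]) (use U_dual in auto)
 ultimately show "tensor_pair R A Pm Nm" by (simp add: tensor_pair_def)
qed

abbreviation pt where "pt == %X i j x y. tp.tens (i + j) X i x y"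

sublocale tw: twisted_pairing R A T Pm "val Nm" "lact Nm" tp.Ten pt
 by (intro twisted_pairing.intro twisted_axioms tp.pairing_tensor)

lemma tm_in_U: "X : Ob A ==> x .: cpt (lt s T (Hom A X) (cmp A X)) n ==> x : U"
 and dual_in_U: "X : Ob A ==> y .: cpt (rt T (yon A X)) m ==> y : U"
 using U_tmod U_dual by blast+

text \<open>The sign in \<open>op_mod\<close> and the one in \<open>lact\<close> have the same
  exponent and cancel, so the left action recovered from the transported module is plain
  composition.\<close>

lemma Nm_lact:
 assumes o: "X : Ob A" "Y : Ob A" and f: "f .: dhom A X Y j" and y: "y .: cpt (rt T (yon A X)) l"
 shows "lact Nm X Y j l f (\<iota> y) = \<iota> (dla A T X Y j l f y)"
proof -
 have c: "dla A T X Y j l f y .: cpt (rt T (yon A Y)) (j + l)" by (rule V.la_cl[OF o f y refl])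
 interpret G: agrp "cpt (rt T (yon A Y)) (j + l)" by (rule V.lval_ag[OF o(2)])
 have "sg (cpt (rt T (yon A Y)) (j + l)) (j * l) (sg (cpt (rt T (yon A Y)) (l + j)) (l * j) (dla A T X Y j l f y)) = dla A T X Y j l f y"
  using G.sg_sg[OF c, of "j * l" "j * l"] by (simp add: add.commute[of l j] mult.commute[of l j])
 then show ?thesis
  using iota_signed[OF V.lval_module[OF o(2)] U_dual[OF o(2)] G.sg_cl[OF c]] dual_in_U[OF o(1) y]
  by (simp add: lact_def add.commute[of l j] mult.commute[of l j])
qed

text \<open>The inclusion of the term \<open>j\<close> into \<open>T\<close>, as a graded morphism
  that need not be closed; \<open>cobas j\<close> is the projection onto that term. The composites
  of projections followed by inclusions add up to the identity of \<open>T\<close>.\<close>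

definition bas :: "int => int => 'a" where
 "bas j = (%k:sp T. if k = j then ident A T$j else 0[dhom A T$j T$k (j - k)])"

definition cobas :: "int => int => 'a" where
 "cobas j = (%k:sp T. if k = j then ident A T$j else 0[dhom A T$k T$j (k - j)])"

definition cell :: "int => 'o \<times> int \<times> 'u" where
 "cell j = (T$j, j - s, \<iota> (bas j))"

lemma hom_zero: "X : Ob A ==> Y : Ob A ==> 0[dhom A X Y n] .: dhom A X Y n"
 using hom_ag[of X Y n] by (simp add: agrp_def abelian_group_def abelian_monoid.zero_closed)

lemma bas_closed: "j : sp T ==> bas j .: cpt (lt s T (Hom A T$j) (cmp A T$j)) (j - s)"
 unfolding tmod_cpt[OF tob] using ident_closed[OF tob] hom_zero[OF tob tob] by (auto simp: bas_def)

lemma cobas_closed: "j : sp T ==> cobas j .: cpt (rt T (yon A T$j)) (- j)"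
 using twisted_right.rt_cpt[OF tr_yon[OF tob]] ident_closed[OF tob] hom_zero[OF tob tob] by (auto simp: cobas_def)

lemma bas_act:
 assumes Y: "Y : Ob A" and j: "j : sp T" and a: "a .: dhom A Y T$j (n - (j - s))"
 shows "act Pm Y T$j (j - s) (n - (j - s)) (\<iota> (bas j)) a =
  \<iota> (%k:sp T. if k = j then a else 0[dhom A Y T$k (n + s - k)])"
proof -
 have "cmp A Y T$j T$k (j - s + s - k) (n - (j - s)) (bas j k) a =
   (if k = j then a else 0[dhom A Y T$k (n + s - k)])" if k: "k : sp T" for k
 proof (cases "k = j")
  case True
  then show ?thesis using comp_ident_left[OF Y tob[OF j] a] k by (simp add: bas_def)
 next
  case False
  have "cmp A Y T$j T$k (j - k) (n - (j - s)) 0[dhom A T$j T$k (j - k)] a = 0[dhom A Y T$k (n + s - k)]"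
   by (rule am_0[OF hom_ag[OF tob[OF j] tob[OF k]] hom_ag[OF Y tob[OF k]] cmp_am_l[OF Y tob[OF j] tob[OF k] a]]) simp
  then show ?thesis using False k by (simp add: bas_def)
 qed
 then show ?thesis using tm_in_U[OF tob[OF j] bas_closed[OF j]] by (simp cong: restrict_cong)
qed

lemma Pm_sum:
 assumes Y: "Y : Ob A" and J: "J <= sp T" and a: "!!j. j : J ==> a j .: dhom A Y T$j (n - (j - s))"
 shows "(\<Oplus>[vcpt Pm Y n] j:J. act Pm Y T$j (j - s) (n - (j - s)) (\<iota> (bas j)) (a j)) =
  \<iota> (%k:sp T. if k : J then a k else 0[dhom A Y T$k (n + s - k)])"
proof -
 let ?L = "cpt (lt s T (Hom A Y) (cmp A Y)) n"
 define e where "e j = (%k:sp T. if k = j then a j else 0[dhom A Y T$k (n + s - k)])" for j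
 have L: "Module.module R ?L" using Pt.val_module[OF Y, of n] by simp
 interpret G: agrp ?L by (rule module_agrp[OF L])
 interpret G': agrp "trm ?L" by (rule module_agrp[OF trm_module[OF L U_tmod[OF Y]]])
 have deg: "n - (j - s) = n + s - j" for j by simp
 have ec: "e j .: ?L" if "j : J" for j
  unfolding tmod_cpt[OF Y] using a[OF that] J that hom_zero[OF Y tob] by (auto simp: e_def deg)
 have "(\<Oplus>[vcpt Pm Y n] j:J. act Pm Y T$j (j - s) (n - (j - s)) (\<iota> (bas j)) (a j)) = (\<Oplus>[trm ?L] j:J. \<iota> (e j))"
  using bas_act[OF Y _ a] J ec by (simp add: e_def subset_iff) (rule G'.finsum_cong', auto simp: e_def)
 also have "... = \<iota> (\<Oplus>[?L] j:J. e j)"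
  by (rule am_finsum[OF G.ag G'.ag lin_am[OF iota_linear[OF U_tmod[OF Y], of R]] ec, symmetric])
 also have "(\<Oplus>[?L] j:J. e j) = (%k:sp T. if k : J then a k else 0[dhom A Y T$k (n + s - k)])"
  unfolding e_def tmod_cpt[OF Y]
  by (rule pm_sum_single[OF tfin hom_ag[OF Y tob] _ J]) (use G.ag a in \<open>auto simp: tmod_cpt[OF Y] deg\<close>)
 finally show ?thesis .
qed

lemma cell_inj: "inj_on cell J"
 by (auto simp: cell_def inj_on_def)

lemma cell_cellset: "J <= sp T ==> cellset A Pm (cell ` J)"
 using tob bas_closed by (auto simp: cellset_def cell_def)

lemma cell_simps [simp]: "fst (cell j) = T$j" "deg (cell j) = j - s" "snd (snd (cell j)) = \<iota> (bas j)"
 by (simp_all add: cell_def)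

lemma combination_cells:
 assumes Y: "Y : Ob A" and J: "J <= sp T" and a: "!!j. j : J ==> a (cell j) .: dhom A Y T$j (n - (j - s))"
 shows "combination A Pm (cell ` J) Y n a = \<iota> (%k:sp T. if k : J then a (cell k) else 0[dhom A Y T$k (n + s - k)])"
proof -
 interpret G: agrp "vcpt Pm Y n" by (rule tp.val_ag[OF Y])
 have "combination A Pm (cell ` J) Y n a = (\<Oplus>[vcpt Pm Y n] \<beta>:cell ` J. bact Pm Y n \<beta> (a \<beta>))"
  by (rule tp.comb_superset[OF cell_cellset[OF J] Y]) (use a finite_subset[OF J tfin] in auto)
 also have "... = (\<Oplus>[vcpt Pm Y n] j:J. bact Pm Y n (cell j) (a (cell j)))"
 proof (rule G.finsum_reindex[OF _ cell_inj])
  have "act Pm Y T$j (j - s) (n - (j - s)) (\<iota> (bas j)) (a (cell j)) .: vcpt Pm Y n" if "j : J" for j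
   by (rule tp.act_cl[OF Y _ _ a[OF that]]) (use J that tob bas_closed in auto)
  then show "(%\<beta>. bact Pm Y n \<beta> (a \<beta>)) : cell ` J \<rightarrow> carrier (vcpt Pm Y n)" by auto
 qed
 also have "... = \<iota> (%k:sp T. if k : J then a (cell k) else 0[dhom A Y T$k (n + s - k)])"
  unfolding cell_simps by (rule Pm_sum[OF Y J a])
 finally show ?thesis .
qed

definition trow :: "int => int => 'a" where "trow i = (%k:sp T. tdiff T i k)"

lemma trow_closed: "i : sp T ==> trow i .: cpt (lt s T (Hom A T$i) (cmp A T$i)) (i - s + 1)"
 unfolding tmod_cpt[OF tob] pm_simps trow_def by (intro restrict_PiE_iff[THEN iffD2] ballI td_cl) auto

text \<open>Identities are closed, so the diagonal contributes nothing and the structure maps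
  leaving the term \<open>i\<close> remain.\<close>

lemma bas_diff:
 assumes i: "i : sp T"
 shows "df (lt s T (Hom A T$i) (cmp A T$i)) (i - s) (bas i) =
  sg (cpt (lt s T (Hom A T$i) (cmp A T$i)) (i - s + 1)) s (trow i)"
proof -
 let ?L = "lt s T (Hom A T$i) (cmp A T$i)"
 interpret L: twisted_left R A T "Hom A T$i" "cmp A T$i" s by (rule tl_coyon[OF tob[OF i]])
 interpret G: agrp "cpt ?L (i - s + 1)" by (rule acxD(1)[OF L.lt_acx])
 show ?thesis
 proof (rule tmod_ext[OF tob[OF i]])
  show "df ?L (i - s) (bas i) .: cpt ?L (i - s + 1)" by (rule acx_cl[OF L.lt_acx bas_closed[OF i] refl])
  show "sg (cpt ?L (i - s + 1)) s (trow i) .: cpt ?L (i - s + 1)" using trow_closed[OF i] by simp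
  fix j assume j: "j : sp T"
  let ?H = "dhom A T$i T$j (i - s + 1 + s - j)"
  interpret H: agrp ?H by (rule hom_ag[OF tob[OF i] tob[OF j]])
  have e: "i - s + s - k = i - k" for k by simp
  have d: "df (Hom A T$i T$j) (i - j) (bas i j) = 0[?H]"
  proof (cases "j = i")
   case True
   then show ?thesis using ident_cocycle[OF tob[OF i]] i by (simp add: bas_def)
  next
   case False
   have "amap (dhom A T$i T$j (i - j)) ?H (df (Hom A T$i T$j) (i - j))"
   using acxD(2)[OF hom_acx[OF tob[OF i] tob[OF j]], of "i - j"] by (simp add: algebra_simps)
   then show ?thesis using am_0[OF hom_ag[OF tob[OF i] tob[OF j]] H.ag] False j by (simp add: bas_def)
  qed
  have aij: "tdiff T i j .: ?H" by (rule td_cl[OF i j]) simp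
  have aii: "cmp A T$i T$i T$j (i - j + 1) (i - i) (tdiff T i j) (bas i i) = tdiff T i j"
   using comp_ident_right[OF tob[OF i] tob[OF j] td_cl[OF i j refl]] i by (simp add: bas_def)
  have "(\<Oplus>[?H] k:sp T. sg ?H s (cmp A T$i T$k T$j (k - j + 1) (i - k) (tdiff T k j) (bas i k))) =
   sg ?H s (cmp A T$i T$i T$j (i - j + 1) (i - i) (tdiff T i j) (bas i i))"
  proof (rule H.finsum_single[OF tfin i])
   show "sg ?H s (cmp A T$i T$i T$j (i - j + 1) (i - i) (tdiff T i j) (bas i i)) .: ?H"
   unfolding aii by (rule H.sg_cl[OF aij])
   fix k assume k: "k : sp T" "k ~= i"
   have "cmp A T$i T$k T$j (k - j + 1) (i - k) (tdiff T k j) 0[dhom A T$i T$k (i - k)] = 0[?H]"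
   by (rule am_0[OF hom_ag[OF tob[OF i] tob[OF k(1)]] H.ag
   cmp_am_r[OF tob[OF i] tob[OF k(1)] tob[OF j] td_cl[OF k(1) j refl]]]) simp
   moreover have "bas i k = 0[dhom A T$i T$k (i - k)]" using k by (simp add: bas_def)
   ultimately show "sg ?H s (cmp A T$i T$k T$j (k - j + 1) (i - k) (tdiff T k j) (bas i k)) = 0[?H]"
   by (simp only: H.sg_0)
  qed
  then have "df ?L (i - s) (bas i) j = sg ?H s (tdiff T i j)"
   unfolding L.lt_diff[OF j] e d aii by (simp only: H.sg_0 H.l_zero[OF H.sg_cl[OF aij]])
  moreover have "sg (cpt ?L (i - s + 1)) s (trow i) j = sg ?H s (tdiff T i j)"
   using am_sg[OF G.ag H.ag tmod_eval[OF tob[OF i] j refl] trow_closed[OF i], of s] j by (simp add: trow_def)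
  ultimately show "df ?L (i - s) (bas i) j = sg (cpt ?L (i - s + 1)) s (trow i) j" by simp
 qed
qed

definition tcol :: "int => int => 'a" where "tcol i = (%k:sp T. tdiff T k i)"

lemma tcol_closed: "i : sp T ==> tcol i .: cpt (rt T (yon A T$i)) (1 - i)"
 unfolding twisted_right.rt_cpt[OF tr_yon[OF tob]] pm_simps yon_simps tcol_def
 by (intro restrict_PiE_iff[THEN iffD2] ballI td_cl) auto

text \<open>Dually, the structure maps arriving at the term \<open>i\<close> remain.\<close>

lemma cobas_diff:
 assumes i: "i : sp T"
 shows "df (rt T (yon A T$i)) (- i) (cobas i) = sg (cpt (rt T (yon A T$i)) (1 - i)) (1 - i) (tcol i)"
proof -
 let ?L = "rt T (yon A T$i)"
 interpret L: twisted_right R A T "yon A T$i" by (rule tr_yon[OF tob[OF i]])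
 interpret G: agrp "cpt ?L (1 - i)" by (rule acxD(1)[OF L.rt_acx])
 show ?thesis
 proof (rule L.rt_ext)
  show "df ?L (- i) (cobas i) .: cpt ?L (1 - i)" by (rule acx_cl[OF L.rt_acx cobas_closed[OF i]]) simp
  show "sg (cpt ?L (1 - i)) (1 - i) (tcol i) .: cpt ?L (1 - i)" using tcol_closed[OF i] by simp
  fix j assume j: "j : sp T"
  let ?H = "dhom A T$j T$i (j + (- i + 1))"
  interpret H: agrp ?H by (rule hom_ag[OF tob[OF j] tob[OF i]])
  have e: "k + - i = k - i" for k by simp
  have d: "df (Hom A T$j T$i) (j - i) (cobas i j) = 0[?H]"
  proof (cases "j = i")
   case True
   then show ?thesis using ident_cocycle[OF tob[OF i]] i by (simp add: cobas_def)
  next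
   case False
   have "amap (dhom A T$j T$i (j - i)) ?H (df (Hom A T$j T$i) (j - i))"
   using acxD(2)[OF hom_acx[OF tob[OF j] tob[OF i]], of "j - i"] by (simp add: algebra_simps)
   then show ?thesis using am_0[OF hom_ag[OF tob[OF j] tob[OF i]] H.ag] False j by (simp add: cobas_def)
  qed
  have aji: "tdiff T j i .: ?H" by (rule td_cl[OF j i]) simp
  have aii: "cmp A T$j T$i T$i (i - i) (j - i + 1) (cobas i i) (tdiff T j i) = tdiff T j i"
   using comp_ident_left[OF tob[OF j] tob[OF i] td_cl[OF j i refl]] i by (simp add: cobas_def)
  have "(\<Oplus>[?H] k:sp T. sg ?H (- i + 1) (cmp A T$j T$k T$i (k - i) (j - k + 1) (cobas i k) (tdiff T j k))) =
   sg ?H (- i + 1) (cmp A T$j T$i T$i (i - i) (j - i + 1) (cobas i i) (tdiff T j i))"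
  proof (rule H.finsum_single[OF tfin i])
   show "sg ?H (- i + 1) (cmp A T$j T$i T$i (i - i) (j - i + 1) (cobas i i) (tdiff T j i)) .: ?H"
   unfolding aii by (rule H.sg_cl[OF aji])
   fix k assume k: "k : sp T" "k ~= i"
   have "cmp A T$j T$k T$i (k - i) (j - k + 1) 0[dhom A T$k T$i (k - i)] (tdiff T j k) = 0[?H]"
   by (rule am_0[OF hom_ag[OF tob[OF k(1)] tob[OF i]] H.ag
   cmp_am_l[OF tob[OF j] tob[OF k(1)] tob[OF i] td_cl[OF j k(1) refl]]]) simp
   moreover have "cobas i k = 0[dhom A T$k T$i (k - i)]" using k by (simp add: cobas_def)
   ultimately show "sg ?H (- i + 1) (cmp A T$j T$k T$i (k - i) (j - k + 1) (cobas i k) (tdiff T j k)) = 0[?H]"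
   by (simp only: H.sg_0)
  qed
  then have "df ?L (- i) (cobas i) j = sg ?H (- i + 1) (tdiff T j i)"
   unfolding L.rt_diff[OF j] yon_simps e d aii by (simp only: H.l_zero[OF H.sg_cl[OF aji]])
  moreover have "sg (cpt ?L (1 - i)) (1 - i) (tcol i) j = sg ?H (- i + 1) (tdiff T j i)"
   using L.rt_signed[OF j tcol_closed[OF i], of "1 - i"] j by (simp add: tcol_def algebra_simps)
  ultimately show "df ?L (- i) (cobas i) j = sg (cpt ?L (1 - i)) (1 - i) (tcol i) j" by simp
 qed
qed

end

section \<open>The module of T as its own resolution, and the two hearts\<close>

context lower
begin

lemma trow_signed: "i : sp T ==> k : sp T ==>
 sg (cpt (lt s T (Hom A T$i) (cmp A T$i)) (i - s + 1)) n (trow i) k =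
 sg (dhom A T$i T$k (i - s + 1 + s - k)) n (tdiff T i k)"
proof -
 assume i: "i : sp T" and k: "k : sp T"
 have "agrp (cpt (lt s T (Hom A T$i) (cmp A T$i)) (i - s + 1))"
  using module_agrp[OF Pt.val_module[OF tob[OF i]]] by simp
 from am_sg[OF this hom_ag[OF tob[OF i] tob[OF k]] tmod_eval[OF tob[OF i] k refl] trow_closed[OF i], of n]
 show ?thesis using k by (simp add: trow_def)
qed

text \<open>The inclusions of the terms of \<open>T\<close> form a finite semi-basis, so no
  resolution has to be constructed. The level of the cell \<open>j\<close> is \<open>s - j\<close>:
  a structure map raises the index and hence lowers the level.\<close>

lemma Pm_semi_basis: "semi_basis A Pm (cell ` sp T) (%\<beta>. nat (- deg \<beta>))"
proof -
 let ?B = "cell ` sp T"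
 have 1: "X : Ob A & b .: vcpt Pm X m" if "(X, m, b) : ?B" for X m b
  using cell_cellset[OF subset_refl] that by (auto simp: cellset_def)
 have 2: "bij_betw (combination A Pm ?B Y n) (coefficients A ?B Y n) (carrier (vcpt Pm Y n))" if Y: "Y : Ob A" for Y n
 proof -
  have co: "coefficients A ?B Y n = (\<Pi>\<^sub>E \<beta>\<in>?B. carrier (bhom A Y n \<beta>))"
   unfolding coefficients_eq using tfin by auto
  have deg: "n - (j - s) = n + s - j" for j by simp
  have am: "a (cell j) .: dhom A Y T$j (n - (j - s))" if "a : coefficients A ?B Y n" "j : sp T" for a j
   using PiE_mem[OF that(1)[unfolded co], of "cell j"] that(2) by simp
  have comb: "combination A Pm ?B Y n a = \<iota> (%k:sp T. a (cell k))" if "a : coefficients A ?B Y n" for a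
   using combination_cells[OF Y subset_refl am[OF that]] by (simp cong: restrict_cong)
  have wc: "(%k:sp T. a (cell k)) .: cpt (lt s T (Hom A Y) (cmp A Y)) n" if "a : coefficients A ?B Y n" for a
   unfolding tmod_cpt[OF Y] pm_simps using am[OF that] by (auto simp: deg)
  \<comment> \<open>The inverse of \<open>combination\<close>: a cell of degree \<open>j - s\<close>
    takes the entry of the tuple at \<open>j\<close>, recovered as its degree plus
    \<open>s\<close>.\<close>
  define f where "f y = (%\<beta>:?B. retr y (deg \<beta> + s))" for y
  have fy: "f (\<iota> x) : coefficients A ?B Y n" "combination A Pm ?B Y n (f (\<iota> x)) = \<iota> x"
   if x: "x .: cpt (lt s T (Hom A Y) (cmp A Y)) n" for x
  proof -
   have "x j .: dhom A Y T$j (n - (j - s))" if "j : sp T" for j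
   by (rule tmod_mem[OF Y x that]) simp
   then show f: "f (\<iota> x) : coefficients A ?B Y n"
   unfolding co f_def using tm_in_U[OF Y x] by auto
   have "(%k:sp T. f (\<iota> x) (cell k)) = restrict x (sp T)"
   using tm_in_U[OF Y x] by (auto simp: f_def)
   also have "... = x" using x unfolding tmod_cpt[OF Y] by (auto simp: PiE_def intro: extensional_restrict)
   finally show "combination A Pm ?B Y n (f (\<iota> x)) = \<iota> x" unfolding comb[OF f] by simp
  qed
  show ?thesis
  proof (rule bij_betw_byWitness[where f' = f])
   show "ALL a:coefficients A ?B Y n. f (combination A Pm ?B Y n a) = a"
   proof
   fix a assume a: "a : coefficients A ?B Y n"
   have "f (combination A Pm ?B Y n a) : coefficients A ?B Y n" unfolding comb[OF a] by (rule fy(1)[OF wc[OF a]])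
   then show "f (combination A Pm ?B Y n a) = a"
   using a tm_in_U[OF Y wc[OF a]] unfolding co comb[OF a] by (intro PiE_ext[of _ ?B]) (auto simp: f_def)
   qed
   show "ALL y:carrier (vcpt Pm Y n). combination A Pm ?B Y n (f y) = y" using fy(2) by auto
   show "combination A Pm ?B Y n ` coefficients A ?B Y n <= carrier (vcpt Pm Y n)" using comb wc by auto
   show "f ` carrier (vcpt Pm Y n) <= coefficients A ?B Y n" using fy(1) by auto
  qed
 qed
 have 3: "df (val Pm T$j) (j - s) (\<iota> (bas j)) \<in>
   combination A Pm (cell ` {k : sp T. j < k}) T$j (j - s + 1) ` coefficients A (cell ` {k : sp T. j < k}) T$j (j - s + 1)"
  if j: "j : sp T" for j
 proof -
  let ?J = "{k : sp T. j < k}" and ?L = "cpt (lt s T (Hom A T$j) (cmp A T$j)) (j - s + 1)"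
  have J: "?J <= sp T" by auto
  have e: "j - s + 1 - (k - s) = j - s + 1 + s - k" for k by simp
  \<comment> \<open>The coefficients of the differential of the basis element at \<open>j\<close>:
    the structure maps out of \<open>j\<close> with the sign from \<open>bas_diff\<close>. They
    vanish at indices up to \<open>j\<close>, so cells of lower level suffice.\<close>
  define a where "a = (%\<beta>:cell ` ?J. sg (bhom A T$j (j - s + 1) \<beta>) s (tdiff T j (deg \<beta> + s)))"
  have ac: "a (cell k) .: dhom A T$j T$k (j - s + 1 - (k - s))" if "k : ?J" for k
  proof -
   interpret H: agrp "dhom A T$j T$k (j - s + 1 - (k - s))" by (rule hom_ag[OF tob[OF j] tob]) (use that in simp)
   have "tdiff T j k .: dhom A T$j T$k (j - s + 1 - (k - s))" by (rule td_cl[OF j]) (use that in auto)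
   then show ?thesis using imageI[OF that, of cell] H.sg_cl by (simp add: a_def)
  qed
  have co: "a : coefficients A (cell ` ?J) T$j (j - s + 1)"
  proof -
   have "a : (\<Pi>\<^sub>E \<beta>\<in>cell ` ?J. carrier (bhom A T$j (j - s + 1) \<beta>))"
   proof (rule PiE_I)
   fix \<beta> assume "\<beta> : cell ` ?J"
   then obtain k where "k : ?J" "\<beta> = cell k" by blast
   then show "a \<beta> .: bhom A T$j (j - s + 1) \<beta>" using ac by simp
   qed (auto simp: a_def)
   then show ?thesis unfolding coefficients_eq using finite_subset[OF J tfin] by simp
  qed
  interpret L: agrp ?L using module_agrp[OF Pt.val_module[OF tob[OF j], of "j - s + 1"]] by simp
  have sc: "sg ?L s (trow j) .: ?L" using trow_closed[OF j] by simp
  have "combination A Pm (cell ` ?J) T$j (j - s + 1) a = \<iota> (%k:sp T. if k : ?J then a (cell k) else 0[dhom A T$j T$k (j - s + 1 + s - k)])"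
   by (rule combination_cells[OF tob[OF j] J ac])
  also have "(%k:sp T. if k : ?J then a (cell k) else 0[dhom A T$j T$k (j - s + 1 + s - k)]) = restrict (sg ?L s (trow j)) (sp T)"
  proof (rule restrict_cong[OF refl], unfold simp_implies_def)
   fix k assume k: "k : sp T"
   show "(if k : ?J then a (cell k) else 0[dhom A T$j T$k (j - s + 1 + s - k)]) = sg ?L s (trow j) k"
   proof (cases "j < k")
   case True
   moreover have "cell k : cell ` ?J" using True k by blast
   ultimately show ?thesis unfolding trow_signed[OF j k] using k by (simp add: a_def e)
   next
   case False
   interpret H: agrp "dhom A T$j T$k (j - s + 1 + s - k)" by (rule hom_ag[OF tob[OF j] tob[OF k]])
   have "j - s + 1 + s - k = j - k + 1" by simp
   then have "tdiff T j k = 0[dhom A T$j T$k (j - s + 1 + s - k)]" using tdiff_zero[OF j k] False by (simp only: not_less)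
   moreover have "k ~: ?J" using False by simp
   ultimately show ?thesis unfolding trow_signed[OF j k] by (simp only: if_False H.sg_0)
   qed
  qed
  also have "... = sg ?L s (trow j)" using sc unfolding tmod_cpt[OF tob[OF j]] by (auto simp: PiE_def intro: extensional_restrict)
  also have "\<iota> (sg ?L s (trow j)) = df (val Pm T$j) (j - s) (\<iota> (bas j))"
   using bas_diff[OF j] tm_in_U[OF tob[OF j] bas_closed[OF j]] by simp
  finally show ?thesis by (rule image_eqI[OF sym co])
 qed
 \<comment> \<open>Since the indices do not exceed \<open>s\<close>, all the numbers
   \<open>- (j - s)\<close> are nonnegative and \<open>nat\<close> preserves their order.\<close>
 have 4: "{\<beta> : ?B. nat (- deg \<beta>) < nat (- (j - s))} = cell ` {k : sp T. j < k}" if "j : sp T" for j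
 proof -
  have "nat (- deg (cell k)) < nat (- (j - s)) \<longleftrightarrow> j < k" if "k : sp T" for k
   using that \<open>j : sp T\<close> support by auto
  then show ?thesis by auto
 qed
 show ?thesis
  unfolding semi_basis_def Let_def
 proof (intro conjI ballI allI)
  fix \<beta> assume "\<beta> : ?B"
  then obtain j where j: "j : sp T" "\<beta> = cell j" by blast
  show "case \<beta> of (X, m, b) => X : Ob A & b .: vcpt Pm X m" using 1 \<open>\<beta> : ?B\<close> by blast
  show "case \<beta> of (X, m, b) => df (val Pm X) m b \<in>
   combination A Pm {\<beta> : ?B. nat (- deg \<beta>) < nat (- deg (X, m, b))} X (m + 1) `
   coefficients A {\<beta> : ?B. nat (- deg \<beta>) < nat (- deg (X, m, b))} X (m + 1)"
   unfolding j(2) cell_def[of j] prod.case fst_conv snd_conv 4[OF j(1)] by (rule 3[OF j(1)])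
 qed (rule 2)
qed

text \<open>Cohomology in negative degrees vanishes by left exactness of \<open>T\<close>. In degree
  \<open>i > 0\<close> the terms contribute morphisms of degree \<open>i + s - j > 0\<close>, which
  connectivity makes acyclic; this is why the shift is the largest possible index.\<close>

lemma Pm_heart:
 assumes con: "connective A" and lex: "!!X i. X : Ob A ==> i < s ==> htw_zero A (in_degree A X i) T"
 shows "in_heart R A Pm"
 unfolding in_heart_def
proof (intro conjI ballI allI impI tp.dg_module_axioms)
 fix X i assume X: "X : Ob A" and i: "(i :: int) ~= 0"
 have "hz (lt s T (Hom A X) (cmp A X)) i"
 proof (cases "i < 0")
  case True
  then show ?thesis using htw_zero_left[OF X lex[OF X], of "i + s" s] by simp
 next
  case False
  show ?thesis
  proof (rule twisted_left.lt_cohomology_zero[OF tl_coyon[OF X]])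
   fix j assume j: "j : sp T"
   then have "0 < i + s - j" using False i support by fastforce
   then show "hz (Hom A X T$j) (i + s - j)" using con X tob[OF j] by (simp add: connective_def)
  qed
 qed
 then show "hz (val Pm X) i"
  using trc_cohomology_zero[OF Pt.val_complex[OF X]] U_tmod[OF X] by simp
qed

text \<open>Right exactness covers the negative degrees. In degree \<open>i > 0\<close> the term
  \<open>j\<close> contributes morphisms of degree \<open>j + i > 0\<close>, since indices are
  nonnegative.\<close>

lemma Nm_heart:
 assumes con: "connective A" and rex: "!!X i. X : Ob A ==> 1 <= i ==> htw_zero A T (in_degree A X i)"
 shows "in_heart R (op_dgcat A) Nm"
 unfolding in_heart_def
proof (intro conjI ballI allI impI tp.N.dg_module_axioms)
 fix X i assume "X : Ob (op_dgcat A)" and i: "(i :: int) ~= 0"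
 then have X: "X : Ob A" by simp
 have "hz (rt T (yon A X)) i"
 proof (cases "i < 0")
  case True
  then show ?thesis using htw_zero_right[OF X rex[OF X], of "- i"] by simp
 next
  case False
  show ?thesis
  proof (rule twisted_right.rt_cohomology_zero[OF tr_yon[OF X]])
   fix j assume j: "j : sp T"
   then have "0 < j + i" using False i support by fastforce
   then show "hz (val (yon A X) T$j) (j + i)" using con X tob[OF j] by (simp add: connective_def)
  qed
 qed
 then show "hz (val Nm X) i"
  using trc_cohomology_zero[OF V.lval_complex[OF X] U_dual[OF X]] by simp
qed

text \<open>The inclusions assembled into one morphism from \<open>T\<close> to its own module. Its
  evaluation on \<open>ct\<close> is the sum of the tensors of inclusions and projections, that is,
  the identity of \<open>T\<close>.\<close>

definition bt :: "int => 'u" where "bt = (%k:sp T. \<iota> (bas k))"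
definition ct :: "int => 'u" where "ct = (%k:sp T. \<iota> (cobas k))"

lemma bt_closed: "bt .: cpt tw.TP (- s)"
 unfolding tw.tr.rt_cpt using bas_closed by (auto simp: bt_def)

lemma ct_closed: "ct .: cpt tw.TV 0"
 unfolding tw.tl.lt_cpt using cobas_closed by (auto simp: ct_def)

text \<open>The diagonal term at \<open>i\<close> is, up to sign, the row of structure maps leaving
  \<open>i\<close>; the off-diagonal terms assemble the same row, with signs \<open>s\<close> and
  \<open>- s + 1\<close>.\<close>

lemma bt_diff: "df tw.TP (- s) bt = 0[cpt tw.TP (- s + 1)]"
proof (rule tw.tr.rt_ext)
 show "df tw.TP (- s) bt .: cpt tw.TP (- s + 1)" by (rule acx_cl[OF tw.tr.rt_acx bt_closed refl])
 show "0[cpt tw.TP (- s + 1)] .: cpt tw.TP (- s + 1)"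
  using acxD(1)[OF tw.tr.rt_acx, of "- s + 1"] by (simp add: agrp_def abelian_group_def abelian_monoid.zero_closed)
 fix i assume i: "i : sp T"
 let ?H = "vcpt Pm T$i (i - s + 1)" and ?L = "cpt (lt s T (Hom A T$i) (cmp A T$i)) (i - s + 1)"
 interpret H: agrp ?H by (rule tp.val_ag[OF tob[OF i]])
 have L: "Module.module R ?L" using Pt.val_module[OF tob[OF i], of "i - s + 1"] by simp
 have e: "k + - s = k - s" "i + (- s + 1) = i - s + 1" for k by simp_all
 have tc: "\<iota> (trow i) .: ?H" using trow_closed[OF i] by simp
 have a: "act Pm T$i T$k (k - s) (i - k + 1) (bt k) (tdiff T i k) .: ?H" if k: "k : sp T" for k
  by (rule tp.act_cl[OF tob[OF i] tob[OF k] _ td_cl[OF i k refl]]) (use k bas_closed[OF k] in \<open>auto simp: bt_def\<close>)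
 have "(\<Oplus>[?H] k:sp T. act Pm T$i T$k (k - s) (i - k + 1) (bt k) (tdiff T i k)) =
  (\<Oplus>[?H] k:sp T. act Pm T$i T$k (k - s) (i - s + 1 - (k - s)) (\<iota> (bas k)) (tdiff T i k))"
 proof (rule H.finsum_cong'[OF refl])
  have e: "i - s + 1 - (k - s) = i - k + 1" for k by simp
  show 1: "act Pm T$i T$k (k - s) (i - k + 1) (bt k) (tdiff T i k) =
   act Pm T$i T$k (k - s) (i - s + 1 - (k - s)) (\<iota> (bas k)) (tdiff T i k)" if "k : sp T" for k
   unfolding e using that by (simp add: bt_def)
  show "(%k. act Pm T$i T$k (k - s) (i - s + 1 - (k - s)) (\<iota> (bas k)) (tdiff T i k)) : sp T \<rightarrow> carrier ?H"
   using a 1 by (intro Pi_I) (simp only:)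
 qed
 also have "... = \<iota> (%k:sp T. if k : sp T then tdiff T i k else 0[dhom A T$i T$k (i - s + 1 + s - k)])"
  by (rule Pm_sum[OF tob[OF i] subset_refl]) (rule td_cl[OF i], auto)
 also have "... = \<iota> (trow i)" by (simp add: trow_def cong: restrict_cong)
 finally have S: "(\<Oplus>[?H] k:sp T. act Pm T$i T$k (k - s) (i - k + 1) (bt k) (tdiff T i k)) = \<iota> (trow i)" .
 have "df (val Pm T$i) (i - s) (bt i) = sg ?H s (\<iota> (trow i))"
  using bas_diff[OF i] tm_in_U[OF tob[OF i] bas_closed[OF i]] iota_signed[OF L U_tmod[OF tob[OF i]] trow_closed[OF i]] i
  by (simp add: bt_def)
 moreover have "(\<Oplus>[?H] k:sp T. sg ?H (- s + 1) (act Pm T$i T$k (k - s) (i - k + 1) (bt k) (tdiff T i k))) = sg ?H (- s + 1) (\<iota> (trow i))"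
  unfolding S[symmetric] by (rule sg_finsum[OF H.ag a, symmetric])
 ultimately have "df tw.TP (- s) bt i = sg ?H s (\<iota> (trow i)) +[?H] sg ?H (- s + 1) (\<iota> (trow i))"
  unfolding tw.tr.rt_diff[OF i] e by simp
 also have "... = 0[?H]" by (rule H.sg_cancel[OF tc]) simp
 finally show "df tw.TP (- s) bt i = 0[cpt tw.TP (- s + 1)] i"
  using i unfolding tw.tr.rt_cpt e(2)[symmetric] by (simp only: pm_simps restrict_apply if_True)
qed

text \<open>The same cancellation for columns of structure maps: after the diagonal sign
  \<open>i\<close> the differential of the projection contributes the column with an odd sign, the
  off-diagonal terms contribute it with an even one.\<close>

lemma ct_diff: "df tw.TV 0 ct = 0[cpt tw.TV (0 + 1)]"
proof -
 have "df tw.TV 0 ct i = 0[cpt (val Nm T$i) (0 + 1 + 0 - i)]" if i: "i : sp T" for i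
 proof -
  let ?H = "cpt (val Nm T$i) (0 + 1 + 0 - i)" and ?L = "cpt (rt T (yon A T$i)) (1 - i)"
  interpret H: agrp ?H by (rule tp.L.lval_ag[OF tob[OF i]])
  have L: "Module.module R ?L" by (rule V.lval_module[OF tob[OF i]])
  interpret G: agrp ?L by (rule module_agrp[OF L])
  have HL: "?H = trm ?L" by simp
  note am = lin_am[OF iota_linear[OF U_dual[OF tob[OF i]], of R "1 - i"]]
  have Lc: "?L = pm (sp T) (%j. dhom A T$j T$i (j + (1 - i)))"
   using twisted_right.rt_cpt[OF tr_yon[OF tob[OF i]]] by simp
  define e where "e k = (%j:sp T. if j = k then tdiff T k i else 0[dhom A T$j T$i (j + (1 - i))])" for k
  have tk: "tdiff T k i .: dhom A T$k T$i (k + (1 - i))" if "k : sp T" for k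
   by (rule td_cl[OF that i]) simp
  have ec: "e k .: ?L" if k: "k : sp T" for k
   unfolding Lc using tk[OF k] hom_zero[OF tob tob[OF i]] by (auto simp: e_def)
  have le: "sg ?H 0 (lact Nm T$k T$i (k - i + 1) (0 + 0 - k) (tdiff T k i) (ct k)) = \<iota> (e k)" if k: "k : sp T" for k
  proof -
   have "cmp A T$j T$k T$i (k - i + 1) (j + (- k)) (tdiff T k i) (cobas k j) = e k j" if j: "j : sp T" for j
   proof (cases "j = k")
   case True
   then show ?thesis using comp_ident_right[OF tob[OF k] tob[OF i] td_cl[OF k i refl]] k
   by (simp add: cobas_def e_def)
   next
   case False
   have "cmp A T$j T$k T$i (k - i + 1) (j - k) (tdiff T k i) 0[dhom A T$j T$k (j - k)] =
   0[dhom A T$j T$i (j + (1 - i))]"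
   by (rule am_0[OF hom_ag[OF tob[OF j] tob[OF k]] hom_ag[OF tob[OF j] tob[OF i]]
   cmp_am_r[OF tob[OF j] tob[OF k] tob[OF i] td_cl[OF k i refl]]]) simp
   then show ?thesis using False j by (simp add: cobas_def e_def)
   qed
   then have "dla A T T$k T$i (k - i + 1) (- k) (tdiff T k i) (cobas k) = restrict (e k) (sp T)"
   by (auto simp: dla_def)
   then have "dla A T T$k T$i (k - i + 1) (- k) (tdiff T k i) (cobas k) = e k" by (simp add: e_def)
   then show ?thesis
   using Nm_lact[OF tob[OF k] tob[OF i] td_cl[OF k i refl] cobas_closed[OF k]] k by (simp add: ct_def)
  qed
  have "(\<Oplus>[?H] k:sp T. sg ?H 0 (lact Nm T$k T$i (k - i + 1) (0 + 0 - k) (tdiff T k i) (ct k))) = (\<Oplus>[?H] k:sp T. \<iota> (e k))"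
   by (rule H.finsum_cong') (use le ec in auto)
  also have "... = \<iota> (\<Oplus>[?L] k:sp T. e k)"
   unfolding HL by (rule am_finsum[OF G.ag H.ag[unfolded HL] am ec, symmetric])
  also have "(\<Oplus>[?L] k:sp T. e k) = (%j:sp T. if j : sp T then tdiff T j i else 0[dhom A T$j T$i (j + (1 - i))])"
   unfolding Lc e_def by (rule pm_sum_single[OF tfin hom_ag[OF tob tob[OF i]] G.ag[unfolded Lc] subset_refl tk])
  also have "... = tcol i" by (simp add: tcol_def cong: restrict_cong)
  finally have S: "(\<Oplus>[?H] k:sp T. sg ?H 0 (lact Nm T$k T$i (k - i + 1) (0 + 0 - k) (tdiff T k i) (ct k))) = \<iota> (tcol i)" .
  have tc: "\<iota> (tcol i) .: ?H" using tcol_closed[OF i] by simp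
  have D: "df (val Nm T$i) (0 + 0 - i) (ct i) = sg ?H (1 - i) (\<iota> (tcol i))"
   using cobas_diff[OF i] dual_in_U[OF tob[OF i] cobas_closed[OF i]] iota_signed[OF L U_dual[OF tob[OF i]] tcol_closed[OF i]] i
   by (simp add: ct_def)
  have "df tw.TV 0 ct i = sg ?H (i + 0) (sg ?H (1 - i) (\<iota> (tcol i))) +[?H] \<iota> (tcol i)"
   unfolding tw.tl.lt_diff[OF i] S D by (rule refl)
  also have "sg ?H (i + 0) (sg ?H (1 - i) (\<iota> (tcol i))) = -[?H] \<iota> (tcol i)"
   unfolding H.sg_sg[OF tc] by (rule sg_odd) simp
  finally show ?thesis unfolding H.l_neg[OF tc] .
 qed
 moreover have "df tw.TV 0 ct .: cpt tw.TV (0 + 1)" by (rule acx_cl[OF tw.tl.lt_acx ct_closed refl])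
 moreover have "0[cpt tw.TV (0 + 1)] .: cpt tw.TV (0 + 1)"
  using acxD(1)[OF tw.tl.lt_acx, of "0 + 1"] by (simp add: agrp_def abelian_group_def abelian_monoid.zero_closed)
 ultimately show ?thesis
  unfolding tw.tl.lt_cpt pm_simps by (intro PiE_ext[of _ "sp T"]) (assumption | simp only: restrict_apply if_True)+
qed

text \<open>Evaluation in index zero is a functional on the module of \<open>T\<close>. It sends the canonical cocycle
 to the class of the identity of the object in index zero.\<close>

lemma not_acyclic:
 assumes con: "connective A" and nz: "\<not> h0_zero_object A T$0"
  and ac: "!!k. k : sp T ==> 1 <= k ==> hz (Hom A T$k T$0) (k - 1)"
 shows "\<not> hz tp.Ten (- s)"
proof
 assume cz: "hz tp.Ten (- s)"
 let ?X = "T$0"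
 note X = tob[OF zero_support]
 let ?V = "rt T (yon A ?X)"
 interpret Y: twisted_right R A T "yon A ?X" by (rule tr_yon[OF X])
 define z where "z = tw.tpair (- s) 0 bt ct"
 have zc: "z .: cpt tp.Ten (- s)" unfolding z_def by (rule tw.tpair_closed[OF bt_closed ct_closed]) simp
 have "df tp.Ten (- s + 0) z = tw.tpair (- s + 1) 0 (df tw.TP (- s) bt) ct"
  unfolding z_def by (rule tw.tpair_diff[OF bt_closed ct_closed ct_diff])
 also have "... = 0[cpt tp.Ten (- s + 1)]"
  unfolding bt_diff by (rule am_0[OF acxD(1)[OF tw.tr.rt_acx] tw.C_ag tw.tpair_addmap[OF ct_closed]]) simp
 finally have dz: "df tp.Ten (- s) z = 0[cpt tp.Ten (- s + 1)]" by simp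
 obtain y where y: "y .: cpt tp.Ten (- s - 1)" "df tp.Ten (- s - 1) y = z"
  by (rule acyclicE[OF cz zc dz]) auto
 \<comment> \<open>Evaluation in index \<open>0\<close> on transported tuples. Its degree is
   \<open>- s\<close>, because the cell at index \<open>0\<close> has that degree.\<close>
 define c where "c Y n u = retr u 0" for Y :: 'o and n :: int and u :: 'u
 have c: "functional R A Pm ?X (- s) c"
  unfolding functional_def
 proof (intro conjI ballI allI X)
  fix Y i assume Y: "Y : Ob A"
  have "linear_map R (cpt (lt s T (Hom A Y) (cmp A Y)) i) (dhom A Y ?X (i + s - 0)) (%x. x 0)"
   unfolding tmod_cpt[OF Y] by (rule linear_map_tuple_component[OF zero_support, of R "%j. dhom A Y T$j (i + s - j)" _ "%x. x"])
   (auto intro!: linI)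
  from lin_comp[OF retr_linear[OF Pt.val_module[OF Y, unfolded tmod_simps] U_tmod[OF Y]] this]
  show "linear_map R (vcpt Pm Y i) (dhom A Y ?X (i - - s)) (c Y i)" by (simp add: c_def[abs_def])
 next
  fix Y Z i j u f assume o: "Y : Ob A" "Z : Ob A" and "u .: vcpt Pm Z i" and f: "f .: dhom A Y Z j"
  then obtain x where x: "x .: cpt (lt s T (Hom A Z) (cmp A Z)) i" "u = \<iota> x" by auto
  show "c Y (i + j) (act Pm Y Z i j u f) = cmp A Y Z ?X (i - - s) j (c Z i u) f"
   using tm_in_U[OF o(2) x(1)] tm_in_U[OF o(1) tmod_act_closed[OF o x(1) f refl]] zero_support by (simp add: c_def x(2))
 qed
 obtain h where h: "!!n. amap (cpt tp.Ten n) (cpt (val Nm ?X) (n - - s)) (h n)"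
  and hp: "!!n Y i j x y. Y : Ob A ==> x .: vcpt Pm Y i ==> y .: cpt (val Nm Y) j ==> n = i + j ==>
   h n (pt Y i j x y) = lact Nm Y ?X (i - - s) j (c Y i x) y"
  using tw.pr_lift[OF c] by blast
 \<comment> \<open>No structure map arrives at index \<open>0\<close>, all indices being
   nonnegative. So the functional commutes with the differentials, up to the sign \<open>s\<close>
   of the shift.\<close>
 have cd: "c Y (i + 1) (df (val Pm Y) i x) = sg (dhom A Y ?X (i + 1 + s)) s (df (Hom A Y ?X) (i + s) (c Y i x))"
  "c Y i x .: dhom A Y ?X (i + s)"
  if Y: "Y : Ob A" and "x .: vcpt Pm Y i" for Y i x
 proof -
  obtain u where u: "u .: cpt (lt s T (Hom A Y) (cmp A Y)) i" "x = \<iota> u" using \<open>x : _\<close> by auto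
  interpret L: twisted_left R A T "Hom A Y" "cmp A Y" s by (rule tl_coyon[OF Y])
  let ?H = "dhom A Y ?X (i + 1 + s - 0)"
  interpret H: agrp ?H by (rule hom_ag[OF Y X])
  have "(\<Oplus>[?H] k:sp T. sg ?H s (cmp A Y T$k ?X (k - 0 + 1) (i + s - k) (tdiff T k 0) (u k))) = 0[?H]"
  proof (rule H.finsum_all_0)
   fix k assume k: "k : sp T"
   then have "0 <= k" using support by auto
   have "cmp A Y T$k ?X (k - 0 + 1) (i + s - k) 0[dhom A T$k ?X (k - 0 + 1)] (u k) = 0[?H]"
   by (rule am_0[OF hom_ag[OF tob[OF k] X] H.ag cmp_am_l[OF Y tob[OF k] X tmod_mem[OF Y u(1) k refl]]]) simp
   then show "sg ?H s (cmp A Y T$k ?X (k - 0 + 1) (i + s - k) (tdiff T k 0) (u k)) = 0[?H]"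
   unfolding tdiff_zero[OF k zero_support \<open>0 <= k\<close>] by (simp only: H.sg_0)
  qed
  moreover have u0: "u 0 .: dhom A Y ?X (i + s - 0)" by (rule tmod_mem[OF Y u(1) zero_support refl])
  moreover have d: "df (Hom A Y ?X) (i + s - 0) (u 0) .: ?H" by (rule acx_cl[OF hom_acx[OF Y X] u0]) simp
  ultimately have "df (lt s T (Hom A Y) (cmp A Y)) i u 0 = sg ?H (0 + s) (df (Hom A Y ?X) (i + s - 0) (u 0))"
   unfolding L.lt_diff[OF zero_support] by (simp only: H.r_zero[OF H.sg_cl[OF d]])
  moreover have "df (lt s T (Hom A Y) (cmp A Y)) i u : U" by (rule tm_in_U[OF Y acx_cl[OF L.lt_acx u(1) refl]])
  ultimately show "c Y (i + 1) (df (val Pm Y) i x) = sg (dhom A Y ?X (i + 1 + s)) s (df (Hom A Y ?X) (i + s) (c Y i x))"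
   "c Y i x .: dhom A Y ?X (i + s)"
   using tm_in_U[OF Y u(1)] u0 by (simp_all add: c_def u(2))
 qed
 \<comment> \<open>The lift \<open>h\<close> of the functional is a chain map up to the sign
   \<open>s\<close>. It is only known on symbols, hence the induction over sums of symbols.\<close>
 have hd: "h (n + 1) (df tp.Ten n w) = sg (cpt (val Nm ?X) (n + 1 + s)) s (df (val Nm ?X) (n + s) (h n w))"
  if "w .: cpt tp.Ten n" for n w
  using that
 proof (induction rule: tp.Ten_induct)
  let ?K = "cpt (val Nm ?X) (n + s)" and ?K1 = "cpt (val Nm ?X) (n + 1 + s)"
  interpret K: agrp ?K by (rule tp.L.lval_ag[OF X])
  interpret K1: agrp ?K1 by (rule tp.L.lval_ag[OF X])
  interpret C: agrp "cpt tp.Ten n" by (rule tw.C_ag)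
  interpret C1: agrp "cpt tp.Ten (n + 1)" by (rule tw.C_ag)
  have h0: "amap (cpt tp.Ten n) ?K (h n)" using h[of n] by simp
  have h1: "amap (cpt tp.Ten (n + 1)) ?K1 (h (n + 1))" using h[of "n + 1"] by simp
  have dK: "amap ?K ?K1 (df (val Nm ?X) (n + s))"
   using acxD(2)[OF tp.L.lv_acx[OF X], of "n + s"] by (simp add: algebra_simps)
  case zero
  show ?case
   unfolding am_0[OF C.ag C1.ag tw.C_addmap] am_0[OF C1.ag K1.ag h1]
   am_0[OF C.ag K.ag h0] am_0[OF K.ag K1.ag dK] by (simp only: K1.sg_0)
 next
  let ?K = "cpt (val Nm ?X) (n + s)" and ?K1 = "cpt (val Nm ?X) (n + 1 + s)"
  interpret K: agrp ?K by (rule tp.L.lval_ag[OF X])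
  interpret K1: agrp ?K1 by (rule tp.L.lval_ag[OF X])
  interpret C: agrp "cpt tp.Ten n" by (rule tw.C_ag)
  interpret C1: agrp "cpt tp.Ten (n + 1)" by (rule tw.C_ag)
  have h0: "amap (cpt tp.Ten n) ?K (h n)" using h[of n] by simp
  have h1: "amap (cpt tp.Ten (n + 1)) ?K1 (h (n + 1))" using h[of "n + 1"] by simp
  have dK: "amap ?K ?K1 (df (val Nm ?X) (n + s))"
   using acxD(2)[OF tp.L.lv_acx[OF X], of "n + s"] by (simp add: algebra_simps)
  case (add Y i x v w)
  note Y = add(1) and x = add(2) and v = add(3)
  let ?dx = "df (val Pm Y) i x" and ?dv = "df (val Nm Y) (n - i) v"
  have t: "pt Y i (n - i) x v .: cpt tp.Ten n" by (rule tw.pr_cl[OF Y x v]) simp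
  have dx: "?dx .: vcpt Pm Y (i + 1)" by (rule acx_cl[OF tp.val_acx[OF Y] x refl])
  have dv: "?dv .: cpt (val Nm Y) (n - i + 1)" by (rule acx_cl[OF tp.L.lv_acx[OF Y] v refl])
  note cx = cd(2)[OF Y x]
  let ?dc = "df (Hom A Y ?X) (i + s) (c Y i x)"
  have dc: "?dc .: dhom A Y ?X (i + 1 + s)" by (rule acx_cl[OF hom_acx[OF Y X] cx]) simp
  have p1: "pt Y (i + 1) (n - i) ?dx v .: cpt tp.Ten (n + 1)" by (rule tw.pr_cl[OF Y dx v]) simp
  have p2: "pt Y i (n - i + 1) x ?dv .: cpt tp.Ten (n + 1)" by (rule tw.pr_cl[OF Y x dv]) simp
  have l1: "lact Nm Y ?X (i + 1 + s) (n - i) ?dc v .: ?K1" by (rule tp.L.la_cl[OF Y X dc v]) simp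
  have l2: "lact Nm Y ?X (i + s) (n - i + 1) (c Y i x) ?dv .: ?K1" by (rule tp.L.la_cl[OF Y X cx dv]) simp
  have "df tp.Ten n (pt Y i (n - i) x v) = pt Y (i + 1) (n - i) ?dx v +[cpt tp.Ten (n + 1)]
   sg (cpt tp.Ten (n + 1)) i (pt Y i (n - i + 1) x ?dv)"
   by (rule tw.pr_leibniz[OF Y x v]) auto
  then have "h (n + 1) (df tp.Ten n (pt Y i (n - i) x v)) = h (n + 1) (pt Y (i + 1) (n - i) ?dx v) +[?K1]
   sg ?K1 i (h (n + 1) (pt Y i (n - i + 1) x ?dv))"
   using am_add[OF h1 p1 C1.sg_cl[OF p2]] am_sg[OF C1.ag K1.ag h1 p2] by simp
  also have "h (n + 1) (pt Y (i + 1) (n - i) ?dx v) = sg ?K1 s (lact Nm Y ?X (i + 1 + s) (n - i) ?dc v)"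
  proof -
   have "h (n + 1) (pt Y (i + 1) (n - i) ?dx v) = lact Nm Y ?X (i + 1 - - s) (n - i) (c Y (i + 1) ?dx) v"
   by (rule hp[OF Y dx v]) simp
   also have "... = lact Nm Y ?X (i + 1 + s) (n - i) (sg (dhom A Y ?X (i + 1 + s)) s ?dc) v"
   unfolding cd(1)[OF Y x] by simp
   also have "... = sg ?K1 s (lact Nm Y ?X (i + 1 + s) (n - i) ?dc v)"
   by (rule am_sg[OF hom_ag[OF Y X] K1.ag tp.L.la_am_l[OF Y X v] dc]) simp
   finally show ?thesis .
  qed
  also have "h (n + 1) (pt Y i (n - i + 1) x ?dv) = lact Nm Y ?X (i + s) (n - i + 1) (c Y i x) ?dv"
   using hp[OF Y x dv, of "n + 1"] by simp
  also have "sg ?K1 s (lact Nm Y ?X (i + 1 + s) (n - i) ?dc v) +[?K1] sg ?K1 i (lact Nm Y ?X (i + s) (n - i + 1) (c Y i x) ?dv) =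
   sg ?K1 s (lact Nm Y ?X (i + 1 + s) (n - i) ?dc v +[?K1] sg ?K1 (i + s) (lact Nm Y ?X (i + s) (n - i + 1) (c Y i x) ?dv))"
  proof -
   have "sg ?K1 s (sg ?K1 (i + s) (lact Nm Y ?X (i + s) (n - i + 1) (c Y i x) ?dv)) = sg ?K1 i (lact Nm Y ?X (i + s) (n - i + 1) (c Y i x) ?dv)"
   unfolding K1.sg_sg[OF l2] by (rule sg_parity) simp
   then show ?thesis unfolding K1.sg_add[OF l1 K1.sg_cl[OF l2]] by simp
  qed
  also have "lact Nm Y ?X (i + 1 + s) (n - i) ?dc v +[?K1] sg ?K1 (i + s) (lact Nm Y ?X (i + s) (n - i + 1) (c Y i x) ?dv) =
   df (val Nm ?X) (n + s) (lact Nm Y ?X (i + s) (n - i) (c Y i x) v)"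
   by (rule tp.L.la_leibniz'[OF Y X cx v, symmetric]) auto
  also have "lact Nm Y ?X (i + s) (n - i) (c Y i x) v = h n (pt Y i (n - i) x v)"
   using hp[OF Y x v, of n] by simp
  finally have "h (n + 1) (df tp.Ten n (pt Y i (n - i) x v)) = sg ?K1 s (df (val Nm ?X) (n + s) (h n (pt Y i (n - i) x v)))" .
  moreover have "pt Y i (n - i) x v = tp.tens n Y i x v" by simp
  ultimately have 1: "h (n + 1) (df tp.Ten n (tp.tens n Y i x v)) = sg ?K1 s (df (val Nm ?X) (n + s) (h n (tp.tens n Y i x v)))" by simp
  have t': "tp.tens n Y i x v .: cpt tp.Ten n" using t by simp
  note dt = am_cl[OF tw.C_addmap t'] am_cl[OF tw.C_addmap add(4)]
  note ht = am_cl[OF h0 t'] am_cl[OF h0 add(4)]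
  show ?case
   unfolding am_add[OF tw.C_addmap t' add(4)] am_add[OF h1 dt] am_add[OF h0 t' add(4)] am_add[OF dK ht] 1 add(5)
   by (rule K1.sg_add[OF am_cl[OF dK ht(1)] am_cl[OF dK ht(2)], symmetric])
 qed
 \<comment> \<open>An inclusion has a nonzero component at index \<open>0\<close> only if it belongs
   to that index; there it is the identity, and the projection onto \<open>?X\<close> is left
   over.\<close>
 have hz: "h (- s) z = \<iota> (cobas 0)"
 proof -
  interpret K: agrp "cpt (val Nm ?X) 0" by (rule tp.L.lval_ag[OF X])
  have am: "amap (cpt tp.Ten (- s + 0)) (cpt (val Nm ?X) 0) (h (- s))" using h[of "- s"] by simp
  have bk: "bt k .: vcpt Pm T$k (k + - s)" and ck: "ct k .: cpt (val Nm T$k) (0 - k)" if k: "k : sp T" for k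
   using tw.tr.rt_mem[OF bt_closed k refl] tw.TV_mem[OF ct_closed k refl] by auto
  have hk: "h (- s) (pt T$k (k + - s) (0 - k) (bt k) (ct k)) = lact Nm T$k ?X k (- k) (bas k 0) (\<iota> (cobas k))" if k: "k : sp T" for k
   using hp[OF tob[OF k] bk[OF k] ck[OF k], of "- s"] k tm_in_U[OF tob[OF k] bas_closed[OF k]] by (simp add: c_def bt_def ct_def)
  have c0: "\<iota> (cobas 0) .: cpt (val Nm ?X) 0" using cobas_closed[OF zero_support] by simp
  have "h (- s) z = (\<Oplus>[cpt (val Nm ?X) 0] k:sp T. h (- s) (pt T$k (k + - s) (0 - k) (bt k) (ct k)))"
   unfolding z_def tw.tpair_def
   by (rule am_finsum[OF tw.C_ag K.ag am]) (rule tw.tpair_term[OF bt_closed ct_closed _ refl])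
  also have "... = h (- s) (pt ?X (0 + - s) (0 - 0) (bt 0) (ct 0))"
  proof (rule K.finsum_single[OF tfin zero_support])
   show "h (- s) (pt ?X (0 + - s) (0 - 0) (bt 0) (ct 0)) .: cpt (val Nm ?X) 0"
   by (rule am_cl[OF am tw.tpair_term[OF bt_closed ct_closed zero_support refl]])
   fix k assume k: "k : sp T" "k ~= 0"
   have cc: "\<iota> (cobas k) .: cpt (val Nm T$k) (- k)" using cobas_closed[OF k(1)] by simp
   have "lact Nm T$k ?X k (- k) 0[dhom A T$k ?X k] (\<iota> (cobas k)) = 0[cpt (val Nm ?X) 0]"
   by (rule am_0[OF hom_ag[OF tob[OF k(1)] X] K.ag tp.L.la_am_l[OF tob[OF k(1)] X cc]]) simp
   moreover have "bas k 0 = 0[dhom A T$k ?X k]" using k zero_support by (simp add: bas_def)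
   ultimately show "h (- s) (pt T$k (k + - s) (0 - k) (bt k) (ct k)) = 0[cpt (val Nm ?X) 0]"
   unfolding hk[OF k(1)] by (simp only:)
  qed
  also have "... = lact Nm ?X ?X 0 0 (ident A ?X) (\<iota> (cobas 0))"
   unfolding hk[OF zero_support] using zero_support by (simp add: bas_def)
  also have "... = \<iota> (cobas 0)" by (rule tp.L.la_ident[OF X c0])
  finally show ?thesis .
 qed
 define u where "u = h (- s - 1) y"
 have u: "u .: cpt (val Nm ?X) (-1)" unfolding u_def using am_cl[OF h y(1)] by simp
 have hy: "\<iota> (cobas 0) = sg (cpt (val Nm ?X) 0) s (df (val Nm ?X) (-1) u)"
  using hd[OF y(1)] y(2) hz by (simp add: u_def)
 obtain w where w: "w .: cpt ?V (-1)" "u = \<iota> w" using u by auto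
 have dw: "df ?V (-1) w .: cpt ?V 0" by (rule acx_cl[OF V.lv_acx[OF X] w(1)]) simp
 interpret K: agrp "cpt ?V 0" by (rule V.lval_ag[OF X])
 interpret K': agrp "cpt ?V (-1)" by (rule V.lval_ag[OF X])
 have "\<iota> (cobas 0) = \<iota> (sg (cpt ?V 0) s (df ?V (-1) w))"
  using hy dual_in_U[OF X w(1)] iota_signed[OF V.lval_module[OF X] U_dual[OF X] dw] by (simp add: w(2))
 then have e: "cobas 0 = sg (cpt ?V 0) s (df ?V (-1) w)"
  using inj_onD[OF iota_inj] dual_in_U[OF X cobas_closed[OF zero_support]] dual_in_U[OF X K.sg_cl[OF dw]] by blast
 \<comment> \<open>The remaining sign is absorbed into the primitive, so the projection from
   \<open>T\<close> to \<open>?X\<close> is exactly a coboundary in the dual of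
   \<open>T\<close>.\<close>
 let ?w = "sg (cpt ?V (-1)) s w"
 have w': "?w .: cpt ?V (-1)" using w by simp
 have "amap (cpt ?V (-1)) (cpt ?V 0) (df ?V (-1))" using acxD(2)[OF V.lv_acx[OF X], of "-1"] by simp
 then have dw': "df ?V (-1) ?w = cobas 0"
  unfolding e by (rule am_sg[OF K'.ag K.ag _ w(1)])
 \<comment> \<open>The projection vanishes at positive indices, so its null-homotopy can be moved
   into index \<open>0\<close>; the hypothesis \<open>ac\<close> clears the other indices. There it
   contracts the identity of \<open>?X\<close>.\<close>
 have "df ?V (-1) ?w 0 : cobd (val (yon A ?X) ?X) (-1 + 1)"
 proof (rule Y.index_zero_boundary[OF _ zero_support _ w'])
  show "sp T <= {0..}" using support by auto
  show "hz (val (yon A ?X) T$k) (k + -1)" if "k : sp T" "1 <= k" for k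
   using ac[OF that] by simp
  show "df ?V (-1) ?w k = 0[vcpt (yon A ?X) T$k (k + (-1 + 1))]" if "k : sp T" "1 <= k" for k
   unfolding dw' using that by (simp add: cobas_def)
 qed
 then have "ident A ?X : cobd (Hom A ?X ?X) 0" unfolding dw' using zero_support by (simp add: cobas_def)
 then show False using null_ident_zero_object[OF X] nz by blast
qed

end

section \<open>Assembling the two bounds\<close>

lemma quasi_iso_refl:
 assumes "dg_module R A M"
 shows "quasi_iso R A M M (%_ _ x. x)"
proof -
 interpret dg_module R A M by fact
 have "w -[vcpt M X n] w : cobd (val M X) n" if "X : Ob A" "w : cocycles (val M X) n" for X n w
 proof -
  interpret G: agrp "vcpt M X n" by (rule val_ag[OF that(1)])
  have "w -[vcpt M X n] w = 0[vcpt M X n]" using that(2) by (simp add: cocycles_def G.minus_eq_zero_iff)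
  then show ?thesis using additive_subgroup.zero_closed[OF cobd_sub[OF val_acx[OF that(1)]]] by simp
 qed
 then show ?thesis unfolding quasi_iso_def by (auto intro!: linI)
qed

text \<open>Injectivity on cohomology carries vanishing from the heart object to its
  resolution.\<close>

lemma quasi_iso_acyclic:
 assumes P: "dg_module R A P" and M: "dg_module R A M" and q: "quasi_iso R A P M q" and X: "X : Ob A"
  and z: "hz (val M X) n"
 shows "hz (val P X) n"
proof -
 interpret P: dg_module R A P by fact
 interpret M: dg_module R A M by fact
 have lin: "linear_map R (vcpt P X n) (vcpt M X n) (q X n)" for n using q X by (auto simp: quasi_iso_def)
 have "z : cobd (val P X) n" if zc: "z : cocycles (val P X) n" for z
 proof -
  have zP: "z .: vcpt P X n" "df (val P X) n z = 0[vcpt P X (n + 1)]" using zc by (auto simp: cocycles_def)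
  have "df (val M X) n (q X n z) = q X (n + 1) (df (val P X) n z)"
   using q X zP(1) by (auto simp: quasi_iso_def)
  also have "... = 0[vcpt M X (n + 1)]"
   unfolding zP(2) by (rule am_0[OF P.val_ag[OF X] M.val_ag[OF X] lin_am[OF lin]])
  finally have "q X n z : cobd (val M X) n"
   using z am_cl[OF lin_am[OF lin] zP(1)] by (auto simp: cohomology_zero_def cocycles_def)
  then show ?thesis using q X zc by (auto simp: quasi_iso_def)
 qed
 then show ?thesis using acx_coboundary_cocycle[OF P.val_acx[OF X], of n] by (auto simp: cohomology_zero_def)
qed

lemma weak_gl_dim_upper:
 fixes M :: "('o, 'k, 'a) dgcat"
 assumes st: "d_stable R d M"
 shows "weak_gl_dim_le TYPE('u) R M (d + 1)"
 unfolding weak_gl_dim_le_def derived_tensor_in_D_ge_def in_D_ge_def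
proof (intro allI impI)
 fix Q N P :: "('o, 'k, 'a, 'u) dgmod" and q e
 assume h: "in_heart R M Q & in_heart R (op_dgcat M) N" and r: "semifree_resolution R M P Q q" and e: "e < - int (d + 1)"
 obtain B lev where P: "dg_module R M P" "semi_basis M P B lev" "quasi_iso R M P Q q" using r by (auto simp: semifree_resolution_def)
 have Q: "dg_module R M Q" using h by (simp add: in_heart_def)
 interpret P: dg_module R M P by (rule P(1))
 interpret N: dg_module R "op_dgcat M" N using h by (simp add: in_heart_def)
 interpret vanishing R M P B lev N d
 proof unfold_locales
  show "semi_basis M P B lev" by (rule P(2))
  show "additive_dgcat M" "connective M" using st by (auto simp: d_stable_def)
  show "EX T. homotopy_cokernel d M X Y f T" if "X : Ob M" "Y : Ob M" "f : Z0 M X Y" for X Y f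
   using st that by (auto simp: d_stable_def)
  show "hz (val P X) i" if "X : Ob M" "i < 0" for X i
   using h that by (intro quasi_iso_acyclic[OF P(1) Q P(3)]) (auto simp: in_heart_def)
  show "hz (val N X) i" if "X : Ob M" "i ~= 0" for X i
   using h that by (auto simp: in_heart_def)
 qed
 show "hz (dg_tensor R M P N) e" by (rule tensor_vanishing) (use e in simp)
qed

text \<open>The two modules of \<open>T\<close> lie in the hearts and their tensor product is not
  acyclic in degree \<open>- (d + 1)\<close>; a bound \<open>n\<close> below \<open>d + 1\<close>
  would require it to be.\<close>

lemma weak_gl_dim_lower:
 fixes M :: "('o, 'k, 'a) dgcat"
 assumes st: "d_stable R d M" and nz: "h0_nonzero M" and small: "small_in TYPE('u) M" and le: "weak_gl_dim_le TYPE('u) R M n"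
 shows "d + 1 <= n"
proof (rule ccontr)
 assume n: "\<not> d + 1 <= n"
 interpret dg_category R M using st by (simp add: d_stable_def)
 have con: "connective M" using st by (simp add: d_stable_def)
 obtain X where X: "X : Ob M" "\<not> h0_zero_object M X" using nz by (auto simp: h0_nonzero_def)
 obtain Z where Z: "h0_zero_object M Z" using st by (auto simp: d_stable_def additive_dgcat_def)
 then have Zo: "Z : Ob M" and Zc: "hz (Hom M Z X) 0" using X by (auto simp: h0_zero_object_def)
 have "0[dhom M X Z 0] : Z0 M X Z"
  using additive_subgroup.zero_closed[OF cocycles_subgroup[OF hom_acx[OF X(1) Zo]]] .
 \<comment> \<open>The target is a zero object so that \<open>T\<close> has a term without morphisms
   to \<open>X\<close> in index \<open>1\<close>; connectivity alone would not cover this index,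
   where degree \<open>0\<close> is at stake.\<close>
 then obtain T where T: "homotopy_cokernel d M X Z 0[dhom M X Z 0] T" using st X Zo by (auto simp: d_stable_def) blast
 then have re: "right_exact d M T" and dt: "d_twisted d M T" by (auto simp: homotopy_cokernel_def right_exact_def)
 then have lex: "left_exact d M T" using st by (auto simp: d_stable_def)
 have twc: "twisted_complex M T" and sup: "sp T <= {0..int d + 1}" using dt by (auto simp: d_twisted_def tw_def)
 have T01: "0 : sp T" "T$0 = X" "T$1 = Z" using T by (auto simp: homotopy_cokernel_def component_is_def)
 \<comment> \<open>All morphisms of all degrees. Smallness embeds this set into \<open>'u\<close>,
   and finite tuples over it are then coded by single elements of \<open>'u\<close>.\<close>
 define H where "H = (\<Union>X\<in>Ob M. \<Union>Y\<in>Ob M. \<Union>n. carrier (dhom M X Y n))"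
 have inf: "infinite (UNIV :: 'u set)" using small by (simp add: small_in_def)
 obtain \<kappa> :: "'a => 'u" where kap: "inj_on \<kappa> H" using small by (auto simp: small_in_def H_def)
 have fin: "finite (sp T)" using twc by (simp add: twisted_complex_def)
 obtain g :: "(int => 'u) => 'u" where g: "inj_on g (\<Pi>\<^sub>E i\<in>sp T. UNIV)" using infinite_tuples_inj[OF inf fin] by blast
 define U where "U = (\<Pi>\<^sub>E i\<in>sp T. H)"
 define \<iota> where "\<iota> f = g (%k:sp T. \<kappa> (f k))" for f
 have inj: "inj_on \<iota> U"
 proof (rule inj_onI)
  fix f f' assume f: "f : U" "f' : U" and "\<iota> f = \<iota> f'"
  then have "(%k:sp T. \<kappa> (f k)) = (%k:sp T. \<kappa> (f' k))" using inj_onD[OF g] by (simp add: \<iota>_def)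
  then have "\<kappa> (f k) = \<kappa> (f' k)" if "k : sp T" for k using that by (metis restrict_apply')
  moreover have "f k : H" "f' k : H" if "k : sp T" for k
   using PiE_mem[OF f(1)[unfolded U_def] that] PiE_mem[OF f(2)[unfolded U_def] that] by simp_all
  ultimately have "f k = f' k" if "k : sp T" for k using inj_onD[OF kap] that by blast
  then show "f = f'" by (rule PiE_ext[OF f[unfolded U_def]])
 qed
 interpret T: twisted R M T by unfold_locales (rule twc)
 have homH: "x : H" if "Y : Ob M" "Y' : Ob M" "x .: dhom M Y Y' i" for x Y Y' i using that by (auto simp: H_def)
 interpret lower R M T \<iota> U "int d + 1"
 proof unfold_locales
  show "inj_on \<iota> U" by (rule inj)
  show "sp T <= {0..int d + 1}" by (rule sup)
  show "0 : sp T" by (rule T01)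
  show "carrier (cpt (lt (int d + 1) T (Hom M Y) (cmp M Y)) i) <= U" if "Y : Ob M" for Y i
   unfolding T.tmod_cpt[OF that] pm_simps U_def by (rule PiE_mono) (use homH[OF that T.tob] in blast)
  show "carrier (cpt (rt T (yon M Y)) i) <= U" if "Y : Ob M" for Y i
   unfolding twisted_right.rt_cpt[OF T.tr_yon[OF that]] pm_simps U_def yon_simps
   by (rule PiE_mono) (use homH[OF T.tob that] in blast)
 qed
 have ph: "in_heart R M Pm" by (rule Pm_heart[OF con]) (use lex in \<open>auto simp: left_exact_def\<close>)
 have nh: "in_heart R (op_dgcat M) Nm" by (rule Nm_heart[OF con]) (use re in \<open>auto simp: right_exact_def\<close>)
 have pd: "dg_module R M Pm" using ph by (simp add: in_heart_def)
 \<comment> \<open>The identity serves as the augmentation: the module is semi-free already.\<close>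
 have "semifree_resolution R M Pm Pm (%_ _ x. x)"
  unfolding semifree_resolution_def using pd Pm_semi_basis quasi_iso_refl[OF pd] by blast
 then have "in_D_ge (dg_tensor R M Pm Nm) (- int n)"
  using le ph nh unfolding weak_gl_dim_le_def derived_tensor_in_D_ge_def by blast
 then have "hz (dg_tensor R M Pm Nm) (- (int d + 1))" using n by (simp add: in_D_ge_def)
 moreover have "\<not> hz (dg_tensor R M Pm Nm) (- (int d + 1))"
 proof (rule not_acyclic[OF con])
  show "\<not> h0_zero_object M T$0" using X T01 by simp
  fix k assume k: "k : sp T" "1 <= k"
  \<comment> \<open>In index \<open>1\<close> this is degree \<open>0\<close> of the morphisms from
    the zero object \<open>Z\<close>; for larger indices the degree is positive and connectivity
    applies.\<close>
  show "hz (Hom M T$k T$0) (k - 1)"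
  proof (cases "k = 1")
   case True
   then show ?thesis using Zc T01 by simp
  next
   case False
   then show ?thesis using k con T.tob[OF k(1)] X(1) T01 by (simp add: connective_def)
  qed
 qed
 ultimately show False by blast
qed

theorem corollary2p4:
  fixes R :: "'k ring" and M :: "('o, 'k, 'a) dgcat" and d :: nat
  assumes "cring R"
    and "d \<ge> 1"
    and "d_stable R d M"
    and "h0_nonzero M"
    and "small_in TYPE('u) M"
  shows "weak_gl_dim TYPE('u) R M = enat (d + 1)"
 unfolding weak_gl_dim_def
proof (rule antisym)
 show "Inf (enat ` {n. weak_gl_dim_le TYPE('u) R M n}) <= enat (d + 1)"
  by (rule Inf_lower) (use weak_gl_dim_upper[OF assms(3)] in blast)
 show "enat (d + 1) <= Inf (enat ` {n. weak_gl_dim_le TYPE('u) R M n})"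
  by (rule Inf_greatest) (use weak_gl_dim_lower[OF assms(3,4,5)] in auto)
qed

end
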